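(* Let $\mathcal{H}$ be a cocommutative Hopf $K$-algebra which is projective as a $K$-module. For $n\ge 0$ let $C_n'=\mathcal{H}_{par}^{\otimes_{\mathcal{B}}\,n+1}$ (tensor product over $\mathcal{B}$ of $n+1$ copies of $\mathcal{H}_{par}$), regarded as a left $\mathcal{H}_{par}$-module through the first factor. Let $\psi:C_0'=\mathcal{H}_{par}\to\mathcal{B}$ be $\psi(x)=x\triangleright 1_{\mathcal{B}}$, and for $n\ge1$ let $\partial_n=\sum_{i=0}^n(-1)^id_i:C_n'\to C_{n-1}'$, where $$d_i(x_0\otimes_{\mathcal{B}}\cdots\otimes_{\mathcal{B}}x_n)=x_0\otimes_{\mathcal{B}}\cdots\otimes_{\mathcal{B}}x_ix_{i+1}\otimes_{\mathcal{B}}\cdots\otimes_{\mathcal{B}}x_n\quad(0\le i\le n-1),$$ $$d_n(x_0\otimes_{\mathcal{B}}\cdots\otimes_{\mathcal{B}}x_n)=x_0\otimes_{\mathcal{B}}\cdots\otimes_{\mathcal{B}}x_{n-1}\psi(x_n).$$ Then $(C_\bullet',\partial_\bullet)\overset{\psi}{\to}\mathcal{B}$ is a projective resolution of $\mathcal{B}$ in the category of left $\mathcal{H}_{par}$-modules.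
   Context: $K$ is a commutative unital ring, $\otimes=\otimes_K$. $\mathcal{H}$ has antipode $S$, and Sweedler notation $\Delta(h)=h_{(1)}\otimes h_{(2)}$ is used. The algebra $\mathcal{H}_{par}$ is the quotient of the tensor algebra $T(\mathcal{H})$ by the ideal generated by the elements ($h,k\in\mathcal{H}$): $1_{\mathcal{H}}-1_{T(\mathcal{H})}$; $h\otimes k_{(1)}\otimes S(k_{(2)})-hk_{(1)}\otimes S(k_{(2)})$; $h_{(1)}\otimes S(h_{(2)})\otimes k-h_{(1)}\otimes S(h_{(2)})k$; $h\otimes S(k_{(1)})\otimes k_{(2)}-hS(k_{(1)})\otimes k_{(2)}$; $S(h_{(1)})\otimes h_{(2)}\otimes k-S(h_{(1)})\otimes h_{(2)}k$. The class of $h$ is $[h]$. $\mathcal{B}\subseteq\mathcal{H}_{par}$ is the subalgebra generated by the elements $e_h:=[h_{(1)}][S(h_{(2)})]$, $h\in\mathcal{H}$; it is a left $\mathcal{H}_{par}$-module with action determined by $[h]\triangleright b=[h_{(1)}]b[S(h_{(2)})]$. $\mathcal{H}_{par}$ is a $\mathcal{B}$-bimodule via left and right multiplication. *)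

theory Defs
  imports "HOL-Algebra.Algebra" "HOL-Library.Poly_Mapping"
begin

section \<open>Left modules and projective resolutions\<close>

text \<open>The library locale \<^locale>\<open>module\<close> is restricted to commutative rings of scalars.\<close>

locale left_module = R?: ring R + M?: abelian_group M
  for R :: "('r, 's) ring_scheme" and M :: "('r, 'm, 't) module_scheme" +
  assumes smult_closed:
      "\<lbrakk>a \<in> carrier R; x \<in> carrier M\<rbrakk> \<Longrightarrow> a \<odot>\<^bsub>M\<^esub> x \<in> carrier M"
    and smult_l_distr:
      "\<lbrakk>a \<in> carrier R; b \<in> carrier R; x \<in> carrier M\<rbrakk> \<Longrightarrow>
        (a \<oplus>\<^bsub>R\<^esub> b) \<odot>\<^bsub>M\<^esub> x = a \<odot>\<^bsub>M\<^esub> x \<oplus>\<^bsub>M\<^esub> b \<odot>\<^bsub>M\<^esub> x"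
    and smult_r_distr:
      "\<lbrakk>a \<in> carrier R; x \<in> carrier M; y \<in> carrier M\<rbrakk> \<Longrightarrow>
        a \<odot>\<^bsub>M\<^esub> (x \<oplus>\<^bsub>M\<^esub> y) = a \<odot>\<^bsub>M\<^esub> x \<oplus>\<^bsub>M\<^esub> a \<odot>\<^bsub>M\<^esub> y"
    and smult_assoc:
      "\<lbrakk>a \<in> carrier R; b \<in> carrier R; x \<in> carrier M\<rbrakk> \<Longrightarrow>
        (a \<otimes>\<^bsub>R\<^esub> b) \<odot>\<^bsub>M\<^esub> x = a \<odot>\<^bsub>M\<^esub> (b \<odot>\<^bsub>M\<^esub> x)"
    and smult_one:
      "x \<in> carrier M \<Longrightarrow> \<one>\<^bsub>R\<^esub> \<odot>\<^bsub>M\<^esub> x = x"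

definition lmod_hom ::
  "('r, 's) ring_scheme \<Rightarrow> ('r, 'm, 't) module_scheme \<Rightarrow> ('r, 'n, 'u) module_scheme \<Rightarrow> ('m \<Rightarrow> 'n) set"
  where "lmod_hom R M N =
    {f \<in> carrier M \<rightarrow> carrier N.
      (\<forall>x\<in>carrier M. \<forall>y\<in>carrier M. f (x \<oplus>\<^bsub>M\<^esub> y) = f x \<oplus>\<^bsub>N\<^esub> f y) \<and>
      (\<forall>a\<in>carrier R. \<forall>x\<in>carrier M. f (a \<odot>\<^bsub>M\<^esub> x) = a \<odot>\<^bsub>N\<^esub> f x)}"

text \<open>
  The lifting property of a projective left module, tested on the surjections between modules
  whose carriers live in the types \<open>'x\<close> and \<open>'y\<close>; HOL cannot quantify over these types inside a
  formula. With \<open>'x\<close>, \<open>'y\<close> schematic in a conclusion this is projectivity. For a hypothesis,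
  \<open>'x = 'm \<Rightarrow> 'r\<close> and \<open>'y = 'm\<close> suffice: they contain the canonical surjection from the free
  module on the set \<open>carrier P\<close> onto \<open>P\<close>, and a splitting of it gives the lifting property in
  all types.
\<close>

definition projective ::
  "'x itself \<Rightarrow> 'y itself \<Rightarrow> ('r, 's) ring_scheme \<Rightarrow> ('r, 'm, 't) module_scheme \<Rightarrow> bool"
  where "projective _ _ R P \<longleftrightarrow>
    left_module R P \<and>
    (\<forall>(M :: ('r, 'x) module) (N :: ('r, 'y) module) g f.
      left_module R M \<and> left_module R N \<and>
      g \<in> lmod_hom R M N \<and> g ` carrier M = carrier N \<and> f \<in> lmod_hom R P N \<longrightarrow>
      (\<exists>h \<in> lmod_hom R P M. \<forall>p\<in>carrier P. g (h p) = f p))"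

text \<open>\<open>d n\<close>, for \<open>n \<ge> 1\<close>, is the differential \<open>C n \<rightarrow> C (n - 1)\<close>; \<open>d 0\<close> is irrelevant.\<close>

definition projective_resolution ::
  "'x itself \<Rightarrow> 'y itself \<Rightarrow> ('r, 's) ring_scheme \<Rightarrow> (nat \<Rightarrow> ('r, 'm, 't) module_scheme) \<Rightarrow>
    (nat \<Rightarrow> 'm \<Rightarrow> 'm) \<Rightarrow> ('m \<Rightarrow> 'n) \<Rightarrow> ('r, 'n, 'u) module_scheme \<Rightarrow> bool"
  where "projective_resolution tx ty R C d \<epsilon> N \<longleftrightarrow>
    left_module R N \<and>
    (\<forall>n. projective tx ty R (C n)) \<and>
    (\<forall>n\<ge>1. d n \<in> lmod_hom R (C n) (C (n - 1))) \<and>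
    \<epsilon> \<in> lmod_hom R (C 0) N \<and>
    \<epsilon> ` carrier (C 0) = carrier N \<and>
    a_kernel (C 0) N \<epsilon> = d 1 ` carrier (C 1) \<and>
    (\<forall>n\<ge>1. a_kernel (C n) (C (n - 1)) (d n) = d (n + 1) ` carrier (C (n + 1)))"


section \<open>Tensor powers of a bimodule\<close>

text \<open>
  The \<open>n\<close>-fold tensor power of \<open>M\<close> over \<open>R\<close>, where \<open>R\<close> acts on \<open>M\<close> from the left by \<open>l\<close> and from
  the right by \<open>r\<close>: the free abelian group on the words of length \<open>n\<close> over \<open>carrier M\<close>
  (the word \<open>[x1, ..., xn]\<close> standing for \<open>x1 \<otimes> ... \<otimes> xn\<close>), modulo additivity in each
  position and balancing \<open>... \<otimes> x b \<otimes> y \<otimes> ... = ... \<otimes> x \<otimes> b y \<otimes> ...\<close>.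
\<close>

definition words :: "('m, 's) partial_object_scheme \<Rightarrow> nat \<Rightarrow> 'm list set"
  where "words M n = {w. set w \<subseteq> carrier M \<and> length w = n}"

definition tensor_kernel ::
  "('m, 's) ring_scheme \<Rightarrow> 'r set \<Rightarrow> ('r \<Rightarrow> 'm \<Rightarrow> 'm) \<Rightarrow> ('m \<Rightarrow> 'r \<Rightarrow> 'm) \<Rightarrow> nat \<Rightarrow>
    ('m list \<Rightarrow>\<^sub>0 int) set"
  where "tensor_kernel M R l r n = generate (free_Abelian_group (words M n))
    ({frag_of (u @ [x \<oplus>\<^bsub>M\<^esub> y] @ v) - frag_of (u @ [x] @ v) - frag_of (u @ [y] @ v) | u v x y.
        x \<in> carrier M \<and> y \<in> carrier M \<and> u @ [x] @ v \<in> words M n} \<union>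
     {frag_of (u @ [r x b, y] @ v) - frag_of (u @ [x, l b y] @ v) | u v x y b.
        b \<in> R \<and> u @ [x, y] @ v \<in> words M n})"

definition tensor_class ::
  "('m, 's) ring_scheme \<Rightarrow> 'r set \<Rightarrow> ('r \<Rightarrow> 'm \<Rightarrow> 'm) \<Rightarrow> ('m \<Rightarrow> 'r \<Rightarrow> 'm) \<Rightarrow> nat \<Rightarrow>
    ('m list \<Rightarrow>\<^sub>0 int) \<Rightarrow> ('m list \<Rightarrow>\<^sub>0 int) set"
  where "tensor_class M R l r n c =
    tensor_kernel M R l r n #>\<^bsub>free_Abelian_group (words M n)\<^esub> c"

definition tensor_power ::
  "('m, 's) ring_scheme \<Rightarrow> 'r set \<Rightarrow> ('r \<Rightarrow> 'm \<Rightarrow> 'm) \<Rightarrow> ('m \<Rightarrow> 'r \<Rightarrow> 'm) \<Rightarrow> nat \<Rightarrow>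
    ('m list \<Rightarrow>\<^sub>0 int) set monoid"
  where "tensor_power M R l r n =
    free_Abelian_group (words M n) Mod tensor_kernel M R l r n"


section \<open>Cocommutative Hopf algebras\<close>

text \<open>A finite sum of pure tensors in the \<open>n\<close>-fold tensor power of \<open>H\<close> over \<open>K\<close>.\<close>

definition tsum ::
  "('k, 's) ring_scheme \<Rightarrow> ('k, 'h, 't) module_scheme \<Rightarrow> nat \<Rightarrow> 'h list list \<Rightarrow>
    ('h list \<Rightarrow>\<^sub>0 int) set"
  where "tsum K H n ws =
    tensor_class H (carrier K) (smult H) (\<lambda>x a. a \<odot>\<^bsub>H\<^esub> x) n (sum_list (map frag_of ws))"

text \<open>
  Sweedler notation: \<open>sweedler K H \<Delta> h ps\<close> says that the pairs \<open>(a, b)\<close> in the list \<open>ps\<close> satisfy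
  \<open>\<Delta> h = \<Sum> a \<otimes> b\<close>. An expression in \<open>h\<^sub>1\<close> and \<open>h\<^sub>2\<close> is written as a sum over such a list; being
  bilinear in \<open>(a, b)\<close>, it does not depend on the choice of the list.
\<close>

definition sweedler ::
  "('k, 's) ring_scheme \<Rightarrow> ('k, 'h, 't) module_scheme \<Rightarrow> ('h \<Rightarrow> ('h list \<Rightarrow>\<^sub>0 int) set) \<Rightarrow>
    'h \<Rightarrow> ('h \<times> 'h) list \<Rightarrow> bool"
  where "sweedler K H \<Delta> h ps \<longleftrightarrow>
    h \<in> carrier H \<and> set ps \<subseteq> carrier H \<times> carrier H \<and>
    \<Delta> h = tsum K H 2 [[a, b]. (a, b) \<leftarrow> ps]"

definition add_list :: "('a, 's) ring_scheme \<Rightarrow> 'a list \<Rightarrow> 'a"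
  where "add_list G xs = foldr (\<oplus>\<^bsub>G\<^esub>) xs \<zero>\<^bsub>G\<^esub>"

locale hopf_algebra = module K H + H: ring H
  for K :: "('k, 's) ring_scheme" and H :: "('k, 'h, 't) module_scheme" +
  fixes \<Delta> :: "'h \<Rightarrow> ('h list \<Rightarrow>\<^sub>0 int) set" and \<epsilon> :: "'h \<Rightarrow> 'k" and S :: "'h \<Rightarrow> 'h"
  assumes smult_mult_left: "\<lbrakk>a \<in> carrier K; x \<in> carrier H; y \<in> carrier H\<rbrakk> \<Longrightarrow>
      a \<odot>\<^bsub>H\<^esub> (x \<otimes>\<^bsub>H\<^esub> y) = (a \<odot>\<^bsub>H\<^esub> x) \<otimes>\<^bsub>H\<^esub> y"
    and smult_mult_right: "\<lbrakk>a \<in> carrier K; x \<in> carrier H; y \<in> carrier H\<rbrakk> \<Longrightarrow>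
      a \<odot>\<^bsub>H\<^esub> (x \<otimes>\<^bsub>H\<^esub> y) = x \<otimes>\<^bsub>H\<^esub> (a \<odot>\<^bsub>H\<^esub> y)"
    \<comment> \<open>comultiplication: a \<open>K\<close>-algebra homomorphism\<close>
    and comult_closed: "h \<in> carrier H \<Longrightarrow>
      \<Delta> h \<in> carrier (tensor_power H (carrier K) (smult H) (\<lambda>x a. a \<odot>\<^bsub>H\<^esub> x) 2)"
    and comult_add: "\<lbrakk>sweedler K H \<Delta> x ps; sweedler K H \<Delta> y qs\<rbrakk> \<Longrightarrow>
      sweedler K H \<Delta> (x \<oplus>\<^bsub>H\<^esub> y) (ps @ qs)"
    and comult_smult: "\<lbrakk>r \<in> carrier K; sweedler K H \<Delta> x ps\<rbrakk> \<Longrightarrow>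
      sweedler K H \<Delta> (r \<odot>\<^bsub>H\<^esub> x) [(r \<odot>\<^bsub>H\<^esub> a, b). (a, b) \<leftarrow> ps]"
    and comult_one: "sweedler K H \<Delta> \<one>\<^bsub>H\<^esub> [(\<one>\<^bsub>H\<^esub>, \<one>\<^bsub>H\<^esub>)]"
    and comult_mult: "\<lbrakk>sweedler K H \<Delta> x ps; sweedler K H \<Delta> y qs\<rbrakk> \<Longrightarrow>
      sweedler K H \<Delta> (x \<otimes>\<^bsub>H\<^esub> y) [(a \<otimes>\<^bsub>H\<^esub> c, b \<otimes>\<^bsub>H\<^esub> d). (a, b) \<leftarrow> ps, (c, d) \<leftarrow> qs]"
    \<comment> \<open>coassociativity; \<open>ex\<close> chooses an expansion of \<open>\<Delta> x\<close> for each \<open>x\<close>\<close>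
    and coassoc: "\<lbrakk>sweedler K H \<Delta> h ps; \<And>x. x \<in> carrier H \<Longrightarrow> sweedler K H \<Delta> x (ex x)\<rbrakk> \<Longrightarrow>
      tsum K H 3 [[c, d, b]. (a, b) \<leftarrow> ps, (c, d) \<leftarrow> ex a] =
      tsum K H 3 [[a, c, d]. (a, b) \<leftarrow> ps, (c, d) \<leftarrow> ex b]"
    \<comment> \<open>counit: a \<open>K\<close>-algebra homomorphism\<close>
    and counit_hom: "\<epsilon> \<in> ring_hom H K"
    and counit_smult: "\<lbrakk>r \<in> carrier K; x \<in> carrier H\<rbrakk> \<Longrightarrow> \<epsilon> (r \<odot>\<^bsub>H\<^esub> x) = r \<otimes>\<^bsub>K\<^esub> \<epsilon> x"
    and counit_left: "sweedler K H \<Delta> h ps \<Longrightarrow> add_list H [\<epsilon> a \<odot>\<^bsub>H\<^esub> b. (a, b) \<leftarrow> ps] = h"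
    and counit_right: "sweedler K H \<Delta> h ps \<Longrightarrow> add_list H [\<epsilon> b \<odot>\<^bsub>H\<^esub> a. (a, b) \<leftarrow> ps] = h"
    \<comment> \<open>antipode\<close>
    and antipode_closed: "x \<in> carrier H \<Longrightarrow> S x \<in> carrier H"
    and antipode_add: "\<lbrakk>x \<in> carrier H; y \<in> carrier H\<rbrakk> \<Longrightarrow> S (x \<oplus>\<^bsub>H\<^esub> y) = S x \<oplus>\<^bsub>H\<^esub> S y"
    and antipode_smult: "\<lbrakk>r \<in> carrier K; x \<in> carrier H\<rbrakk> \<Longrightarrow> S (r \<odot>\<^bsub>H\<^esub> x) = r \<odot>\<^bsub>H\<^esub> S x"
    and antipode_left: "sweedler K H \<Delta> h ps \<Longrightarrow>
      add_list H [S a \<otimes>\<^bsub>H\<^esub> b. (a, b) \<leftarrow> ps] = \<epsilon> h \<odot>\<^bsub>H\<^esub> \<one>\<^bsub>H\<^esub>"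
    and antipode_right: "sweedler K H \<Delta> h ps \<Longrightarrow>
      add_list H [a \<otimes>\<^bsub>H\<^esub> S b. (a, b) \<leftarrow> ps] = \<epsilon> h \<odot>\<^bsub>H\<^esub> \<one>\<^bsub>H\<^esub>"

locale cocommutative_hopf_algebra = hopf_algebra +
  assumes cocomm: "sweedler K H \<Delta> h ps \<Longrightarrow> sweedler K H \<Delta> h [(b, a). (a, b) \<leftarrow> ps]"


section \<open>The tensor algebra\<close>

text \<open>
  The free \<open>K\<close>-algebra on the set \<open>carrier H\<close>: finitely supported functions on words, with
  convolution along concatenation.
\<close>

definition free_alg ::
  "('k, 's) ring_scheme \<Rightarrow> ('h, 't) partial_object_scheme \<Rightarrow> ('h list \<Rightarrow> 'k) ring"
  where "free_alg K H =
    \<lparr>carrier = {f. (\<forall>w. f w \<in> carrier K) \<and> (\<forall>w. \<not> set w \<subseteq> carrier H \<longrightarrow> f w = \<zero>\<^bsub>K\<^esub>) \<and>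
                   finite {w. f w \<noteq> \<zero>\<^bsub>K\<^esub>}},
     monoid.mult = (\<lambda>f g w. \<Oplus>\<^bsub>K\<^esub>i\<in>{..length w}. f (take i w) \<otimes>\<^bsub>K\<^esub> g (drop i w)),
     one = (\<lambda>w. if w = [] then \<one>\<^bsub>K\<^esub> else \<zero>\<^bsub>K\<^esub>),
     ring.zero = (\<lambda>w. \<zero>\<^bsub>K\<^esub>),
     ring.add = (\<lambda>f g w. f w \<oplus>\<^bsub>K\<^esub> g w)\<rparr>"

definition free_monom :: "('k, 's) ring_scheme \<Rightarrow> 'k \<Rightarrow> 'h list \<Rightarrow> 'h list \<Rightarrow> 'k"
  where "free_monom K r w = (\<lambda>v. if v = w then r else \<zero>\<^bsub>K\<^esub>)"

text \<open>
  The ideal of linear relations. In degree \<open>n\<close> it is spanned by the \<open>K\<close>-multilinearity relations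
  on words of length \<open>n\<close>, so that the quotient is the direct sum of all tensor powers of \<open>H\<close>
  over \<open>K\<close>, multiplied by concatenation.
\<close>

definition linear_ideal ::
  "('k, 's) ring_scheme \<Rightarrow> ('k, 'h, 't) module_scheme \<Rightarrow> ('h list \<Rightarrow> 'k) set"
  where "linear_ideal K H = (let F = free_alg K H; gen = (\<lambda>h. free_monom K \<one>\<^bsub>K\<^esub> [h]) in
    Idl\<^bsub>F\<^esub> ({gen (x \<oplus>\<^bsub>H\<^esub> y) \<ominus>\<^bsub>F\<^esub> (gen x \<oplus>\<^bsub>F\<^esub> gen y) | x y. x \<in> carrier H \<and> y \<in> carrier H} \<union>
           {gen (r \<odot>\<^bsub>H\<^esub> x) \<ominus>\<^bsub>F\<^esub> free_monom K r [x] | r x. r \<in> carrier K \<and> x \<in> carrier H}))"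

definition tensor_alg ::
  "('k, 's) ring_scheme \<Rightarrow> ('k, 'h, 't) module_scheme \<Rightarrow> ('h list \<Rightarrow> 'k) set ring"
  where "tensor_alg K H = free_alg K H Quot linear_ideal K H"

text \<open>\<open>talg_monom K H r [h1, ..., hn]\<close> is \<open>r (h1 \<otimes> ... \<otimes> hn)\<close>.\<close>

definition talg_monom ::
  "('k, 's) ring_scheme \<Rightarrow> ('k, 'h, 't) module_scheme \<Rightarrow> 'k \<Rightarrow> 'h list \<Rightarrow> ('h list \<Rightarrow> 'k) set"
  where "talg_monom K H r w = linear_ideal K H +>\<^bsub>free_alg K H\<^esub> free_monom K r w"


section \<open>The partial Hopf algebra and its base algebra\<close>

definition par_ideal ::
  "('k, 's) ring_scheme \<Rightarrow> ('k, 'h, 't) module_scheme \<Rightarrow> ('h \<Rightarrow> ('h list \<Rightarrow>\<^sub>0 int) set) \<Rightarrow>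
    ('h \<Rightarrow> 'h) \<Rightarrow> ('h list \<Rightarrow> 'k) set set"
  where "par_ideal K H \<Delta> S = (let T = tensor_alg K H; t = talg_monom K H \<one>\<^bsub>K\<^esub> in
    Idl\<^bsub>T\<^esub> ({t [\<one>\<^bsub>H\<^esub>] \<ominus>\<^bsub>T\<^esub> \<one>\<^bsub>T\<^esub>} \<union>
      {add_list T [t [h, a, S b]. (a, b) \<leftarrow> ps] \<ominus>\<^bsub>T\<^esub> add_list T [t [h \<otimes>\<^bsub>H\<^esub> a, S b]. (a, b) \<leftarrow> ps]
        | h k ps. h \<in> carrier H \<and> sweedler K H \<Delta> k ps} \<union>
      {add_list T [t [a, S b, k]. (a, b) \<leftarrow> ps] \<ominus>\<^bsub>T\<^esub> add_list T [t [a, S b \<otimes>\<^bsub>H\<^esub> k]. (a, b) \<leftarrow> ps]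
        | h k ps. k \<in> carrier H \<and> sweedler K H \<Delta> h ps} \<union>
      {add_list T [t [h, S a, b]. (a, b) \<leftarrow> ps] \<ominus>\<^bsub>T\<^esub> add_list T [t [h \<otimes>\<^bsub>H\<^esub> S a, b]. (a, b) \<leftarrow> ps]
        | h k ps. h \<in> carrier H \<and> sweedler K H \<Delta> k ps} \<union>
      {add_list T [t [S a, b, k]. (a, b) \<leftarrow> ps] \<ominus>\<^bsub>T\<^esub> add_list T [t [S a, b \<otimes>\<^bsub>H\<^esub> k]. (a, b) \<leftarrow> ps]
        | h k ps. k \<in> carrier H \<and> sweedler K H \<Delta> h ps}))"

definition par_alg ::
  "('k, 's) ring_scheme \<Rightarrow> ('k, 'h, 't) module_scheme \<Rightarrow> ('h \<Rightarrow> ('h list \<Rightarrow>\<^sub>0 int) set) \<Rightarrow>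
    ('h \<Rightarrow> 'h) \<Rightarrow> ('h list \<Rightarrow> 'k) set set ring"
  where "par_alg K H \<Delta> S = tensor_alg K H Quot par_ideal K H \<Delta> S"

definition par_monom ::
  "('k, 's) ring_scheme \<Rightarrow> ('k, 'h, 't) module_scheme \<Rightarrow> ('h \<Rightarrow> ('h list \<Rightarrow>\<^sub>0 int) set) \<Rightarrow>
    ('h \<Rightarrow> 'h) \<Rightarrow> 'k \<Rightarrow> 'h list \<Rightarrow> ('h list \<Rightarrow> 'k) set set"
  where "par_monom K H \<Delta> S r w = par_ideal K H \<Delta> S +>\<^bsub>tensor_alg K H\<^esub> talg_monom K H r w"

definition par_class ::
  "('k, 's) ring_scheme \<Rightarrow> ('k, 'h, 't) module_scheme \<Rightarrow> ('h \<Rightarrow> ('h list \<Rightarrow>\<^sub>0 int) set) \<Rightarrow>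
    ('h \<Rightarrow> 'h) \<Rightarrow> 'h \<Rightarrow> ('h list \<Rightarrow> 'k) set set"
  where "par_class K H \<Delta> S h = par_monom K H \<Delta> S \<one>\<^bsub>K\<^esub> [h]"

text \<open>
  The \<open>K\<close>-subalgebra generated by the \<open>e h = [h\<^sub>1][S h\<^sub>2]\<close>; the elements \<open>par_monom K H \<Delta> S r []\<close>
  are the scalars \<open>r 1\<close>.
\<close>

definition par_base ::
  "('k, 's) ring_scheme \<Rightarrow> ('k, 'h, 't) module_scheme \<Rightarrow> ('h \<Rightarrow> ('h list \<Rightarrow>\<^sub>0 int) set) \<Rightarrow>
    ('h \<Rightarrow> 'h) \<Rightarrow> ('h list \<Rightarrow> 'k) set set set"
  where "par_base K H \<Delta> S = (let A = par_alg K H \<Delta> S; c = par_class K H \<Delta> S in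
    generate_ring A
      ({par_monom K H \<Delta> S r [] | r. r \<in> carrier K} \<union>
       {add_list A [c a \<otimes>\<^bsub>A\<^esub> c (S b). (a, b) \<leftarrow> ps] | h ps. sweedler K H \<Delta> h ps}))"

definition par_base_lmod ::
  "('k, 's) ring_scheme \<Rightarrow> ('k, 'h, 't) module_scheme \<Rightarrow> ('h \<Rightarrow> ('h list \<Rightarrow>\<^sub>0 int) set) \<Rightarrow>
    ('h \<Rightarrow> 'h) \<Rightarrow> (('h list \<Rightarrow> 'k) set set \<Rightarrow> ('h list \<Rightarrow> 'k) set set \<Rightarrow> ('h list \<Rightarrow> 'k) set set) \<Rightarrow>
    (('h list \<Rightarrow> 'k) set set, ('h list \<Rightarrow> 'k) set set) module"
  where "par_base_lmod K H \<Delta> S act = (let A = par_alg K H \<Delta> S in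
    \<lparr>carrier = par_base K H \<Delta> S, monoid.mult = monoid.mult A, one = \<one>\<^bsub>A\<^esub>,
     ring.zero = \<zero>\<^bsub>A\<^esub>, ring.add = ring.add A, smult = act\<rparr>)"

definition is_par_action ::
  "('k, 's) ring_scheme \<Rightarrow> ('k, 'h, 't) module_scheme \<Rightarrow> ('h \<Rightarrow> ('h list \<Rightarrow>\<^sub>0 int) set) \<Rightarrow>
    ('h \<Rightarrow> 'h) \<Rightarrow> (('h list \<Rightarrow> 'k) set set \<Rightarrow> ('h list \<Rightarrow> 'k) set set \<Rightarrow> ('h list \<Rightarrow> 'k) set set) \<Rightarrow> bool"
  where "is_par_action K H \<Delta> S act \<longleftrightarrow>
    (let A = par_alg K H \<Delta> S; c = par_class K H \<Delta> S in
      left_module A (par_base_lmod K H \<Delta> S act) \<and>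
      (\<forall>h ps b. sweedler K H \<Delta> h ps \<and> b \<in> par_base K H \<Delta> S \<longrightarrow>
        act (c h) b = add_list A [c x \<otimes>\<^bsub>A\<^esub> b \<otimes>\<^bsub>A\<^esub> c (S y). (x, y) \<leftarrow> ps]))"

text \<open>
  The action exists for a cocommutative Hopf algebra, and its values on
  \<open>carrier (par_alg K H \<Delta> S) \<times> par_base K H \<Delta> S\<close> are unique, since the \<open>[h]\<close> and the scalars
  generate the algebra; only values outside of this set are left to the choice operator.
\<close>

definition par_act ::
  "('k, 's) ring_scheme \<Rightarrow> ('k, 'h, 't) module_scheme \<Rightarrow> ('h \<Rightarrow> ('h list \<Rightarrow>\<^sub>0 int) set) \<Rightarrow>
    ('h \<Rightarrow> 'h) \<Rightarrow> ('h list \<Rightarrow> 'k) set set \<Rightarrow> ('h list \<Rightarrow> 'k) set set \<Rightarrow> ('h list \<Rightarrow> 'k) set set"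
  where "par_act K H \<Delta> S = (SOME act. is_par_action K H \<Delta> S act)"

definition par_psi ::
  "('k, 's) ring_scheme \<Rightarrow> ('k, 'h, 't) module_scheme \<Rightarrow> ('h \<Rightarrow> ('h list \<Rightarrow>\<^sub>0 int) set) \<Rightarrow>
    ('h \<Rightarrow> 'h) \<Rightarrow> ('h list \<Rightarrow> 'k) set set \<Rightarrow> ('h list \<Rightarrow> 'k) set set"
  where "par_psi K H \<Delta> S x = par_act K H \<Delta> S x \<one>\<^bsub>par_alg K H \<Delta> S\<^esub>"


section \<open>The complex\<close>

text \<open>Here \<open>A\<close> is a ring, \<open>B\<close> a subring and \<open>\<psi> : A \<rightarrow> B\<close> a map.\<close>

definition bar_class ::
  "('a, 's) ring_scheme \<Rightarrow> 'a set \<Rightarrow> nat \<Rightarrow> ('a list \<Rightarrow>\<^sub>0 int) \<Rightarrow> ('a list \<Rightarrow>\<^sub>0 int) set"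
  where "bar_class A B n = tensor_class A B (monoid.mult A) (monoid.mult A) (n + 1)"

text \<open>
  The additive map on a tensor power, with values in the \<open>(n + 1)\<close>-fold one, given on pure
  tensors by the function \<open>f\<close> on words. As for \<^const>\<open>rcoset_mult\<close>, the union over all
  representatives is a single coset exactly if the map is well defined.
\<close>

definition bar_induced ::
  "('a, 's) ring_scheme \<Rightarrow> 'a set \<Rightarrow> nat \<Rightarrow> ('a list \<Rightarrow> 'a list) \<Rightarrow>
    ('a list \<Rightarrow>\<^sub>0 int) set \<Rightarrow> ('a list \<Rightarrow>\<^sub>0 int) set"
  where "bar_induced A B n f z = (\<Union>c\<in>z. bar_class A B n (frag_extend (\<lambda>w. frag_of (f w)) c))"

text \<open>
  \<open>A\<close> tensored over \<open>B\<close> with itself, \<open>n + 1\<close> factors, as a left \<open>A\<close>-module. The ring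
  multiplication fields of the module record have no meaning here.
\<close>

definition bar_module ::
  "('a, 's) ring_scheme \<Rightarrow> 'a set \<Rightarrow> nat \<Rightarrow> ('a, ('a list \<Rightarrow>\<^sub>0 int) set) module"
  where "bar_module A B n =
    (let P = tensor_power A B (monoid.mult A) (monoid.mult A) (n + 1) in
      \<lparr>carrier = carrier P, monoid.mult = undefined, one = undefined,
       ring.zero = \<one>\<^bsub>P\<^esub>, ring.add = monoid.mult P,
       smult = (\<lambda>a. bar_induced A B n (\<lambda>w. (a \<otimes>\<^bsub>A\<^esub> hd w) # tl w))\<rparr>)"

definition face_word ::
  "('a, 's) ring_scheme \<Rightarrow> ('a \<Rightarrow> 'a) \<Rightarrow> nat \<Rightarrow> nat \<Rightarrow> 'a list \<Rightarrow> 'a list"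
  where "face_word A \<psi> n i w =
    (if i < n then take i w @ [w ! i \<otimes>\<^bsub>A\<^esub> w ! (i + 1)] @ drop (i + 2) w
     else take (n - 1) w @ [w ! (n - 1) \<otimes>\<^bsub>A\<^esub> \<psi> (w ! n)])"

definition bar_face ::
  "('a, 's) ring_scheme \<Rightarrow> 'a set \<Rightarrow> ('a \<Rightarrow> 'a) \<Rightarrow> nat \<Rightarrow> nat \<Rightarrow>
    ('a list \<Rightarrow>\<^sub>0 int) set \<Rightarrow> ('a list \<Rightarrow>\<^sub>0 int) set"
  where "bar_face A B \<psi> n i = bar_induced A B (n - 1) (face_word A \<psi> n i)"

definition bar_diff ::
  "('a, 's) ring_scheme \<Rightarrow> 'a set \<Rightarrow> ('a \<Rightarrow> 'a) \<Rightarrow> nat \<Rightarrow>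
    ('a list \<Rightarrow>\<^sub>0 int) set \<Rightarrow> ('a list \<Rightarrow>\<^sub>0 int) set"
  where "bar_diff A B \<psi> n z = (let C = bar_module A B (n - 1) in
    \<Oplus>\<^bsub>C\<^esub>i\<in>{..n}. if even i then bar_face A B \<psi> n i z else \<ominus>\<^bsub>C\<^esub> bar_face A B \<psi> n i z)"

text \<open>
  \<open>\<psi>\<close> transported along the identification of \<open>A\<close> with its 1-fold tensor power, \<open>x \<mapsto> [x]\<close>.
\<close>

definition bar_aug ::
  "('a, 's) ring_scheme \<Rightarrow> 'a set \<Rightarrow> ('a \<Rightarrow> 'a) \<Rightarrow> ('a list \<Rightarrow>\<^sub>0 int) set \<Rightarrow> 'a"
  where "bar_aug A B \<psi> z = \<psi> (THE x. x \<in> carrier A \<and> z = bar_class A B 0 (frag_of [x]))"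

end

theory Submission
  imports Defs
begin

text \<open>
  Write \<open>A\<close> for the partial Hopf algebra, \<open>B\<close> for its base algebra and \<open>[h]\<close> for the class of \<open>h\<close>.
  The proof separates into a statement about rings and the construction of the data it requires.

  \<^bold>\<open>The ring-theoretic part.\<close> Let \<open>B\<close> be a subring of any ring \<open>A\<close>, and let \<open>A\<close> act on \<open>B\<close> so that
  \<open>B\<close> itself acts by multiplication; put \<open>\<psi> x = x \<triangleright> 1\<close>. Inserting \<open>1\<close> in front is an additive,
  though not \<open>A\<close>-linear, map \<open>s\<close> from each \<open>C\<^sub>n\<close> to the next module with \<open>\<partial> s = id - s \<partial>\<close>
  (\<open>bar_diff_cons_one\<close>). As the boundary is \<open>A\<close>-linear and the \<open>A\<close>-multiples of the values of \<open>s\<close> span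
  the next module, this identity yields \<open>\<partial> \<partial> = 0\<close> by induction, and exactness. For
  projectivity, a left dual basis of \<open>A\<close> over \<open>B\<close> suffices: left \<open>B\<close>-linear \<open>\<theta>\<^sub>i : A \<rightarrow> B\<close> and
  \<open>v\<^sub>i \<in> A\<close> with \<open>x = \<Sum> \<theta>\<^sub>i x v\<^sub>i\<close>, a finite sum for every \<open>x\<close>. Then
  \<open>u \<otimes> x \<otimes> y = \<Sum> u \<otimes> x (\<theta>\<^sub>i y) \<otimes> v\<^sub>i\<close> exhibits every bar module as a retract of a direct sum of
  copies of the preceding one, down to \<open>C\<^sub>0 = A\<close> (\<open>extend_contract_sum\<close>, \<open>bar_lift\<close>).

  \<^bold>\<open>The data.\<close> Both the action of \<open>A\<close> on \<open>B\<close> and the dual basis come from one representation of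
  \<open>A\<close> on the \<open>K\<close>-linear maps \<open>f : H \<rightarrow> A\<close>, in which \<open>[h]\<close> sends \<open>f\<close> to
  \<open>x \<mapsto> [h\<^sub>1] f (x h\<^sub>3) [S h\<^sub>2]\<close>. It is the convolution product of left multiplication by \<open>[h]\<close>, right
  multiplication by \<open>[S h]\<close> and translation of the argument. These are three commuting partial
  representations, and for a cocommutative \<open>H\<close> the convolution of commuting partial representations
  is again one (\<open>partial_rep_convolve\<close>), so the universal property of \<open>A\<close> applies. The maps
  \<open>x \<mapsto> \<epsilon> x a\<close> form a subrepresentation, which is the action on elements \<open>a\<close>. If \<open>\<phi>\<^sub>y\<close> are the
  coordinates of a dual basis of \<open>H\<close> over \<open>K\<close>, provided by the projectivity of \<open>H\<close>, then
  \<open>\<theta>\<^sub>y x\<close> is the value at \<open>1\<close> of \<open>x\<close> applied to the scalar map \<open>k \<mapsto> \<phi>\<^sub>y k 1\<close>.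

  The computations rest on the elements \<open>e\<^sub>h = [h\<^sub>1][S h\<^sub>2]\<close>. They commute, so \<open>B\<close> is commutative, and
  \<open>[h] e\<^sub>k\<close> is the sum of the \<open>e\<close> of \<open>h\<^sub>1 k\<close> times \<open>[h\<^sub>2]\<close>; hence every \<open>[h]\<close> moves past \<open>B\<close>
  (\<open>cl_base\<close>), and \<open>B\<close> is stable under the action. By \<open>conj_conj_antipode\<close>, \<open>b \<in> B\<close> acts on
  \<open>B\<close>-valued maps by pointwise multiplication, which contains both the compatibility of the action
  with the multiplication of \<open>B\<close> and the left \<open>B\<close>-linearity of \<open>\<theta>\<^sub>y\<close>. Finally \<open>x = \<Sum> \<theta>\<^sub>y x [y]\<close> holds for
  \<open>x = [h]\<close>, where it reduces to \<open>[h]\<close> being the sum of the \<open>e\<close> of \<open>h\<^sub>1\<close> times \<open>[h\<^sub>2]\<close>, and the \<open>[h]\<close>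
  span \<open>A\<close> over \<open>B\<close>.
\<close>

section \<open>The universal property of tensor powers\<close>

lemma words_iff: "w \<in> words M n \<longleftrightarrow> set w \<subseteq> carrier M \<and> length w = n"
  by (simp add: words_def)

locale tensor_factors = abelian_group M for M :: "('m, 's) ring_scheme" (structure) +
  fixes R :: "'r set" and l :: "'r \<Rightarrow> 'm \<Rightarrow> 'm" and r :: "'m \<Rightarrow> 'r \<Rightarrow> 'm"
  assumes l_closed: "\<lbrakk>b \<in> R; x \<in> carrier M\<rbrakk> \<Longrightarrow> l b x \<in> carrier M"
    and r_closed: "\<lbrakk>x \<in> carrier M; b \<in> R\<rbrakk> \<Longrightarrow> r x b \<in> carrier M"
begin

abbreviation T where "T n \<equiv> tensor_power M R l r n"

definition pure :: "nat \<Rightarrow> 'm list \<Rightarrow> ('m list \<Rightarrow>\<^sub>0 int) set"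
  where "pure n w = tensor_class M R l r n (frag_of w)"

definition balanced_map :: "('c, 'd) monoid_scheme \<Rightarrow> nat \<Rightarrow> ('m list \<Rightarrow> 'c) \<Rightarrow> bool"
  where "balanced_map G n \<phi> \<longleftrightarrow> \<phi> \<in> words M n \<rightarrow> carrier G \<and>
    (\<forall>u v x y. x \<in> carrier M \<longrightarrow> y \<in> carrier M \<longrightarrow> u @ x # v \<in> words M n \<longrightarrow>
      \<phi> (u @ (x \<oplus> y) # v) = \<phi> (u @ x # v) \<otimes>\<^bsub>G\<^esub> \<phi> (u @ y # v)) \<and>
    (\<forall>u v x y b. b \<in> R \<longrightarrow> u @ x # y # v \<in> words M n \<longrightarrow>
      \<phi> (u @ r x b # y # v) = \<phi> (u @ x # l b y # v))"

lemma kernel_normal: "tensor_kernel M R l r n \<lhd> free_Abelian_group (words M n)"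
proof -
  interpret F: comm_group "free_Abelian_group (words M n)"
    by (rule abelian_free_Abelian_group)
  have "x - y - z \<in> carrier (free_Abelian_group (words M n))"
    if "x \<in> frag_of ` words M n" "y \<in> frag_of ` words M n" "z \<in> frag_of ` words M n" for x y z
  proof -
    have "Poly_Mapping.keys (x - y) \<subseteq> words M n" using that keys_diff[of x y] by auto
    then show ?thesis using that keys_diff[of "x - y" z] by auto
  qed
  moreover have "x - y \<in> carrier (free_Abelian_group (words M n))"
    if "x \<in> frag_of ` words M n" "y \<in> frag_of ` words M n" for x y
    using that keys_diff[of x y] by auto
  ultimately have "subgroup (tensor_kernel M R l r n) (free_Abelian_group (words M n))"
    unfolding tensor_kernel_def
    by (intro F.generate_is_subgroup)
      (auto intro!: imageI simp: words_iff l_closed r_closed simp del: carrier_free_Abelian_group_iff)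
  then show ?thesis
    by (rule F.subgroup_imp_normal)
qed

lemma comm_group_tensor_power: "comm_group (T n)"
proof -
  interpret F: comm_group "free_Abelian_group (words M n)"
    by (rule abelian_free_Abelian_group)
  show ?thesis
    unfolding tensor_power_def
    by (rule F.abelian_FactGroup) (rule normal_imp_subgroup[OF kernel_normal])
qed

lemma tensor_class_hom: "tensor_class M R l r n \<in> hom (free_Abelian_group (words M n)) (T n)"
  unfolding tensor_class_def tensor_power_def by (rule normal.r_coset_hom_Mod[OF kernel_normal])

lemma tensor_class_surj: "tensor_class M R l r n ` carrier (free_Abelian_group (words M n)) = carrier (T n)"
  unfolding tensor_class_def tensor_power_def by (simp only: carrier_FactGroup)

lemma tensor_class_eq_iff:
  assumes "Poly_Mapping.keys c \<subseteq> words M n" "Poly_Mapping.keys d \<subseteq> words M n"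
  shows "tensor_class M R l r n c = tensor_class M R l r n d \<longleftrightarrow> c - d \<in> tensor_kernel M R l r n"
proof -
  interpret F: comm_group "free_Abelian_group (words M n)"
    by (rule abelian_free_Abelian_group)
  interpret N: normal "tensor_kernel M R l r n" "free_Abelian_group (words M n)"
    by (rule kernel_normal)
  have "c - d \<in> tensor_kernel M R l r n \<longleftrightarrow> c \<in> tensor_class M R l r n d"
    using N.rcos_module[OF F.is_group, of d c] assms
    by (simp add: tensor_class_def add.commute)
  also have "\<dots> \<longleftrightarrow> tensor_class M R l r n c = tensor_class M R l r n d"
    unfolding tensor_class_def
    using F.repr_independence[of c _ d] F.rcos_self[of c "tensor_kernel M R l r n"] N.subgroup_axioms assms
    by (metis carrier_free_Abelian_group_iff)
  finally show ?thesis by simp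
qed

lemma tensor_power_member:
  assumes "z \<in> carrier (T n)"
  shows "z \<noteq> {}"
    and "c \<in> z \<Longrightarrow> Poly_Mapping.keys c \<subseteq> words M n \<and> tensor_class M R l r n c = z"
proof -
  interpret F: comm_group "free_Abelian_group (words M n)"
    by (rule abelian_free_Abelian_group)
  interpret N: normal "tensor_kernel M R l r n" "free_Abelian_group (words M n)"
    by (rule kernel_normal)
  obtain d where d: "d \<in> carrier (free_Abelian_group (words M n))" "z = tensor_class M R l r n d"
    using assms tensor_class_surj[of n, symmetric] by auto
  show "z \<noteq> {}"
    using F.rcos_self[OF d(1) N.subgroup_axioms] d(2) by (auto simp: tensor_class_def)
  show "Poly_Mapping.keys c \<subseteq> words M n \<and> tensor_class M R l r n c = z" if "c \<in> z"
    using that d N.elemrcos_carrier[OF F.is_group d(1)] F.repr_independence[OF _ d(1) N.subgroup_axioms, of c]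
    by (auto simp: tensor_class_def)
qed

lemma pure_closed: "w \<in> words M n \<Longrightarrow> pure n w \<in> carrier (T n)"
  using tensor_class_surj[of n] by (auto simp: pure_def)

text \<open>
  Formal sums have integer coefficients, so the pure tensors generate under subtraction alone.
\<close>

lemma tensor_power_induct [consumes 1, case_names zero pure diff]:
  assumes "z \<in> carrier (T n)"
    and "P \<one>\<^bsub>T n\<^esub>"
    and "\<And>w. w \<in> words M n \<Longrightarrow> P (pure n w)"
    and "\<And>x y. \<lbrakk>x \<in> carrier (T n); y \<in> carrier (T n); P x; P y\<rbrakk> \<Longrightarrow> P (x \<otimes>\<^bsub>T n\<^esub> inv\<^bsub>T n\<^esub> y)"
  shows "P z"
proof -
  interpret F: comm_group "free_Abelian_group (words M n)"
    by (rule abelian_free_Abelian_group)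
  interpret T: comm_group "T n" by (rule comm_group_tensor_power)
  interpret q: group_hom "free_Abelian_group (words M n)" "T n" "tensor_class M R l r n"
    by unfold_locales (rule tensor_class_hom)
  obtain c where c: "Poly_Mapping.keys c \<subseteq> words M n" "z = tensor_class M R l r n c"
    using assms(1) tensor_class_surj[of n, symmetric] by auto
  have "Poly_Mapping.keys c \<subseteq> words M n \<and> P (tensor_class M R l r n c)"
    using c(1)
  proof (induction c rule: frag_induction)
    case zero
    then show ?case using q.hom_one assms(2) by simp
  next
    case (one x)
    then show ?case using assms(3) by (simp add: pure_def)
  next
    case (diff a b)
    then have "tensor_class M R l r n (a - b) =
        tensor_class M R l r n a \<otimes>\<^bsub>T n\<^esub> inv\<^bsub>T n\<^esub> tensor_class M R l r n b"
      using q.hom_mult[of a "- b"] q.hom_inv[of b] by simp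
    moreover have "Poly_Mapping.keys (a - b) \<subseteq> words M n"
      using diff keys_diff[of a b] by auto
    ultimately show ?case
      using diff assms(4) q.hom_closed by simp
  qed
  then show ?thesis using c(2) by simp
qed

lemma tensor_power_hom_eqI:
  assumes "group G" "f \<in> hom (T n) G" "g \<in> hom (T n) G"
    and "\<And>w. w \<in> words M n \<Longrightarrow> f (pure n w) = g (pure n w)"
    and "z \<in> carrier (T n)"
  shows "f z = g z"
proof -
  interpret T: comm_group "T n" by (rule comm_group_tensor_power)
  interpret G: group G by fact
  interpret f: group_hom "T n" G f by unfold_locales fact
  interpret g: group_hom "T n" G g by unfold_locales fact
  show ?thesis
    using assms(5) by (induction rule: tensor_power_induct) (auto simp: assms(4))
qed

lemma pure_balanced: "balanced_map (T n) n (pure n)"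
proof -
  interpret F: comm_group "free_Abelian_group (words M n)"
    by (rule abelian_free_Abelian_group)
  interpret q: group_hom "free_Abelian_group (words M n)" "T n" "tensor_class M R l r n"
    using comm_group_tensor_power[of n] tensor_class_hom[of n]
    by (simp add: F.is_group comm_group_def group_hom_axioms_def group_hom_def)
  note gen = generate.incl[where G = "free_Abelian_group (words M n)"]
  have add: "pure n (u @ (x \<oplus> y) # v) = pure n (u @ x # v) \<otimes>\<^bsub>T n\<^esub> pure n (u @ y # v)"
    if "x \<in> carrier M" "y \<in> carrier M" "u @ x # v \<in> words M n" for u v x y
  proof -
    have "frag_of (u @ [x \<oplus> y] @ v) - frag_of (u @ [x] @ v) - frag_of (u @ [y] @ v) \<in> tensor_kernel M R l r n"
      unfolding tensor_kernel_def using that by (intro gen UnI1) (auto simp: words_iff)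
    then have "tensor_class M R l r n (frag_of (u @ [x \<oplus> y] @ v)) =
        tensor_class M R l r n (frag_of (u @ [x] @ v) + frag_of (u @ [y] @ v))"
      using that keys_add[of "frag_of (u @ [x] @ v)" "frag_of (u @ [y] @ v)"]
      by (subst tensor_class_eq_iff) (auto simp: words_iff diff_diff_eq)
    then show ?thesis
      using that q.hom_mult[of "frag_of (u @ [x] @ v)" "frag_of (u @ [y] @ v)"]
      by (simp add: pure_def words_iff)
  qed
  have bal: "pure n (u @ r x b # y # v) = pure n (u @ x # l b y # v)"
    if "b \<in> R" "u @ x # y # v \<in> words M n" for u v x y b
  proof -
    have "frag_of (u @ [r x b, y] @ v) - frag_of (u @ [x, l b y] @ v) \<in> tensor_kernel M R l r n"
      unfolding tensor_kernel_def using that by (intro gen UnI2) fastforce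
    then show ?thesis
      using that unfolding pure_def by (subst tensor_class_eq_iff) (auto simp: words_iff l_closed r_closed)
  qed
  show ?thesis
    unfolding balanced_map_def using add bal pure_closed by (simp add: Pi_iff)
qed

lemmas pure_add = pure_balanced[unfolded balanced_map_def, THEN conjunct2, THEN conjunct1, rule_format]
  and pure_bal = pure_balanced[unfolded balanced_map_def, THEN conjunct2, THEN conjunct2, rule_format]

text \<open>
  The homomorphism induced on the free abelian group kills the generators of the kernel, because
  these are exactly the relations that a balanced map satisfies.
\<close>

lemma tensor_power_universal:
  assumes "comm_group G" and \<phi>: "balanced_map G n \<phi>"
  obtains h where "h \<in> hom (T n) G" "\<And>w. w \<in> words M n \<Longrightarrow> h (pure n w) = \<phi> w"
proof -
  interpret G: comm_group G by fact
  interpret F: comm_group "free_Abelian_group (words M n)"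
    by (rule abelian_free_Abelian_group)
  interpret N: normal "tensor_kernel M R l r n" "free_Abelian_group (words M n)"
    by (rule kernel_normal)
  have closed: "\<phi> w \<in> carrier G" if "w \<in> words M n" for w
    using \<phi> that by (auto simp: balanced_map_def)
  obtain h0 where h0: "h0 \<in> hom (free_Abelian_group (words M n)) G"
      "\<And>w. w \<in> words M n \<Longrightarrow> h0 (frag_of w) = \<phi> w"
    using G.free_Abelian_group_universal[of \<phi> "words M n"] closed by blast
  interpret h0: group_hom "free_Abelian_group (words M n)" G h0
    by unfold_locales (rule h0)
  have diff: "h0 (a - b) = h0 a \<otimes>\<^bsub>G\<^esub> inv\<^bsub>G\<^esub> h0 b" "a - b \<in> carrier (free_Abelian_group (words M n))"
    if "Poly_Mapping.keys a \<subseteq> words M n" "Poly_Mapping.keys b \<subseteq> words M n" for a b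
    using h0.hom_mult[of a "- b"] h0.hom_inv[of b] that keys_diff[of a b] by auto
  have "tensor_kernel M R l r n \<subseteq> kernel (free_Abelian_group (words M n)) G h0"
    unfolding tensor_kernel_def
  proof (rule F.generate_subgroup_incl[OF _ h0.subgroup_kernel], rule subsetI, elim UnE)
    fix c
    assume "c \<in> {frag_of (u @ [x \<oplus> y] @ v) - frag_of (u @ [x] @ v) - frag_of (u @ [y] @ v) | u v x y.
        x \<in> carrier M \<and> y \<in> carrier M \<and> u @ [x] @ v \<in> words M n}"
    then obtain u v x y where c: "c = frag_of (u @ (x \<oplus> y) # v) - frag_of (u @ x # v) - frag_of (u @ y # v)"
      and *: "x \<in> carrier M" "y \<in> carrier M" "u @ x # v \<in> words M n"
      by auto
    from * have **: "u @ y # v \<in> words M n" "u @ (x \<oplus> y) # v \<in> words M n"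
      by (auto simp: words_iff)
    have "\<phi> (u @ (x \<oplus> y) # v) = \<phi> (u @ x # v) \<otimes>\<^bsub>G\<^esub> \<phi> (u @ y # v)"
      using \<phi> * unfolding balanced_map_def by blast
    then show "c \<in> kernel (free_Abelian_group (words M n)) G h0"
      using * ** diff closed
      by (simp add: c kernel_def h0 G.m_comm[of "\<phi> (u @ x # v)" "\<phi> (u @ y # v)"] G.m_assoc)
  next
    fix c
    assume "c \<in> {frag_of (u @ [r x b, y] @ v) - frag_of (u @ [x, l b y] @ v) | u v x y b.
        b \<in> R \<and> u @ [x, y] @ v \<in> words M n}"
    then obtain u v x y b where c: "c = frag_of (u @ r x b # y # v) - frag_of (u @ x # l b y # v)"
      and *: "b \<in> R" "u @ x # y # v \<in> words M n"
      by auto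
    from * have **: "u @ r x b # y # v \<in> words M n" "u @ x # l b y # v \<in> words M n"
      by (auto simp: words_iff l_closed r_closed)
    have "\<phi> (u @ r x b # y # v) = \<phi> (u @ x # l b y # v)"
      using \<phi> * unfolding balanced_map_def by blast
    then show "c \<in> kernel (free_Abelian_group (words M n)) G h0"
      using * ** diff closed by (simp add: c kernel_def h0)
  qed
  then have kernel: "h0 c = \<one>\<^bsub>G\<^esub>" if "c \<in> tensor_kernel M R l r n" for c
    using that by (auto simp: kernel_def)
  have "h0 c = h0 d"
    if c: "c \<in> carrier (free_Abelian_group (words M n))"
      and d: "d \<in> carrier (free_Abelian_group (words M n))"
      and eq: "tensor_kernel M R l r n #>\<^bsub>free_Abelian_group (words M n)\<^esub> c =
        tensor_kernel M R l r n #>\<^bsub>free_Abelian_group (words M n)\<^esub> d" for c d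
  proof -
    have "c - d \<in> tensor_kernel M R l r n"
      using c d eq tensor_class_eq_iff[of c n d] by (simp add: tensor_class_def)
    then have "h0 c \<otimes>\<^bsub>G\<^esub> inv\<^bsub>G\<^esub> h0 d = \<one>\<^bsub>G\<^esub>"
      using kernel[of "c - d"] diff(1)[of c d] c d by simp
    then show ?thesis
      using G.inv_solve_right'[of "\<one>\<^bsub>G\<^esub>" "h0 c" "h0 d"] h0.hom_closed[OF c] h0.hom_closed[OF d]
      by simp
  qed
  from FactGroup_universal[OF h0(1) kernel_normal this]
  obtain h where "h \<in> hom (free_Abelian_group (words M n) Mod tensor_kernel M R l r n) G"
      "\<And>c. c \<in> carrier (free_Abelian_group (words M n)) \<Longrightarrow>
        h (tensor_kernel M R l r n #>\<^bsub>free_Abelian_group (words M n)\<^esub> c) = h0 c"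
    by blast
  then show thesis
    using that[of h] h0(2) by (simp add: tensor_power_def pure_def tensor_class_def)
qed

end

section \<open>The bar construction as a complex of left modules\<close>

locale bar_construction = ring A for A :: "('a, 's) ring_scheme" (structure) +
  fixes B :: "'a set"
  assumes subring: "subring B A"

sublocale bar_construction \<subseteq> tensor_factors A B "monoid.mult A" "monoid.mult A"
  by unfold_locales (auto dest: subringE(1)[OF subring, THEN subsetD])

context bar_construction
begin

abbreviation C where "C \<equiv> bar_module A B"

lemma base_carrier: "b \<in> B \<Longrightarrow> b \<in> carrier A"
  using subringE(1)[OF subring] by auto

lemma bar_module_simps [simp]:
  "carrier (C n) = carrier (T (Suc n))"
  "ring.add (C n) = monoid.mult (T (Suc n))"
  "ring.zero (C n) = one (T (Suc n))"
  by (simp_all add: bar_module_def Let_def)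

lemma bar_abelian_group: "abelian_group (C n)"
proof -
  interpret T: comm_group "T (Suc n)" by (rule comm_group_tensor_power)
  show ?thesis
  proof (rule abelian_groupI)
    fix x y assume "x \<in> carrier (C n)" "y \<in> carrier (C n)"
    then show "x \<oplus>\<^bsub>C n\<^esub> y = y \<oplus>\<^bsub>C n\<^esub> x"
      using T.m_comm by simp
  qed (auto simp: T.m_assoc intro!: bexI[of _ "inv\<^bsub>T (Suc n)\<^esub> x" for x])
qed

text \<open>
  The homomorphism supplied by the universal property sends the class of every representative
  to the class of its image. All members of the union that defines \<^const>\<open>bar_induced\<close> therefore
  coincide, and the union is their common value.
\<close>

lemma bar_induced_hom:
  assumes f: "f \<in> words A (Suc n) \<rightarrow> words A (Suc m)"
    and bal: "balanced_map (T (Suc m)) (Suc n) (\<lambda>w. pure (Suc m) (f w))"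
  shows "bar_induced A B m f \<in> hom (T (Suc n)) (T (Suc m))"
    and "w \<in> words A (Suc n) \<Longrightarrow> bar_induced A B m f (pure (Suc n) w) = pure (Suc m) (f w)"
proof -
  define \<phi> where "\<phi> = frag_extend (\<lambda>w. frag_of (f w))"
  obtain h where h: "h \<in> hom (T (Suc n)) (T (Suc m))"
      "\<And>w. w \<in> words A (Suc n) \<Longrightarrow> h (pure (Suc n) w) = pure (Suc m) (f w)"
    using tensor_power_universal[OF comm_group_tensor_power bal] by blast
  interpret Fn: comm_group "free_Abelian_group (words A (Suc n))" by (rule abelian_free_Abelian_group)
  interpret Fm: comm_group "free_Abelian_group (words A (Suc m))" by (rule abelian_free_Abelian_group)
  interpret Tn: comm_group "T (Suc n)" by (rule comm_group_tensor_power)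
  interpret Tm: comm_group "T (Suc m)" by (rule comm_group_tensor_power)
  interpret qn: group_hom "free_Abelian_group (words A (Suc n))" "T (Suc n)"
    "tensor_class A B (monoid.mult A) (monoid.mult A) (Suc n)"
    by unfold_locales (rule tensor_class_hom)
  interpret qm: group_hom "free_Abelian_group (words A (Suc m))" "T (Suc m)"
    "tensor_class A B (monoid.mult A) (monoid.mult A) (Suc m)"
    by unfold_locales (rule tensor_class_hom)
  interpret h: group_hom "T (Suc n)" "T (Suc m)" h
    by unfold_locales (rule h)
  have keys: "Poly_Mapping.keys (\<phi> c) \<subseteq> words A (Suc m)" if "Poly_Mapping.keys c \<subseteq> words A (Suc n)" for c
    using keys_frag_extend[of "\<lambda>w. frag_of (f w)" c] f that unfolding \<phi>_def by fastforce
  have "(\<lambda>c. bar_class A B m (\<phi> c)) \<in> hom (free_Abelian_group (words A (Suc n))) (T (Suc m))"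
    by (rule homI) (use keys qm.hom_closed qm.hom_mult in \<open>auto simp: bar_class_def \<phi>_def frag_extend_add\<close>)
  then interpret p: group_hom "free_Abelian_group (words A (Suc n))" "T (Suc m)" "\<lambda>c. bar_class A B m (\<phi> c)"
    by unfold_locales
  have "(\<lambda>c. h (bar_class A B n c)) \<in> hom (free_Abelian_group (words A (Suc n))) (T (Suc m))"
    using qn.homh h(1) hom_compose[of _ _ "T (Suc n)" h] by (fastforce simp: bar_class_def comp_def)
  then interpret q: group_hom "free_Abelian_group (words A (Suc n))" "T (Suc m)" "\<lambda>c. h (bar_class A B n c)"
    by unfold_locales
  have rep: "bar_class A B m (\<phi> c) = h (bar_class A B n c)"
    if "Poly_Mapping.keys c \<subseteq> words A (Suc n)" for c
  proof -
    have "Poly_Mapping.keys c \<subseteq> words A (Suc n) \<and> bar_class A B m (\<phi> c) = h (bar_class A B n c)"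
      using that
    proof (induction c rule: frag_induction)
      case zero
      then show ?case using p.hom_one q.hom_one by simp
    next
      case (one w)
      then show ?case using h(2)[of w] by (simp add: bar_class_def pure_def \<phi>_def)
    next
      case (diff a b)
      then show ?case
        using p.hom_mult[of a "- b"] q.hom_mult[of a "- b"] p.hom_inv[of b] q.hom_inv[of b] keys_diff[of a b]
        by auto
    qed
    then show ?thesis by simp
  qed
  have eq: "bar_induced A B m f z = h z" if z: "z \<in> carrier (T (Suc n))" for z
    using tensor_power_member[OF z] rep unfolding bar_induced_def \<phi>_def[symmetric]
    by (auto simp: bar_class_def)
  show "bar_induced A B m f \<in> hom (T (Suc n)) (T (Suc m))"
    by (rule homI) (auto simp: eq)
  show "bar_induced A B m f (pure (Suc n) w) = pure (Suc m) (f w)" if "w \<in> words A (Suc n)"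
    using that h(2) eq[OF pure_closed] by simp
qed

text \<open>
  The word is split at the entry concerned, so that maps given by operations on lists can be
  checked by simplification.
\<close>

lemma balanced_mapI:
  assumes "f \<in> words A n \<rightarrow> words A m"
    and "\<And>u v x y. \<lbrakk>x \<in> carrier A; y \<in> carrier A; set u \<subseteq> carrier A; set v \<subseteq> carrier A; n = Suc (length u + length v)\<rbrakk> \<Longrightarrow>
      pure m (f (u @ (x \<oplus> y) # v)) = pure m (f (u @ x # v)) \<otimes>\<^bsub>T m\<^esub> pure m (f (u @ y # v))"
    and "\<And>u v x y b. \<lbrakk>b \<in> B; x \<in> carrier A; y \<in> carrier A; set u \<subseteq> carrier A; set v \<subseteq> carrier A;
        n = Suc (Suc (length u + length v))\<rbrakk> \<Longrightarrow>
      pure m (f (u @ (x \<otimes> b) # y # v)) = pure m (f (u @ x # (b \<otimes> y) # v))"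
  shows "balanced_map (T m) n (\<lambda>w. pure m (f w))"
  unfolding balanced_map_def using assms by (auto simp: words_iff pure_closed Pi_iff)

lemma pure_addI:
  assumes "x \<in> carrier A" "y \<in> carrier A" "set u \<subseteq> carrier A" "set v \<subseteq> carrier A" "n = Suc (length u + length v)"
  shows "pure n (u @ (x \<oplus> y) # v) = pure n (u @ x # v) \<otimes>\<^bsub>T n\<^esub> pure n (u @ y # v)"
  using assms by (intro pure_add) (auto simp: words_iff)

lemma pure_balI:
  assumes "b \<in> B" "x \<in> carrier A" "y \<in> carrier A" "set u \<subseteq> carrier A" "set v \<subseteq> carrier A"
    "n = Suc (Suc (length u + length v))"
  shows "pure n (u @ (x \<otimes> b) # y # v) = pure n (u @ x # (b \<otimes> y) # v)"
  using assms by (intro pure_bal) (auto simp: words_iff)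

lemma smult_word_balanced:
  assumes a: "a \<in> carrier A"
  shows "(\<lambda>w. (a \<otimes> hd w) # tl w) \<in> words A (Suc n) \<rightarrow> words A (Suc n)"
    and "balanced_map (T (Suc n)) (Suc n) (\<lambda>w. pure (Suc n) ((a \<otimes> hd w) # tl w))"
proof -
  show *: "(\<lambda>w. (a \<otimes> hd w) # tl w) \<in> words A (Suc n) \<rightarrow> words A (Suc n)"
  proof
    fix w assume "w \<in> words A (Suc n)"
    then show "(a \<otimes> hd w) # tl w \<in> words A (Suc n)"
      using a by (cases w) (auto simp: words_iff)
  qed
  show "balanced_map (T (Suc n)) (Suc n) (\<lambda>w. pure (Suc n) ((a \<otimes> hd w) # tl w))"
  proof (rule balanced_mapI[OF *])
    fix u v x y
    assume h: "x \<in> carrier A" "y \<in> carrier A" "set u \<subseteq> carrier A" "set v \<subseteq> carrier A" "Suc n = Suc (length u + length v)"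
    show "pure (Suc n) ((a \<otimes> hd (u @ (x \<oplus> y) # v)) # tl (u @ (x \<oplus> y) # v)) =
        pure (Suc n) ((a \<otimes> hd (u @ x # v)) # tl (u @ x # v)) \<otimes>\<^bsub>T (Suc n)\<^esub>
        pure (Suc n) ((a \<otimes> hd (u @ y # v)) # tl (u @ y # v))"
    proof (cases u)
      case Nil
      then show ?thesis using h a pure_addI[of "a \<otimes> x" "a \<otimes> y" "[]" v "Suc n"] by (simp add: r_distr)
    next
      case (Cons c u')
      then show ?thesis using h a pure_addI[of x y "(a \<otimes> c) # u'" v "Suc n"] by simp
    qed
  next
    fix u v x y b
    assume h: "b \<in> B" "x \<in> carrier A" "y \<in> carrier A" "set u \<subseteq> carrier A" "set v \<subseteq> carrier A"
      "Suc n = Suc (Suc (length u + length v))"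
    show "pure (Suc n) ((a \<otimes> hd (u @ (x \<otimes> b) # y # v)) # tl (u @ (x \<otimes> b) # y # v)) =
        pure (Suc n) ((a \<otimes> hd (u @ x # (b \<otimes> y) # v)) # tl (u @ x # (b \<otimes> y) # v))"
    proof (cases u)
      case Nil
      then show ?thesis
        using h a pure_balI[of b "a \<otimes> x" y "[]" v "Suc n"] by (simp add: m_assoc base_carrier)
    next
      case (Cons c u')
      then show ?thesis using h a pure_balI[of b x y "(a \<otimes> c) # u'" v "Suc n"] by simp
    qed
  qed
qed

lemma bar_smult_eq: "smult (C n) a = bar_induced A B n (\<lambda>w. (a \<otimes> hd w) # tl w)"
  by (simp add: bar_module_def Let_def)

lemma bar_smult_hom: "a \<in> carrier A \<Longrightarrow> smult (C n) a \<in> hom (T (Suc n)) (T (Suc n))"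
  unfolding bar_smult_eq by (rule bar_induced_hom(1)[OF smult_word_balanced])

lemma bar_smult_pure:
  "\<lbrakk>a \<in> carrier A; w \<in> words A (Suc n)\<rbrakk> \<Longrightarrow> smult (C n) a (pure (Suc n) w) = pure (Suc n) ((a \<otimes> hd w) # tl w)"
  unfolding bar_smult_eq by (rule bar_induced_hom(2)[OF smult_word_balanced])

lemma bar_left_module: "left_module A (C n)"
proof -
  interpret C: abelian_group "C n" by (rule bar_abelian_group)
  note hom = bar_smult_hom[of _ n]
  interpret T: comm_group "T (Suc n)" by (rule comm_group_tensor_power)
  note eqI = tensor_power_hom_eqI[OF T.is_group, of _ "Suc n"]
  have wE: "\<exists>x v. w = x # v \<and> x \<in> carrier A \<and> set v \<subseteq> carrier A \<and> n = length v" if "w \<in> words A (Suc n)" for w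
    using that by (cases w) (auto simp: words_iff)
  show ?thesis
  proof (intro_locales, unfold_locales)
    fix a x assume "a \<in> carrier A" "x \<in> carrier (C n)"
    then show "a \<odot>\<^bsub>C n\<^esub> x \<in> carrier (C n)" using hom[of a] by (auto simp: hom_def)
  next
    fix a b x assume h: "a \<in> carrier A" "b \<in> carrier A" "x \<in> carrier (C n)"
    show "(a \<oplus> b) \<odot>\<^bsub>C n\<^esub> x = a \<odot>\<^bsub>C n\<^esub> x \<oplus>\<^bsub>C n\<^esub> b \<odot>\<^bsub>C n\<^esub> x"
    proof (rule eqI[where f = "smult (C n) (a \<oplus> b)" and z = x])
      show "(\<lambda>x. a \<odot>\<^bsub>C n\<^esub> x \<oplus>\<^bsub>C n\<^esub> b \<odot>\<^bsub>C n\<^esub> x) \<in> hom (T (Suc n)) (T (Suc n))"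
        using T.hom_group_mult[OF hom[OF h(1)] hom[OF h(2)]] by simp
      fix w assume w: "w \<in> words A (Suc n)"
      then obtain x v where "w = x # v" "x \<in> carrier A" "set v \<subseteq> carrier A" "n = length v" using wE by blast
      then show "(a \<oplus> b) \<odot>\<^bsub>C n\<^esub> pure (Suc n) w = a \<odot>\<^bsub>C n\<^esub> pure (Suc n) w \<oplus>\<^bsub>C n\<^esub> b \<odot>\<^bsub>C n\<^esub> pure (Suc n) w"
        using w h pure_addI[of "a \<otimes> x" "b \<otimes> x" "[]" v "Suc n"] by (simp add: bar_smult_pure l_distr)
    qed (use h hom in auto)
  next
    fix a x y assume "a \<in> carrier A" "x \<in> carrier (C n)" "y \<in> carrier (C n)"
    then show "a \<odot>\<^bsub>C n\<^esub> (x \<oplus>\<^bsub>C n\<^esub> y) = a \<odot>\<^bsub>C n\<^esub> x \<oplus>\<^bsub>C n\<^esub> a \<odot>\<^bsub>C n\<^esub> y"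
      using hom[of a] by (auto simp: hom_def)
  next
    fix a b x assume h: "a \<in> carrier A" "b \<in> carrier A" "x \<in> carrier (C n)"
    show "(a \<otimes> b) \<odot>\<^bsub>C n\<^esub> x = a \<odot>\<^bsub>C n\<^esub> (b \<odot>\<^bsub>C n\<^esub> x)"
    proof (rule eqI[where f = "smult (C n) (a \<otimes> b)" and z = x])
      show "(\<lambda>x. a \<odot>\<^bsub>C n\<^esub> (b \<odot>\<^bsub>C n\<^esub> x)) \<in> hom (T (Suc n)) (T (Suc n))"
        using hom_compose[OF hom[OF h(2)] hom[OF h(1)]] by (simp add: comp_def)
      fix w assume w: "w \<in> words A (Suc n)"
      then obtain x v where "w = x # v" "x \<in> carrier A" "set v \<subseteq> carrier A" "n = length v" using wE by blast
      then show "(a \<otimes> b) \<odot>\<^bsub>C n\<^esub> pure (Suc n) w = a \<odot>\<^bsub>C n\<^esub> (b \<odot>\<^bsub>C n\<^esub> pure (Suc n) w)"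
        using w h by (simp add: bar_smult_pure words_iff m_assoc)
    qed (use h hom in auto)
  next
    fix x assume h: "x \<in> carrier (C n)"
    show "\<one> \<odot>\<^bsub>C n\<^esub> x = x"
    proof (rule eqI[where f = "smult (C n) \<one>" and z = x])
      show "(\<lambda>x. x) \<in> hom (T (Suc n)) (T (Suc n))" by (auto simp: hom_def)
      fix w assume w: "w \<in> words A (Suc n)"
      then obtain x v where "w = x # v" "x \<in> carrier A" "set v \<subseteq> carrier A" "n = length v" using wE by blast
      then show "\<one> \<odot>\<^bsub>C n\<^esub> pure (Suc n) w = pure (Suc n) w"
        using w by (simp add: bar_smult_pure)
    qed (use h hom in auto)
  qed
qed

end

section \<open>Faces and the contracting homotopy\<close>

lemma abelian_group_homI:
  assumes "abelian_group G" "abelian_group H" "f \<in> carrier G \<rightarrow> carrier H"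
    and "\<And>x y. \<lbrakk>x \<in> carrier G; y \<in> carrier G\<rbrakk> \<Longrightarrow> f (x \<oplus>\<^bsub>G\<^esub> y) = f x \<oplus>\<^bsub>H\<^esub> f y"
  shows "abelian_group_hom G H f"
  using assms
  by (intro abelian_group_hom.intro abelian_group_hom_axioms.intro group_hom.intro group_hom_axioms.intro)
    (auto simp: abelian_group.a_group hom_def)

lemma abelian_group_hom_compose:
  assumes "abelian_group_hom G H f" "abelian_group_hom H I g"
  shows "abelian_group_hom G I (\<lambda>x. g (f x))"
proof -
  interpret f: abelian_group_hom G H f by fact
  interpret g: abelian_group_hom H I g by fact
  show ?thesis
    by (intro abelian_group_homI f.G.abelian_group_axioms g.H.abelian_group_axioms) auto
qed

lemma lmod_hom_abelian_group_hom:
  assumes "left_module R M" "left_module R N" "f \<in> lmod_hom R M N"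
  shows "abelian_group_hom M N f"
  using assms by (intro abelian_group_homI) (auto simp: lmod_hom_def left_module_def)

lemma (in abelian_group_hom) hom_finsum_finite:
  assumes "finite F" "g \<in> F \<rightarrow> carrier G"
  shows "h (finsum G g F) = finsum H (\<lambda>i. h (g i)) F"
  using assms
proof (induction F rule: finite_induct)
  case (insert i F)
  then show ?case
    by (subst G.finsum_insert) (auto simp: H.finsum_insert Pi_iff)
qed simp

lemma (in left_module) smult_abelian_group_hom:
  "a \<in> carrier R \<Longrightarrow> abelian_group_hom M M (smult M a)"
  by (rule abelian_group_homI) (auto simp: smult_closed smult_r_distr M.abelian_group_axioms)

lemma lmod_hom_finsum:
  assumes M: "left_module R M" and N: "left_module R N" and F: "finite F" "\<And>i. i \<in> F \<Longrightarrow> f i \<in> lmod_hom R M N"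
  shows "(\<lambda>x. finsum N (\<lambda>i. f i x) F) \<in> lmod_hom R M N"
proof -
  interpret M: left_module R M by fact
  interpret N: left_module R N by fact
  have closed: "(\<lambda>i. f i x) \<in> F \<rightarrow> carrier N" if "x \<in> carrier M" for x
    using F(2) that unfolding lmod_hom_def by blast
  show ?thesis
    unfolding lmod_hom_def
  proof (intro CollectI conjI ballI)
    show "(\<lambda>x. finsum N (\<lambda>i. f i x) F) \<in> carrier M \<rightarrow> carrier N"
      using closed by (auto intro!: N.M.finsum_closed)
    show "finsum N (\<lambda>i. f i (x \<oplus>\<^bsub>M\<^esub> y)) F = finsum N (\<lambda>i. f i x) F \<oplus>\<^bsub>N\<^esub> finsum N (\<lambda>i. f i y) F"
      if "x \<in> carrier M" "y \<in> carrier M" for x y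
    proof -
      have "finsum N (\<lambda>i. f i (x \<oplus>\<^bsub>M\<^esub> y)) F = finsum N (\<lambda>i. f i x \<oplus>\<^bsub>N\<^esub> f i y) F"
        using closed that F(2) by (intro N.M.finsum_cong') (auto simp: lmod_hom_def Pi_iff)
      then show ?thesis
        using N.M.finsum_addf[OF closed closed] that by simp
    qed
    show "finsum N (\<lambda>i. f i (a \<odot>\<^bsub>M\<^esub> x)) F = a \<odot>\<^bsub>N\<^esub> finsum N (\<lambda>i. f i x) F"
      if "a \<in> carrier R" "x \<in> carrier M" for a x
    proof -
      have f: "f i x \<in> carrier N" "f i (a \<odot>\<^bsub>M\<^esub> x) = a \<odot>\<^bsub>N\<^esub> f i x" if "i \<in> F" for i
        using closed F(2)[OF that] \<open>a \<in> carrier R\<close> \<open>x \<in> carrier M\<close> that by (auto simp: lmod_hom_def)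
      have "finsum N (\<lambda>i. f i (a \<odot>\<^bsub>M\<^esub> x)) F = finsum N (\<lambda>i. a \<odot>\<^bsub>N\<^esub> f i x) F"
        using f that N.smult_closed by (intro N.M.finsum_cong') auto
      then show ?thesis
        using abelian_group_hom.hom_finsum_finite[OF N.smult_abelian_group_hom[OF that(1)] F(1) closed[OF that(2)]]
        by simp
    qed
  qed
qed

lemma lmod_hom_uminus:
  assumes M: "left_module R M" and N: "left_module R N" and f: "f \<in> lmod_hom R M N"
  shows "(\<lambda>x. \<ominus>\<^bsub>N\<^esub> f x) \<in> lmod_hom R M N"
proof -
  interpret M: left_module R M by fact
  interpret N: left_module R N by fact
  show ?thesis
    using f abelian_group_hom.hom_a_inv[OF N.smult_abelian_group_hom]
    by (auto simp: lmod_hom_def N.M.minus_add Pi_iff)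
qed

lemma lmod_hom_cong:
  assumes "left_module R M" "f \<in> lmod_hom R M N" "\<And>x. x \<in> carrier M \<Longrightarrow> f x = g x"
  shows "g \<in> lmod_hom R M N"
proof -
  interpret M: left_module R M by fact
  show ?thesis
    using assms(2) by (auto simp: lmod_hom_def Pi_iff assms(3)[symmetric] M.smult_closed)
qed

text \<open>
  Every face of the bar construction replaces two neighbouring entries \<open>x\<close>, \<open>y\<close> by \<open>m x y\<close>, with
  \<open>m\<close> the product, except for the last one, where \<open>m x y = x \<psi> y\<close>. The projectivity argument uses the
  same operation with \<open>m x y = x \<theta> y\<close>.
\<close>

fun merge :: "('a \<Rightarrow> 'a \<Rightarrow> 'a) \<Rightarrow> nat \<Rightarrow> 'a list \<Rightarrow> 'a list" where
  "merge m 0 (x # y # w) = m x y # w"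
| "merge m (Suc i) (x # w) = x # merge m i w"
| "merge m i w = w"

lemma length_merge: "Suc i < length w \<Longrightarrow> length (merge m i w) = length w - 1"
  by (induction m i w rule: merge.induct) auto

lemma merge_take_drop:
  "Suc i < length w \<Longrightarrow> merge m i w = take i w @ [m (w ! i) (w ! Suc i)] @ drop (Suc (Suc i)) w"
  by (induction m i w rule: merge.induct) auto

lemma merge_append2: "length u = i \<Longrightarrow> merge m i (u @ x # y # v) = u @ m x y # v"
  by (induction u arbitrary: i) auto

lemma face_word_merge:
  assumes "length w = Suc (Suc n)"
  shows "i \<le> n \<Longrightarrow> face_word A \<psi> (Suc n) i w = merge (monoid.mult A) i w"
    and "face_word A \<psi> (Suc n) (Suc n) w = merge (\<lambda>x y. x \<otimes>\<^bsub>A\<^esub> \<psi> y) n w"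
  using assms by (auto simp: face_word_def merge_take_drop)

context bar_construction
begin

text \<open>
  Left linear over \<open>A\<close>, balanced over \<open>B\<close>. Compatibility with the right action of \<open>B\<close> is not
  included, since \<open>\<lambda>x y. x \<otimes> \<psi> y\<close> lacks it; this operation only merges the last two entries, where
  no entry follows to which a scalar could pass.
\<close>

definition bilinear_op where
  "bilinear_op m \<longleftrightarrow>
    (\<forall>x\<in>carrier A. \<forall>y\<in>carrier A. m x y \<in> carrier A) \<and>
    (\<forall>x\<in>carrier A. \<forall>x'\<in>carrier A. \<forall>y\<in>carrier A. m (x \<oplus> x') y = m x y \<oplus> m x' y) \<and>
    (\<forall>x\<in>carrier A. \<forall>y\<in>carrier A. \<forall>y'\<in>carrier A. m x (y \<oplus> y') = m x y \<oplus> m x y') \<and>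
    (\<forall>a\<in>carrier A. \<forall>x\<in>carrier A. \<forall>y\<in>carrier A. m (a \<otimes> x) y = a \<otimes> m x y) \<and>
    (\<forall>b\<in>B. \<forall>x\<in>carrier A. \<forall>y\<in>carrier A. m (x \<otimes> b) y = m x (b \<otimes> y))"

lemma set_merge:
  "\<lbrakk>bilinear_op m; set w \<subseteq> carrier A\<rbrakk> \<Longrightarrow> set (merge m i w) \<subseteq> carrier A"
  by (induction m i w rule: merge.induct) (auto simp: bilinear_op_def)

lemma merge_words: "\<lbrakk>bilinear_op m; i \<le> n\<rbrakk> \<Longrightarrow> merge m i \<in> words A (Suc (Suc n)) \<rightarrow> words A (Suc n)"
  using set_merge[of m _ i] by (auto simp: words_iff length_merge)

text \<open>
  The prefix \<open>p\<close> makes the induction along the word work: \<^const>\<open>merge\<close> strips entries from the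
  front, while the tensors are classes of whole words.
\<close>

lemma merge_add:
  assumes m: "bilinear_op m"
  shows "\<lbrakk>x \<in> carrier A; y \<in> carrier A; set p \<subseteq> carrier A; set u \<subseteq> carrier A; set v \<subseteq> carrier A;
      i < length u + length v; n = length p + length u + length v\<rbrakk> \<Longrightarrow>
    pure n (p @ merge m i (u @ (x \<oplus> y) # v)) =
      pure n (p @ merge m i (u @ x # v)) \<otimes>\<^bsub>T n\<^esub> pure n (p @ merge m i (u @ y # v))"
proof (induction i arbitrary: p u)
  case 0
  show ?case
  proof (cases u)
    case Nil
    then obtain c v' where "v = c # v'" using 0 by (cases v) auto
    then show ?thesis
      using 0 m Nil pure_addI[of "m x c" "m y c" p v' n] by (auto simp: bilinear_op_def)
  next
    case u: (Cons d u')
    show ?thesis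
    proof (cases u')
      case Nil
      then show ?thesis
        using 0 m u pure_addI[of "m d x" "m d y" p v n] by (auto simp: bilinear_op_def)
    next
      case (Cons d' u'')
      then show ?thesis
        using 0 m u pure_addI[of x y "p @ m d d' # u''" v n] by (auto simp: bilinear_op_def)
    qed
  qed
next
  case (Suc i)
  show ?case
  proof (cases u)
    case Nil
    then show ?thesis
      using Suc.prems pure_addI[of x y p "merge m i v" n] set_merge[OF m, of v i]
      by (auto simp: length_merge)
  next
    case (Cons d u')
    then show ?thesis using Suc.prems Suc.IH[of "p @ [d]" u'] by simp
  qed
qed

text \<open>
  If the scalar stands directly behind the merged pair, it has to pass out of \<open>m x y\<close>. This can
  happen only if an entry follows the pair, which is the situation \<open>i < length u + length v\<close>.
\<close>

lemma merge_bal: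
  assumes m: "bilinear_op m"
  shows "\<lbrakk>b \<in> B; x \<in> carrier A; y \<in> carrier A; set p \<subseteq> carrier A; set u \<subseteq> carrier A; set v \<subseteq> carrier A;
      i \<le> length u + length v; n = Suc (length p + length u + length v);
      i < length u + length v \<Longrightarrow> \<forall>x\<in>carrier A. \<forall>y\<in>carrier A. m x (y \<otimes> b) = m x y \<otimes> b\<rbrakk> \<Longrightarrow>
    pure n (p @ merge m i (u @ (x \<otimes> b) # y # v)) = pure n (p @ merge m i (u @ x # (b \<otimes> y) # v))"
proof (induction i arbitrary: p u)
  case 0
  show ?case
  proof (cases u)
    case Nil
    then show ?thesis using 0 m by (auto simp: bilinear_op_def)
  next
    case u: (Cons d u')
    show ?thesis
    proof (cases u')
      case Nil
      then show ?thesis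
        using 0 m u pure_balI[of b "m d x" y p v n] by (auto simp: bilinear_op_def)
    next
      case (Cons d' u'')
      then show ?thesis
        using 0 m u pure_balI[of b x y "p @ m d d' # u''" v n] by (auto simp: bilinear_op_def)
    qed
  qed
next
  case (Suc i)
  show ?case
  proof (cases u)
    case Nil
    show ?thesis
    proof (cases i)
      case 0
      then obtain c v' where v: "v = c # v'" using Suc.prems Nil by (cases v) auto
      have "m (b \<otimes> y) c = b \<otimes> m y c"
        using m Suc.prems v base_carrier by (auto simp: bilinear_op_def)
      then show ?thesis
        using 0 v Nil Suc.prems m pure_balI[of b x "m y c" p v' n] by (auto simp: bilinear_op_def)
    next
      case (Suc j)
      then show ?thesis
        using Suc.prems Nil pure_balI[of b x y p "merge m j v" n] set_merge[OF m, of v j]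
        by (auto simp: length_merge)
    qed
  next
    case (Cons d u')
    then show ?thesis using Suc.prems Suc.IH[of "p @ [d]" u'] by simp
  qed
qed

lemma merge_balanced:
  assumes m: "bilinear_op m" and i: "i \<le> n"
    and r: "\<And>b x y. \<lbrakk>i < n; b \<in> B; x \<in> carrier A; y \<in> carrier A\<rbrakk> \<Longrightarrow> m x (y \<otimes> b) = m x y \<otimes> b"
  shows "balanced_map (T (Suc n)) (Suc (Suc n)) (\<lambda>w. pure (Suc n) (merge m i w))"
proof (rule balanced_mapI[OF merge_words[OF m i]])
  fix u v x y
  assume "x \<in> carrier A" "y \<in> carrier A" "set u \<subseteq> carrier A" "set v \<subseteq> carrier A" "Suc (Suc n) = Suc (length u + length v)"
  then show "pure (Suc n) (merge m i (u @ (x \<oplus> y) # v)) =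
      pure (Suc n) (merge m i (u @ x # v)) \<otimes>\<^bsub>T (Suc n)\<^esub> pure (Suc n) (merge m i (u @ y # v))"
    using merge_add[OF m, of x y "[]" u v i "Suc n"] i by simp
next
  fix u v x y b
  assume "b \<in> B" "x \<in> carrier A" "y \<in> carrier A" "set u \<subseteq> carrier A" "set v \<subseteq> carrier A"
    "Suc (Suc n) = Suc (Suc (length u + length v))"
  then show "pure (Suc n) (merge m i (u @ (x \<otimes> b) # y # v)) = pure (Suc n) (merge m i (u @ x # (b \<otimes> y) # v))"
    using merge_bal[OF m, of b x y "[]" u v i "Suc n"] i r by simp
qed

lemma bar_hom_eqI:
  assumes "abelian_group_hom (C n) M f" "abelian_group_hom (C n) M g"
    and "\<And>w. w \<in> words A (Suc n) \<Longrightarrow> f (pure (Suc n) w) = g (pure (Suc n) w)"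
    and "z \<in> carrier (C n)"
  shows "f z = g z"
proof (rule tensor_power_hom_eqI[of "add_monoid M" f "Suc n" g])
  show "Group.group (add_monoid M)" "f \<in> hom (T (Suc n)) (add_monoid M)" "g \<in> hom (T (Suc n)) (add_monoid M)"
    using assms(1,2) by (auto simp: abelian_group_hom_def abelian_group_hom_axioms_def group_hom_def group_hom_axioms_def hom_def)
qed (use assms in auto)

lemma bar_induced_abelian_group_hom:
  assumes "f \<in> words A (Suc n) \<rightarrow> words A (Suc m)"
    and "balanced_map (T (Suc m)) (Suc n) (\<lambda>w. pure (Suc m) (f w))"
  shows "abelian_group_hom (C n) (C m) (bar_induced A B m f)"
  using bar_induced_hom(1)[OF assms] by (intro abelian_group_homI bar_abelian_group) (auto simp: hom_def)

lemma bar_induced_lmod_hom: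
  assumes f: "f \<in> words A (Suc n) \<rightarrow> words A (Suc m)"
    and bal: "balanced_map (T (Suc m)) (Suc n) (\<lambda>w. pure (Suc m) (f w))"
    and lin: "\<And>a x v. \<lbrakk>a \<in> carrier A; x # v \<in> words A (Suc n)\<rbrakk> \<Longrightarrow>
      pure (Suc m) (f ((a \<otimes> x) # v)) = a \<odot>\<^bsub>C m\<^esub> pure (Suc m) (f (x # v))"
  shows "bar_induced A B m f \<in> lmod_hom A (C n) (C m)"
proof -
  interpret n: left_module A "C n" by (rule bar_left_module)
  interpret m: left_module A "C m" by (rule bar_left_module)
  interpret f: abelian_group_hom "C n" "C m" "bar_induced A B m f"
    by (rule bar_induced_abelian_group_hom[OF f bal])
  have "bar_induced A B m f (a \<odot>\<^bsub>C n\<^esub> z) = a \<odot>\<^bsub>C m\<^esub> bar_induced A B m f z"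
    if "a \<in> carrier A" "z \<in> carrier (C n)" for a z
  proof (rule bar_hom_eqI[OF _ _ _ that(2)])
    show "abelian_group_hom (C n) (C m) (\<lambda>z. bar_induced A B m f (a \<odot>\<^bsub>C n\<^esub> z))"
      using that f.hom_closed n.smult_closed n.smult_r_distr
      by (intro abelian_group_homI bar_abelian_group) (auto simp del: bar_module_simps)
    show "abelian_group_hom (C n) (C m) (\<lambda>z. a \<odot>\<^bsub>C m\<^esub> bar_induced A B m f z)"
      using that f.hom_closed m.smult_closed m.smult_r_distr
      by (intro abelian_group_homI bar_abelian_group) (auto simp del: bar_module_simps)
    fix w assume w: "w \<in> words A (Suc n)"
    then obtain x v where xv: "w = x # v" by (cases w) (auto simp: words_iff)
    then have "(a \<otimes> x) # v \<in> words A (Suc n)" using w that by (auto simp: words_iff)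
    then show "bar_induced A B m f (a \<odot>\<^bsub>C n\<^esub> pure (Suc n) w) = a \<odot>\<^bsub>C m\<^esub> bar_induced A B m f (pure (Suc n) w)"
      using that w xv lin[of a x v] bar_induced_hom(2)[OF f bal] by (simp add: bar_smult_pure)
  qed
  then show ?thesis
    using f.hom_closed f.hom_add by (auto simp: lmod_hom_def simp del: bar_module_simps)
qed

lemma bar_induced_cong:
  assumes "\<And>w. w \<in> words A (Suc n) \<Longrightarrow> f w = g w" and z: "z \<in> carrier (C n)"
  shows "bar_induced A B m f z = bar_induced A B m g z"
proof -
  have "frag_extend (\<lambda>w. frag_of (f w)) c = frag_extend (\<lambda>w. frag_of (g w)) c" if "c \<in> z" for c
    using tensor_power_member(2)[of z "Suc n" c] z that assms(1) by (intro frag_extend_eq) auto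
  then show ?thesis by (simp add: bar_induced_def)
qed

lemma merge_lmod_hom:
  assumes m: "bilinear_op m" and i: "i \<le> n"
    and r: "\<And>b x y. \<lbrakk>i < n; b \<in> B; x \<in> carrier A; y \<in> carrier A\<rbrakk> \<Longrightarrow> m x (y \<otimes> b) = m x y \<otimes> b"
  shows "bar_induced A B n (merge m i) \<in> lmod_hom A (C (Suc n)) (C n)"
    and "w \<in> words A (Suc (Suc n)) \<Longrightarrow> bar_induced A B n (merge m i) (pure (Suc (Suc n)) w) = pure (Suc n) (merge m i w)"
proof -
  show "bar_induced A B n (merge m i) \<in> lmod_hom A (C (Suc n)) (C n)"
  proof (rule bar_induced_lmod_hom[OF merge_words[OF m i] merge_balanced[OF m i r]])
    fix a x v assume h: "a \<in> carrier A" "x # v \<in> words A (Suc (Suc n))"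
    then obtain y v' where v: "v = y # v'" by (cases v) (auto simp: words_iff)
    have "merge m i (x # v) \<in> words A (Suc n)" using h(2) merge_words[OF m i] by auto
    moreover have "merge m i ((a \<otimes> x) # v) = (a \<otimes> hd (merge m i (x # v))) # tl (merge m i (x # v))"
      using h v m by (cases i) (auto simp: words_iff bilinear_op_def)
    ultimately show "pure (Suc n) (merge m i ((a \<otimes> x) # v)) = a \<odot>\<^bsub>C n\<^esub> pure (Suc n) (merge m i (x # v))"
      using h by (simp add: bar_smult_pure)
  qed
  show "bar_induced A B n (merge m i) (pure (Suc (Suc n)) w) = pure (Suc n) (merge m i w)"
    if "w \<in> words A (Suc (Suc n))"
    by (rule bar_induced_hom(2)[OF merge_words[OF m i] merge_balanced[OF m i r] that])
qed

lemma bilinear_mult: "bilinear_op (\<otimes>)"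
  by (auto simp: bilinear_op_def l_distr r_distr m_assoc base_carrier)

lemma bilinear_mult_left:
  assumes "\<theta> \<in> carrier A \<rightarrow> carrier A"
    and "\<And>x y. \<lbrakk>x \<in> carrier A; y \<in> carrier A\<rbrakk> \<Longrightarrow> \<theta> (x \<oplus> y) = \<theta> x \<oplus> \<theta> y"
    and "\<And>b x. \<lbrakk>b \<in> B; x \<in> carrier A\<rbrakk> \<Longrightarrow> \<theta> (b \<otimes> x) = b \<otimes> \<theta> x"
  shows "bilinear_op (\<lambda>x y. x \<otimes> \<theta> y)"
  using assms by (auto simp: bilinear_op_def l_distr r_distr m_assoc base_carrier Pi_iff)

text \<open>
  The contracting homotopy. It is additive but not \<open>A\<close>-linear.
\<close>

definition cons_one where "cons_one n = bar_induced A B (Suc n) (\<lambda>w. \<one> # w)"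

lemma cons_one_hom: "abelian_group_hom (C n) (C (Suc n)) (cons_one n)"
  and cons_one_pure: "w \<in> words A (Suc n) \<Longrightarrow> cons_one n (pure (Suc n) w) = pure (Suc (Suc n)) (\<one> # w)"
proof -
  have *: "(\<lambda>w. \<one> # w) \<in> words A (Suc n) \<rightarrow> words A (Suc (Suc n))" by (auto simp: words_iff)
  have **: "balanced_map (T (Suc (Suc n))) (Suc n) (\<lambda>w. pure (Suc (Suc n)) (\<one> # w))"
    using pure_addI[of _ _ "\<one> # u" for u] pure_balI[of _ _ _ "\<one> # u" for u]
    by (intro balanced_mapI[OF *]) auto
  show "abelian_group_hom (C n) (C (Suc n)) (cons_one n)"
    unfolding cons_one_def by (rule bar_induced_abelian_group_hom[OF * **])
  show "w \<in> words A (Suc n) \<Longrightarrow> cons_one n (pure (Suc n) w) = pure (Suc (Suc n)) (\<one> # w)"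
    unfolding cons_one_def by (rule bar_induced_hom(2)[OF * **])
qed

text \<open>
  A pure tensor \<open>x \<otimes> w\<close> equals \<open>x \<odot> (\<one> \<otimes> w)\<close>, hence the multiples of the values of the homotopy
  span. Linear identities thus need to be checked only on the image of \<^const>\<open>cons_one\<close>.
\<close>

lemma smult_cons_one_induct [consumes 1, case_names zero smult_cons_one diff]:
  assumes "z \<in> carrier (C (Suc n))"
    and "P \<zero>\<^bsub>C (Suc n)\<^esub>"
    and "\<And>a y. \<lbrakk>a \<in> carrier A; y \<in> carrier (C n)\<rbrakk> \<Longrightarrow> P (a \<odot>\<^bsub>C (Suc n)\<^esub> cons_one n y)"
    and "\<And>x y. \<lbrakk>x \<in> carrier (C (Suc n)); y \<in> carrier (C (Suc n)); P x; P y\<rbrakk> \<Longrightarrow> P (x \<ominus>\<^bsub>C (Suc n)\<^esub> y)"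
  shows "P z"
proof -
  have "z \<in> carrier (T (Suc (Suc n)))" using assms(1) by simp
  then show ?thesis
  proof (induction rule: tensor_power_induct)
    case zero
    then show ?case using assms(2) by simp
  next
    case (pure w)
    then obtain x v where w: "w = x # v" "x \<in> carrier A" "v \<in> words A (Suc n)"
      by (cases w) (auto simp: words_iff)
    then have "pure (Suc (Suc n)) w = x \<odot>\<^bsub>C (Suc n)\<^esub> cons_one n (pure (Suc n) v)"
      using bar_smult_pure[of x "\<one> # v" "Suc n"] by (simp add: cons_one_pure words_iff)
    then show ?case using assms(3) w pure_closed by simp
  next
    case (diff x y)
    interpret C: abelian_group "C (Suc n)" by (rule bar_abelian_group)
    interpret T: comm_group "T (Suc (Suc n))" by (rule comm_group_tensor_power)
    have "\<ominus>\<^bsub>C (Suc n)\<^esub> y = inv\<^bsub>T (Suc (Suc n))\<^esub> y"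
      using diff C.minus_equality[of "inv\<^bsub>T (Suc (Suc n))\<^esub> y" y] by simp
    then show ?case using assms(4)[of x y] diff by (simp add: a_minus_def)
  qed
qed

end

section \<open>The differential of the bar complex\<close>

text \<open>
  \<open>N\<close> is \<open>B\<close> with an action of all of \<open>A\<close>. The action extends the multiplication of \<open>B\<close>; this makes
  \<open>\<psi>\<close> left \<open>B\<close>-linear, so that the last face respects the tensor product over \<open>B\<close>, and makes \<open>\<psi>\<close>
  the identity on \<open>B\<close>.
\<close>

locale bar_resolution = bar_construction A B for A :: "('a, 's) ring_scheme" (structure) and B +
  fixes N :: "('a, 'a, 't) module_scheme" and \<psi> :: "'a \<Rightarrow> 'a"
  assumes base_module: "left_module A N"
    and base_module_simps: "carrier N = B" "ring.add N = ring.add A" "ring.zero N = \<zero>"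
    and base_smult: "\<lbrakk>b \<in> B; c \<in> B\<rbrakk> \<Longrightarrow> b \<odot>\<^bsub>N\<^esub> c = b \<otimes> c"
    and psi_eq: "x \<in> carrier A \<Longrightarrow> \<psi> x = x \<odot>\<^bsub>N\<^esub> \<one>"
begin

lemma one_base: "\<one> \<in> B"
  using subringE(3)[OF subring] .

lemma psi_closed: "x \<in> carrier A \<Longrightarrow> \<psi> x \<in> B"
  using left_module.smult_closed[OF base_module] one_base by (simp add: psi_eq base_module_simps)

lemma psi_add: "\<lbrakk>x \<in> carrier A; y \<in> carrier A\<rbrakk> \<Longrightarrow> \<psi> (x \<oplus> y) = \<psi> x \<oplus> \<psi> y"
  using left_module.smult_l_distr[OF base_module, of x y \<one>] one_base by (simp add: psi_eq base_module_simps)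

lemma psi_mult: "\<lbrakk>x \<in> carrier A; y \<in> carrier A\<rbrakk> \<Longrightarrow> \<psi> (x \<otimes> y) = x \<odot>\<^bsub>N\<^esub> \<psi> y"
  using left_module.smult_assoc[OF base_module, of x y \<one>] one_base by (simp add: psi_eq base_module_simps)

lemma psi_base: "b \<in> B \<Longrightarrow> \<psi> b = b"
  using one_base base_carrier by (simp add: psi_eq base_smult)

lemma psi_base_mult: "\<lbrakk>b \<in> B; x \<in> carrier A\<rbrakk> \<Longrightarrow> \<psi> (b \<otimes> x) = b \<otimes> \<psi> x"
  by (simp add: psi_mult base_carrier base_smult psi_closed)

lemma bilinear_psi: "bilinear_op (\<lambda>x y. x \<otimes> \<psi> y)"
  using psi_closed base_carrier by (intro bilinear_mult_left) (auto simp: psi_add psi_base_mult)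

lemma bar_face_lmod_hom:
  assumes "i \<le> Suc n"
  shows "bar_face A B \<psi> (Suc n) i \<in> lmod_hom A (C (Suc n)) (C n)"
    and "w \<in> words A (Suc (Suc n)) \<Longrightarrow>
      bar_face A B \<psi> (Suc n) i (pure (Suc (Suc n)) w) = pure (Suc n) (face_word A \<psi> (Suc n) i w)"
    and "w \<in> words A (Suc (Suc n)) \<Longrightarrow> face_word A \<psi> (Suc n) i w \<in> words A (Suc n)"
proof -
  define m where "m = (if i \<le> n then monoid.mult A else (\<lambda>x y. x \<otimes> \<psi> y))"
  define j where "j = (if i \<le> n then i else n)"
  have m: "bilinear_op m" using bilinear_mult bilinear_psi by (simp add: m_def)
  have j: "j \<le> n" by (simp add: j_def)
  have r: "m x (y \<otimes> b) = m x y \<otimes> b" if "j < n" "b \<in> B" "x \<in> carrier A" "y \<in> carrier A" for b x y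
    using that base_carrier by (auto simp: m_def j_def m_assoc split: if_splits)
  have face: "face_word A \<psi> (Suc n) i w = merge m j w" if "w \<in> words A (Suc (Suc n))" for w
    using that assms face_word_merge(1)[of w n i A \<psi>] face_word_merge(2)[of w n A \<psi>] le_Suc_eq[of i n] by (auto simp: words_iff m_def j_def)
  have eq: "bar_face A B \<psi> (Suc n) i z = bar_induced A B n (merge m j) z" if "z \<in> carrier (C (Suc n))" for z
    unfolding bar_face_def diff_Suc_1 by (rule bar_induced_cong[OF face that])
  show "w \<in> words A (Suc (Suc n)) \<Longrightarrow> face_word A \<psi> (Suc n) i w \<in> words A (Suc n)"
    using merge_words[OF m j] face by auto
  show "bar_face A B \<psi> (Suc n) i \<in> lmod_hom A (C (Suc n)) (C n)"
    using lmod_hom_cong[OF bar_left_module merge_lmod_hom(1)[OF m j r]] eq by simp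
  show "bar_face A B \<psi> (Suc n) i (pure (Suc (Suc n)) w) = pure (Suc n) (face_word A \<psi> (Suc n) i w)"
    if "w \<in> words A (Suc (Suc n))"
    using merge_lmod_hom(2)[OF m j r that] eq pure_closed face that by simp
qed

lemma signed_face_lmod_hom:
  assumes "i \<le> Suc n"
  shows "(\<lambda>z. if even i then bar_face A B \<psi> (Suc n) i z else \<ominus>\<^bsub>C n\<^esub> bar_face A B \<psi> (Suc n) i z)
    \<in> lmod_hom A (C (Suc n)) (C n)"
  using bar_face_lmod_hom(1)[OF assms] lmod_hom_uminus[OF bar_left_module bar_left_module bar_face_lmod_hom(1)[OF assms]]
  by (cases "even i") simp_all

lemma bar_diff_Suc:
  "bar_diff A B \<psi> (Suc n) z =
    (\<Oplus>\<^bsub>C n\<^esub>i\<in>{..Suc n}. if even i then bar_face A B \<psi> (Suc n) i z else \<ominus>\<^bsub>C n\<^esub> bar_face A B \<psi> (Suc n) i z)"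
  by (simp only: bar_diff_def Let_def diff_Suc_1)

lemma bar_diff_lmod_hom: "bar_diff A B \<psi> (Suc n) \<in> lmod_hom A (C (Suc n)) (C n)"
proof -
  have "(\<lambda>z. \<Oplus>\<^bsub>C n\<^esub>i\<in>{..Suc n}. if even i then bar_face A B \<psi> (Suc n) i z else \<ominus>\<^bsub>C n\<^esub> bar_face A B \<psi> (Suc n) i z)
    \<in> lmod_hom A (C (Suc n)) (C n)"
    by (rule lmod_hom_finsum[OF bar_left_module bar_left_module]) (use signed_face_lmod_hom in auto)
  moreover have "bar_diff A B \<psi> (Suc n) = (\<lambda>z. \<Oplus>\<^bsub>C n\<^esub>i\<in>{..Suc n}.
      if even i then bar_face A B \<psi> (Suc n) i z else \<ominus>\<^bsub>C n\<^esub> bar_face A B \<psi> (Suc n) i z)"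
    by (rule ext) (rule bar_diff_Suc)
  ultimately show ?thesis by simp
qed

text \<open>
  The first face multiplies the inserted \<open>1\<close> into the following entry.
\<close>

lemma face_cons_one_0:
  assumes z: "z \<in> carrier (C n)"
  shows "bar_face A B \<psi> (Suc n) 0 (cons_one n z) = z"
proof (rule bar_hom_eqI[OF _ _ _ z])
  show "abelian_group_hom (C n) (C n) (\<lambda>z. bar_face A B \<psi> (Suc n) 0 (cons_one n z))"
    using abelian_group_hom_compose[OF cons_one_hom lmod_hom_abelian_group_hom[OF bar_left_module bar_left_module bar_face_lmod_hom(1)]]
    by (simp del: bar_module_simps)
  show "abelian_group_hom (C n) (C n) (\<lambda>z. z)"
    by (intro abelian_group_homI bar_abelian_group) auto
  show "bar_face A B \<psi> (Suc n) 0 (cons_one n (pure (Suc n) w)) = pure (Suc n) w"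
    if w: "w \<in> words A (Suc n)" for w
  proof -
    obtain x v where "w = x # v" "x \<in> carrier A" "\<one> # w \<in> words A (Suc (Suc n))"
      using w by (cases w) (auto simp: words_iff)
    then show ?thesis
      using w by (simp add: cons_one_pure bar_face_lmod_hom(2) face_word_def)
  qed
qed

text \<open>
  The other faces act behind the inserted \<open>1\<close>, at an index that is shifted by one.
\<close>

lemma face_cons_one_Suc:
  assumes z: "z \<in> carrier (C (Suc n))" and i: "i \<le> Suc n"
  shows "bar_face A B \<psi> (Suc (Suc n)) (Suc i) (cons_one (Suc n) z) = cons_one n (bar_face A B \<psi> (Suc n) i z)"
proof (rule bar_hom_eqI[OF _ _ _ z])
  show "abelian_group_hom (C (Suc n)) (C (Suc n)) (\<lambda>z. bar_face A B \<psi> (Suc (Suc n)) (Suc i) (cons_one (Suc n) z))"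
    using abelian_group_hom_compose[OF cons_one_hom lmod_hom_abelian_group_hom[OF bar_left_module bar_left_module bar_face_lmod_hom(1)]] i
    by (simp del: bar_module_simps)
  show "abelian_group_hom (C (Suc n)) (C (Suc n)) (\<lambda>z. cons_one n (bar_face A B \<psi> (Suc n) i z))"
    using abelian_group_hom_compose[OF lmod_hom_abelian_group_hom[OF bar_left_module bar_left_module bar_face_lmod_hom(1)] cons_one_hom] i
    by (simp del: bar_module_simps)
  show "bar_face A B \<psi> (Suc (Suc n)) (Suc i) (cons_one (Suc n) (pure (Suc (Suc n)) w)) =
      cons_one n (bar_face A B \<psi> (Suc n) i (pure (Suc (Suc n)) w))"
    if w: "w \<in> words A (Suc (Suc n))" for w
  proof -
    have w1: "\<one> # w \<in> words A (Suc (Suc (Suc n)))" using w by (auto simp: words_iff)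
    have fw: "face_word A \<psi> (Suc n) i w \<in> words A (Suc n)"
      by (rule bar_face_lmod_hom(3)[OF i w])
    have "face_word A \<psi> (Suc (Suc n)) (Suc i) (\<one> # w) = \<one> # face_word A \<psi> (Suc n) i w"
      by (simp add: face_word_def)
    then show ?thesis
      using w w1 fw i by (simp add: cons_one_pure bar_face_lmod_hom(2))
  qed
qed

text \<open>
  The first face gives \<open>z\<close>. In the remaining ones the shift of the index turns every sign around.
\<close>

lemma bar_diff_cons_one:
  assumes z: "z \<in> carrier (C (Suc n))"
  shows "bar_diff A B \<psi> (Suc (Suc n)) (cons_one (Suc n) z) =
    z \<ominus>\<^bsub>C (Suc n)\<^esub> cons_one n (bar_diff A B \<psi> (Suc n) z)"
proof -
  interpret C: abelian_group "C (Suc n)" by (rule bar_abelian_group)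
  interpret s: abelian_group_hom "C n" "C (Suc n)" "cons_one n" by (rule cons_one_hom)
  define f where "f i = (if even i then bar_face A B \<psi> (Suc n) i z else \<ominus>\<^bsub>C n\<^esub> bar_face A B \<psi> (Suc n) i z)" for i
  define g where "g i = (if even i then bar_face A B \<psi> (Suc (Suc n)) i (cons_one (Suc n) z)
    else \<ominus>\<^bsub>C (Suc n)\<^esub> bar_face A B \<psi> (Suc (Suc n)) i (cons_one (Suc n) z))" for i
  have face: "bar_face A B \<psi> (Suc n) i z \<in> carrier (C n)" if "i \<le> Suc n" for i
    using bar_face_lmod_hom(1)[OF that] z by (auto simp: lmod_hom_def simp del: bar_module_simps)
  have f: "f i \<in> carrier (C n)" if "i \<le> Suc n" for i
    using face[OF that] s.G.a_inv_closed by (simp add: f_def del: bar_module_simps)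
  have g0: "g 0 = z"
    using face_cons_one_0[OF z] by (simp add: g_def)
  have gS: "g (Suc i) = \<ominus>\<^bsub>C (Suc n)\<^esub> cons_one n (f i)" if "i \<le> Suc n" for i
    using face[OF that] s.hom_closed[OF face[OF that]] that
    by (simp add: g_def f_def face_cons_one_Suc[OF z] s.hom_a_inv C.minus_minus del: bar_module_simps)
  have g: "g i \<in> carrier (C (Suc n))" if "i \<le> Suc (Suc n)" for i
    using that g0 gS z f s.hom_closed C.a_inv_closed by (cases i) (auto simp del: bar_module_simps)
  have neg: "abelian_group_hom (C (Suc n)) (C (Suc n)) (a_inv (C (Suc n)))"
    by (intro abelian_group_homI C.abelian_group_axioms) (auto simp: C.minus_add simp del: bar_module_simps)
  have "bar_diff A B \<psi> (Suc (Suc n)) (cons_one (Suc n) z) = (\<Oplus>\<^bsub>C (Suc n)\<^esub>i\<in>{..Suc (Suc n)}. g i)"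
    by (simp only: bar_diff_Suc g_def)
  also have "\<dots> = (\<Oplus>\<^bsub>C (Suc n)\<^esub>i\<in>{..Suc n}. g (Suc i)) \<oplus>\<^bsub>C (Suc n)\<^esub> g 0"
    using g by (intro C.finsum_Suc2) (auto simp del: bar_module_simps)
  also have "(\<Oplus>\<^bsub>C (Suc n)\<^esub>i\<in>{..Suc n}. g (Suc i)) = (\<Oplus>\<^bsub>C (Suc n)\<^esub>i\<in>{..Suc n}. \<ominus>\<^bsub>C (Suc n)\<^esub> cons_one n (f i))"
    using gS f s.hom_closed by (intro C.finsum_cong') (auto simp del: bar_module_simps)
  also have "\<dots> = \<ominus>\<^bsub>C (Suc n)\<^esub> (\<Oplus>\<^bsub>C (Suc n)\<^esub>i\<in>{..Suc n}. cons_one n (f i))"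
    using f s.hom_closed by (intro abelian_group_hom.hom_finsum_finite[OF neg, symmetric]) (auto simp del: bar_module_simps)
  also have "(\<Oplus>\<^bsub>C (Suc n)\<^esub>i\<in>{..Suc n}. cons_one n (f i)) = cons_one n (\<Oplus>\<^bsub>C n\<^esub>i\<in>{..Suc n}. f i)"
    using f by (intro s.hom_finsum_finite[symmetric]) (auto simp del: bar_module_simps)
  also have "(\<Oplus>\<^bsub>C n\<^esub>i\<in>{..Suc n}. f i) = bar_diff A B \<psi> (Suc n) z"
    by (simp only: bar_diff_Suc f_def)
  finally show ?thesis
    using g0 z C.a_comm bar_diff_lmod_hom[of n] s.hom_closed C.a_inv_closed
    by (auto simp: a_minus_def lmod_hom_def Pi_iff simp del: bar_module_simps)
qed

end

section \<open>Exactness of the bar complex\<close>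

context bar_resolution
begin

lemma pure_slot_hom:
  assumes "set u \<subseteq> carrier A" "set v \<subseteq> carrier A" "n = length u + length v"
  shows "abelian_group_hom A (C n) (\<lambda>x. pure (Suc n) (u @ x # v))"
  using assms
  by (intro abelian_group_homI bar_abelian_group) (simp_all add: pure_addI words_iff pure_closed abelian_group_axioms)

lemma pure_singleton_hom: "abelian_group_hom A (C 0) (\<lambda>x. pure (Suc 0) [x])"
  using pure_slot_hom[of "[]" "[]"] by simp

text \<open>
  There are no balancing relations between words of length one, so taking the only entry is
  well defined on the first tensor power.
\<close>

lemma pure_singleton_inj:
  assumes "x \<in> carrier A" "y \<in> carrier A" "pure (Suc 0) [x] = pure (Suc 0) [y]"
  shows "x = y"
proof -
  have one: "u = [] \<and> v = []" if "u @ a # v \<in> words A (Suc 0)" for u v a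
    using that by (simp add: words_iff)
  have two: "u @ a # b # v \<notin> words A (Suc 0)" for u v a b
    by (simp add: words_iff)
  have "balanced_map (add_monoid A) (Suc 0) hd"
    unfolding balanced_map_def
  proof (intro conjI allI impI)
    show "hd \<in> words A (Suc 0) \<rightarrow> carrier (add_monoid A)"
      by (auto simp: words_iff length_Suc_conv)
    fix u v a b assume "u @ a # v \<in> words A (Suc 0)"
    from one[OF this] show "hd (u @ (a \<oplus> b) # v) = hd (u @ a # v) \<otimes>\<^bsub>add_monoid A\<^esub> hd (u @ b # v)" by simp
  next
    fix u v a b c assume "u @ a # b # v \<in> words A (Suc 0)"
    with two[of u a b v] show "hd (u @ (a \<otimes> c) # b # v) = hd (u @ a # (c \<otimes> b) # v)" by (rule notE)
  qed
  then show ?thesis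
  proof (rule tensor_power_universal[OF a_comm_group])
    fix h assume h: "\<And>w. w \<in> words A (Suc 0) \<Longrightarrow> h (pure (Suc 0) w) = hd w"
    have "h (pure (Suc 0) [z]) = z" if "z \<in> carrier A" for z
      using h[of "[z]"] that unfolding words_iff by simp
    from this[OF assms(1)] this[OF assms(2)] show "x = y" unfolding assms(3) by (rule trans[OF sym])
  qed
qed

lemma pure_singleton_cases:
  assumes "z \<in> carrier (C 0)"
  obtains x where "x \<in> carrier A" "z = pure (Suc 0) [x]"
proof -
  interpret p: abelian_group_hom A "C 0" "\<lambda>x. pure (Suc 0) [x]" by (rule pure_singleton_hom)
  have "z \<in> carrier (T (Suc 0))" using assms by simp
  then have "\<exists>x\<in>carrier A. z = pure (Suc 0) [x]"
  proof (induction rule: tensor_power_induct)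
    case zero
    then show ?case using p.hom_zero by (intro bexI[of _ \<zero>]) auto
  next
    case (pure w)
    then show ?case by (auto simp: words_iff length_Suc_conv)
  next
    case (diff y z)
    then obtain x x' where x: "x \<in> carrier A" "y = pure (Suc 0) [x]" "x' \<in> carrier A" "z = pure (Suc 0) [x']"
      by auto
    interpret T: comm_group "T (Suc 0)" by (rule comm_group_tensor_power)
    have "pure (Suc 0) [\<ominus> x'] \<otimes>\<^bsub>T (Suc 0)\<^esub> z = \<one>\<^bsub>T (Suc 0)\<^esub>"
      using x p.hom_add[of "\<ominus> x'" x'] p.hom_zero by (simp add: l_neg)
    then have "inv\<^bsub>T (Suc 0)\<^esub> z = pure (Suc 0) [\<ominus> x']"
      using x p.hom_closed[of "\<ominus> x'"] diff by (intro T.inv_equality) auto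
    then show ?case
      using x p.hom_add[of x "\<ominus> x'"] by (intro bexI[of _ "x \<ominus> x'"]) (auto simp: a_minus_def)
  qed
  then show thesis using that by blast
qed

lemma bar_aug_pure: "x \<in> carrier A \<Longrightarrow> bar_aug A B \<psi> (pure (Suc 0) [x]) = \<psi> x"
  unfolding bar_aug_def
  by (rule arg_cong[where f = \<psi>], rule the_equality)
    (auto simp: bar_class_def pure_def[symmetric] dest: pure_singleton_inj)

lemma bar_aug_lmod_hom: "bar_aug A B \<psi> \<in> lmod_hom A (C 0) N"
proof -
  interpret p: abelian_group_hom A "C 0" "\<lambda>x. pure (Suc 0) [x]" by (rule pure_singleton_hom)
  show ?thesis
    unfolding lmod_hom_def
  proof (intro CollectI conjI ballI)
    show "bar_aug A B \<psi> \<in> carrier (C 0) \<rightarrow> carrier N"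
      by (rule funcsetI, elim pure_singleton_cases) (simp add: bar_aug_pure psi_closed base_module_simps)
    show "bar_aug A B \<psi> (z \<oplus>\<^bsub>C 0\<^esub> z') = bar_aug A B \<psi> z \<oplus>\<^bsub>N\<^esub> bar_aug A B \<psi> z'"
      if z: "z \<in> carrier (C 0)" and z': "z' \<in> carrier (C 0)" for z z'
    proof -
      obtain x y where xy: "x \<in> carrier A" "z = pure (Suc 0) [x]" "y \<in> carrier A" "z' = pure (Suc 0) [y]"
        using pure_singleton_cases[OF z] pure_singleton_cases[OF z'] by metis
      then have "bar_aug A B \<psi> (z \<oplus>\<^bsub>C 0\<^esub> z') = \<psi> (x \<oplus> y)"
        using p.hom_add[of x y] bar_aug_pure[of "x \<oplus> y"] by (simp only: a_closed)
      then show ?thesis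
        using xy by (simp add: bar_aug_pure psi_add base_module_simps del: bar_module_simps)
    qed
    show "bar_aug A B \<psi> (a \<odot>\<^bsub>C 0\<^esub> z) = a \<odot>\<^bsub>N\<^esub> bar_aug A B \<psi> z"
      if a: "a \<in> carrier A" and z: "z \<in> carrier (C 0)" for a z
      using z a by (elim pure_singleton_cases) (simp add: bar_smult_pure words_iff bar_aug_pure psi_mult)
  qed
qed

lemma bar_diff_1_cons_one:
  assumes "x \<in> carrier A"
  shows "bar_diff A B \<psi> (Suc 0) (cons_one 0 (pure (Suc 0) [x])) = pure (Suc 0) [x] \<ominus>\<^bsub>C 0\<^esub> pure (Suc 0) [\<psi> x]"
proof -
  interpret C: abelian_group "C 0" by (rule bar_abelian_group)
  have x: "[x] \<in> words A (Suc 0)" "[\<one>, x] \<in> words A (Suc (Suc 0))" using assms by (auto simp: words_iff)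
  have closed: "pure (Suc 0) [x] \<in> carrier (C 0)" "pure (Suc 0) [\<psi> x] \<in> carrier (C 0)"
    using assms psi_closed base_carrier by (auto intro!: pure_closed simp: words_iff)
  have face: "bar_face A B \<psi> (Suc 0) 0 (pure (Suc (Suc 0)) [\<one>, x]) = pure (Suc 0) [x]"
    "bar_face A B \<psi> (Suc 0) (Suc 0) (pure (Suc (Suc 0)) [\<one>, x]) = pure (Suc 0) [\<psi> x]"
    using assms x psi_closed base_carrier by (simp_all add: bar_face_lmod_hom(2) face_word_def)
  have "bar_face A B \<psi> (Suc 0) i (pure (Suc (Suc 0)) [\<one>, x]) \<in> carrier (C 0)" if "i \<le> Suc 0" for i
    using that closed face by (cases i) (simp_all del: bar_module_simps)
  then show ?thesis
    unfolding cons_one_pure[OF x(1)] bar_diff_Suc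
    using closed C.a_comm by (subst C.finsum_Suc) (auto simp: face a_minus_def simp del: bar_module_simps)
qed

text \<open>
  On cycles the homotopy identity says that \<^const>\<open>cons_one\<close> is a section of the boundary map.
  In degree \<open>0\<close> the role of the boundary is taken by the augmentation.
\<close>

lemma bar_diff_section:
  assumes "z \<in> carrier (C n)" and "if n = 0 then bar_aug A B \<psi> z = \<zero> else bar_diff A B \<psi> n z = \<zero>\<^bsub>C (n - 1)\<^esub>"
  shows "bar_diff A B \<psi> (Suc n) (cons_one n z) = z"
proof (cases n)
  case 0
  interpret p: abelian_group_hom A "C 0" "\<lambda>x. pure (Suc 0) [x]" by (rule pure_singleton_hom)
  obtain x where x: "x \<in> carrier A" "z = pure (Suc 0) [x]"
    using assms(1) 0 pure_singleton_cases by blast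
  then have "\<psi> x = \<zero>" using assms(2) 0 by (simp add: bar_aug_pure)
  then show ?thesis
    using x 0 p.hom_zero p.hom_closed[of x]
    by (simp add: bar_diff_1_cons_one a_minus_def del: bar_module_simps)
next
  case (Suc k)
  interpret s: abelian_group_hom "C k" "C (Suc k)" "cons_one k" by (rule cons_one_hom)
  show ?thesis
    using assms Suc bar_diff_cons_one[of z k] s.hom_zero
    by (simp add: a_minus_def del: bar_module_simps)
qed

lemma bar_diff_smult_cons_one:
  assumes "a \<in> carrier A" "y \<in> carrier (C n)"
  shows "bar_diff A B \<psi> (Suc n) (a \<odot>\<^bsub>C (Suc n)\<^esub> cons_one n y) = a \<odot>\<^bsub>C n\<^esub> bar_diff A B \<psi> (Suc n) (cons_one n y)"
proof -
  interpret s: abelian_group_hom "C n" "C (Suc n)" "cons_one n" by (rule cons_one_hom)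
  show ?thesis
    using bar_diff_lmod_hom[of n] assms s.hom_closed by (auto simp: lmod_hom_def simp del: bar_module_simps)
qed

lemma bar_aug_diff:
  assumes "z \<in> carrier (C (Suc 0))"
  shows "bar_aug A B \<psi> (bar_diff A B \<psi> (Suc 0) z) = \<zero>"
proof -
  interpret N: left_module A N by (rule base_module)
  interpret C: left_module A "C 0" by (rule bar_left_module)
  interpret d: abelian_group_hom "C (Suc 0)" "C 0" "bar_diff A B \<psi> (Suc 0)"
    by (rule lmod_hom_abelian_group_hom[OF bar_left_module bar_left_module bar_diff_lmod_hom])
  interpret e: abelian_group_hom "C 0" N "bar_aug A B \<psi>"
    by (rule lmod_hom_abelian_group_hom[OF bar_left_module base_module bar_aug_lmod_hom])
  interpret p: abelian_group_hom A "C 0" "\<lambda>x. pure (Suc 0) [x]" by (rule pure_singleton_hom)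
  have "bar_aug A B \<psi> (bar_diff A B \<psi> (Suc 0) z) = \<zero>\<^bsub>N\<^esub>"
    using assms
  proof (induction rule: smult_cons_one_induct)
    case zero
    then show ?case by (simp only: d.hom_zero e.hom_zero)
  next
    case (smult_cons_one a y)
    obtain x where x: "x \<in> carrier A" "y = pure (Suc 0) [x]"
      using smult_cons_one(2) pure_singleton_cases by blast
    have psi: "\<psi> x \<in> carrier A" "\<psi> x \<in> carrier N" using psi_closed base_carrier base_module_simps x by auto
    have "bar_aug A B \<psi> (pure (Suc 0) [x] \<ominus>\<^bsub>C 0\<^esub> pure (Suc 0) [\<psi> x]) = \<psi> x \<ominus>\<^bsub>N\<^esub> \<psi> x"
      using x psi p.hom_closed[of x] p.hom_closed[of "\<psi> x"] psi_base psi_closed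
      by (simp add: a_minus_def e.hom_a_inv bar_aug_pure del: bar_module_simps)
    then have "bar_aug A B \<psi> (bar_diff A B \<psi> (Suc 0) (cons_one 0 y)) = \<zero>\<^bsub>N\<^esub>"
      using x psi by (simp add: bar_diff_1_cons_one N.M.r_neg a_minus_def)
    then show ?case
      using smult_cons_one bar_aug_lmod_hom N.smult_abelian_group_hom[OF smult_cons_one(1), THEN abelian_group_hom.hom_zero]
        d.hom_closed abelian_group_hom.hom_closed[OF cons_one_hom]
      by (simp add: bar_diff_smult_cons_one lmod_hom_def del: bar_module_simps)
  next
    case (diff x y)
    then show ?case
      by (simp add: a_minus_def e.hom_a_inv d.hom_a_inv del: bar_module_simps)
  qed
  then show ?thesis by (simp add: base_module_simps)
qed

text \<open>
  On an element \<open>s y\<close> the inner boundary is \<open>y - s (\<partial> y)\<close>. Its boundary vanishes as soon as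
  \<open>\<partial> (s (\<partial> y)) = \<partial> y\<close>, which holds since \<open>\<partial> y\<close> is a cycle by the statement one degree lower.
\<close>

lemma bar_diff_diff:
  "z \<in> carrier (C (Suc (Suc n))) \<Longrightarrow> bar_diff A B \<psi> (Suc n) (bar_diff A B \<psi> (Suc (Suc n)) z) = \<zero>\<^bsub>C n\<^esub>"
proof (induction n arbitrary: z)
  have step: "bar_diff A B \<psi> (Suc n) (bar_diff A B \<psi> (Suc (Suc n)) z) = \<zero>\<^bsub>C n\<^esub>"
    if z: "z \<in> carrier (C (Suc (Suc n)))"
      and IH: "\<And>y. y \<in> carrier (C (Suc n)) \<Longrightarrow> bar_diff A B \<psi> (Suc n) (cons_one n (bar_diff A B \<psi> (Suc n) y)) =
        bar_diff A B \<psi> (Suc n) y" for n z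
  proof -
    interpret C: left_module A "C n" by (rule bar_left_module)
    interpret D: left_module A "C (Suc n)" by (rule bar_left_module)
    interpret d: abelian_group_hom "C (Suc n)" "C n" "bar_diff A B \<psi> (Suc n)"
      by (rule lmod_hom_abelian_group_hom[OF bar_left_module bar_left_module bar_diff_lmod_hom])
    interpret d': abelian_group_hom "C (Suc (Suc n))" "C (Suc n)" "bar_diff A B \<psi> (Suc (Suc n))"
      by (rule lmod_hom_abelian_group_hom[OF bar_left_module bar_left_module bar_diff_lmod_hom])
    interpret s: abelian_group_hom "C n" "C (Suc n)" "cons_one n" by (rule cons_one_hom)
    interpret s': abelian_group_hom "C (Suc n)" "C (Suc (Suc n))" "cons_one (Suc n)" by (rule cons_one_hom)
    show ?thesis
      using z
    proof (induction rule: smult_cons_one_induct)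
      case zero
      then show ?case by (simp only: d.hom_zero d'.hom_zero)
    next
      case (smult_cons_one a y)
      have "bar_diff A B \<psi> (Suc n) (bar_diff A B \<psi> (Suc (Suc n)) (cons_one (Suc n) y)) = \<zero>\<^bsub>C n\<^esub>"
        using smult_cons_one(2) IH[of y]
        by (simp add: bar_diff_cons_one a_minus_def d.hom_a_inv C.M.r_neg del: bar_module_simps)
      then show ?case
        using smult_cons_one bar_diff_lmod_hom[of n] C.smult_abelian_group_hom[OF smult_cons_one(1), THEN abelian_group_hom.hom_zero]
        by (simp add: bar_diff_smult_cons_one lmod_hom_def del: bar_module_simps)
    next
      case (diff x y)
      then show ?case
        by (simp add: a_minus_def d.hom_a_inv d'.hom_a_inv del: bar_module_simps)
    qed
  qed
  have closed: "bar_diff A B \<psi> (Suc n) y \<in> carrier (C n)" if "y \<in> carrier (C (Suc n))" for n y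
    using bar_diff_lmod_hom[of n] that by (auto simp: lmod_hom_def simp del: bar_module_simps)
  {
    case 0
    show ?case
      by (rule step[OF 0]) (rule bar_diff_section[OF closed], simp_all add: bar_aug_diff del: bar_module_simps)
  next
    case (Suc n)
    show ?case
      by (rule step[OF Suc.prems], rule bar_diff_section[OF closed])
        (use Suc.IH in \<open>simp_all del: bar_module_simps\<close>)
  }
qed

lemma bar_exact:
  "a_kernel (C (Suc n)) (C n) (bar_diff A B \<psi> (Suc n)) = bar_diff A B \<psi> (Suc (Suc n)) ` carrier (C (Suc (Suc n)))"
proof -
  have "bar_diff A B \<psi> (Suc (Suc n)) z \<in> carrier (C (Suc n))" if "z \<in> carrier (C (Suc (Suc n)))" for z
    using bar_diff_lmod_hom[of "Suc n"] that by (auto simp: lmod_hom_def simp del: bar_module_simps)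
  moreover have "z \<in> bar_diff A B \<psi> (Suc (Suc n)) ` carrier (C (Suc (Suc n)))"
    if "z \<in> carrier (C (Suc n))" "bar_diff A B \<psi> (Suc n) z = \<zero>\<^bsub>C n\<^esub>" for z
    using bar_diff_section[of z "Suc n"] that abelian_group_hom.hom_closed[OF cons_one_hom, of z "Suc n"]
    by (intro image_eqI[of _ _ "cons_one (Suc n) z"]) (simp_all del: bar_module_simps)
  ultimately show ?thesis
    using bar_diff_diff by (auto simp: a_kernel_def' simp del: bar_module_simps)
qed

lemma bar_exact_0: "a_kernel (C 0) N (bar_aug A B \<psi>) = bar_diff A B \<psi> 1 ` carrier (C 1)"
proof -
  have "bar_diff A B \<psi> (Suc 0) z \<in> carrier (C 0)" if "z \<in> carrier (C (Suc 0))" for z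
    using bar_diff_lmod_hom[of 0] that by (auto simp: lmod_hom_def simp del: bar_module_simps)
  moreover have "z \<in> bar_diff A B \<psi> (Suc 0) ` carrier (C (Suc 0))"
    if "z \<in> carrier (C 0)" "bar_aug A B \<psi> z = \<zero>" for z
    using bar_diff_section[of z 0] that abelian_group_hom.hom_closed[OF cons_one_hom, of z 0]
    by (intro image_eqI[of _ _ "cons_one 0 z"]) (simp_all del: bar_module_simps)
  ultimately show ?thesis
    using bar_aug_diff by (auto simp: a_kernel_def' base_module_simps simp del: bar_module_simps)
qed

lemma bar_aug_surj: "bar_aug A B \<psi> ` carrier (C 0) = carrier N"
proof -
  have "b \<in> bar_aug A B \<psi> ` carrier (C 0)" if "b \<in> B" for b
    using that base_carrier psi_base
    by (intro image_eqI[of _ _ "pure (Suc 0) [b]"]) (auto simp: bar_aug_pure words_iff intro!: pure_closed)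
  then show ?thesis
    using bar_aug_lmod_hom by (auto simp: lmod_hom_def base_module_simps simp del: bar_module_simps)
qed

end

section \<open>Projectivity of the bar modules\<close>

text \<open>
  A sum over a possibly infinite index set with finitely many nonzero terms; the sum over an
  infinite set is \<open>\<zero>\<close> by convention.
\<close>

definition fsum :: "('a, 's) ring_scheme \<Rightarrow> ('i \<Rightarrow> 'a) \<Rightarrow> 'i set \<Rightarrow> 'a"
  where "fsum M f I = finsum M f {i \<in> I. f i \<noteq> \<zero>\<^bsub>M\<^esub>}"

lemma (in abelian_monoid) fsum_superset:
  assumes "finite F" "{i \<in> I. f i \<noteq> \<zero>} \<subseteq> F" "F \<subseteq> I" "f \<in> I \<rightarrow> carrier G"
  shows "fsum G f I = finsum G f F"
  unfolding fsum_def using assms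
  by (intro add.finprod_mono_neutral_cong_left) auto

lemma lmod_hom_fsum:
  assumes M: "left_module R M" and N: "left_module R N"
    and f: "\<And>i. i \<in> I \<Longrightarrow> f i \<in> lmod_hom R M N"
    and fin: "\<And>x. x \<in> carrier M \<Longrightarrow> finite {i \<in> I. f i x \<noteq> \<zero>\<^bsub>N\<^esub>}"
  shows "(\<lambda>x. fsum N (\<lambda>i. f i x) I) \<in> lmod_hom R M N"
proof -
  interpret M: left_module R M by fact
  interpret N: left_module R N by fact
  have closed: "(\<lambda>i. f i x) \<in> I \<rightarrow> carrier N" if "x \<in> carrier M" for x
    using f that unfolding lmod_hom_def by blast
  have hom: "(\<lambda>x. finsum N (\<lambda>i. f i x) F) \<in> lmod_hom R M N" if "finite F" "F \<subseteq> I" for F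
    using that f by (intro lmod_hom_finsum[OF M N]) auto
  have eq: "fsum N (\<lambda>i. f i x) I = finsum N (\<lambda>i. f i x) F"
    if "finite F" "F \<subseteq> I" "{i \<in> I. f i x \<noteq> \<zero>\<^bsub>N\<^esub>} \<subseteq> F" "x \<in> carrier M" for x F
    using that closed by (intro N.M.fsum_superset) auto
  show ?thesis
    unfolding lmod_hom_def
  proof (intro CollectI conjI ballI)
    show "(\<lambda>x. fsum N (\<lambda>i. f i x) I) \<in> carrier M \<rightarrow> carrier N"
      using closed by (auto simp: fsum_def intro!: N.M.finsum_closed)
    fix x y assume x: "x \<in> carrier M" and y: "y \<in> carrier M"
    define F where "F = {i \<in> I. f i x \<noteq> \<zero>\<^bsub>N\<^esub>} \<union> {i \<in> I. f i y \<noteq> \<zero>\<^bsub>N\<^esub>} \<union> {i \<in> I. f i (x \<oplus>\<^bsub>M\<^esub> y) \<noteq> \<zero>\<^bsub>N\<^esub>}"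
    have F: "finite F" "F \<subseteq> I" using fin x y by (auto simp: F_def)
    show "fsum N (\<lambda>i. f i (x \<oplus>\<^bsub>M\<^esub> y)) I = fsum N (\<lambda>i. f i x) I \<oplus>\<^bsub>N\<^esub> fsum N (\<lambda>i. f i y) I"
    proof -
      have "fsum N (\<lambda>i. f i u) I = finsum N (\<lambda>i. f i u) F" if "u \<in> {x, y, x \<oplus>\<^bsub>M\<^esub> y}" for u
        using that x y by (intro eq[OF F]) (auto simp: F_def)
      then show ?thesis
        using hom[OF F] x y by (simp add: lmod_hom_def)
    qed
  next
    fix a x assume a: "a \<in> carrier R" and x: "x \<in> carrier M"
    define F where "F = {i \<in> I. f i x \<noteq> \<zero>\<^bsub>N\<^esub>} \<union> {i \<in> I. f i (a \<odot>\<^bsub>M\<^esub> x) \<noteq> \<zero>\<^bsub>N\<^esub>}"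
    have F: "finite F" "F \<subseteq> I" using fin x a M.smult_closed by (auto simp: F_def)
    have "fsum N (\<lambda>i. f i (a \<odot>\<^bsub>M\<^esub> x)) I = finsum N (\<lambda>i. f i (a \<odot>\<^bsub>M\<^esub> x)) F"
      "fsum N (\<lambda>i. f i x) I = finsum N (\<lambda>i. f i x) F"
      using a x M.smult_closed F by (auto intro!: eq simp: F_def)
    then show "fsum N (\<lambda>i. f i (a \<odot>\<^bsub>M\<^esub> x)) I = a \<odot>\<^bsub>N\<^esub> fsum N (\<lambda>i. f i x) I"
      using hom[OF F] a x by (simp add: lmod_hom_def)
  qed
qed

lemma lmod_hom_compose:
  "\<lbrakk>f \<in> lmod_hom R L M; g \<in> lmod_hom R M N\<rbrakk> \<Longrightarrow> (\<lambda>x. g (f x)) \<in> lmod_hom R L N"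
  by (auto simp: lmod_hom_def Pi_iff)

text \<open>
  \<open>v\<close> and \<open>\<theta>\<close> form a left dual basis of \<open>A\<close> over \<open>B\<close>.
\<close>

locale bar_projective = bar_resolution +
  fixes I :: "'i set" and v :: "'i \<Rightarrow> 'a" and \<theta> :: "'i \<Rightarrow> 'a \<Rightarrow> 'a"
  assumes v_closed: "i \<in> I \<Longrightarrow> v i \<in> carrier A"
    and theta_closed: "\<lbrakk>i \<in> I; x \<in> carrier A\<rbrakk> \<Longrightarrow> \<theta> i x \<in> B"
    and theta_add: "\<lbrakk>i \<in> I; x \<in> carrier A; y \<in> carrier A\<rbrakk> \<Longrightarrow> \<theta> i (x \<oplus> y) = \<theta> i x \<oplus> \<theta> i y"
    and theta_mult: "\<lbrakk>i \<in> I; b \<in> B; x \<in> carrier A\<rbrakk> \<Longrightarrow> \<theta> i (b \<otimes> x) = b \<otimes> \<theta> i x"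
    and theta_finite: "x \<in> carrier A \<Longrightarrow> finite {i \<in> I. \<theta> i x \<noteq> \<zero>}"
    and theta_expansion: "x \<in> carrier A \<Longrightarrow> x = finsum A (\<lambda>i. \<theta> i x \<otimes> v i) {i \<in> I. \<theta> i x \<noteq> \<zero>}"
begin

text \<open>
  Together over all \<open>i\<close>, \<open>contract n i : u \<otimes> x \<otimes> y \<mapsto> u \<otimes> x \<theta>\<^sub>i y\<close> and \<open>extend n i : w \<mapsto> w \<otimes> v\<^sub>i\<close> are
  the inclusion and the projection of a retract of a direct sum of copies of \<open>C n\<close>.
\<close>

definition contract where "contract n i = bar_induced A B n (merge (\<lambda>x y. x \<otimes> \<theta> i y) n)"
definition extend where "extend n i = bar_induced A B (Suc n) (\<lambda>w. w @ [v i])"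

lemma contract_lmod_hom:
  assumes "i \<in> I"
  shows "contract n i \<in> lmod_hom A (C (Suc n)) (C n)"
    and "\<lbrakk>set u \<subseteq> carrier A; length u = n; x \<in> carrier A; y \<in> carrier A\<rbrakk> \<Longrightarrow>
      contract n i (pure (Suc (Suc n)) (u @ [x, y])) = pure (Suc n) (u @ [x \<otimes> \<theta> i y])"
proof -
  have m: "bilinear_op (\<lambda>x y. x \<otimes> \<theta> i y)"
    using assms theta_closed base_carrier by (intro bilinear_mult_left) (auto simp: theta_add theta_mult)
  show "contract n i \<in> lmod_hom A (C (Suc n)) (C n)"
    unfolding contract_def by (rule merge_lmod_hom(1)[OF m]) auto
  show "contract n i (pure (Suc (Suc n)) (u @ [x, y])) = pure (Suc n) (u @ [x \<otimes> \<theta> i y])"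
    if "set u \<subseteq> carrier A" "length u = n" "x \<in> carrier A" "y \<in> carrier A"
    unfolding contract_def using that by (subst merge_lmod_hom(2)[OF m]) (auto simp: words_iff merge_append2)
qed

lemma extend_lmod_hom:
  assumes "i \<in> I"
  shows "extend n i \<in> lmod_hom A (C n) (C (Suc n))"
    and "w \<in> words A (Suc n) \<Longrightarrow> extend n i (pure (Suc n) w) = pure (Suc (Suc n)) (w @ [v i])"
proof -
  have *: "(\<lambda>w. w @ [v i]) \<in> words A (Suc n) \<rightarrow> words A (Suc (Suc n))"
    using assms v_closed by (auto simp: words_iff)
  have **: "balanced_map (T (Suc (Suc n))) (Suc n) (\<lambda>w. pure (Suc (Suc n)) (w @ [v i]))"
    using assms v_closed by (intro balanced_mapI[OF *]) (simp_all add: pure_addI pure_balI)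
  show "extend n i \<in> lmod_hom A (C n) (C (Suc n))"
    unfolding extend_def
    by (rule bar_induced_lmod_hom[OF * **])
      (use assms v_closed in \<open>auto simp: bar_smult_pure words_iff\<close>)
  show "extend n i (pure (Suc n) w) = pure (Suc (Suc n)) (w @ [v i])" if "w \<in> words A (Suc n)"
    unfolding extend_def by (rule bar_induced_hom(2)[OF * ** that])
qed

lemma words_SucSuc_cases:
  assumes "w \<in> words A (Suc (Suc n))"
  obtains u x y where "w = u @ [x, y]" "set u \<subseteq> carrier A" "length u = n" "x \<in> carrier A" "y \<in> carrier A"
proof -
  obtain w' y where w: "w = w' @ [y]" using assms by (cases w rule: rev_cases) (auto simp: words_iff)
  obtain u x where "w' = u @ [x]" using assms w by (cases w' rule: rev_cases) (auto simp: words_iff)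
  with w show thesis using assms that[of u x y] by (auto simp: words_iff)
qed

text \<open>
  For pure tensors this is the finiteness of the dual basis at the last entry, and it passes to
  differences.
\<close>

lemma contract_finite:
  assumes "z \<in> carrier (C (Suc n))"
  shows "finite {i \<in> I. contract n i z \<noteq> \<zero>\<^bsub>C n\<^esub>}"
proof -
  interpret D: abelian_group "C n" by (rule bar_abelian_group)
  have hom: "abelian_group_hom (C (Suc n)) (C n) (contract n i)" if "i \<in> I" for i
    by (rule lmod_hom_abelian_group_hom[OF bar_left_module bar_left_module contract_lmod_hom(1)[OF that]])
  have "z \<in> carrier (T (Suc (Suc n)))" using assms by simp
  then show ?thesis
  proof (induction rule: tensor_power_induct)
    case zero
    have none: "{i \<in> I. contract n i \<zero>\<^bsub>C (Suc n)\<^esub> \<noteq> \<zero>\<^bsub>C n\<^esub>} = {}"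
      using abelian_group_hom.hom_zero[OF hom] by (auto simp del: bar_module_simps)
    show ?case unfolding bar_module_simps(3)[symmetric] none by simp
  next
    case (pure w)
    obtain u x y where w: "w = u @ [x, y]" "set u \<subseteq> carrier A" "length u = n" "x \<in> carrier A" "y \<in> carrier A"
      using words_SucSuc_cases[OF pure] by metis
    interpret p: abelian_group_hom A "C n" "\<lambda>x. pure (Suc n) (u @ [x])"
      using pure_slot_hom[of u "[]" n] w by simp
    have "{i \<in> I. contract n i (pure (Suc (Suc n)) w) \<noteq> \<zero>\<^bsub>C n\<^esub>} \<subseteq> {i \<in> I. \<theta> i y \<noteq> \<zero>}"
      using contract_lmod_hom(2)[OF _ w(2-5)] p.hom_zero w(1,4) by (force simp del: bar_module_simps)
    then show ?case using theta_finite[OF w(5)] finite_subset by blast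
  next
    case (diff x y)
    interpret T: comm_group "T (Suc (Suc n))" by (rule comm_group_tensor_power)
    interpret E: abelian_group "C (Suc n)" by (rule bar_abelian_group)
    have "\<ominus>\<^bsub>C (Suc n)\<^esub> y = inv\<^bsub>T (Suc (Suc n))\<^esub> y"
      using diff E.minus_equality[of "inv\<^bsub>T (Suc (Suc n))\<^esub> y" y] by simp
    then have eq: "x \<otimes>\<^bsub>T (Suc (Suc n))\<^esub> inv\<^bsub>T (Suc (Suc n))\<^esub> y = x \<oplus>\<^bsub>C (Suc n)\<^esub> \<ominus>\<^bsub>C (Suc n)\<^esub> y"
      by simp
    have xy: "x \<in> carrier (C (Suc n))" "y \<in> carrier (C (Suc n))" using diff by simp_all
    have "contract n i (x \<oplus>\<^bsub>C (Suc n)\<^esub> \<ominus>\<^bsub>C (Suc n)\<^esub> y) = contract n i x \<oplus>\<^bsub>C n\<^esub> \<ominus>\<^bsub>C n\<^esub> contract n i y" if "i \<in> I" for i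
      using abelian_group_hom.hom_add[OF hom[OF that] xy(1), of "\<ominus>\<^bsub>C (Suc n)\<^esub> y"]
        abelian_group_hom.hom_a_inv[OF hom[OF that] xy(2)] E.a_inv_closed[OF xy(2)]
      by (simp del: bar_module_simps)
    moreover have neg_zero: "\<ominus>\<^bsub>C n\<^esub> \<zero>\<^bsub>C n\<^esub> = \<zero>\<^bsub>C n\<^esub>"
      by (rule D.minus_equality) (rule D.l_zero D.zero_closed)+
    ultimately have "{i \<in> I. contract n i (x \<oplus>\<^bsub>C (Suc n)\<^esub> \<ominus>\<^bsub>C (Suc n)\<^esub> y) \<noteq> \<zero>\<^bsub>C n\<^esub>} \<subseteq>
        {i \<in> I. contract n i x \<noteq> \<zero>\<^bsub>C n\<^esub>} \<union> {i \<in> I. contract n i y \<noteq> \<zero>\<^bsub>C n\<^esub>}"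
      by (auto simp: neg_zero simp del: bar_module_simps)
    then show ?case unfolding eq using diff.IH finite_subset by blast
  qed
qed

text \<open>
  \<open>u \<otimes> x \<otimes> y = \<Sum> u \<otimes> x \<otimes> \<theta>\<^sub>i y v\<^sub>i = \<Sum> u \<otimes> x (\<theta>\<^sub>i y) \<otimes> v\<^sub>i\<close>, by the expansion of \<open>y\<close> and because the
  tensor product is balanced over \<open>B\<close>.
\<close>

lemma extend_contract_sum:
  assumes "z \<in> carrier (C (Suc n))"
  shows "fsum (C (Suc n)) (\<lambda>i. extend n i (contract n i z)) I = z"
proof -
  interpret E: abelian_group "C (Suc n)" by (rule bar_abelian_group)
  have ec: "(\<lambda>z. extend n i (contract n i z)) \<in> lmod_hom A (C (Suc n)) (C (Suc n))" if "i \<in> I" for i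
    using lmod_hom_compose[OF contract_lmod_hom(1)[OF that] extend_lmod_hom(1)[OF that]] .
  have ext0: "extend n i \<zero>\<^bsub>C n\<^esub> = \<zero>\<^bsub>C (Suc n)\<^esub>" if "i \<in> I" for i
    by (rule abelian_group_hom.hom_zero[OF lmod_hom_abelian_group_hom[OF bar_left_module bar_left_module extend_lmod_hom(1)[OF that]]])
  have fin: "finite {i \<in> I. extend n i (contract n i x) \<noteq> \<zero>\<^bsub>C (Suc n)\<^esub>}" if "x \<in> carrier (C (Suc n))" for x
    by (rule finite_subset[OF _ contract_finite[OF that]]) (use ext0 in auto)
  show ?thesis
  proof (rule bar_hom_eqI[OF _ _ _ assms])
    show "abelian_group_hom (C (Suc n)) (C (Suc n)) (\<lambda>z. fsum (C (Suc n)) (\<lambda>i. extend n i (contract n i z)) I)"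
      by (rule lmod_hom_abelian_group_hom[OF bar_left_module bar_left_module lmod_hom_fsum[OF bar_left_module bar_left_module ec fin]])
    show "abelian_group_hom (C (Suc n)) (C (Suc n)) (\<lambda>z. z)"
      by (intro abelian_group_homI bar_abelian_group) auto
    fix w assume "w \<in> words A (Suc (Suc n))"
    then obtain u x y where w: "w = u @ [x, y]" "set u \<subseteq> carrier A" "length u = n" "x \<in> carrier A" "y \<in> carrier A"
      by (rule words_SucSuc_cases)
    define F where "F = {i \<in> I. \<theta> i y \<noteq> \<zero>}"
    have F: "finite F" "F \<subseteq> I" using theta_finite[OF w(5)] by (auto simp: F_def)
    interpret p: abelian_group_hom A "C n" "\<lambda>x. pure (Suc n) (u @ [x])"
      using pure_slot_hom[of u "[]" n] w by simp
    interpret q: abelian_group_hom A "C (Suc n)" "\<lambda>y. pure (Suc (Suc n)) (u @ [x, y])"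
      using pure_slot_hom[of "u @ [x]" "[]" "Suc n"] w by simp
    have eq: "extend n i (contract n i (pure (Suc (Suc n)) w)) = pure (Suc (Suc n)) (u @ [x, \<theta> i y \<otimes> v i])"
      if "i \<in> I" for i
    proof -
      have th: "\<theta> i y \<in> B" using theta_closed[OF that w(5)] .
      have "extend n i (contract n i (pure (Suc (Suc n)) w)) = pure (Suc (Suc n)) (u @ [x \<otimes> \<theta> i y, v i])"
        using w that th base_carrier by (simp add: contract_lmod_hom(2) extend_lmod_hom(2) words_iff)
      also have "\<dots> = pure (Suc (Suc n)) (u @ [x, \<theta> i y \<otimes> v i])"
        using w th v_closed[OF that] by (intro pure_balI) auto
      finally show ?thesis .
    qed
    have "fsum (C (Suc n)) (\<lambda>i. extend n i (contract n i (pure (Suc (Suc n)) w))) I =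
        finsum (C (Suc n)) (\<lambda>i. extend n i (contract n i (pure (Suc (Suc n)) w))) F"
    proof (rule E.fsum_superset[OF F(1) _ F(2)])
      show "{i \<in> I. extend n i (contract n i (pure (Suc (Suc n)) w)) \<noteq> \<zero>\<^bsub>C (Suc n)\<^esub>} \<subseteq> F"
        using q.hom_zero v_closed by (auto simp: F_def eq simp del: bar_module_simps)
      show "(\<lambda>i. extend n i (contract n i (pure (Suc (Suc n)) w))) \<in> I \<rightarrow> carrier (C (Suc n))"
        using theta_closed[OF _ w(5)] base_carrier v_closed q.hom_closed
        by (intro funcsetI, subst eq) (simp_all del: bar_module_simps)
    qed
    also have "\<dots> = finsum (C (Suc n)) (\<lambda>i. pure (Suc (Suc n)) (u @ [x, \<theta> i y \<otimes> v i])) F"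
      using subsetD[OF F(2)] theta_closed[OF _ w(5)] base_carrier v_closed q.hom_closed eq
      by (intro E.finsum_cong' refl funcsetI) (simp_all del: bar_module_simps)
    also have "\<dots> = pure (Suc (Suc n)) (u @ [x, finsum A (\<lambda>i. \<theta> i y \<otimes> v i) F])"
      using F theta_closed base_carrier v_closed w by (intro q.hom_finsum_finite[symmetric]) auto
    also have "finsum A (\<lambda>i. \<theta> i y \<otimes> v i) F = y"
      using theta_expansion[OF w(5)] by (simp add: F_def)
    finally show "fsum (C (Suc n)) (\<lambda>i. extend n i (contract n i (pure (Suc (Suc n)) w))) I = pure (Suc (Suc n)) w"
      using w(1) by simp
  qed
qed

text \<open>
  \<open>C 0\<close> is free on \<open>[\<one>]\<close>. In the induction step a map \<open>f\<close> on \<open>C (Suc n)\<close> is restricted along every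
  \<^term>\<open>extend n i\<close>, lifted there, and the lifts are put together with \<^term>\<open>contract n i\<close>.
\<close>

lemma bar_lift:
  assumes P: "left_module A P" and Q: "left_module A Q"
    and g: "g \<in> lmod_hom A P Q" "g ` carrier P = carrier Q"
  shows "f \<in> lmod_hom A (C n) Q \<Longrightarrow> \<exists>h \<in> lmod_hom A (C n) P. \<forall>z\<in>carrier (C n). g (h z) = f z"
proof (induction n arbitrary: f)
  case 0
  interpret P: left_module A P by fact
  interpret p: abelian_group_hom A "C 0" "\<lambda>x. pure (Suc 0) [x]" by (rule pure_singleton_hom)
  have "f (pure (Suc 0) [\<one>]) \<in> g ` carrier P"
    using 0 g p.hom_closed by (auto simp: lmod_hom_def simp del: bar_module_simps)
  then obtain m where m: "m \<in> carrier P" "g m = f (pure (Suc 0) [\<one>])" by auto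
  define x where "x z = (THE x. x \<in> carrier A \<and> z = pure (Suc 0) [x])" for z
  have x: "x (pure (Suc 0) [a]) = a" if "a \<in> carrier A" for a
    unfolding x_def using that by (intro the_equality) (auto dest: pure_singleton_inj)
  have "(\<lambda>z. x z \<odot>\<^bsub>P\<^esub> m) \<in> lmod_hom A (C 0) P"
    unfolding lmod_hom_def
  proof (intro CollectI conjI ballI)
    show "(\<lambda>z. x z \<odot>\<^bsub>P\<^esub> m) \<in> carrier (C 0) \<rightarrow> carrier P"
      by (rule funcsetI, elim pure_singleton_cases) (simp add: x P.smult_closed m)
    show "x (z \<oplus>\<^bsub>C 0\<^esub> z') \<odot>\<^bsub>P\<^esub> m = x z \<odot>\<^bsub>P\<^esub> m \<oplus>\<^bsub>P\<^esub> x z' \<odot>\<^bsub>P\<^esub> m"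
      if z: "z \<in> carrier (C 0)" and z': "z' \<in> carrier (C 0)" for z z'
    proof -
      obtain a b where ab: "a \<in> carrier A" "z = pure (Suc 0) [a]" "b \<in> carrier A" "z' = pure (Suc 0) [b]"
        using pure_singleton_cases[OF z] pure_singleton_cases[OF z'] by metis
      then have "x (z \<oplus>\<^bsub>C 0\<^esub> z') = a \<oplus> b"
        using p.hom_add[of a b] x[of "a \<oplus> b"] by (simp only: a_closed)
      then show ?thesis
        using ab by (simp add: x P.smult_l_distr m del: bar_module_simps)
    qed
    show "x (a \<odot>\<^bsub>C 0\<^esub> z) \<odot>\<^bsub>P\<^esub> m = a \<odot>\<^bsub>P\<^esub> (x z \<odot>\<^bsub>P\<^esub> m)" if "a \<in> carrier A" "z \<in> carrier (C 0)" for a z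
      using that(2,1) by (elim pure_singleton_cases) (simp add: bar_smult_pure words_iff x P.smult_assoc m)
  qed
  moreover have "g (x z \<odot>\<^bsub>P\<^esub> m) = f z" if z: "z \<in> carrier (C 0)" for z
  proof -
    obtain a where a: "a \<in> carrier A" "z = pure (Suc 0) [a]" using pure_singleton_cases[OF z] by metis
    have "g (x z \<odot>\<^bsub>P\<^esub> m) = a \<odot>\<^bsub>Q\<^esub> f (pure (Suc 0) [\<one>])"
      using g(1) a m by (simp add: x lmod_hom_def)
    also have "\<dots> = f (a \<odot>\<^bsub>C 0\<^esub> pure (Suc 0) [\<one>])"
      using 0 a p.hom_closed[of \<one>] by (simp add: lmod_hom_def del: bar_module_simps)
    also have "a \<odot>\<^bsub>C 0\<^esub> pure (Suc 0) [\<one>] = z"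
      using a by (simp add: bar_smult_pure words_iff)
    finally show ?thesis .
  qed
  ultimately show ?case by (intro bexI[of _ "\<lambda>z. x z \<odot>\<^bsub>P\<^esub> m"]) auto
next
  case (Suc n)
  interpret P: left_module A P by fact
  interpret Q: left_module A Q by fact
  interpret E: left_module A "C (Suc n)" by (rule bar_left_module)
  have "\<exists>h. h \<in> lmod_hom A (C n) P \<and> (\<forall>z\<in>carrier (C n). g (h z) = f (extend n i z))" if "i \<in> I" for i
    using Suc.IH[OF lmod_hom_compose[OF extend_lmod_hom(1)[OF that] Suc.prems]] by blast
  then obtain h where h: "\<And>i. i \<in> I \<Longrightarrow> h i \<in> lmod_hom A (C n) P"
    "\<And>i z. \<lbrakk>i \<in> I; z \<in> carrier (C n)\<rbrakk> \<Longrightarrow> g (h i z) = f (extend n i z)"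
    by metis
  have h0: "h i \<zero>\<^bsub>C n\<^esub> = \<zero>\<^bsub>P\<^esub>" if "i \<in> I" for i
    by (rule abelian_group_hom.hom_zero[OF lmod_hom_abelian_group_hom[OF bar_left_module P h(1)[OF that]]])
  have ext0: "extend n i \<zero>\<^bsub>C n\<^esub> = \<zero>\<^bsub>C (Suc n)\<^esub>" if "i \<in> I" for i
    by (rule abelian_group_hom.hom_zero[OF lmod_hom_abelian_group_hom[OF bar_left_module bar_left_module extend_lmod_hom(1)[OF that]]])
  interpret g: abelian_group_hom P Q g by (rule lmod_hom_abelian_group_hom[OF P Q g(1)])
  interpret f: abelian_group_hom "C (Suc n)" Q f by (rule lmod_hom_abelian_group_hom[OF bar_left_module Q Suc.prems])
  define h' where "h' z = fsum P (\<lambda>i. h i (contract n i z)) I" for z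
  have "h' \<in> lmod_hom A (C (Suc n)) P"
    unfolding h'_def[abs_def]
  proof (rule lmod_hom_fsum[OF bar_left_module P lmod_hom_compose[OF contract_lmod_hom(1) h(1)]])
    show "finite {i \<in> I. h i (contract n i z) \<noteq> \<zero>\<^bsub>P\<^esub>}" if "z \<in> carrier (C (Suc n))" for z
      by (rule finite_subset[OF _ contract_finite[OF that]]) (use h0 in auto)
  qed auto
  moreover have "g (h' z) = f z" if z: "z \<in> carrier (C (Suc n))" for z
  proof -
    define F where "F = {i \<in> I. contract n i z \<noteq> \<zero>\<^bsub>C n\<^esub>}"
    have F: "finite F" "F \<subseteq> I" using contract_finite[OF z] by (auto simp: F_def)
    have c: "contract n i z \<in> carrier (C n)" if "i \<in> I" for i
      using contract_lmod_hom(1)[OF that] z unfolding lmod_hom_def by blast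
    have hc: "h i (contract n i z) \<in> carrier P" if "i \<in> I" for i
      using h(1)[OF that] c[OF that] unfolding lmod_hom_def by blast
    have ec: "extend n i (contract n i z) \<in> carrier (C (Suc n))" if "i \<in> I" for i
      using extend_lmod_hom(1)[OF that] c[OF that] unfolding lmod_hom_def by blast
    have "h' z = finsum P (\<lambda>i. h i (contract n i z)) F"
      unfolding h'_def by (rule P.M.fsum_superset[OF F(1) _ F(2)]) (use hc h0 in \<open>auto simp: F_def\<close>)
    then have "g (h' z) = finsum Q (\<lambda>i. g (h i (contract n i z))) F"
      using F hc by (auto intro!: g.hom_finsum_finite)
    also have "\<dots> = finsum Q (\<lambda>i. f (extend n i (contract n i z))) F"
      using F c ec h(2) f.hom_closed by (intro Q.M.finsum_cong') (auto simp: subset_iff simp del: bar_module_simps)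
    also have "\<dots> = f (finsum (C (Suc n)) (\<lambda>i. extend n i (contract n i z)) F)"
      using F ec by (intro f.hom_finsum_finite[symmetric]) auto
    also have "finsum (C (Suc n)) (\<lambda>i. extend n i (contract n i z)) F =
        fsum (C (Suc n)) (\<lambda>i. extend n i (contract n i z)) I"
      by (rule E.M.fsum_superset[OF F(1) _ F(2), symmetric]) (use ec ext0 in \<open>auto simp: F_def simp del: bar_module_simps\<close>)
    also have "\<dots> = z" by (rule extend_contract_sum[OF z])
    finally show ?thesis .
  qed
  ultimately show ?case by blast
qed

theorem bar_projective_resolution:
  "projective_resolution TYPE('x) TYPE('y) A C (bar_diff A B \<psi>) (bar_aug A B \<psi>) N"
proof -
  have "projective TYPE('x) TYPE('y) A (C n)" for n
    unfolding projective_def using bar_left_module bar_lift by blast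
  moreover have "bar_diff A B \<psi> n \<in> lmod_hom A (C n) (C (n - 1))" if "1 \<le> n" for n
    using bar_diff_lmod_hom[of "n - 1"] that by simp
  moreover have "a_kernel (C n) (C (n - 1)) (bar_diff A B \<psi> n) = bar_diff A B \<psi> (n + 1) ` carrier (C (n + 1))"
    if "1 \<le> n" for n
    using bar_exact[of "n - 1"] that by (simp del: bar_module_simps)
  ultimately show ?thesis
    unfolding projective_resolution_def
    using base_module bar_aug_lmod_hom bar_aug_surj bar_exact_0 by blast
qed

end

section \<open>Sweedler sums\<close>

locale k_algebra = module K E + ring E
  for K :: "('k, 's) ring_scheme" and E :: "('k, 'e, 't) module_scheme" +
  assumes smult_mult_left: "\<lbrakk>r \<in> carrier K; x \<in> carrier E; y \<in> carrier E\<rbrakk> \<Longrightarrow> r \<odot>\<^bsub>E\<^esub> (x \<otimes>\<^bsub>E\<^esub> y) = (r \<odot>\<^bsub>E\<^esub> x) \<otimes>\<^bsub>E\<^esub> y"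
    and smult_mult_right: "\<lbrakk>r \<in> carrier K; x \<in> carrier E; y \<in> carrier E\<rbrakk> \<Longrightarrow> r \<odot>\<^bsub>E\<^esub> (x \<otimes>\<^bsub>E\<^esub> y) = x \<otimes>\<^bsub>E\<^esub> (r \<odot>\<^bsub>E\<^esub> y)"

context abelian_monoid
begin

lemma add_list_simps [simp]:
  "add_list G [] = \<zero>" "add_list G (x # xs) = x \<oplus> add_list G xs"
  by (simp_all add: add_list_def)

lemma add_list_closed: "set xs \<subseteq> carrier G \<Longrightarrow> add_list G xs \<in> carrier G"
  by (induction xs) auto

lemma add_list_append:
  "\<lbrakk>set xs \<subseteq> carrier G; set ys \<subseteq> carrier G\<rbrakk> \<Longrightarrow> add_list G (xs @ ys) = add_list G xs \<oplus> add_list G ys"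
  by (induction xs) (auto simp: add_list_closed a_assoc)

lemma add_list_map_add:
  "\<lbrakk>\<And>x. x \<in> set xs \<Longrightarrow> f x \<in> carrier G; \<And>x. x \<in> set xs \<Longrightarrow> g x \<in> carrier G\<rbrakk> \<Longrightarrow>
    add_list G (map (\<lambda>x. f x \<oplus> g x) xs) = add_list G (map f xs) \<oplus> add_list G (map g xs)"
proof (induction xs)
  case (Cons x xs)
  have "add_list G (map f xs) \<in> carrier G" "add_list G (map g xs) \<in> carrier G"
    using Cons.prems by (auto intro!: add_list_closed)
  then show ?case using Cons by (simp add: a_ac)
qed simp

lemma add_list_zero: "add_list G (map (\<lambda>x. \<zero>) xs) = \<zero>"
  by (induction xs) auto

lemma add_list_concat:
  "(\<And>x. x \<in> set xs \<Longrightarrow> set (f x) \<subseteq> carrier G) \<Longrightarrow>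
    add_list G (concat (map f xs)) = add_list G (map (\<lambda>x. add_list G (f x)) xs)"
proof (induction xs)
  case (Cons x xs)
  then have "set (concat (map f xs)) \<subseteq> carrier G" by auto
  then show ?case using Cons by (simp add: add_list_append)
qed simp

lemma add_list_swap:
  "(\<And>x y. x \<in> set xs \<Longrightarrow> y \<in> set ys \<Longrightarrow> f x y \<in> carrier G) \<Longrightarrow>
    add_list G (map (\<lambda>x. add_list G (map (f x) ys)) xs) = add_list G (map (\<lambda>y. add_list G (map (\<lambda>x. f x y) xs)) ys)"
proof (induction xs)
  case Nil
  then show ?case by (simp add: add_list_zero)
next
  case (Cons x xs)
  then have "add_list G (map (\<lambda>y. f x y \<oplus> add_list G (map (\<lambda>x. f x y) xs)) ys) =
      add_list G (map (f x) ys) \<oplus> add_list G (map (\<lambda>y. add_list G (map (\<lambda>x. f x y) xs)) ys)"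
    by (intro add_list_map_add) (auto intro!: add_list_closed)
  then show ?case using Cons by simp
qed

end

lemma (in abelian_group_hom) hom_add_list:
  "set xs \<subseteq> carrier G \<Longrightarrow> h (add_list G xs) = add_list H (map h xs)"
  by (induction xs) (auto simp: G.add_list_closed)

locale cocommutative_hopf = cocommutative_hopf_algebra K H \<Delta> \<epsilon> S
  for K :: "('k, 's) ring_scheme" and H :: "('k, 'h, 't) module_scheme"
    and \<Delta> :: "'h \<Rightarrow> ('h list \<Rightarrow>\<^sub>0 int) set" and \<epsilon> :: "'h \<Rightarrow> 'k" and S :: "'h \<Rightarrow> 'h"
begin

abbreviation mult_H (infixl "\<cdot>" 70) where "x \<cdot> y \<equiv> x \<otimes>\<^bsub>H\<^esub> y"

definition lin :: "('k, 'g, 'z) module_scheme \<Rightarrow> ('h \<Rightarrow> 'g) \<Rightarrow> bool"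
  where "lin G f \<longleftrightarrow> f \<in> carrier H \<rightarrow> carrier G \<and>
    (\<forall>x\<in>carrier H. \<forall>y\<in>carrier H. f (x \<oplus>\<^bsub>H\<^esub> y) = f x \<oplus>\<^bsub>G\<^esub> f y) \<and>
    (\<forall>r\<in>carrier K. \<forall>x\<in>carrier H. f (r \<odot>\<^bsub>H\<^esub> x) = r \<odot>\<^bsub>G\<^esub> f x)"

lemma linD:
  assumes "lin G f"
  shows "x \<in> carrier H \<Longrightarrow> f x \<in> carrier G"
    and "\<lbrakk>x \<in> carrier H; y \<in> carrier H\<rbrakk> \<Longrightarrow> f (x \<oplus>\<^bsub>H\<^esub> y) = f x \<oplus>\<^bsub>G\<^esub> f y"
    and "\<lbrakk>r \<in> carrier K; x \<in> carrier H\<rbrakk> \<Longrightarrow> f (r \<odot>\<^bsub>H\<^esub> x) = r \<odot>\<^bsub>G\<^esub> f x"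
  using assms by (auto simp: lin_def)

lemma linI:
  assumes "\<And>x. x \<in> carrier H \<Longrightarrow> f x \<in> carrier G"
    and "\<And>x y. \<lbrakk>x \<in> carrier H; y \<in> carrier H\<rbrakk> \<Longrightarrow> f (x \<oplus>\<^bsub>H\<^esub> y) = f x \<oplus>\<^bsub>G\<^esub> f y"
    and "\<And>r x. \<lbrakk>r \<in> carrier K; x \<in> carrier H\<rbrakk> \<Longrightarrow> f (r \<odot>\<^bsub>H\<^esub> x) = r \<odot>\<^bsub>G\<^esub> f x"
  shows "lin G f"
  using assms by (auto simp: lin_def)

lemma tensor_factors_H: "tensor_factors H (carrier K) (smult H) (\<lambda>x a. a \<odot>\<^bsub>H\<^esub> x)"
  by unfold_locales auto

interpretation TH: tensor_factors H "carrier K" "smult H" "\<lambda>x a. a \<odot>\<^bsub>H\<^esub> x"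
  by (rule tensor_factors_H)

lemma sum_list_frag_of_keys: "set ws \<subseteq> words H n \<Longrightarrow> Poly_Mapping.keys (sum_list (map frag_of ws) :: _ \<Rightarrow>\<^sub>0 int) \<subseteq> words H n"
proof (induction ws)
  case (Cons w ws)
  then show ?case using keys_add[of "frag_of w" "sum_list (map frag_of ws) :: _ \<Rightarrow>\<^sub>0 int"] by auto
qed simp

lemma tsum_Cons:
  assumes "set (w # ws) \<subseteq> words H n"
  shows "tsum K H n (w # ws) = TH.pure n w \<otimes>\<^bsub>TH.T n\<^esub> tsum K H n ws"
proof -
  have "Poly_Mapping.keys (frag_of w) \<subseteq> words H n" using assms by simp
  then show ?thesis
    using TH.tensor_class_hom[of n] sum_list_frag_of_keys[of ws n] assms
    by (simp add: tsum_def TH.pure_def hom_def)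
qed

lemma tsum_Nil: "tsum K H n [] = \<one>\<^bsub>TH.T n\<^esub>"
proof -
  have "group_hom (free_Abelian_group (words H n)) (TH.T n) (tensor_class H (carrier K) (smult H) (\<lambda>x a. a \<odot>\<^bsub>H\<^esub> x) n)"
    using TH.tensor_class_hom[of n] TH.comm_group_tensor_power[of n]
    by (simp add: group_hom_def group_hom_axioms_def comm_group_def)
  from group_hom.hom_one[OF this] show ?thesis by (simp add: tsum_def)
qed

lemma tsum_closed: "set ws \<subseteq> words H n \<Longrightarrow> tsum K H n ws \<in> carrier (TH.T n)"
  using TH.tensor_class_surj[of n] sum_list_frag_of_keys[of ws n] by (auto simp: tsum_def)

text \<open>
  Sums in a tensor power are only compared as classes. A balanced map extends to the tensor power
  and hence takes equal values on two lists that represent the same class.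
\<close>

lemma tsum_balanced:
  assumes G: "abelian_group G" and "TH.balanced_map (add_monoid G) n \<phi>"
    and ws: "set ws \<subseteq> words H n" and vs: "set vs \<subseteq> words H n" and eq: "tsum K H n ws = tsum K H n vs"
  shows "add_list G (map \<phi> ws) = add_list G (map \<phi> vs)"
proof -
  interpret G: abelian_group G by fact
  show ?thesis
  proof (rule TH.tensor_power_universal[OF G.a_comm_group assms(2)])
    fix h assume h: "h \<in> hom (TH.T n) (add_monoid G)" "\<And>w. w \<in> words H n \<Longrightarrow> h (TH.pure n w) = \<phi> w"
    interpret T: comm_group "TH.T n" by (rule TH.comm_group_tensor_power)
    interpret h: group_hom "TH.T n" "add_monoid G" h
      using h(1) by (simp add: group_hom_def group_hom_axioms_def T.is_group G.a_group)
    have "h (tsum K H n us) = add_list G (map \<phi> us)" if "set us \<subseteq> words H n" for us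
      using that
    proof (induction us)
      case Nil
      then show ?case using h.hom_one by (simp add: tsum_Nil)
    next
      case (Cons w us)
      then have "w \<in> words H n" "tsum K H n us \<in> carrier (TH.T n)" using tsum_closed[of us n] by auto
      then show ?case using Cons h.hom_mult[OF TH.pure_closed] h(2) by (simp add: tsum_Cons)
    qed
    then show ?thesis using ws vs eq by metis
  qed
qed

lemma words2: "w \<in> words H 2 \<longleftrightarrow> (\<exists>a\<in>carrier H. \<exists>b\<in>carrier H. w = [a, b])"
  by (auto simp: words_iff numeral_2_eq_2 length_Suc_conv)

lemma words3: "w \<in> words H 3 \<longleftrightarrow> (\<exists>a\<in>carrier H. \<exists>b\<in>carrier H. \<exists>c\<in>carrier H. w = [a, b, c])"
  by (auto simp: words_iff numeral_3_eq_3 length_Suc_conv)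

lemma bilinear_balanced:
  assumes f: "\<And>a. a \<in> carrier H \<Longrightarrow> lin G (\<lambda>b. f a b)" "\<And>b. b \<in> carrier H \<Longrightarrow> lin G (\<lambda>a. f a b)"
  shows "TH.balanced_map (add_monoid G) 2 (\<lambda>w. f (w ! 0) (w ! 1))"
  unfolding TH.balanced_map_def
proof (intro conjI allI impI)
  show "(\<lambda>w. f (w ! 0) (w ! 1)) \<in> words H 2 \<rightarrow> carrier (add_monoid G)"
    using linD(1)[OF f(1)] by (auto simp: words2)
  fix u v x y assume h: "x \<in> carrier H" "y \<in> carrier H" "u @ x # v \<in> words H 2"
  then consider c where "u = []" "v = [c]" "c \<in> carrier H" | c where "u = [c]" "v = []" "c \<in> carrier H"
    by (cases u) (auto simp: words_iff length_Suc_conv numeral_2_eq_2)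
  then show "f ((u @ (x \<oplus>\<^bsub>H\<^esub> y) # v) ! 0) ((u @ (x \<oplus>\<^bsub>H\<^esub> y) # v) ! 1) =
      f ((u @ x # v) ! 0) ((u @ x # v) ! 1) \<otimes>\<^bsub>add_monoid G\<^esub> f ((u @ y # v) ! 0) ((u @ y # v) ! 1)"
    using h linD(2)[OF f(1)] linD(2)[OF f(2)] by cases auto
next
  fix u v x y r assume h: "r \<in> carrier K" "u @ x # y # v \<in> words H 2"
  then have "u = []" "v = []" "x \<in> carrier H" "y \<in> carrier H" by (auto simp: words_iff)
  then show "f ((u @ (r \<odot>\<^bsub>H\<^esub> x) # y # v) ! 0) ((u @ (r \<odot>\<^bsub>H\<^esub> x) # y # v) ! 1) =
      f ((u @ x # (r \<odot>\<^bsub>H\<^esub> y) # v) ! 0) ((u @ x # (r \<odot>\<^bsub>H\<^esub> y) # v) ! 1)"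
    using h linD(3)[OF f(1)] linD(3)[OF f(2)] by simp
qed

lemma trilinear_balanced:
  assumes f: "\<And>a b. \<lbrakk>a \<in> carrier H; b \<in> carrier H\<rbrakk> \<Longrightarrow> lin G (\<lambda>c. f a b c)"
    "\<And>a c. \<lbrakk>a \<in> carrier H; c \<in> carrier H\<rbrakk> \<Longrightarrow> lin G (\<lambda>b. f a b c)"
    "\<And>b c. \<lbrakk>b \<in> carrier H; c \<in> carrier H\<rbrakk> \<Longrightarrow> lin G (\<lambda>a. f a b c)"
  shows "TH.balanced_map (add_monoid G) 3 (\<lambda>w. f (w ! 0) (w ! 1) (w ! 2))"
  unfolding TH.balanced_map_def
proof (intro conjI allI impI)
  show "(\<lambda>w. f (w ! 0) (w ! 1) (w ! 2)) \<in> words H 3 \<rightarrow> carrier (add_monoid G)"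
    using linD(1)[OF f(1)] by (auto simp: words3)
  fix u v x y assume h: "x \<in> carrier H" "y \<in> carrier H" "u @ x # v \<in> words H 3"
  then consider c d where "u = []" "v = [c, d]" "c \<in> carrier H" "d \<in> carrier H"
    | c d where "u = [c]" "v = [d]" "c \<in> carrier H" "d \<in> carrier H"
    | c d where "u = [c, d]" "v = []" "c \<in> carrier H" "d \<in> carrier H"
    by (cases u; cases "tl u") (auto simp: words_iff length_Suc_conv numeral_3_eq_3)
  then show "f ((u @ (x \<oplus>\<^bsub>H\<^esub> y) # v) ! 0) ((u @ (x \<oplus>\<^bsub>H\<^esub> y) # v) ! 1) ((u @ (x \<oplus>\<^bsub>H\<^esub> y) # v) ! 2) =
      f ((u @ x # v) ! 0) ((u @ x # v) ! 1) ((u @ x # v) ! 2) \<otimes>\<^bsub>add_monoid G\<^esub>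
      f ((u @ y # v) ! 0) ((u @ y # v) ! 1) ((u @ y # v) ! 2)"
    using h linD(2)[OF f(1)] linD(2)[OF f(2)] linD(2)[OF f(3)] by cases auto
next
  fix u v x y r assume h: "r \<in> carrier K" "u @ x # y # v \<in> words H 3"
  then consider c where "u = []" "v = [c]" "c \<in> carrier H" "x \<in> carrier H" "y \<in> carrier H"
    | c where "u = [c]" "v = []" "c \<in> carrier H" "x \<in> carrier H" "y \<in> carrier H"
    by (cases u) (auto simp: words_iff length_Suc_conv numeral_3_eq_3)
  then show "f ((u @ (r \<odot>\<^bsub>H\<^esub> x) # y # v) ! 0) ((u @ (r \<odot>\<^bsub>H\<^esub> x) # y # v) ! 1) ((u @ (r \<odot>\<^bsub>H\<^esub> x) # y # v) ! 2) =
      f ((u @ x # (r \<odot>\<^bsub>H\<^esub> y) # v) ! 0) ((u @ x # (r \<odot>\<^bsub>H\<^esub> y) # v) ! 1) ((u @ x # (r \<odot>\<^bsub>H\<^esub> y) # v) ! 2)"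
    using h linD(3)[OF f(1)] linD(3)[OF f(2)] linD(3)[OF f(3)] by cases auto
qed

text \<open>
  The negative of \<open>a \<otimes> b\<close> is \<open>(-a) \<otimes> b\<close>, so finite sums of pure tensors are closed under
  differences and exhaust the tensor square.
\<close>

lemma sweedler_exists:
  assumes "h \<in> carrier H"
  obtains ps where "sweedler K H \<Delta> h ps"
proof -
  interpret T: comm_group "TH.T 2" by (rule TH.comm_group_tensor_power)
  have neg: "inv\<^bsub>TH.T 2\<^esub> (TH.pure 2 [a, b]) = TH.pure 2 [\<ominus>\<^bsub>H\<^esub> a, b]" if "a \<in> carrier H" "b \<in> carrier H" for a b
  proof (rule T.inv_equality)
    have zero: "TH.pure 2 [\<zero>\<^bsub>H\<^esub>, b] = \<one>\<^bsub>TH.T 2\<^esub>"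
    proof -
      have "TH.pure 2 [\<zero>\<^bsub>H\<^esub>, b] \<otimes>\<^bsub>TH.T 2\<^esub> TH.pure 2 [\<zero>\<^bsub>H\<^esub>, b] = TH.pure 2 [\<zero>\<^bsub>H\<^esub>, b]"
        using TH.pure_add[of "\<zero>\<^bsub>H\<^esub>" "\<zero>\<^bsub>H\<^esub>" "[]" "[b]" 2] that by (simp add: words2)
      moreover have "TH.pure 2 [\<zero>\<^bsub>H\<^esub>, b] \<in> carrier (TH.T 2)"
        using that by (intro TH.pure_closed) (simp add: words2)
      ultimately show ?thesis using T.l_cancel_one' by metis
    qed
    have "TH.pure 2 [\<ominus>\<^bsub>H\<^esub> a \<oplus>\<^bsub>H\<^esub> a, b] = TH.pure 2 [\<ominus>\<^bsub>H\<^esub> a, b] \<otimes>\<^bsub>TH.T 2\<^esub> TH.pure 2 [a, b]"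
      using TH.pure_add[of "\<ominus>\<^bsub>H\<^esub> a" a "[]" "[b]" 2] that by (simp add: words2)
    then show "TH.pure 2 [\<ominus>\<^bsub>H\<^esub> a, b] \<otimes>\<^bsub>TH.T 2\<^esub> TH.pure 2 [a, b] = \<one>\<^bsub>TH.T 2\<^esub>"
      using zero that by (simp add: M.l_neg)
  qed (use that in \<open>auto intro!: TH.pure_closed simp: words2\<close>)
  define expr where "expr ps = tsum K H 2 [[a, b]. (a, b) \<leftarrow> ps]" for ps :: "('h \<times> 'h) list"
  have expr_Nil: "expr [] = \<one>\<^bsub>TH.T 2\<^esub>" by (simp add: expr_def tsum_Nil)
  have expr_Cons: "expr ((a, b) # ps) = TH.pure 2 [a, b] \<otimes>\<^bsub>TH.T 2\<^esub> expr ps"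
    if "set ((a, b) # ps) \<subseteq> carrier H \<times> carrier H" for a b ps
    using that unfolding expr_def by (subst tsum_Cons[symmetric]) (auto simp: words2)
  have expr_closed: "expr ps \<in> carrier (TH.T 2)" if "set ps \<subseteq> carrier H \<times> carrier H" for ps
    using that unfolding expr_def by (intro tsum_closed) (auto simp: words2)
  have expr_append: "expr (ps @ qs) = expr ps \<otimes>\<^bsub>TH.T 2\<^esub> expr qs"
    if "set ps \<subseteq> carrier H \<times> carrier H" "set qs \<subseteq> carrier H \<times> carrier H" for ps qs
    using that
  proof (induction ps)
    case (Cons p ps)
    obtain a b where p: "p = (a, b)" "a \<in> carrier H" "b \<in> carrier H" using Cons.prems by (cases p) auto
    then have "TH.pure 2 [a, b] \<in> carrier (TH.T 2)" by (intro TH.pure_closed) (simp add: words2)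
    then show ?case
      using Cons p expr_closed[of ps] expr_closed[of qs] by (simp add: expr_Cons T.m_assoc del: mult_FactGroup)
  qed (simp add: expr_Nil expr_closed)
  have expr_neg: "inv\<^bsub>TH.T 2\<^esub> (expr ps) = expr (map (\<lambda>(a, b). (\<ominus>\<^bsub>H\<^esub> a, b)) ps)"
    if "set ps \<subseteq> carrier H \<times> carrier H" for ps
    using that
  proof (induction ps)
    case (Cons p ps)
    obtain a b where p: "p = (a, b)" "a \<in> carrier H" "b \<in> carrier H" using Cons.prems by (cases p) auto
    then have "TH.pure 2 [a, b] \<in> carrier (TH.T 2)" by (intro TH.pure_closed) (simp add: words2)
    moreover have "set ((\<ominus>\<^bsub>H\<^esub> a, b) # map (\<lambda>(a, b). (\<ominus>\<^bsub>H\<^esub> a, b)) ps) \<subseteq> carrier H \<times> carrier H"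
      using Cons.prems p by auto
    ultimately show ?case
      using Cons p expr_closed[of ps] by (simp add: expr_Cons T.inv_mult neg del: mult_FactGroup)
  qed (simp add: expr_Nil)
  have "\<exists>ps. set ps \<subseteq> carrier H \<times> carrier H \<and> z = expr ps" if "z \<in> carrier (TH.T 2)" for z
    using that
  proof (induction rule: TH.tensor_power_induct)
    case zero
    then show ?case by (intro exI[of _ "[]"]) (simp add: expr_Nil)
  next
    case (pure w)
    then obtain a b where "a \<in> carrier H" "b \<in> carrier H" "w = [a, b]" by (auto simp: words2)
    with pure show ?case
      using expr_Cons[of a b "[]"] TH.pure_closed[of w 2]
      by (intro exI[of _ "[(a, b)]"]) (simp add: expr_Nil del: mult_FactGroup)
  next
    case (diff x y)
    then obtain ps qs where "set ps \<subseteq> carrier H \<times> carrier H" "x = expr ps"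
      "set qs \<subseteq> carrier H \<times> carrier H" "y = expr qs" by blast
    then show ?case
      by (intro exI[of _ "ps @ map (\<lambda>(a, b). (\<ominus>\<^bsub>H\<^esub> a, b)) qs"], subst expr_append)
        (auto simp: expr_neg simp del: mult_FactGroup)
  qed
  then show thesis
    using comult_closed[OF assms] that assms unfolding sweedler_def expr_def by blast
qed

definition expansion :: "'h \<Rightarrow> ('h \<times> 'h) list"
  where "expansion h = (SOME ps. sweedler K H \<Delta> h ps)"

lemma sweedler_expansion: "h \<in> carrier H \<Longrightarrow> sweedler K H \<Delta> h (expansion h)"
  unfolding expansion_def by (rule someI_ex) (metis sweedler_exists)

lemma expansion_closed: "\<lbrakk>h \<in> carrier H; (a, b) \<in> set (expansion h)\<rbrakk> \<Longrightarrow> a \<in> carrier H \<and> b \<in> carrier H"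
  using sweedler_expansion[of h] by (auto simp: sweedler_def)

lemma expansion_closed': "\<lbrakk>h \<in> carrier H; p \<in> set (expansion h)\<rbrakk> \<Longrightarrow> fst p \<in> carrier H \<and> snd p \<in> carrier H"
  using expansion_closed[of h "fst p" "snd p"] by simp

text \<open>
  \<open>D G h (\<lambda>a b. f a b)\<close> is the value of the Sweedler expression \<open>f h\<^sub>1 h\<^sub>2\<close> in \<open>G\<close>. For bilinear
  \<open>f\<close> all expansions give the same value. Outside of the carrier the value is zero, which frees closure and
  congruence rules from a membership premise on \<open>h\<close>.
\<close>

definition D :: "('k, 'g, 'z) module_scheme \<Rightarrow> 'h \<Rightarrow> ('h \<Rightarrow> 'h \<Rightarrow> 'g) \<Rightarrow> 'g"
  where "D G h f = add_list G (if h \<in> carrier H then [f a b. (a, b) \<leftarrow> expansion h] else [])"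

lemma sweedler_sum_eq:
  assumes G: "abelian_group G"
    and f: "\<And>a. a \<in> carrier H \<Longrightarrow> lin G (\<lambda>b. f a b)" "\<And>b. b \<in> carrier H \<Longrightarrow> lin G (\<lambda>a. f a b)"
    and ps: "sweedler K H \<Delta> h ps" and qs: "sweedler K H \<Delta> h qs"
  shows "add_list G [f a b. (a, b) \<leftarrow> ps] = add_list G [f a b. (a, b) \<leftarrow> qs]"
proof -
  have "add_list G (map (\<lambda>w. f (w ! 0) (w ! 1)) [[a, b]. (a, b) \<leftarrow> ps]) =
      add_list G (map (\<lambda>w. f (w ! 0) (w ! 1)) [[a, b]. (a, b) \<leftarrow> qs])"
    by (rule tsum_balanced[OF G bilinear_balanced[OF f]])
      (use ps qs in \<open>auto simp: sweedler_def words2\<close>)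
  then show ?thesis by (simp add: comp_def case_prod_unfold)
qed

lemma D_sweedler:
  assumes "abelian_group G" "sweedler K H \<Delta> h ps"
    and "\<And>a. a \<in> carrier H \<Longrightarrow> lin G (\<lambda>b. f a b)" "\<And>b. b \<in> carrier H \<Longrightarrow> lin G (\<lambda>a. f a b)"
  shows "add_list G [f a b. (a, b) \<leftarrow> ps] = D G h f"
  using sweedler_sum_eq[of G f h ps "expansion h"] assms sweedler_expansion[of h]
  by (auto simp: D_def sweedler_def)

text \<open>
  Under the sum the bound variables may be assumed to lie in \<open>H\<close>. As a congruence rule this lets
  the simplifier rewrite with conditional equations there.
\<close>

lemma D_cong [cong]:
  assumes "h = h'" "\<And>a b. \<lbrakk>a \<in> carrier H; b \<in> carrier H\<rbrakk> \<Longrightarrow> f a b = g a b"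
  shows "D G h f = D G h' g"
proof -
  have "map (\<lambda>(a, b). f a b) (expansion h) = map (\<lambda>(a, b). g a b) (expansion h)" if "h \<in> carrier H"
    using expansion_closed[OF that] assms(2) by (intro map_cong) auto
  then show ?thesis using assms(1) by (simp add: D_def del: map_eq_conv)
qed

lemma D_closed:
  assumes "abelian_group G" "\<And>a b. \<lbrakk>a \<in> carrier H; b \<in> carrier H\<rbrakk> \<Longrightarrow> f a b \<in> carrier G"
  shows "D G h f \<in> carrier G"
proof -
  interpret G: abelian_group G by fact
  show ?thesis
  proof (cases "h \<in> carrier H")
    case True
    have "set [f a b. (a, b) \<leftarrow> expansion h] \<subseteq> carrier G"
      using assms(2) expansion_closed[OF True] by auto
    then show ?thesis using True by (simp add: D_def G.add_list_closed)
  qed (simp add: D_def)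
qed

lemma D_hom:
  assumes u: "abelian_group_hom G G' u" and f: "\<And>a b. \<lbrakk>a \<in> carrier H; b \<in> carrier H\<rbrakk> \<Longrightarrow> f a b \<in> carrier G"
  shows "u (D G h f) = D G' h (\<lambda>a b. u (f a b))"
proof -
  interpret u: abelian_group_hom G G' u by fact
  have "set [f a b. (a, b) \<leftarrow> expansion h] \<subseteq> carrier G" if "h \<in> carrier H"
    using f expansion_closed[OF that] by auto
  then show ?thesis
    using u.hom_add_list by (auto simp: D_def comp_def case_prod_unfold)
qed

lemma D_add:
  assumes "abelian_group G" "\<And>a b. \<lbrakk>a \<in> carrier H; b \<in> carrier H\<rbrakk> \<Longrightarrow> f a b \<in> carrier G"
    "\<And>a b. \<lbrakk>a \<in> carrier H; b \<in> carrier H\<rbrakk> \<Longrightarrow> g a b \<in> carrier G"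
  shows "D G h (\<lambda>a b. f a b \<oplus>\<^bsub>G\<^esub> g a b) = D G h f \<oplus>\<^bsub>G\<^esub> D G h g"
proof -
  interpret G: abelian_group G by fact
  show ?thesis
  proof (cases "h \<in> carrier H")
    case True
    then have "add_list G (map (\<lambda>p. f (fst p) (snd p) \<oplus>\<^bsub>G\<^esub> g (fst p) (snd p)) (expansion h)) =
      add_list G (map (\<lambda>p. f (fst p) (snd p)) (expansion h)) \<oplus>\<^bsub>G\<^esub> add_list G (map (\<lambda>p. g (fst p) (snd p)) (expansion h))"
      using expansion_closed[OF True] assms(2,3) by (intro G.add_list_map_add) auto
    then show ?thesis using True by (simp add: D_def case_prod_unfold)
  qed (simp add: D_def)
qed

lemma D_swap:
  assumes "abelian_group G"
    and "\<And>a b c d. \<lbrakk>a \<in> carrier H; b \<in> carrier H; c \<in> carrier H; d \<in> carrier H\<rbrakk> \<Longrightarrow> f a b c d \<in> carrier G"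
  shows "D G h (\<lambda>a b. D G k (\<lambda>c d. f a b c d)) = D G k (\<lambda>c d. D G h (\<lambda>a b. f a b c d))"
proof -
  interpret G: abelian_group G by fact
  show ?thesis
  proof (cases "h \<in> carrier H \<and> k \<in> carrier H")
    case True
    then have "add_list G (map (\<lambda>p. add_list G (map (\<lambda>q. f (fst p) (snd p) (fst q) (snd q)) (expansion k))) (expansion h)) =
        add_list G (map (\<lambda>q. add_list G (map (\<lambda>p. f (fst p) (snd p) (fst q) (snd q)) (expansion h))) (expansion k))"
      using expansion_closed'[of h] expansion_closed'[of k] assms(2) by (intro G.add_list_swap) simp_all
    then show ?thesis using True by (simp add: D_def case_prod_unfold)
  next
    case False
    then show ?thesis by (auto simp: D_def case_prod_unfold G.add_list_zero)
  qed
qed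

text \<open>
  An expansion of a sum is the concatenation of expansions, and scalars enter through the first
  factor.
\<close>

lemma lin_D:
  assumes G: "module K G"
    and f: "\<And>a. a \<in> carrier H \<Longrightarrow> lin G (\<lambda>b. f a b)" "\<And>b. b \<in> carrier H \<Longrightarrow> lin G (\<lambda>a. f a b)"
  shows "lin G (\<lambda>h. D G h f)"
proof -
  interpret G: module K G by fact
  note ag = G.M.abelian_group_axioms
  have fc: "f a b \<in> carrier G" if "a \<in> carrier H" "b \<in> carrier H" for a b
    using linD(1)[OF f(1)] that by blast
  note Ds = D_sweedler[OF ag _ f]
  show ?thesis
  proof (rule linI)
    fix x assume "x \<in> carrier H"
    then show "D G x f \<in> carrier G" by (intro D_closed ag fc)
  next
    fix x y assume x: "x \<in> carrier H" and y: "y \<in> carrier H"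
    have cl: "set [f a b. (a, b) \<leftarrow> expansion h] \<subseteq> carrier G" if "h \<in> carrier H" for h
      using fc expansion_closed[OF that] by auto
    have "D G (x \<oplus>\<^bsub>H\<^esub> y) f = add_list G [f a b. (a, b) \<leftarrow> expansion x @ expansion y]"
      by (rule Ds[symmetric]) (rule comult_add[OF sweedler_expansion[OF x] sweedler_expansion[OF y]])
    then show "D G (x \<oplus>\<^bsub>H\<^esub> y) f = D G x f \<oplus>\<^bsub>G\<^esub> D G y f"
      using x y cl G.M.add_list_append by (simp add: D_def)
  next
    fix r x assume r: "r \<in> carrier K" and x: "x \<in> carrier H"
    have "D G (r \<odot>\<^bsub>H\<^esub> x) f = add_list G [f a b. (a, b) \<leftarrow> [(r \<odot>\<^bsub>H\<^esub> a, b). (a, b) \<leftarrow> expansion x]]"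
      by (rule Ds[symmetric]) (rule comult_smult[OF r sweedler_expansion[OF x]])
    also have "\<dots> = D G x (\<lambda>a b. f (r \<odot>\<^bsub>H\<^esub> a) b)"
      using x by (simp add: D_def comp_def case_prod_unfold)
    also have "\<dots> = D G x (\<lambda>a b. r \<odot>\<^bsub>G\<^esub> f a b)"
      using linD(3)[OF f(2)] r by simp
    also have "\<dots> = r \<odot>\<^bsub>G\<^esub> D G x f"
    proof (rule D_hom[symmetric])
      show "abelian_group_hom G G (smult G r)"
        using r by (intro abelian_group_homI ag) (auto simp: G.smult_r_distr)
    qed (rule fc)
    finally show "D G (r \<odot>\<^bsub>H\<^esub> x) f = r \<odot>\<^bsub>G\<^esub> D G x f" .
  qed
qed

lemma lin_comp: "\<lbrakk>lin G f; lin H g\<rbrakk> \<Longrightarrow> lin G (\<lambda>x. f (g x))"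
  by (auto simp: lin_def Pi_iff)

lemma lin_D_arg:
  assumes "module K G" "lin H g"
    and "\<And>a. a \<in> carrier H \<Longrightarrow> lin G (\<lambda>b. f a b)" "\<And>b. b \<in> carrier H \<Longrightarrow> lin G (\<lambda>a. f a b)"
  shows "lin G (\<lambda>x. D G (g x) f)"
  using lin_comp[OF lin_D[OF assms(1,3,4)] assms(2)] .

lemma lin_D_body:
  assumes G: "module K G" and f: "\<And>a b. \<lbrakk>a \<in> carrier H; b \<in> carrier H\<rbrakk> \<Longrightarrow> lin G (\<lambda>x. f x a b)"
  shows "lin G (\<lambda>x. D G h (\<lambda>a b. f x a b))"
proof -
  interpret G: module K G by fact
  note ag = G.M.abelian_group_axioms
  show ?thesis
  proof (rule linI)
    show "D G h (\<lambda>a b. f x a b) \<in> carrier G" if "x \<in> carrier H" for x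
      using linD(1)[OF f] that by (intro D_closed ag)
    show "D G h (\<lambda>a b. f (x \<oplus>\<^bsub>H\<^esub> y) a b) = D G h (\<lambda>a b. f x a b) \<oplus>\<^bsub>G\<^esub> D G h (\<lambda>a b. f y a b)"
      if "x \<in> carrier H" "y \<in> carrier H" for x y
      using linD(1)[OF f] that by (simp add: linD(2)[OF f] D_add[OF ag])
    show "D G h (\<lambda>a b. f (r \<odot>\<^bsub>H\<^esub> x) a b) = r \<odot>\<^bsub>G\<^esub> D G h (\<lambda>a b. f x a b)"
      if "r \<in> carrier K" "x \<in> carrier H" for r x
    proof -
      have "abelian_group_hom G G (smult G r)"
        using that by (intro abelian_group_homI ag) (auto simp: G.smult_r_distr)
      then show ?thesis
        using linD(1)[OF f] that by (simp add: linD(3)[OF f] D_hom)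
    qed
  qed
qed

lemma D_cocomm:
  assumes "abelian_group G"
    and f: "\<And>a. a \<in> carrier H \<Longrightarrow> lin G (\<lambda>b. f a b)" "\<And>b. b \<in> carrier H \<Longrightarrow> lin G (\<lambda>a. f a b)"
  shows "D G h (\<lambda>a b. f a b) = D G h (\<lambda>a b. f b a)"
proof (cases "h \<in> carrier H")
  case True
  have "D G h f = add_list G [f a b. (a, b) \<leftarrow> [(b, a). (a, b) \<leftarrow> expansion h]]"
    by (rule D_sweedler[OF assms(1) cocomm[OF sweedler_expansion[OF True]] f, symmetric])
  then show ?thesis using True by (simp add: D_def comp_def case_prod_unfold)
qed (simp add: D_def)

text \<open>
  Both sides are the expression \<open>f h\<^sub>1 h\<^sub>2 h\<^sub>3\<close>.
\<close>

lemma D_coassoc: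
  assumes G: "abelian_group G"
    and f: "\<And>a b. \<lbrakk>a \<in> carrier H; b \<in> carrier H\<rbrakk> \<Longrightarrow> lin G (\<lambda>c. f a b c)"
    "\<And>a c. \<lbrakk>a \<in> carrier H; c \<in> carrier H\<rbrakk> \<Longrightarrow> lin G (\<lambda>b. f a b c)"
    "\<And>b c. \<lbrakk>b \<in> carrier H; c \<in> carrier H\<rbrakk> \<Longrightarrow> lin G (\<lambda>a. f a b c)"
  shows "D G h (\<lambda>a b. D G a (\<lambda>c d. f c d b)) = D G h (\<lambda>a b. D G b (\<lambda>c d. f a c d))"
proof (cases "h \<in> carrier H")
  case True
  interpret G: abelian_group G by fact
  note ec = expansion_closed[OF True]
  have fc: "f a b c \<in> carrier G" if "a \<in> carrier H" "b \<in> carrier H" "c \<in> carrier H" for a b c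
    using linD(1)[OF f(1)] that by blast
  let ?\<phi> = "\<lambda>w. f (w ! 0) (w ! 1) (w ! 2)"
  let ?ws = "[[c, d, b]. (a, b) \<leftarrow> expansion h, (c, d) \<leftarrow> expansion a]"
  let ?vs = "[[a, c, d]. (a, b) \<leftarrow> expansion h, (c, d) \<leftarrow> expansion b]"
  have "add_list G (map ?\<phi> ?ws) = add_list G (map ?\<phi> ?vs)"
  proof (rule tsum_balanced[OF G trilinear_balanced[OF f]])
    have ws: "[c, d, b] \<in> words H 3" if "(a, b) \<in> set (expansion h)" "(c, d) \<in> set (expansion a)" for a b c d
      using ec[OF that(1)] expansion_closed[of a c d] that by (simp add: words3)
    have vs: "[a, c, d] \<in> words H 3" if "(a, b) \<in> set (expansion h)" "(c, d) \<in> set (expansion b)" for a b c d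
      using ec[OF that(1)] expansion_closed[of b c d] that by (simp add: words3)
    show "set ?ws \<subseteq> words H 3" using ws by auto
    show "set ?vs \<subseteq> words H 3" using vs by auto
    show "tsum K H 3 ?ws = tsum K H 3 ?vs"
      by (rule coassoc[OF sweedler_expansion[OF True] sweedler_expansion])
  qed
  moreover have "add_list G (map ?\<phi> ?ws) = D G h (\<lambda>a b. D G a (\<lambda>c d. f c d b))"
  proof -
    have "map ?\<phi> ?ws = concat (map (\<lambda>p. map (\<lambda>q. f (fst q) (snd q) (snd p)) (expansion (fst p))) (expansion h))"
      by (simp add: map_concat comp_def case_prod_unfold)
    moreover have "set (map (\<lambda>q. f (fst q) (snd q) (snd p)) (expansion (fst p))) \<subseteq> carrier G" if "p \<in> set (expansion h)" for p
      using expansion_closed'[OF True that] expansion_closed'[of "fst p"] fc by (auto simp del: mult_FactGroup)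
    ultimately have "add_list G (map ?\<phi> ?ws) =
        add_list G (map (\<lambda>p. add_list G (map (\<lambda>q. f (fst q) (snd q) (snd p)) (expansion (fst p)))) (expansion h))"
      by (simp only: G.add_list_concat)
    also have "\<dots> = add_list G (map (\<lambda>p. D G (fst p) (\<lambda>c d. f c d (snd p))) (expansion h))"
      using expansion_closed'[OF True] by (intro arg_cong[where f = "add_list G"] map_cong refl) (simp add: D_def case_prod_unfold)
    finally show ?thesis using True by (simp add: D_def[of G h] case_prod_unfold)
  qed
  moreover have "add_list G (map ?\<phi> ?vs) = D G h (\<lambda>a b. D G b (\<lambda>c d. f a c d))"
  proof -
    have "map ?\<phi> ?vs = concat (map (\<lambda>p. map (\<lambda>q. f (fst p) (fst q) (snd q)) (expansion (snd p))) (expansion h))"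
      by (simp add: map_concat comp_def case_prod_unfold)
    moreover have "set (map (\<lambda>q. f (fst p) (fst q) (snd q)) (expansion (snd p))) \<subseteq> carrier G" if "p \<in> set (expansion h)" for p
      using expansion_closed'[OF True that] expansion_closed'[of "snd p"] fc by (auto simp del: mult_FactGroup)
    ultimately have "add_list G (map ?\<phi> ?vs) =
        add_list G (map (\<lambda>p. add_list G (map (\<lambda>q. f (fst p) (fst q) (snd q)) (expansion (snd p)))) (expansion h))"
      by (simp only: G.add_list_concat)
    also have "\<dots> = add_list G (map (\<lambda>p. D G (snd p) (\<lambda>c d. f (fst p) c d)) (expansion h))"
      using expansion_closed'[OF True] by (intro arg_cong[where f = "add_list G"] map_cong refl) (simp add: D_def case_prod_unfold)
    finally show ?thesis using True by (simp add: D_def[of G h] case_prod_unfold)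
  qed
  ultimately show ?thesis by simp
qed (simp add: D_def)

lemma lin_abelian_group_hom: "\<lbrakk>abelian_group G; lin G f\<rbrakk> \<Longrightarrow> abelian_group_hom H G f"
  by (intro abelian_group_homI M.abelian_group_axioms) (auto simp: lin_def)

lemma lin_add_list:
  "\<lbrakk>abelian_group G; lin G f; set xs \<subseteq> carrier H\<rbrakk> \<Longrightarrow> f (add_list H xs) = add_list G (map f xs)"
  by (rule abelian_group_hom.hom_add_list[OF lin_abelian_group_hom])

lemma counit_closed: "x \<in> carrier H \<Longrightarrow> \<epsilon> x \<in> carrier K"
  using counit_hom by (auto simp: ring_hom_def)

lemma D_counit_left:
  assumes "abelian_group G" "lin G f" "h \<in> carrier H"
  shows "D G h (\<lambda>a b. \<epsilon> a \<odot>\<^bsub>G\<^esub> f b) = f h"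
proof -
  have "f (add_list H [\<epsilon> a \<odot>\<^bsub>H\<^esub> b. (a, b) \<leftarrow> expansion h]) = add_list G (map f [\<epsilon> a \<odot>\<^bsub>H\<^esub> b. (a, b) \<leftarrow> expansion h])"
    using expansion_closed[OF assms(3)] counit_closed by (intro lin_add_list assms) auto
  also have "map f [\<epsilon> a \<odot>\<^bsub>H\<^esub> b. (a, b) \<leftarrow> expansion h] = [\<epsilon> a \<odot>\<^bsub>G\<^esub> f b. (a, b) \<leftarrow> expansion h]"
    using expansion_closed[OF assms(3)] counit_closed linD(3)[OF assms(2)] by auto
  finally show ?thesis
    using assms(3) counit_left[OF sweedler_expansion] by (simp add: D_def)
qed

lemma D_counit_right:
  assumes "abelian_group G" "lin G f" "h \<in> carrier H"
  shows "D G h (\<lambda>a b. \<epsilon> b \<odot>\<^bsub>G\<^esub> f a) = f h"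
proof -
  have "f (add_list H [\<epsilon> b \<odot>\<^bsub>H\<^esub> a. (a, b) \<leftarrow> expansion h]) = add_list G (map f [\<epsilon> b \<odot>\<^bsub>H\<^esub> a. (a, b) \<leftarrow> expansion h])"
    using expansion_closed[OF assms(3)] counit_closed by (intro lin_add_list assms) auto
  also have "map f [\<epsilon> b \<odot>\<^bsub>H\<^esub> a. (a, b) \<leftarrow> expansion h] = [\<epsilon> b \<odot>\<^bsub>G\<^esub> f a. (a, b) \<leftarrow> expansion h]"
    using expansion_closed[OF assms(3)] counit_closed linD(3)[OF assms(2)] by auto
  finally show ?thesis
    using assms(3) counit_right[OF sweedler_expansion] by (simp add: D_def)
qed

lemma D_antipode_left:
  assumes "abelian_group G" "lin G f" "h \<in> carrier H"
  shows "D G h (\<lambda>a b. f (S a \<cdot> b)) = \<epsilon> h \<odot>\<^bsub>G\<^esub> f \<one>\<^bsub>H\<^esub>"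
proof -
  have "f (add_list H [S a \<cdot> b. (a, b) \<leftarrow> expansion h]) = add_list G (map f [S a \<cdot> b. (a, b) \<leftarrow> expansion h])"
    using expansion_closed[OF assms(3)] antipode_closed by (intro lin_add_list assms) auto
  then show ?thesis
    using assms(3) antipode_left[OF sweedler_expansion] linD(3)[OF assms(2)] counit_closed
    by (simp add: D_def comp_def case_prod_unfold)
qed

lemma D_antipode_right:
  assumes "abelian_group G" "lin G f" "h \<in> carrier H"
  shows "D G h (\<lambda>a b. f (a \<cdot> S b)) = \<epsilon> h \<odot>\<^bsub>G\<^esub> f \<one>\<^bsub>H\<^esub>"
proof -
  have "f (add_list H [a \<cdot> S b. (a, b) \<leftarrow> expansion h]) = add_list G (map f [a \<cdot> S b. (a, b) \<leftarrow> expansion h])"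
    using expansion_closed[OF assms(3)] antipode_closed by (intro lin_add_list assms) auto
  then show ?thesis
    using assms(3) antipode_right[OF sweedler_expansion] linD(3)[OF assms(2)] counit_closed
    by (simp add: D_def comp_def case_prod_unfold)
qed

lemma D_one:
  assumes "abelian_group G"
    and f: "\<And>a. a \<in> carrier H \<Longrightarrow> lin G (\<lambda>b. f a b)" "\<And>b. b \<in> carrier H \<Longrightarrow> lin G (\<lambda>a. f a b)"
  shows "D G \<one>\<^bsub>H\<^esub> f = f \<one>\<^bsub>H\<^esub> \<one>\<^bsub>H\<^esub>"
proof -
  interpret G: abelian_group G by fact
  show ?thesis
    using D_sweedler[OF assms(1) comult_one f] linD(1)[OF f(1)[of "\<one>\<^bsub>H\<^esub>"], of "\<one>\<^bsub>H\<^esub>"] by simp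
qed

text \<open>
  The comultiplication is an algebra homomorphism.
\<close>

lemma D_mult:
  assumes "abelian_group G"
    and f: "\<And>a. a \<in> carrier H \<Longrightarrow> lin G (\<lambda>b. f a b)" "\<And>b. b \<in> carrier H \<Longrightarrow> lin G (\<lambda>a. f a b)"
    and h: "h \<in> carrier H" and k: "k \<in> carrier H"
  shows "D G (h \<cdot> k) f = D G h (\<lambda>a b. D G k (\<lambda>c d. f (a \<cdot> c) (b \<cdot> d)))"
proof -
  interpret G: abelian_group G by fact
  let ?ps = "[(a \<cdot> c, b \<cdot> d). (a, b) \<leftarrow> expansion h, (c, d) \<leftarrow> expansion k]"
  have fc: "f a b \<in> carrier G" if "a \<in> carrier H" "b \<in> carrier H" for a b
    using linD(1)[OF f(1)] that by blast
  have "D G (h \<cdot> k) f = add_list G [f a b. (a, b) \<leftarrow> ?ps]"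
    by (rule D_sweedler[OF assms(1) comult_mult[OF sweedler_expansion[OF h] sweedler_expansion[OF k]] f, symmetric])
  also have "[f a b. (a, b) \<leftarrow> ?ps] =
      concat (map (\<lambda>p. map (\<lambda>q. f (fst p \<cdot> fst q) (snd p \<cdot> snd q)) (expansion k)) (expansion h))"
    by (simp add: map_concat comp_def case_prod_unfold)
  also have "add_list G \<dots> =
      add_list G (map (\<lambda>p. add_list G (map (\<lambda>q. f (fst p \<cdot> fst q) (snd p \<cdot> snd q)) (expansion k))) (expansion h))"
  proof (rule G.add_list_concat)
    fix p assume "p \<in> set (expansion h)"
    then have "fst p \<in> carrier H \<and> snd p \<in> carrier H" using expansion_closed[OF h, of "fst p" "snd p"] by simp
    then show "set (map (\<lambda>q. f (fst p \<cdot> fst q) (snd p \<cdot> snd q)) (expansion k)) \<subseteq> carrier G"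
      using expansion_closed[OF k] fc by auto
  qed
  finally show ?thesis using h k by (simp add: D_def case_prod_unfold)
qed

end

lemma (in k_algebra) k_algebra: "k_algebra K E" ..

text \<open>
  Rules for linearity and for membership in carriers. The side conditions of the calculus with
  Sweedler sums, linearity of an expression in each variable separately, are derived by
  applying them exhaustively.
\<close>

named_theorems lins

context cocommutative_hopf
begin

lemma H_algebra [lins]: "k_algebra K H"
  using smult_mult_left smult_mult_right by unfold_locales auto

lemma k_algebra_module: "k_algebra K E \<Longrightarrow> module K E"
  by (simp add: k_algebra_def)

lemma module_abelian_group: "module K G \<Longrightarrow> abelian_group G"
  by (simp add: module_def)

lemma H_module [lins]: "module K H" "abelian_group H"
  by unfold_locales

lemma lin_id [lins]: "lin H (\<lambda>x. x)"
  by (rule linI) auto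

lemma lin_antipode [lins]: "lin H g \<Longrightarrow> lin H (\<lambda>x. S (g x))"
  by (rule lin_comp[of H S]) (auto intro: linI antipode_closed antipode_add antipode_smult)

lemma lin_mult_left: "\<lbrakk>k_algebra K E; c \<in> carrier E; lin E f\<rbrakk> \<Longrightarrow> lin E (\<lambda>x. c \<otimes>\<^bsub>E\<^esub> f x)"
  and lin_mult_right: "\<lbrakk>k_algebra K E; c \<in> carrier E; lin E f\<rbrakk> \<Longrightarrow> lin E (\<lambda>x. f x \<otimes>\<^bsub>E\<^esub> c)"
proof -
  assume E: "k_algebra K E" "c \<in> carrier E" "lin E f"
  interpret E: k_algebra K E by fact
  show "lin E (\<lambda>x. c \<otimes>\<^bsub>E\<^esub> f x)" "lin E (\<lambda>x. f x \<otimes>\<^bsub>E\<^esub> c)"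
    using E(2) linD[OF E(3)]
    by (auto intro!: linI simp: E.r_distr E.l_distr E.smult_mult_left[symmetric] E.smult_mult_right[symmetric])
qed

lemma lin_smult: "\<lbrakk>module K G; r \<in> carrier K; lin G f\<rbrakk> \<Longrightarrow> lin G (\<lambda>x. r \<odot>\<^bsub>G\<^esub> f x)"
proof -
  assume G: "module K G" "r \<in> carrier K" "lin G f"
  interpret G: module K G by fact
  have "r \<odot>\<^bsub>G\<^esub> (s \<odot>\<^bsub>G\<^esub> x) = s \<odot>\<^bsub>G\<^esub> (r \<odot>\<^bsub>G\<^esub> x)" if "s \<in> carrier K" "x \<in> carrier G" for s x
    using G(2) that by (simp add: G.smult_assoc1[symmetric] m_comm)
  then show ?thesis
    using G(2) linD[OF G(3)] by (auto intro!: linI simp: G.smult_r_distr)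
qed

lemma counit_add: "\<lbrakk>x \<in> carrier H; y \<in> carrier H\<rbrakk> \<Longrightarrow> \<epsilon> (x \<oplus>\<^bsub>H\<^esub> y) = \<epsilon> x \<oplus>\<^bsub>K\<^esub> \<epsilon> y"
  and counit_mult: "\<lbrakk>x \<in> carrier H; y \<in> carrier H\<rbrakk> \<Longrightarrow> \<epsilon> (x \<cdot> y) = \<epsilon> x \<otimes>\<^bsub>K\<^esub> \<epsilon> y"
  and counit_one: "\<epsilon> \<one>\<^bsub>H\<^esub> = \<one>\<^bsub>K\<^esub>"
  using counit_hom by (auto simp: ring_hom_def)

lemma lin_counit_smult: "\<lbrakk>module K G; m \<in> carrier G; lin H g\<rbrakk> \<Longrightarrow> lin G (\<lambda>x. \<epsilon> (g x) \<odot>\<^bsub>G\<^esub> m)"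
proof -
  assume G: "module K G" "m \<in> carrier G" "lin H g"
  interpret G: module K G by fact
  have "lin G (\<lambda>x. \<epsilon> x \<odot>\<^bsub>G\<^esub> m)"
    using G(2) counit_closed by (auto intro!: linI simp: counit_add counit_smult G.smult_l_distr G.smult_assoc1)
  then show ?thesis using G(3) by (rule lin_comp)
qed

lemma k_algebra_m_closed: "\<lbrakk>k_algebra K E; x \<in> carrier E; y \<in> carrier E\<rbrakk> \<Longrightarrow> x \<otimes>\<^bsub>E\<^esub> y \<in> carrier E"
  by (simp add: k_algebra_def ring.ring_simprules)

lemma module_smult_closed: "\<lbrakk>module K G; r \<in> carrier K; x \<in> carrier G\<rbrakk> \<Longrightarrow> r \<odot>\<^bsub>G\<^esub> x \<in> carrier G"
  by (simp add: module_def module_axioms_def)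

lemmas [lins] = lin_mult_left lin_mult_right lin_counit_smult lin_smult lin_D_arg lin_D_body
  k_algebra_m_closed module_smult_closed counit_closed antipode_closed D_closed H.one_closed R.one_closed

lemma D_mult_left:
  assumes E: "k_algebra K E" and c: "c \<in> carrier E"
    and f: "\<And>a b. \<lbrakk>a \<in> carrier H; b \<in> carrier H\<rbrakk> \<Longrightarrow> f a b \<in> carrier E"
  shows "D E h (\<lambda>a b. c \<otimes>\<^bsub>E\<^esub> f a b) = c \<otimes>\<^bsub>E\<^esub> D E h f"
proof -
  interpret E: k_algebra K E by fact
  show ?thesis
    by (rule D_hom[symmetric, OF _ f])
      (auto intro!: abelian_group_homI E.M.abelian_group_axioms simp: c E.r_distr)
qed

lemma D_mult_right:
  assumes E: "k_algebra K E" and c: "c \<in> carrier E"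
    and f: "\<And>a b. \<lbrakk>a \<in> carrier H; b \<in> carrier H\<rbrakk> \<Longrightarrow> f a b \<in> carrier E"
  shows "D E h (\<lambda>a b. f a b \<otimes>\<^bsub>E\<^esub> c) = D E h f \<otimes>\<^bsub>E\<^esub> c"
proof -
  interpret E: k_algebra K E by fact
  show ?thesis
    by (rule D_hom[symmetric, OF _ f, where u = "\<lambda>x. x \<otimes>\<^bsub>E\<^esub> c"])
      (auto intro!: abelian_group_homI E.M.abelian_group_axioms simp: c E.l_distr)
qed

lemma D_smult:
  assumes G: "module K G" and r: "r \<in> carrier K"
    and f: "\<And>a b. \<lbrakk>a \<in> carrier H; b \<in> carrier H\<rbrakk> \<Longrightarrow> f a b \<in> carrier G"
  shows "D G h (\<lambda>a b. r \<odot>\<^bsub>G\<^esub> f a b) = r \<odot>\<^bsub>G\<^esub> D G h f"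
proof -
  interpret G: module K G by fact
  show ?thesis
    by (rule D_hom[symmetric, OF _ f])
      (auto intro!: abelian_group_homI G.M.abelian_group_axioms simp: r G.smult_r_distr)
qed

text \<open>
  By cocommutativity \<open>f h\<^sub>1 h\<^sub>2 h\<^sub>3 h\<^sub>4\<close> is symmetric under exchanging the two inner legs. The
  bracketing has to be changed so that these become the two legs of one element, and back.
\<close>

lemma D_middle_swap:
  assumes G: "module K G"
    and f: "\<And>b c d. \<lbrakk>b \<in> carrier H; c \<in> carrier H; d \<in> carrier H\<rbrakk> \<Longrightarrow> lin G (\<lambda>a. f a b c d)"
    "\<And>a c d. \<lbrakk>a \<in> carrier H; c \<in> carrier H; d \<in> carrier H\<rbrakk> \<Longrightarrow> lin G (\<lambda>b. f a b c d)"
    "\<And>a b d. \<lbrakk>a \<in> carrier H; b \<in> carrier H; d \<in> carrier H\<rbrakk> \<Longrightarrow> lin G (\<lambda>c. f a b c d)"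
    "\<And>a b c. \<lbrakk>a \<in> carrier H; b \<in> carrier H; c \<in> carrier H\<rbrakk> \<Longrightarrow> lin G (\<lambda>d. f a b c d)"
  shows "D G h (\<lambda>x y. D G x (\<lambda>a b. D G y (\<lambda>c d. f a b c d))) = D G h (\<lambda>x y. D G x (\<lambda>a b. D G y (\<lambda>c d. f a c b d)))"
proof -
  note ag = module_abelian_group[OF G]
  note [lins] = G ag f linD(1)[OF f(1)]
  have "D G h (\<lambda>x y. D G x (\<lambda>a b. D G y (\<lambda>c d. f a b c d))) = D G h (\<lambda>a z. D G z (\<lambda>b y. D G y (\<lambda>c d. f a b c d)))"
    by (rule D_coassoc[OF ag]) (assumption | rule lins)+
  also have "\<dots> = D G h (\<lambda>a z. D G z (\<lambda>w d. D G w (\<lambda>b c. f a b c d)))"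
    by (rule D_cong[OF refl], rule D_coassoc[OF ag, symmetric]) (assumption | rule lins)+
  also have "\<dots> = D G h (\<lambda>a z. D G z (\<lambda>w d. D G w (\<lambda>b c. f a c b d)))"
    by (rule D_cong[OF refl], rule D_cong[OF refl], rule D_cocomm[OF ag]) (assumption | rule lins)+
  also have "\<dots> = D G h (\<lambda>a z. D G z (\<lambda>b y. D G y (\<lambda>c d. f a c b d)))"
    by (rule D_cong[OF refl], rule D_coassoc[OF ag]) (assumption | rule lins)+
  also have "\<dots> = D G h (\<lambda>x y. D G x (\<lambda>a b. D G y (\<lambda>c d. f a c b d)))"
    by (rule D_coassoc[OF ag, symmetric]) (assumption | rule lins)+
  finally show ?thesis .
qed

section \<open>The antipode of a cocommutative Hopf algebra\<close>

text \<open>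
  Cancelling \<open>k\<^sub>2 S k\<^sub>3\<close> backwards gives \<open>S (h\<^sub>1 k) h\<^sub>2 = S (h\<^sub>1 k\<^sub>1) (h\<^sub>2 k\<^sub>2) S k\<^sub>3\<close>, where the first two
  factors form \<open>S x\<^sub>1 x\<^sub>2\<close> for \<open>x = h k\<^sub>1\<close>.
\<close>

lemma antipode_mult_collapse:
  assumes h: "h \<in> carrier H" and k: "k \<in> carrier H"
  shows "D H h (\<lambda>a b. S (a \<cdot> k) \<cdot> b) = \<epsilon> h \<odot>\<^bsub>H\<^esub> S k"
proof -
  note ag = H_module(2)
  have "S (a \<cdot> k) \<cdot> b = D H k (\<lambda>v d. D H v (\<lambda>p q. S (a \<cdot> p) \<cdot> (b \<cdot> q)) \<cdot> S d)"
    if ab: "a \<in> carrier H" "b \<in> carrier H" for a b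
  proof -
    have "S (a \<cdot> k) \<cdot> b = D H k (\<lambda>p r. \<epsilon> r \<odot>\<^bsub>H\<^esub> (S (a \<cdot> p) \<cdot> b))"
      by (rule D_counit_right[symmetric, OF ag _ k]) (assumption | rule lins ab)+
    also have "\<dots> = D H k (\<lambda>p r. D H r (\<lambda>q d. (S (a \<cdot> p) \<cdot> (b \<cdot> q)) \<cdot> S d))"
    proof (rule D_cong[OF refl])
      fix p r assume pr: "p \<in> carrier H" "r \<in> carrier H"
      have "D H r (\<lambda>q d. (\<lambda>x. (S (a \<cdot> p) \<cdot> b) \<cdot> x) (q \<cdot> S d)) =
          \<epsilon> r \<odot>\<^bsub>H\<^esub> ((S (a \<cdot> p) \<cdot> b) \<cdot> \<one>\<^bsub>H\<^esub>)"
        by (rule D_antipode_right[OF ag]) (assumption | rule lins ab pr)+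
      then show "\<epsilon> r \<odot>\<^bsub>H\<^esub> (S (a \<cdot> p) \<cdot> b) = D H r (\<lambda>q d. (S (a \<cdot> p) \<cdot> (b \<cdot> q)) \<cdot> S d)"
        using ab pr by (simp add: H.m_assoc antipode_closed)
    qed
    also have "\<dots> = D H k (\<lambda>v d. D H v (\<lambda>p q. (S (a \<cdot> p) \<cdot> (b \<cdot> q)) \<cdot> S d))"
      by (rule D_coassoc[OF ag, symmetric]) (assumption | rule lins ab)+
    also have "\<dots> = D H k (\<lambda>v d. D H v (\<lambda>p q. S (a \<cdot> p) \<cdot> (b \<cdot> q)) \<cdot> S d)"
      by (rule D_cong[OF refl], rule D_mult_right) (assumption | rule lins ab)+
    finally show ?thesis .
  qed
  then have "D H h (\<lambda>a b. S (a \<cdot> k) \<cdot> b) =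
      D H h (\<lambda>a b. D H k (\<lambda>v d. D H v (\<lambda>p q. S (a \<cdot> p) \<cdot> (b \<cdot> q)) \<cdot> S d))"
    by (intro D_cong refl)
  also have "\<dots> = D H k (\<lambda>v d. D H h (\<lambda>a b. D H v (\<lambda>p q. S (a \<cdot> p) \<cdot> (b \<cdot> q)) \<cdot> S d))"
    by (rule D_swap[OF ag]) (assumption | rule lins)+
  also have "\<dots> = D H k (\<lambda>v d. \<epsilon> v \<odot>\<^bsub>H\<^esub> (\<epsilon> h \<odot>\<^bsub>H\<^esub> S d))"
  proof (rule D_cong[OF refl])
    fix v d assume vd: "v \<in> carrier H" "d \<in> carrier H"
    have "D H h (\<lambda>a b. D H v (\<lambda>p q. S (a \<cdot> p) \<cdot> (b \<cdot> q)) \<cdot> S d) =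
        D H h (\<lambda>a b. D H v (\<lambda>p q. S (a \<cdot> p) \<cdot> (b \<cdot> q))) \<cdot> S d"
      by (rule D_mult_right) (assumption | rule lins vd)+
    also have "D H h (\<lambda>a b. D H v (\<lambda>p q. S (a \<cdot> p) \<cdot> (b \<cdot> q))) = D H (h \<cdot> v) (\<lambda>x y. S x \<cdot> y)"
      by (rule D_mult[symmetric, OF ag _ _ h vd(1)]) (assumption | rule lins)+
    also have "\<dots> = \<epsilon> (h \<cdot> v) \<odot>\<^bsub>H\<^esub> \<one>\<^bsub>H\<^esub>"
      using D_antipode_left[OF ag lin_id, of "h \<cdot> v"] h vd by simp
    finally show "D H h (\<lambda>a b. D H v (\<lambda>p q. S (a \<cdot> p) \<cdot> (b \<cdot> q)) \<cdot> S d) = \<epsilon> v \<odot>\<^bsub>H\<^esub> (\<epsilon> h \<odot>\<^bsub>H\<^esub> S d)"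
      using h vd by (simp add: counit_mult counit_closed antipode_closed smult_mult_left[symmetric] smult_assoc1[symmetric] m_comm)
  qed
  also have "\<dots> = \<epsilon> h \<odot>\<^bsub>H\<^esub> S k"
    by (rule D_counit_left[OF ag _ k]) (assumption | rule lins h)+
  finally show ?thesis .
qed

text \<open>
  \<open>S (h k) = S (h\<^sub>1 k) h\<^sub>2 S h\<^sub>3 = S k S h\<close>, with the preceding lemma in the second step.
\<close>

lemma antipode_mult:
  assumes h: "h \<in> carrier H" and k: "k \<in> carrier H"
  shows "S (h \<cdot> k) = S k \<cdot> S h"
proof -
  note ag = H_module(2)
  have "S (h \<cdot> k) = D H h (\<lambda>a r. \<epsilon> r \<odot>\<^bsub>H\<^esub> S (a \<cdot> k))"
    by (rule D_counit_right[symmetric, OF ag _ h]) (assumption | rule lins k)+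
  also have "\<dots> = D H h (\<lambda>a r. D H r (\<lambda>c d. (S (a \<cdot> k) \<cdot> c) \<cdot> S d))"
  proof (rule D_cong[OF refl])
    fix a r assume ar: "a \<in> carrier H" "r \<in> carrier H"
    have "D H r (\<lambda>c d. (\<lambda>x. S (a \<cdot> k) \<cdot> x) (c \<cdot> S d)) = \<epsilon> r \<odot>\<^bsub>H\<^esub> (S (a \<cdot> k) \<cdot> \<one>\<^bsub>H\<^esub>)"
      by (rule D_antipode_right[OF ag]) (assumption | rule lins ar k)+
    then show "\<epsilon> r \<odot>\<^bsub>H\<^esub> S (a \<cdot> k) = D H r (\<lambda>c d. (S (a \<cdot> k) \<cdot> c) \<cdot> S d)"
      using ar k by (simp add: H.m_assoc antipode_closed)
  qed
  also have "\<dots> = D H h (\<lambda>u d. D H u (\<lambda>a c. (S (a \<cdot> k) \<cdot> c) \<cdot> S d))"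
    by (rule D_coassoc[OF ag, symmetric]) (assumption | rule lins k)+
  also have "\<dots> = D H h (\<lambda>u d. \<epsilon> u \<odot>\<^bsub>H\<^esub> (S k \<cdot> S d))"
  proof (rule D_cong[OF refl])
    fix u d assume ud: "u \<in> carrier H" "d \<in> carrier H"
    have "D H u (\<lambda>a c. (S (a \<cdot> k) \<cdot> c) \<cdot> S d) = D H u (\<lambda>a c. S (a \<cdot> k) \<cdot> c) \<cdot> S d"
      by (rule D_mult_right) (assumption | rule lins ud k)+
    then show "D H u (\<lambda>a c. (S (a \<cdot> k) \<cdot> c) \<cdot> S d) = \<epsilon> u \<odot>\<^bsub>H\<^esub> (S k \<cdot> S d)"
      using ud k by (simp add: antipode_mult_collapse smult_mult_left counit_closed antipode_closed)
  qed
  also have "\<dots> = S k \<cdot> S h"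
    by (rule D_counit_left[OF ag _ h]) (assumption | rule lins k)+
  finally show ?thesis .
qed

lemma antipode_one: "S \<one>\<^bsub>H\<^esub> = \<one>\<^bsub>H\<^esub>"
proof -
  note ag = H_module(2)
  have "S \<one>\<^bsub>H\<^esub> \<cdot> \<one>\<^bsub>H\<^esub> = D H \<one>\<^bsub>H\<^esub> (\<lambda>a b. S a \<cdot> b)"
    by (rule D_one[symmetric, OF ag]) (assumption | rule lins)+
  also have "\<dots> = \<epsilon> \<one>\<^bsub>H\<^esub> \<odot>\<^bsub>H\<^esub> \<one>\<^bsub>H\<^esub>"
    by (rule D_antipode_left[OF ag lin_id]) simp
  finally show ?thesis by (simp add: counit_one antipode_closed)
qed

text \<open>
  For cocommutative \<open>H\<close> the antipode is a coalgebra map: \<open>\<Delta> \<circ> S\<close> and \<open>(S \<otimes> S) \<circ> \<Delta>\<close> are both convolution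
  inverses of \<open>\<Delta>\<close>. The proof evaluates \<open>\<Delta> (S h\<^sub>1 h\<^sub>2) (S \<otimes> S) (\<Delta> h\<^sub>3)\<close>, paired with \<open>f\<close>, in two ways.
\<close>

lemma D_antipode:
  assumes G: "module K G"
    and f: "\<And>a. a \<in> carrier H \<Longrightarrow> lin G (\<lambda>b. f a b)" "\<And>b. b \<in> carrier H \<Longrightarrow> lin G (\<lambda>a. f a b)"
    and h: "h \<in> carrier H"
  shows "D G (S h) f = D G h (\<lambda>a b. f (S a) (S b))"
proof -
  interpret G: module K G by fact
  note ag = module_abelian_group[OF G]
  have f': "lin G (\<lambda>b. f a (g b))" if "a \<in> carrier H" "lin H g" for a g
    using lin_comp[OF f(1) that(2)] that by blast
  have f'': "lin G (\<lambda>a. f (g a) b)" if "b \<in> carrier H" "lin H g" for b g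
    using lin_comp[OF f(2) that(2)] that by blast
  note [lins] = G ag f' f'' linD(1)[OF f(1)]
  \<comment> \<open>\<open>?u q z\<close> is \<open>f\<close> evaluated on \<open>\<Delta> z (S \<otimes> S) (\<Delta> q)\<close>\<close>
  let ?u = "\<lambda>q z. D G z (\<lambda>c d. D G q (\<lambda>s t. f (c \<cdot> S s) (d \<cdot> S t)))"
  have "D G h (\<lambda>p q. D G p (\<lambda>x y. ?u q (S x \<cdot> y))) = D G h (\<lambda>p q. \<epsilon> p \<odot>\<^bsub>G\<^esub> D G q (\<lambda>s t. f (S s) (S t)))"
  proof (rule D_cong[OF refl])
    fix p q assume pq: "p \<in> carrier H" "q \<in> carrier H"
    have "D G p (\<lambda>x y. ?u q (S x \<cdot> y)) = \<epsilon> p \<odot>\<^bsub>G\<^esub> ?u q \<one>\<^bsub>H\<^esub>"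
      by (rule D_antipode_left[OF ag]) (assumption | rule lins pq)+
    also have "?u q \<one>\<^bsub>H\<^esub> = D G q (\<lambda>s t. f (\<one>\<^bsub>H\<^esub> \<cdot> S s) (\<one>\<^bsub>H\<^esub> \<cdot> S t))"
      by (rule D_one[OF ag]) (assumption | rule lins pq)+
    finally show "D G p (\<lambda>x y. ?u q (S x \<cdot> y)) = \<epsilon> p \<odot>\<^bsub>G\<^esub> D G q (\<lambda>s t. f (S s) (S t))"
      by (simp add: antipode_closed)
  qed
  also have "\<dots> = D G h (\<lambda>s t. f (S s) (S t))"
    by (rule D_counit_left[OF ag _ h]) (assumption | rule lins)+
  finally have 1: "D G h (\<lambda>p q. D G p (\<lambda>x y. ?u q (S x \<cdot> y))) = D G h (\<lambda>s t. f (S s) (S t))" .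
  let ?F = "\<lambda>a b m n s t. f (a \<cdot> (m \<cdot> S s)) (b \<cdot> (n \<cdot> S t))"
  have "D G h (\<lambda>p q. D G p (\<lambda>x y. ?u q (S x \<cdot> y))) =
      D G h (\<lambda>p q. D G p (\<lambda>x y. D G (S x) (\<lambda>a b. D G y (\<lambda>m n. D G q (\<lambda>s t. ?F a b m n s t)))))"
  proof (intro D_cong[OF refl])
    fix p q x y assume q: "q \<in> carrier H" and xy: "x \<in> carrier H" "y \<in> carrier H"
    have "?u q (S x \<cdot> y) =
        D G (S x) (\<lambda>a b. D G y (\<lambda>m n. D G q (\<lambda>s t. f (a \<cdot> m \<cdot> S s) (b \<cdot> n \<cdot> S t))))"
      by (rule D_mult[OF ag _ _ antipode_closed[OF xy(1)] xy(2)]) (assumption | rule lins q)+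
    then show "?u q (S x \<cdot> y) = D G (S x) (\<lambda>a b. D G y (\<lambda>m n. D G q (\<lambda>s t. ?F a b m n s t)))"
      by (simp add: H.m_assoc antipode_closed)
  qed
  also have "\<dots> = D G h (\<lambda>x r. D G r (\<lambda>y q. D G (S x) (\<lambda>a b. D G y (\<lambda>m n. D G q (\<lambda>s t. ?F a b m n s t)))))"
    by (rule D_coassoc[OF ag]) (assumption | rule lins)+
  also have "\<dots> = D G h (\<lambda>x r. \<epsilon> r \<odot>\<^bsub>G\<^esub> D G (S x) f)"
  proof (rule D_cong[OF refl])
    fix x r assume xr: "x \<in> carrier H" "r \<in> carrier H"
    have "D G r (\<lambda>y q. D G (S x) (\<lambda>a b. D G y (\<lambda>m n. D G q (\<lambda>s t. ?F a b m n s t)))) =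
        D G (S x) (\<lambda>a b. D G r (\<lambda>y q. D G y (\<lambda>m n. D G q (\<lambda>s t. ?F a b m n s t))))"
      by (rule D_swap[OF ag]) (assumption | rule lins)+
    also have "\<dots> = D G (S x) (\<lambda>a b. D G r (\<lambda>y q. D G y (\<lambda>m s. D G q (\<lambda>n t. ?F a b m n s t))))"
      by (rule D_cong[OF refl], rule D_middle_swap[OF G]) (assumption | rule lins)+
    also have "\<dots> = D G (S x) (\<lambda>a b. \<epsilon> r \<odot>\<^bsub>G\<^esub> f a b)"
    proof (rule D_cong[OF refl])
      fix a b assume ab: "a \<in> carrier H" "b \<in> carrier H"
      have "D G y (\<lambda>m s. D G q (\<lambda>n t. ?F a b m n s t)) = \<epsilon> q \<odot>\<^bsub>G\<^esub> (\<epsilon> y \<odot>\<^bsub>G\<^esub> f a b)"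
        if yq: "y \<in> carrier H" "q \<in> carrier H" for y q
      proof -
        have "D G q (\<lambda>n t. ?F a b m n s t) = \<epsilon> q \<odot>\<^bsub>G\<^esub> f (a \<cdot> (m \<cdot> S s)) (b \<cdot> \<one>\<^bsub>H\<^esub>)"
          if "m \<in> carrier H" "s \<in> carrier H" for m s
          by (rule D_antipode_right[OF ag, where f = "\<lambda>z. f (a \<cdot> (m \<cdot> S s)) (b \<cdot> z)"])
            (assumption | rule lins ab yq that)+
        then have "D G y (\<lambda>m s. D G q (\<lambda>n t. ?F a b m n s t)) =
            D G y (\<lambda>m s. \<epsilon> q \<odot>\<^bsub>G\<^esub> f (a \<cdot> (m \<cdot> S s)) (b \<cdot> \<one>\<^bsub>H\<^esub>))"
          by (intro D_cong refl)
        also have "\<dots> = \<epsilon> y \<odot>\<^bsub>G\<^esub> (\<epsilon> q \<odot>\<^bsub>G\<^esub> f (a \<cdot> \<one>\<^bsub>H\<^esub>) (b \<cdot> \<one>\<^bsub>H\<^esub>))"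
          by (rule D_antipode_right[OF ag, where f = "\<lambda>z. \<epsilon> q \<odot>\<^bsub>G\<^esub> f (a \<cdot> z) (b \<cdot> \<one>\<^bsub>H\<^esub>)"])
            (assumption | rule lins ab yq)+
        finally show ?thesis
          using ab yq linD(1)[OF f(1)] by (simp add: counit_closed G.smult_assoc1[symmetric] m_comm)
      qed
      then have "D G r (\<lambda>y q. D G y (\<lambda>m s. D G q (\<lambda>n t. ?F a b m n s t))) = D G r (\<lambda>y q. \<epsilon> q \<odot>\<^bsub>G\<^esub> (\<epsilon> y \<odot>\<^bsub>G\<^esub> f a b))"
        by (intro D_cong refl)
      also have "\<dots> = \<epsilon> r \<odot>\<^bsub>G\<^esub> f a b"
        by (rule D_counit_right[OF ag _ xr(2)]) (assumption | rule lins ab)+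
      finally show "D G r (\<lambda>y q. D G y (\<lambda>m s. D G q (\<lambda>n t. ?F a b m n s t))) = \<epsilon> r \<odot>\<^bsub>G\<^esub> f a b" .
    qed
    also have "\<dots> = \<epsilon> r \<odot>\<^bsub>G\<^esub> D G (S x) f"
      by (rule D_smult) (assumption | rule lins xr)+
    finally show "D G r (\<lambda>y q. D G (S x) (\<lambda>a b. D G y (\<lambda>m n. D G q (\<lambda>s t. ?F a b m n s t)))) = \<epsilon> r \<odot>\<^bsub>G\<^esub> D G (S x) f" .
  qed
  also have "\<dots> = D G (S h) f"
    by (rule D_counit_right[OF ag _ h]) (assumption | rule lins)+
  finally show ?thesis using 1 by simp
qed

lemma counit_antipode: "h \<in> carrier H \<Longrightarrow> \<epsilon> (S h) \<odot>\<^bsub>H\<^esub> \<one>\<^bsub>H\<^esub> = \<epsilon> h \<odot>\<^bsub>H\<^esub> \<one>\<^bsub>H\<^esub>"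
proof -
  assume h: "h \<in> carrier H"
  note ag = H_module(2)
  have "\<epsilon> (S h) \<odot>\<^bsub>H\<^esub> \<one>\<^bsub>H\<^esub> = D H h (\<lambda>a b. \<epsilon> b \<odot>\<^bsub>H\<^esub> (\<epsilon> (S a) \<odot>\<^bsub>H\<^esub> \<one>\<^bsub>H\<^esub>))"
    by (rule D_counit_right[symmetric, OF ag _ h]) (assumption | rule lins)+
  also have "\<dots> = D H h (\<lambda>a b. \<epsilon> (S a \<cdot> b) \<odot>\<^bsub>H\<^esub> \<one>\<^bsub>H\<^esub>)"
    by (simp add: counit_mult antipode_closed counit_closed smult_assoc1[symmetric] m_comm)
  also have "\<dots> = \<epsilon> h \<odot>\<^bsub>H\<^esub> (\<epsilon> \<one>\<^bsub>H\<^esub> \<odot>\<^bsub>H\<^esub> \<one>\<^bsub>H\<^esub>)"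
    by (rule D_antipode_left[OF ag, where f = "\<lambda>x. \<epsilon> x \<odot>\<^bsub>H\<^esub> \<one>\<^bsub>H\<^esub>"]) (assumption | rule lins h)+
  finally show ?thesis by (simp add: counit_one)
qed

text \<open>
  \<open>S (S h)\<close> and \<open>h\<close> are both convolution inverse to \<open>S h\<close>; for the former this is the axiom
  \<open>S a\<^sub>1 a\<^sub>2 = \<epsilon> a 1\<close> at \<open>a = S h\<close>, whose expansion is \<open>S h\<^sub>1 \<otimes> S h\<^sub>2\<close>.
\<close>

lemma antipode_antipode: "h \<in> carrier H \<Longrightarrow> S (S h) = h"
proof -
  assume h: "h \<in> carrier H"
  note ag = H_module(2)
  have SS: "D H w (\<lambda>a b. S (S a) \<cdot> S b) = \<epsilon> w \<odot>\<^bsub>H\<^esub> \<one>\<^bsub>H\<^esub>" if w: "w \<in> carrier H" for w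
  proof -
    have "D H w (\<lambda>a b. S (S a) \<cdot> S b) = D H (S w) (\<lambda>a b. S a \<cdot> b)"
      by (rule D_antipode[symmetric, OF H_module(1) _ _ w]) (assumption | rule lins)+
    also have "\<dots> = \<epsilon> (S w) \<odot>\<^bsub>H\<^esub> \<one>\<^bsub>H\<^esub>"
      by (rule D_antipode_left[OF ag lin_id]) (rule antipode_closed[OF w])
    finally show ?thesis using counit_antipode[OF w] by simp
  qed
  have "S (S h) = D H h (\<lambda>a r. \<epsilon> r \<odot>\<^bsub>H\<^esub> S (S a))"
    by (rule D_counit_right[symmetric, OF ag _ h]) (assumption | rule lins)+
  also have "\<dots> = D H h (\<lambda>a r. D H r (\<lambda>b c. S (S a) \<cdot> S b \<cdot> c))"
  proof (rule D_cong[OF refl])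
    fix a r assume ar: "a \<in> carrier H" "r \<in> carrier H"
    have "D H r (\<lambda>b c. (\<lambda>x. S (S a) \<cdot> x) (S b \<cdot> c)) = \<epsilon> r \<odot>\<^bsub>H\<^esub> (S (S a) \<cdot> \<one>\<^bsub>H\<^esub>)"
      by (rule D_antipode_left[OF ag]) (assumption | rule lins ar)+
    then show "\<epsilon> r \<odot>\<^bsub>H\<^esub> S (S a) = D H r (\<lambda>b c. S (S a) \<cdot> S b \<cdot> c)"
      using ar by (simp add: H.m_assoc antipode_closed)
  qed
  also have "\<dots> = D H h (\<lambda>w c. D H w (\<lambda>a b. S (S a) \<cdot> S b \<cdot> c))"
    by (rule D_coassoc[symmetric, OF ag]) (assumption | rule lins)+
  also have "\<dots> = D H h (\<lambda>w c. D H w (\<lambda>a b. S (S a) \<cdot> S b) \<cdot> c)"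
    by (rule D_cong[OF refl], rule D_mult_right) (assumption | rule lins)+
  also have "\<dots> = D H h (\<lambda>w c. \<epsilon> w \<odot>\<^bsub>H\<^esub> c)"
    by (simp add: SS smult_mult_left[symmetric] counit_closed)
  also have "\<dots> = h"
    by (rule D_counit_left[OF ag lin_id h])
  finally show ?thesis .
qed

end

section \<open>Partial representations\<close>

context cocommutative_hopf
begin

text \<open>
  The linear maps to which the universal property of the partial Hopf algebra applies. Two of the
  four relations of the presentation are listed; the other two are \<open>partial_rep_antipode\<close>.
\<close>

definition partial_rep :: "('k, 'e, 'z) module_scheme \<Rightarrow> ('h \<Rightarrow> 'e) \<Rightarrow> bool"
  where "partial_rep E \<pi> \<longleftrightarrow> lin E \<pi> \<and> \<pi> \<one>\<^bsub>H\<^esub> = \<one>\<^bsub>E\<^esub> \<and>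
    (\<forall>h\<in>carrier H. \<forall>k\<in>carrier H.
      D E k (\<lambda>a b. \<pi> h \<otimes>\<^bsub>E\<^esub> (\<pi> a \<otimes>\<^bsub>E\<^esub> \<pi> (S b))) = D E k (\<lambda>a b. \<pi> (h \<cdot> a) \<otimes>\<^bsub>E\<^esub> \<pi> (S b))) \<and>
    (\<forall>h\<in>carrier H. \<forall>k\<in>carrier H.
      D E h (\<lambda>a b. \<pi> a \<otimes>\<^bsub>E\<^esub> (\<pi> (S b) \<otimes>\<^bsub>E\<^esub> \<pi> k)) = D E h (\<lambda>a b. \<pi> a \<otimes>\<^bsub>E\<^esub> \<pi> (S b \<cdot> k)))"

lemma partial_repD:
  assumes "partial_rep E \<pi>"
  shows "lin E \<pi>" "\<pi> \<one>\<^bsub>H\<^esub> = \<one>\<^bsub>E\<^esub>"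
    "\<lbrakk>h \<in> carrier H; k \<in> carrier H\<rbrakk> \<Longrightarrow>
      D E k (\<lambda>a b. \<pi> h \<otimes>\<^bsub>E\<^esub> (\<pi> a \<otimes>\<^bsub>E\<^esub> \<pi> (S b))) = D E k (\<lambda>a b. \<pi> (h \<cdot> a) \<otimes>\<^bsub>E\<^esub> \<pi> (S b))"
    "\<lbrakk>h \<in> carrier H; k \<in> carrier H\<rbrakk> \<Longrightarrow>
      D E h (\<lambda>a b. \<pi> a \<otimes>\<^bsub>E\<^esub> (\<pi> (S b) \<otimes>\<^bsub>E\<^esub> \<pi> k)) = D E h (\<lambda>a b. \<pi> a \<otimes>\<^bsub>E\<^esub> \<pi> (S b \<cdot> k))"
  using assms by (auto simp: partial_rep_def)

text \<open>
  The listed relations with \<open>S k\<close> and \<open>S h\<close> in place of \<open>k\<close> and \<open>h\<close>, since \<open>S\<close> is an involutive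
  coalgebra map.
\<close>

lemma partial_rep_antipode:
  fixes E :: "('k, 'e, 'z) module_scheme" (structure)
  assumes E: "k_algebra K E" and \<pi>: "partial_rep E \<pi>" and h: "h \<in> carrier H" and k: "k \<in> carrier H"
  shows "D E k (\<lambda>a b. \<pi> h \<otimes> (\<pi> (S a) \<otimes> \<pi> b)) = D E k (\<lambda>a b. \<pi> (h \<cdot> S a) \<otimes> \<pi> b)"
    and "D E h (\<lambda>a b. \<pi> (S a) \<otimes> (\<pi> b \<otimes> \<pi> k)) = D E h (\<lambda>a b. \<pi> (S a) \<otimes> \<pi> (b \<cdot> k))"
proof -
  note G = k_algebra_module[OF E]
  note [lins] = E G module_abelian_group[OF G] lin_comp[OF partial_repD(1)[OF \<pi>]] linD(1)[OF partial_repD(1)[OF \<pi>]]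
  have "D E k (\<lambda>a b. \<pi> h \<otimes> (\<pi> (S a) \<otimes> \<pi> b)) = D E k (\<lambda>a b. \<pi> h \<otimes> (\<pi> (S a) \<otimes> \<pi> (S (S b))))"
    by (simp add: antipode_antipode)
  also have "\<dots> = D E (S k) (\<lambda>a b. \<pi> h \<otimes> (\<pi> a \<otimes> \<pi> (S b)))"
    by (rule D_antipode[symmetric, OF G _ _ k]) (assumption | rule lins h)+
  also have "\<dots> = D E (S k) (\<lambda>a b. \<pi> (h \<cdot> a) \<otimes> \<pi> (S b))"
    by (rule partial_repD(3)[OF \<pi> h antipode_closed[OF k]])
  also have "\<dots> = D E k (\<lambda>a b. \<pi> (h \<cdot> S a) \<otimes> \<pi> (S (S b)))"
    by (rule D_antipode[OF G _ _ k]) (assumption | rule lins h)+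
  finally show "D E k (\<lambda>a b. \<pi> h \<otimes> (\<pi> (S a) \<otimes> \<pi> b)) = D E k (\<lambda>a b. \<pi> (h \<cdot> S a) \<otimes> \<pi> b)"
    by (simp add: antipode_antipode)
  have "D E h (\<lambda>a b. \<pi> (S a) \<otimes> (\<pi> b \<otimes> \<pi> k)) = D E h (\<lambda>a b. \<pi> (S a) \<otimes> (\<pi> (S (S b)) \<otimes> \<pi> k))"
    by (simp add: antipode_antipode)
  also have "\<dots> = D E (S h) (\<lambda>a b. \<pi> a \<otimes> (\<pi> (S b) \<otimes> \<pi> k))"
    by (rule D_antipode[symmetric, OF G _ _ h]) (assumption | rule lins k)+
  also have "\<dots> = D E (S h) (\<lambda>a b. \<pi> a \<otimes> \<pi> (S b \<cdot> k))"
    by (rule partial_repD(4)[OF \<pi> antipode_closed[OF h] k])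
  also have "\<dots> = D E h (\<lambda>a b. \<pi> (S a) \<otimes> \<pi> (S (S b) \<cdot> k))"
    by (rule D_antipode[OF G _ _ h]) (assumption | rule lins k)+
  finally show "D E h (\<lambda>a b. \<pi> (S a) \<otimes> (\<pi> b \<otimes> \<pi> k)) = D E h (\<lambda>a b. \<pi> (S a) \<otimes> \<pi> (b \<cdot> k))"
    by (simp add: antipode_antipode)
qed

text \<open>
  The exchange of inner legs that separates a product of two expressions, each of which needs
  neighbouring legs.
\<close>

lemma D_product:
  fixes E :: "('k, 'e, 'z) module_scheme" (structure)
  assumes E: "k_algebra K E"
    and f: "\<And>a. a \<in> carrier H \<Longrightarrow> lin E (\<lambda>b. f a b)" "\<And>b. b \<in> carrier H \<Longrightarrow> lin E (\<lambda>a. f a b)"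
    and g: "\<And>a. a \<in> carrier H \<Longrightarrow> lin E (\<lambda>b. g a b)" "\<And>b. b \<in> carrier H \<Longrightarrow> lin E (\<lambda>a. g a b)"
  shows "D E k (\<lambda>x y. D E x (\<lambda>p q. D E y (\<lambda>c d. f p c \<otimes> g q d))) = D E k (\<lambda>x y. D E x f \<otimes> D E y g)"
proof -
  note G = k_algebra_module[OF E]
  note [lins] = E G module_abelian_group[OF G] f g linD(1)[OF f(1)] linD(1)[OF g(1)]
  have "D E k (\<lambda>x y. D E x (\<lambda>p q. D E y (\<lambda>c d. f p c \<otimes> g q d))) = D E k (\<lambda>x y. D E x (\<lambda>p q. D E y (\<lambda>c d. f p q \<otimes> g c d)))"
    by (rule D_middle_swap[OF G, of "\<lambda>p q c d. f p c \<otimes> g q d"]) (assumption | rule lins)+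
  also have "\<dots> = D E k (\<lambda>x y. D E x (\<lambda>p q. f p q \<otimes> D E y g))"
    by (rule D_cong[OF refl], rule D_cong[OF refl], rule D_mult_left[OF E]) (assumption | rule lins)+
  also have "\<dots> = D E k (\<lambda>x y. D E x f \<otimes> D E y g)"
    by (rule D_cong[OF refl], rule D_mult_right[OF E]) (assumption | rule lins)+
  finally show ?thesis .
qed

definition convolve :: "('k, 'e, 'z) module_scheme \<Rightarrow> ('h \<Rightarrow> 'e) \<Rightarrow> ('h \<Rightarrow> 'e) \<Rightarrow> 'h \<Rightarrow> 'e"
  where "convolve E \<pi> Y h = D E h (\<lambda>a b. \<pi> a \<otimes>\<^bsub>E\<^esub> Y b)"

lemma lin_convolve:
  assumes E: "k_algebra K E" and "lin E \<pi>" "lin E Y"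
  shows "lin E (convolve E \<pi> Y)"
proof -
  note G = k_algebra_module[OF E]
  note [lins] = E G module_abelian_group[OF G] assms(2,3) linD(1)[OF assms(2)] linD(1)[OF assms(3)]
  have "lin E (\<lambda>h. D E h (\<lambda>a b. \<pi> a \<otimes>\<^bsub>E\<^esub> Y b))"
    by (assumption | rule lins)+
  then show ?thesis by (simp add: convolve_def[abs_def])
qed

text \<open>
  Since the two families commute, a product of values of the convolution can be sorted into a
  factor with values of \<open>\<pi>\<close> and a factor with values of \<open>Y\<close>. The legs then alternate between the two;
  \<open>D_product\<close>, hence cocommutativity, separates them, and the relations of \<open>\<pi>\<close> and \<open>Y\<close> apply to one
  factor each.
\<close>

lemma partial_rep_convolve:
  fixes E :: "('k, 'e, 'z) module_scheme" (structure)
  assumes E: "k_algebra K E" and \<pi>: "partial_rep E \<pi>" and Y: "partial_rep E Y"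
    and comm: "\<And>h k. \<lbrakk>h \<in> carrier H; k \<in> carrier H\<rbrakk> \<Longrightarrow> Y h \<otimes> \<pi> k = \<pi> k \<otimes> Y h"
  shows "partial_rep E (convolve E \<pi> Y)"
proof -
  interpret E: k_algebra K E by fact
  note G = k_algebra_module[OF E]
  note linpi = partial_repD(1)[OF \<pi>] and linY = partial_repD(1)[OF Y]
  note cpi = linD(1)[OF linpi] and cY = linD(1)[OF linY]
  note [lins] = E G module_abelian_group[OF G] lin_comp[OF linpi] lin_comp[OF linY] cpi cY
  let ?Z = "convolve E \<pi> Y"
  have Z: "lin E ?Z" by (rule lin_convolve[OF E linpi linY])
  note cZ = linD(1)[OF Z]
  note ag = module_abelian_group[OF G]
  have Z1: "?Z \<one>\<^bsub>H\<^esub> = \<one>"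
  proof -
    have "?Z \<one>\<^bsub>H\<^esub> = \<pi> \<one>\<^bsub>H\<^esub> \<otimes> Y \<one>\<^bsub>H\<^esub>"
      unfolding convolve_def by (rule D_one[OF ag]) (assumption | rule lins)+
    then show ?thesis by (simp add: partial_repD(2)[OF \<pi>] partial_repD(2)[OF Y])
  qed
  have ZS: "?Z (S h) = D E h (\<lambda>a b. \<pi> (S a) \<otimes> Y (S b))" if "h \<in> carrier H" for h
    unfolding convolve_def by (rule D_antipode[OF G _ _ that]) (assumption | rule lins)+
  have ZM: "?Z (h \<cdot> k) = D E h (\<lambda>a b. D E k (\<lambda>p q. \<pi> (a \<cdot> p) \<otimes> Y (b \<cdot> q)))"
    if "h \<in> carrier H" "k \<in> carrier H" for h k
    unfolding convolve_def by (rule D_mult[OF ag _ _ that]) (assumption | rule lins)+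
  have expand2: "D E x (\<lambda>p q. P p \<otimes> Q q) \<otimes> D E y (\<lambda>c d. P' c \<otimes> Q' d) =
      D E x (\<lambda>p q. D E y (\<lambda>c d. (P p \<otimes> P' c) \<otimes> (Q q \<otimes> Q' d)))"
    if c: "\<And>a. a \<in> carrier H \<Longrightarrow> P a \<in> carrier E" "\<And>a. a \<in> carrier H \<Longrightarrow> Q a \<in> carrier E"
      "\<And>a. a \<in> carrier H \<Longrightarrow> P' a \<in> carrier E" "\<And>a. a \<in> carrier H \<Longrightarrow> Q' a \<in> carrier E"
      and QP: "\<And>a b. \<lbrakk>a \<in> carrier H; b \<in> carrier H\<rbrakk> \<Longrightarrow> Q a \<otimes> P' b = P' b \<otimes> Q a" for P Q P' Q' x y
  proof -
    note [lins] = c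
    have "D E x (\<lambda>p q. P p \<otimes> Q q) \<otimes> D E y (\<lambda>c d. P' c \<otimes> Q' d) =
        D E x (\<lambda>p q. (P p \<otimes> Q q) \<otimes> D E y (\<lambda>c d. P' c \<otimes> Q' d))"
      by (rule D_mult_right[OF E, symmetric]) (assumption | rule lins)+
    also have "\<dots> = D E x (\<lambda>p q. D E y (\<lambda>c d. (P p \<otimes> Q q) \<otimes> (P' c \<otimes> Q' d)))"
      by (rule D_cong[OF refl], rule D_mult_left[OF E, symmetric]) (assumption | rule lins)+
    also have "\<dots> = D E x (\<lambda>p q. D E y (\<lambda>c d. (P p \<otimes> P' c) \<otimes> (Q q \<otimes> Q' d)))"
    proof (intro D_cong[OF refl])
      fix p q c' d assume h: "p \<in> carrier H" "q \<in> carrier H" "c' \<in> carrier H" "d \<in> carrier H"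
      have "(P p \<otimes> Q q) \<otimes> (P' c' \<otimes> Q' d) = P p \<otimes> ((Q q \<otimes> P' c') \<otimes> Q' d)"
        using h c by (simp add: E.m_assoc)
      also have "\<dots> = (P p \<otimes> P' c') \<otimes> (Q q \<otimes> Q' d)"
        using h c by (simp add: QP E.m_assoc)
      finally show "(P p \<otimes> Q q) \<otimes> (P' c' \<otimes> Q' d) = (P p \<otimes> P' c') \<otimes> (Q q \<otimes> Q' d)" .
    qed
    finally show ?thesis .
  qed
  have rel1: "D E k (\<lambda>x y. ?Z h \<otimes> (?Z x \<otimes> ?Z (S y))) = D E k (\<lambda>x y. ?Z (h \<cdot> x) \<otimes> ?Z (S y))"
    if h: "h \<in> carrier H" and k: "k \<in> carrier H" for h k
  proof -
    \<comment> \<open>the two factors that arise after sorting, one for each representation\<close>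
    define L where "L a x = D E x (\<lambda>p c. \<pi> a \<otimes> (\<pi> p \<otimes> \<pi> (S c)))" for a x
    define M where "M a x = D E x (\<lambda>p c. Y a \<otimes> (Y p \<otimes> Y (S c)))" for a x
    have L': "L a x = D E x (\<lambda>p c. \<pi> (a \<cdot> p) \<otimes> \<pi> (S c))" if "a \<in> carrier H" "x \<in> carrier H" for a x
      unfolding L_def by (rule partial_repD(3)[OF \<pi> that])
    have M': "M a x = D E x (\<lambda>p c. Y (a \<cdot> p) \<otimes> Y (S c))" if "a \<in> carrier H" "x \<in> carrier H" for a x
      unfolding M_def by (rule partial_repD(3)[OF Y that])
    have "D E k (\<lambda>x y. ?Z h \<otimes> (?Z x \<otimes> ?Z (S y))) =
        D E k (\<lambda>x y. D E h (\<lambda>a b. D E x (\<lambda>p q. D E y (\<lambda>c d.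
          (\<pi> a \<otimes> (\<pi> p \<otimes> \<pi> (S c))) \<otimes> (Y b \<otimes> (Y q \<otimes> Y (S d)))))))"
    proof (rule D_cong[OF refl])
      fix x y assume xy: "x \<in> carrier H" "y \<in> carrier H"
      have "?Z x \<otimes> ?Z (S y) = D E x (\<lambda>p q. D E y (\<lambda>c d. (\<pi> p \<otimes> \<pi> (S c)) \<otimes> (Y q \<otimes> Y (S d))))"
        unfolding ZS[OF xy(2)] unfolding convolve_def
        by (rule expand2) (assumption | rule lins comm)+
      then have "?Z h \<otimes> (?Z x \<otimes> ?Z (S y)) = D E h (\<lambda>a b. (\<pi> a \<otimes> Y b) \<otimes>
          D E x (\<lambda>p q. D E y (\<lambda>c d. (\<pi> p \<otimes> \<pi> (S c)) \<otimes> (Y q \<otimes> Y (S d)))))"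
        unfolding convolve_def[of _ _ _ h]
        by (simp only:, intro D_mult_right[OF E, symmetric]) (assumption | rule lins)+
      also have "\<dots> = D E h (\<lambda>a b. D E x (\<lambda>p q. (\<pi> a \<otimes> Y b) \<otimes> D E y (\<lambda>c d. (\<pi> p \<otimes> \<pi> (S c)) \<otimes> (Y q \<otimes> Y (S d)))))"
        by (rule D_cong[OF refl], rule D_mult_left[OF E, symmetric]) (assumption | rule lins)+
      also have "\<dots> = D E h (\<lambda>a b. D E x (\<lambda>p q. D E y (\<lambda>c d. (\<pi> a \<otimes> Y b) \<otimes> ((\<pi> p \<otimes> \<pi> (S c)) \<otimes> (Y q \<otimes> Y (S d))))))"
        by (rule D_cong[OF refl], rule D_cong[OF refl], rule D_mult_left[OF E, symmetric]) (assumption | rule lins)+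
      also have "\<dots> = D E h (\<lambda>a b. D E x (\<lambda>p q. D E y (\<lambda>c d.
          (\<pi> a \<otimes> (\<pi> p \<otimes> \<pi> (S c))) \<otimes> (Y b \<otimes> (Y q \<otimes> Y (S d))))))"
      proof (intro D_cong[OF refl])
        fix a b p q c d
        assume m: "a \<in> carrier H" "b \<in> carrier H" "p \<in> carrier H" "q \<in> carrier H" "c \<in> carrier H" "d \<in> carrier H"
        have "Y b \<otimes> (\<pi> p \<otimes> \<pi> (S c)) = (\<pi> p \<otimes> \<pi> (S c)) \<otimes> Y b"
          using m comm[of b p] comm[of b "S c"] E.m_assoc[of "Y b" "\<pi> p" "\<pi> (S c)", symmetric]
            E.m_assoc[of "\<pi> p" "Y b" "\<pi> (S c)"] E.m_assoc[of "\<pi> p" "\<pi> (S c)" "Y b"]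
          by (simp add: antipode_closed cpi cY)
        then show "(\<pi> a \<otimes> Y b) \<otimes> ((\<pi> p \<otimes> \<pi> (S c)) \<otimes> (Y q \<otimes> Y (S d))) =
            (\<pi> a \<otimes> (\<pi> p \<otimes> \<pi> (S c))) \<otimes> (Y b \<otimes> (Y q \<otimes> Y (S d)))"
          using m E.m_assoc[of "Y b" "\<pi> p \<otimes> \<pi> (S c)" "Y q \<otimes> Y (S d)", symmetric]
            E.m_assoc[of "\<pi> p \<otimes> \<pi> (S c)" "Y b" "Y q \<otimes> Y (S d)"]
            E.m_assoc[of "\<pi> a" "Y b" "(\<pi> p \<otimes> \<pi> (S c)) \<otimes> (Y q \<otimes> Y (S d))"]
            E.m_assoc[of "\<pi> a" "\<pi> p \<otimes> \<pi> (S c)" "Y b \<otimes> (Y q \<otimes> Y (S d))"]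
          by (simp add: antipode_closed cpi cY)
      qed
      finally show "?Z h \<otimes> (?Z x \<otimes> ?Z (S y)) = D E h (\<lambda>a b. D E x (\<lambda>p q. D E y (\<lambda>c d.
          (\<pi> a \<otimes> (\<pi> p \<otimes> \<pi> (S c))) \<otimes> (Y b \<otimes> (Y q \<otimes> Y (S d))))))" .
    qed
    also have "\<dots> = D E h (\<lambda>a b. D E k (\<lambda>x y. D E x (\<lambda>p q. D E y (\<lambda>c d.
          (\<pi> a \<otimes> (\<pi> p \<otimes> \<pi> (S c))) \<otimes> (Y b \<otimes> (Y q \<otimes> Y (S d)))))))"
      by (rule D_swap[OF ag]) (assumption | rule lins)+
    also have "\<dots> = D E h (\<lambda>a b. D E k (\<lambda>x y. L a x \<otimes> M b y))"
      unfolding L_def M_def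
      by (rule D_cong[OF refl], rule D_product[OF E]) (assumption | rule lins)+
    also have "\<dots> = D E h (\<lambda>a b. D E k (\<lambda>x y. D E x (\<lambda>p c. \<pi> (a \<cdot> p) \<otimes> \<pi> (S c)) \<otimes> D E y (\<lambda>p c. Y (b \<cdot> p) \<otimes> Y (S c))))"
      by (intro D_cong[OF refl]) (simp add: L' M')
    also have "\<dots> = D E h (\<lambda>a b. D E k (\<lambda>x y. D E x (\<lambda>p q. D E y (\<lambda>c d.
          (\<pi> (a \<cdot> p) \<otimes> \<pi> (S c)) \<otimes> (Y (b \<cdot> q) \<otimes> Y (S d))))))"
      by (rule D_cong[OF refl], rule D_product[OF E, symmetric]) (assumption | rule lins)+
    also have "\<dots> = D E k (\<lambda>x y. D E h (\<lambda>a b. D E x (\<lambda>p q. D E y (\<lambda>c d.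
          (\<pi> (a \<cdot> p) \<otimes> \<pi> (S c)) \<otimes> (Y (b \<cdot> q) \<otimes> Y (S d))))))"
      by (rule D_swap[OF ag]) (assumption | rule lins)+
    also have "\<dots> = D E k (\<lambda>x y. ?Z (h \<cdot> x) \<otimes> ?Z (S y))"
    proof (rule D_cong[OF refl])
      fix x y assume xy: "x \<in> carrier H" "y \<in> carrier H"
      have "?Z (h \<cdot> x) \<otimes> ?Z (S y) =
          D E h (\<lambda>a b. D E x (\<lambda>p q. \<pi> (a \<cdot> p) \<otimes> Y (b \<cdot> q)) \<otimes> D E y (\<lambda>c d. \<pi> (S c) \<otimes> Y (S d)))"
        unfolding ZM[OF h xy(1)] ZS[OF xy(2)]
        by (rule D_mult_right[OF E, symmetric]) (assumption | rule lins)+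
      also have "\<dots> = D E h (\<lambda>a b. D E x (\<lambda>p q. D E y (\<lambda>c d.
          (\<pi> (a \<cdot> p) \<otimes> \<pi> (S c)) \<otimes> (Y (b \<cdot> q) \<otimes> Y (S d)))))"
        by (rule D_cong[OF refl], rule expand2) (assumption | rule lins comm H.m_closed)+
      finally show "D E h (\<lambda>a b. D E x (\<lambda>p q. D E y (\<lambda>c d.
          (\<pi> (a \<cdot> p) \<otimes> \<pi> (S c)) \<otimes> (Y (b \<cdot> q) \<otimes> Y (S d))))) = ?Z (h \<cdot> x) \<otimes> ?Z (S y)" by simp
    qed
    finally show ?thesis .
  qed
  have rel2: "D E h (\<lambda>x y. ?Z x \<otimes> (?Z (S y) \<otimes> ?Z k)) = D E h (\<lambda>x y. ?Z x \<otimes> ?Z (S y \<cdot> k))"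
    if h: "h \<in> carrier H" and k: "k \<in> carrier H" for h k
  proof -
    have "D E h (\<lambda>x y. ?Z x \<otimes> (?Z (S y) \<otimes> ?Z k)) =
        D E h (\<lambda>x y. D E k (\<lambda>a b. D E x (\<lambda>p q. D E y (\<lambda>c d.
          (\<pi> p \<otimes> (\<pi> (S c) \<otimes> \<pi> a)) \<otimes> (Y q \<otimes> (Y (S d) \<otimes> Y b))))))"
    proof (rule D_cong[OF refl])
      fix x y assume xy: "x \<in> carrier H" "y \<in> carrier H"
      have "?Z x \<otimes> ?Z (S y) = D E x (\<lambda>p q. D E y (\<lambda>c d. (\<pi> p \<otimes> \<pi> (S c)) \<otimes> (Y q \<otimes> Y (S d))))"
        unfolding ZS[OF xy(2)] unfolding convolve_def
        by (rule expand2) (assumption | rule lins comm)+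
      then have "(?Z x \<otimes> ?Z (S y)) \<otimes> ?Z k = D E k (\<lambda>a b.
          D E x (\<lambda>p q. D E y (\<lambda>c d. (\<pi> p \<otimes> \<pi> (S c)) \<otimes> (Y q \<otimes> Y (S d)))) \<otimes> (\<pi> a \<otimes> Y b))"
        unfolding convolve_def[of _ _ _ k]
        by (simp only:, intro D_mult_left[OF E, symmetric]) (assumption | rule lins)+
      also have "\<dots> = D E k (\<lambda>a b. D E x (\<lambda>p q. D E y (\<lambda>c d. (\<pi> p \<otimes> \<pi> (S c)) \<otimes> (Y q \<otimes> Y (S d))) \<otimes> (\<pi> a \<otimes> Y b)))"
        by (rule D_cong[OF refl], rule D_mult_right[OF E, symmetric]) (assumption | rule lins)+
      also have "\<dots> = D E k (\<lambda>a b. D E x (\<lambda>p q. D E y (\<lambda>c d. ((\<pi> p \<otimes> \<pi> (S c)) \<otimes> (Y q \<otimes> Y (S d))) \<otimes> (\<pi> a \<otimes> Y b))))"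
        by (rule D_cong[OF refl], rule D_cong[OF refl], rule D_mult_right[OF E, symmetric]) (assumption | rule lins)+
      also have "\<dots> = D E k (\<lambda>a b. D E x (\<lambda>p q. D E y (\<lambda>c d.
          (\<pi> p \<otimes> (\<pi> (S c) \<otimes> \<pi> a)) \<otimes> (Y q \<otimes> (Y (S d) \<otimes> Y b)))))"
      proof (intro D_cong[OF refl])
        fix a b p q c d
        assume m: "a \<in> carrier H" "b \<in> carrier H" "p \<in> carrier H" "q \<in> carrier H" "c \<in> carrier H" "d \<in> carrier H"
        have "(Y q \<otimes> Y (S d)) \<otimes> \<pi> a = \<pi> a \<otimes> (Y q \<otimes> Y (S d))"
          using m comm[of q a] comm[of "S d" a] E.m_assoc[of "Y q" "Y (S d)" "\<pi> a"]
            E.m_assoc[of "Y q" "\<pi> a" "Y (S d)", symmetric] E.m_assoc[of "\<pi> a" "Y q" "Y (S d)"]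
          by (simp add: antipode_closed cpi cY)
        then show "((\<pi> p \<otimes> \<pi> (S c)) \<otimes> (Y q \<otimes> Y (S d))) \<otimes> (\<pi> a \<otimes> Y b) =
            (\<pi> p \<otimes> (\<pi> (S c) \<otimes> \<pi> a)) \<otimes> (Y q \<otimes> (Y (S d) \<otimes> Y b))"
          using m E.m_assoc[of "\<pi> p \<otimes> \<pi> (S c)" "Y q \<otimes> Y (S d)" "\<pi> a \<otimes> Y b"]
            E.m_assoc[of "Y q \<otimes> Y (S d)" "\<pi> a" "Y b", symmetric]
            E.m_assoc[of "\<pi> a" "Y q \<otimes> Y (S d)" "Y b"]
            E.m_assoc[of "\<pi> p \<otimes> \<pi> (S c)" "\<pi> a" "(Y q \<otimes> Y (S d)) \<otimes> Y b", symmetric]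
            E.m_assoc[of "\<pi> p" "\<pi> (S c)" "\<pi> a"] E.m_assoc[of "Y q" "Y (S d)" "Y b"]
          by (simp add: antipode_closed cpi cY)
      qed
      finally show "?Z x \<otimes> (?Z (S y) \<otimes> ?Z k) = D E k (\<lambda>a b. D E x (\<lambda>p q. D E y (\<lambda>c d.
          (\<pi> p \<otimes> (\<pi> (S c) \<otimes> \<pi> a)) \<otimes> (Y q \<otimes> (Y (S d) \<otimes> Y b)))))"
        using E.m_assoc[of "?Z x" "?Z (S y)" "?Z k"] cZ xy k by (simp add: antipode_closed)
    qed
    also have "\<dots> = D E k (\<lambda>a b. D E h (\<lambda>x y. D E x (\<lambda>p q. D E y (\<lambda>c d.
          (\<pi> p \<otimes> (\<pi> (S c) \<otimes> \<pi> a)) \<otimes> (Y q \<otimes> (Y (S d) \<otimes> Y b))))))"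
      by (rule D_swap[OF ag]) (assumption | rule lins)+
    also have "\<dots> = D E k (\<lambda>a b. D E h (\<lambda>x y. D E x (\<lambda>p c. \<pi> p \<otimes> (\<pi> (S c) \<otimes> \<pi> a)) \<otimes> D E y (\<lambda>q d. Y q \<otimes> (Y (S d) \<otimes> Y b))))"
      by (rule D_cong[OF refl], rule D_product[OF E]) (assumption | rule lins)+
    also have "\<dots> = D E k (\<lambda>a b. D E h (\<lambda>x y. D E x (\<lambda>p c. \<pi> p \<otimes> \<pi> (S c \<cdot> a)) \<otimes> D E y (\<lambda>q d. Y q \<otimes> Y (S d \<cdot> b))))"
      by (intro D_cong[OF refl]) (simp only: partial_repD(4)[OF \<pi>] partial_repD(4)[OF Y])
    also have "\<dots> = D E k (\<lambda>a b. D E h (\<lambda>x y. D E x (\<lambda>p q. D E y (\<lambda>c d.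
          (\<pi> p \<otimes> \<pi> (S c \<cdot> a)) \<otimes> (Y q \<otimes> Y (S d \<cdot> b))))))"
      by (rule D_cong[OF refl], rule D_product[OF E, symmetric]) (assumption | rule lins)+
    also have "\<dots> = D E h (\<lambda>x y. D E k (\<lambda>a b. D E x (\<lambda>p q. D E y (\<lambda>c d.
          (\<pi> p \<otimes> \<pi> (S c \<cdot> a)) \<otimes> (Y q \<otimes> Y (S d \<cdot> b))))))"
      by (rule D_swap[OF ag]) (assumption | rule lins)+
    also have "\<dots> = D E h (\<lambda>x y. ?Z x \<otimes> ?Z (S y \<cdot> k))"
    proof (rule D_cong[OF refl])
      fix x y assume xy: "x \<in> carrier H" "y \<in> carrier H"
      have "?Z (S y \<cdot> k) = D E y (\<lambda>c d. D E k (\<lambda>a b. \<pi> (S c \<cdot> a) \<otimes> Y (S d \<cdot> b)))"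
        unfolding ZM[OF antipode_closed[OF xy(2)] k]
        by (rule D_antipode[OF G _ _ xy(2)]) (assumption | rule lins)+
      also have "\<dots> = D E k (\<lambda>a b. D E y (\<lambda>c d. \<pi> (S c \<cdot> a) \<otimes> Y (S d \<cdot> b)))"
        by (rule D_swap[OF ag]) (assumption | rule lins)+
      finally have "?Z x \<otimes> ?Z (S y \<cdot> k) =
          D E x (\<lambda>p q. \<pi> p \<otimes> Y q) \<otimes> D E k (\<lambda>a b. D E y (\<lambda>c d. \<pi> (S c \<cdot> a) \<otimes> Y (S d \<cdot> b)))"
        by (simp only: convolve_def[of _ _ _ x])
      also have "\<dots> = D E k (\<lambda>a b. D E x (\<lambda>p q. \<pi> p \<otimes> Y q) \<otimes> D E y (\<lambda>c d. \<pi> (S c \<cdot> a) \<otimes> Y (S d \<cdot> b)))"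
        by (rule D_mult_left[OF E, symmetric]) (assumption | rule lins)+
      also have "\<dots> = D E k (\<lambda>a b. D E x (\<lambda>p q. D E y (\<lambda>c d.
          (\<pi> p \<otimes> \<pi> (S c \<cdot> a)) \<otimes> (Y q \<otimes> Y (S d \<cdot> b)))))"
        by (rule D_cong[OF refl], rule expand2) (assumption | rule lins comm)+
      finally show "D E k (\<lambda>a b. D E x (\<lambda>p q. D E y (\<lambda>c d.
          (\<pi> p \<otimes> \<pi> (S c \<cdot> a)) \<otimes> (Y q \<otimes> Y (S d \<cdot> b))))) = ?Z x \<otimes> ?Z (S y \<cdot> k)" by simp
    qed
    finally show ?thesis .
  qed
  show ?thesis
    unfolding partial_rep_def using Z Z1 rel1 rel2 by blast
qed

end

section \<open>The free algebra and presentations\<close>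

text \<open>
  The product of the free algebra at a single word.
\<close>

definition cauchy :: "('k, 's) ring_scheme \<Rightarrow> ('h list \<Rightarrow> 'k) \<Rightarrow> ('h list \<Rightarrow> 'k) \<Rightarrow> 'h list \<Rightarrow> 'k"
  where "cauchy K f g w = (\<Oplus>\<^bsub>K\<^esub>i\<in>{..length w}. f (take i w) \<otimes>\<^bsub>K\<^esub> g (drop i w))"

context cring
begin

lemma cauchy_Nil: "\<lbrakk>f [] \<in> carrier R; g [] \<in> carrier R\<rbrakk> \<Longrightarrow> cauchy R f g [] = f [] \<otimes> g []"
  by (simp add: cauchy_def)

text \<open>
  This recursion along the word reduces associativity to an induction, without reindexing of double
  sums.
\<close>

lemma cauchy_Cons:
  assumes "range f \<subseteq> carrier R" "range g \<subseteq> carrier R"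
  shows "cauchy R f g (x # w) = f [] \<otimes> g (x # w) \<oplus> cauchy R (\<lambda>v. f (x # v)) g w"
proof -
  have "f u \<in> carrier R" "g u \<in> carrier R" for u using assms by auto
  then have "cauchy R f g (x # w) =
      (\<Oplus>i\<in>{..length w}. f (take (Suc i) (x # w)) \<otimes> g (drop (Suc i) (x # w))) \<oplus> f (take 0 (x # w)) \<otimes> g (drop 0 (x # w))"
    unfolding cauchy_def length_Cons by (intro finsum_Suc2) auto
  then show ?thesis
    using \<open>\<And>u. f u \<in> carrier R\<close> \<open>\<And>u. g u \<in> carrier R\<close> by (simp add: cauchy_def a_comm)
qed

lemma cauchy_closed:
  assumes "range f \<subseteq> carrier R" "range g \<subseteq> carrier R"
  shows "cauchy R f g w \<in> carrier R"
proof -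
  have "f u \<in> carrier R" "g u \<in> carrier R" for u using assms by auto
  then show ?thesis unfolding cauchy_def by (intro finsum_closed) auto
qed

lemma cauchy_zero_left:
  assumes "range g \<subseteq> carrier R"
  shows "cauchy R (\<lambda>v. \<zero>) g w = \<zero>"
proof -
  have "g u \<in> carrier R" for u using assms by auto
  then show ?thesis by (simp add: cauchy_def)
qed

lemma cauchy_add_left:
  assumes "range f \<subseteq> carrier R" "range f' \<subseteq> carrier R" "range g \<subseteq> carrier R"
  shows "cauchy R (\<lambda>v. f v \<oplus> f' v) g w = cauchy R f g w \<oplus> cauchy R f' g w"
proof -
  have "f u \<in> carrier R" "f' u \<in> carrier R" "g u \<in> carrier R" for u using assms by auto
  then show ?thesis by (simp add: cauchy_def l_distr finsum_addf Pi_def)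
qed

lemma cauchy_add_right:
  assumes "range f \<subseteq> carrier R" "range g' \<subseteq> carrier R" "range g \<subseteq> carrier R"
  shows "cauchy R f (\<lambda>v. g v \<oplus> g' v) w = cauchy R f g w \<oplus> cauchy R f g' w"
proof -
  have "f u \<in> carrier R" "g' u \<in> carrier R" "g u \<in> carrier R" for u using assms by auto
  then show ?thesis by (simp add: cauchy_def r_distr finsum_addf Pi_def)
qed

lemma cauchy_smult_left:
  assumes "range f \<subseteq> carrier R" "range g \<subseteq> carrier R" "r \<in> carrier R"
  shows "cauchy R (\<lambda>v. r \<otimes> f v) g w = r \<otimes> cauchy R f g w"
proof -
  have "f u \<in> carrier R" "g u \<in> carrier R" for u using assms by auto
  then show ?thesis using assms(3) by (simp add: cauchy_def m_assoc finsum_rdistr Pi_def)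
qed

text \<open>
  Splitting off the first letter, \<open>h\<close> and \<open>g\<close> are evaluated at the tail of the word, while \<open>f\<close> is
  replaced by its left translate, hence the induction is over arbitrary functions.
\<close>

lemma cauchy_assoc:
  assumes "range f \<subseteq> carrier R" "range g \<subseteq> carrier R" "range h \<subseteq> carrier R"
  shows "cauchy R (cauchy R f g) h w = cauchy R f (cauchy R g h) w"
  using assms
proof (induction w arbitrary: f g)
  case Nil
  then have "f [] \<in> carrier R" "g [] \<in> carrier R" "h [] \<in> carrier R" by auto
  then show ?case by (simp add: cauchy_Nil m_assoc)
next
  case (Cons x w)
  note fgh = Cons.prems
  have c: "f u \<in> carrier R" "g u \<in> carrier R" "h u \<in> carrier R" for u using fgh by auto
  have fx: "range (\<lambda>v. f (x # v)) \<subseteq> carrier R" and gx: "range (\<lambda>v. g (x # v)) \<subseteq> carrier R" using fgh by auto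
  have cl: "range (cauchy R p q) \<subseteq> carrier R" if "range p \<subseteq> carrier R" "range q \<subseteq> carrier R" for p q
    using cauchy_closed[OF that] by auto
  have "cauchy R (cauchy R f g) h (x # w) =
      cauchy R f g [] \<otimes> h (x # w) \<oplus> cauchy R (\<lambda>v. cauchy R f g (x # v)) h w"
    by (rule cauchy_Cons[OF cl[OF fgh(1,2)] fgh(3)])
  also have "cauchy R (\<lambda>v. cauchy R f g (x # v)) h w =
      cauchy R (\<lambda>v. f [] \<otimes> g (x # v) \<oplus> cauchy R (\<lambda>v. f (x # v)) g v) h w"
    by (simp add: cauchy_Cons[OF fgh(1,2)])
  also have "\<dots> = f [] \<otimes> cauchy R (\<lambda>v. g (x # v)) h w \<oplus> cauchy R (cauchy R (\<lambda>v. f (x # v)) g) h w"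
    using c cl[OF fx fgh(2)] gx fgh(3) by (subst cauchy_add_left) (auto simp: cauchy_smult_left)
  also have "cauchy R (cauchy R (\<lambda>v. f (x # v)) g) h w = cauchy R (\<lambda>v. f (x # v)) (cauchy R g h) w"
    by (rule Cons.IH[OF fx fgh(2,3)])
  finally have "cauchy R (cauchy R f g) h (x # w) =
      (f [] \<otimes> g []) \<otimes> h (x # w) \<oplus> (f [] \<otimes> cauchy R (\<lambda>v. g (x # v)) h w \<oplus> cauchy R (\<lambda>v. f (x # v)) (cauchy R g h) w)"
    using c by (simp add: cauchy_Nil)
  also have "\<dots> = f [] \<otimes> (g [] \<otimes> h (x # w) \<oplus> cauchy R (\<lambda>v. g (x # v)) h w) \<oplus> cauchy R (\<lambda>v. f (x # v)) (cauchy R g h) w"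
    using c cauchy_closed[OF gx fgh(3)] cauchy_closed[OF fx cl[OF fgh(2,3)]]
    by (simp add: m_assoc r_distr a_assoc)
  also have "\<dots> = cauchy R f (cauchy R g h) (x # w)"
    unfolding cauchy_Cons[OF fgh(1) cl[OF fgh(2,3)]] cauchy_Cons[OF fgh(2,3)] ..
  finally show ?case .
qed

lemma cauchy_one_right:
  assumes "range f \<subseteq> carrier R"
  shows "cauchy R f (\<lambda>v. if v = [] then \<one> else \<zero>) w = f w"
  using assms
proof (induction w arbitrary: f)
  case Nil
  then have "f [] \<in> carrier R" by auto
  then show ?case by (simp add: cauchy_Nil)
next
  case (Cons x w)
  have c: "f u \<in> carrier R" for u using Cons.prems by auto
  have "range (\<lambda>v. f (x # v)) \<subseteq> carrier R" using Cons.prems by auto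
  from Cons.IH[OF this] show ?case using c Cons.prems by (subst cauchy_Cons) auto
qed

lemma cauchy_monom_left:
  assumes "r \<in> carrier R" "range g \<subseteq> carrier R"
  shows "cauchy R (free_monom R r u) g w = (if take (length u) w = u then r \<otimes> g (drop (length u) w) else \<zero>)"
proof (induction u arbitrary: w)
  case Nil
  have g: "g u \<in> carrier R" for u using assms by auto
  have m: "range (free_monom R r []) \<subseteq> carrier R" using assms(1) by (auto simp: free_monom_def)
  show ?case
  proof (cases w)
    case Nil
    then show ?thesis using assms g by (simp add: cauchy_Nil free_monom_def)
  next
    case (Cons y w')
    have z: "(\<lambda>v. free_monom R r [] (y # v)) = (\<lambda>v. \<zero>)" by (simp add: free_monom_def)
    show ?thesis
      unfolding Cons cauchy_Cons[OF m assms(2)] z cauchy_zero_left[OF assms(2)]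
      using assms g by (simp add: free_monom_def)
  qed
next
  case (Cons x u)
  have g: "g u \<in> carrier R" for u using assms by auto
  have m: "range (free_monom R r (x # u)) \<subseteq> carrier R" using assms(1) by (auto simp: free_monom_def)
  show ?case
  proof (cases w)
    case Nil
    then show ?thesis using assms g by (simp add: cauchy_Nil free_monom_def)
  next
    case w: (Cons y w')
    have z: "(\<lambda>v. free_monom R r (x # u) (y # v)) = (if y = x then free_monom R r u else (\<lambda>v. \<zero>))"
      by (auto simp: free_monom_def)
    show ?thesis
      unfolding w cauchy_Cons[OF m assms(2)] z
      using assms g Cons.IH cauchy_zero_left[OF assms(2)] by (auto simp: free_monom_def)
  qed
qed

lemma free_alg_simps:
  "f \<in> carrier (free_alg R H) \<longleftrightarrow> range f \<subseteq> carrier R \<and> (\<forall>w. f w \<noteq> \<zero> \<longrightarrow> set w \<subseteq> carrier H) \<and> finite {w. f w \<noteq> \<zero>}"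
  "f \<otimes>\<^bsub>free_alg R H\<^esub> g = cauchy R f g"
  "f \<oplus>\<^bsub>free_alg R H\<^esub> g = (\<lambda>w. f w \<oplus> g w)"
  "\<zero>\<^bsub>free_alg R H\<^esub> = (\<lambda>w. \<zero>)"
  "\<one>\<^bsub>free_alg R H\<^esub> = free_monom R \<one> []"
  by (auto simp: free_alg_def cauchy_def free_monom_def fun_eq_iff)

lemma free_monom_closed: "\<lbrakk>r \<in> carrier R; set w \<subseteq> carrier H\<rbrakk> \<Longrightarrow> free_monom R r w \<in> carrier (free_alg R H)"
proof -
  assume "r \<in> carrier R" "set w \<subseteq> carrier H"
  moreover have "{v. free_monom R r w v \<noteq> \<zero>} \<subseteq> {w}" by (auto simp: free_monom_def)
  then have "finite {v. free_monom R r w v \<noteq> \<zero>}" by (rule finite_subset) simp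
  ultimately show ?thesis
    unfolding free_alg_simps(1) by (auto simp: free_monom_def split: if_splits)
qed

lemma free_monom_mult:
  "\<lbrakk>r \<in> carrier R; s \<in> carrier R\<rbrakk> \<Longrightarrow> free_monom R r u \<otimes>\<^bsub>free_alg R H\<^esub> free_monom R s v = free_monom R (r \<otimes> s) (u @ v)"
proof (rule ext)
  fix w assume rs: "r \<in> carrier R" "s \<in> carrier R"
  have "take (length u) w = u \<and> drop (length u) w = v \<longleftrightarrow> w = u @ v"
    by (metis append_eq_conv_conj)
  then show "(free_monom R r u \<otimes>\<^bsub>free_alg R H\<^esub> free_monom R s v) w = free_monom R (r \<otimes> s) (u @ v) w"
    unfolding free_alg_simps using rs by (subst cauchy_monom_left) (auto simp: free_monom_def)
qed

lemma cauchy_free_alg_closed: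
  assumes f: "f \<in> carrier (free_alg R H)" and g: "g \<in> carrier (free_alg R H)"
  shows "cauchy R f g \<in> carrier (free_alg R H)"
proof -
  have r: "range f \<subseteq> carrier R" "range g \<subseteq> carrier R" using f g by (auto simp: free_alg_simps)
  have c: "f u \<in> carrier R" "g u \<in> carrier R" for u using r by auto
  have split: "\<exists>u v. w = u @ v \<and> f u \<noteq> \<zero> \<and> g v \<noteq> \<zero>" if "cauchy R f g w \<noteq> \<zero>" for w
  proof (rule ccontr)
    assume n: "\<not> ?thesis"
    have "f (take i w) \<otimes> g (drop i w) = \<zero>" for i
      using n c append_take_drop_id[of i w] by (metis l_null r_null)
    then show False using that by (simp add: cauchy_def)
  qed
  have "{w. cauchy R f g w \<noteq> \<zero>} \<subseteq> (\<lambda>(u, v). u @ v) ` ({u. f u \<noteq> \<zero>} \<times> {v. g v \<noteq> \<zero>})"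
    using split by fastforce
  then have "finite {w. cauchy R f g w \<noteq> \<zero>}"
    using f g by (elim finite_subset) (simp add: free_alg_simps)
  moreover have "set w \<subseteq> carrier H" if "cauchy R f g w \<noteq> \<zero>" for w
  proof -
    from split[OF that] obtain u v where "w = u @ v" "f u \<noteq> \<zero>" "g v \<noteq> \<zero>" by blast
    then show ?thesis using f g by (simp add: free_alg_simps)
  qed
  ultimately show ?thesis
    using cauchy_closed[OF r] by (auto simp: free_alg_simps(1))
qed

lemma free_alg_ring: "ring (free_alg R H)"
proof (rule ringI)
  let ?F = "free_alg R H"
  have add_closed: "(\<lambda>w. f w \<oplus> g w) \<in> carrier ?F" if "f \<in> carrier ?F" "g \<in> carrier ?F" for f g
  proof -
    have "{w. f w \<oplus> g w \<noteq> \<zero>} \<subseteq> {w. f w \<noteq> \<zero>} \<union> {w. g w \<noteq> \<zero>}" by auto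
    moreover have "finite ({w. f w \<noteq> \<zero>} \<union> {w. g w \<noteq> \<zero>})" using that by (simp add: free_alg_simps)
    ultimately have "finite {w. f w \<oplus> g w \<noteq> \<zero>}" by (rule finite_subset)
    moreover have "set w \<subseteq> carrier H" if "f w \<oplus> g w \<noteq> \<zero>" for w
    proof -
      have "g w \<in> carrier R" using \<open>g \<in> carrier ?F\<close> by (auto simp: free_alg_simps)
      then have "f w \<noteq> \<zero> \<or> g w \<noteq> \<zero>" using that by auto
      then show ?thesis using \<open>f \<in> carrier ?F\<close> \<open>g \<in> carrier ?F\<close> by (auto simp: free_alg_simps(1))
    qed
    moreover have "f w \<in> carrier R" "g w \<in> carrier R" for w using that by (auto simp: free_alg_simps(1))
    ultimately show ?thesis unfolding free_alg_simps(1) by auto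
  qed
  show "abelian_group ?F"
  proof (rule abelian_groupI)
    fix f assume f: "f \<in> carrier ?F"
    have c: "f w \<in> carrier R" for w using f by (auto simp: free_alg_simps)
    have "{w. \<ominus> f w \<noteq> \<zero>} \<subseteq> {w. f w \<noteq> \<zero>}" by auto
    then have "finite {w. \<ominus> f w \<noteq> \<zero>}" using f by (elim finite_subset) (simp add: free_alg_simps)
    moreover have "f w \<noteq> \<zero>" if "\<ominus> f w \<noteq> \<zero>" for w using that by auto
    ultimately have "(\<lambda>w. \<ominus> f w) \<in> carrier ?F" using f by (auto simp: free_alg_simps)
    then show "\<exists>g\<in>carrier ?F. g \<oplus>\<^bsub>?F\<^esub> f = \<zero>\<^bsub>?F\<^esub>"
      using c by (intro bexI[of _ "\<lambda>w. \<ominus> f w"]) (auto simp: free_alg_simps l_neg)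
    show "\<zero>\<^bsub>?F\<^esub> \<oplus>\<^bsub>?F\<^esub> f = f" using c by (simp add: free_alg_simps)
  next
    fix f g assume "f \<in> carrier ?F" "g \<in> carrier ?F"
    then show "f \<oplus>\<^bsub>?F\<^esub> g \<in> carrier ?F" using add_closed by (simp add: free_alg_simps(3))
    have "f w \<in> carrier R" "g w \<in> carrier R" for w using \<open>f \<in> carrier ?F\<close> \<open>g \<in> carrier ?F\<close> by (auto simp: free_alg_simps)
    then show "f \<oplus>\<^bsub>?F\<^esub> g = g \<oplus>\<^bsub>?F\<^esub> f" by (simp add: free_alg_simps a_comm)
  next
    fix f g h assume "f \<in> carrier ?F" "g \<in> carrier ?F" "h \<in> carrier ?F"
    then have "f w \<in> carrier R" "g w \<in> carrier R" "h w \<in> carrier R" for w by (auto simp: free_alg_simps)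
    then show "f \<oplus>\<^bsub>?F\<^esub> g \<oplus>\<^bsub>?F\<^esub> h = f \<oplus>\<^bsub>?F\<^esub> (g \<oplus>\<^bsub>?F\<^esub> h)" by (simp add: free_alg_simps a_assoc)
  qed (auto simp: free_alg_simps)
  show "Group.monoid ?F"
  proof (rule monoidI)
    show "\<one>\<^bsub>?F\<^esub> \<in> carrier ?F" unfolding free_alg_simps(5) by (rule free_monom_closed) auto
  next
    fix f assume "f \<in> carrier ?F"
    then have r: "range f \<subseteq> carrier R" by (simp add: free_alg_simps)
    then have c: "f u \<in> carrier R" for u by auto
    show "\<one>\<^bsub>?F\<^esub> \<otimes>\<^bsub>?F\<^esub> f = f"
      using c r by (auto simp: free_alg_simps cauchy_monom_left)
    show "f \<otimes>\<^bsub>?F\<^esub> \<one>\<^bsub>?F\<^esub> = f"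
      using cauchy_one_right[OF r] by (simp add: free_alg_simps free_monom_def fun_eq_iff)
  next
    fix f g assume "f \<in> carrier ?F" "g \<in> carrier ?F"
    then show "f \<otimes>\<^bsub>?F\<^esub> g \<in> carrier ?F" using cauchy_free_alg_closed by (simp add: free_alg_simps(2))
  next
    fix f g h assume "f \<in> carrier ?F" "g \<in> carrier ?F" "h \<in> carrier ?F"
    then show "f \<otimes>\<^bsub>?F\<^esub> g \<otimes>\<^bsub>?F\<^esub> h = f \<otimes>\<^bsub>?F\<^esub> (g \<otimes>\<^bsub>?F\<^esub> h)"
      using cauchy_assoc[of f g h] by (simp add: free_alg_simps fun_eq_iff)
  qed
  fix f g h assume "f \<in> carrier ?F" "g \<in> carrier ?F" "h \<in> carrier ?F"
  then have "range f \<subseteq> carrier R" "range g \<subseteq> carrier R" "range h \<subseteq> carrier R" by (simp_all add: free_alg_simps)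
  then show "(f \<oplus>\<^bsub>?F\<^esub> g) \<otimes>\<^bsub>?F\<^esub> h = f \<otimes>\<^bsub>?F\<^esub> h \<oplus>\<^bsub>?F\<^esub> g \<otimes>\<^bsub>?F\<^esub> h" "h \<otimes>\<^bsub>?F\<^esub> (f \<oplus>\<^bsub>?F\<^esub> g) = h \<otimes>\<^bsub>?F\<^esub> f \<oplus>\<^bsub>?F\<^esub> h \<otimes>\<^bsub>?F\<^esub> g"
    by (simp_all add: free_alg_simps cauchy_add_left cauchy_add_right fun_eq_iff)
qed

lemma free_alg_induct [consumes 1, case_names zero monom add]:
  assumes "f \<in> carrier (free_alg R H)"
    and "P (\<lambda>w. \<zero>)"
    and "\<And>r w. \<lbrakk>r \<in> carrier R; set w \<subseteq> carrier H\<rbrakk> \<Longrightarrow> P (free_monom R r w)"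
    and "\<And>f g. \<lbrakk>f \<in> carrier (free_alg R H); g \<in> carrier (free_alg R H); P f; P g\<rbrakk> \<Longrightarrow> P (f \<oplus>\<^bsub>free_alg R H\<^esub> g)"
  shows "P f"
proof -
  have "P f" if "finite F" "f \<in> carrier (free_alg R H)" "{w. f w \<noteq> \<zero>} \<subseteq> F" for F f
    using that
  proof (induction F arbitrary: f rule: finite_induct)
    case empty
    then have "f = (\<lambda>w. \<zero>)" by auto
    then show ?case using assms(2) by simp
  next
    case (insert v F)
    have c: "f w \<in> carrier R" for w using insert.prems by (auto simp: free_alg_simps)
    show ?case
    proof (cases "f v = \<zero>")
      case True
      then show ?thesis using insert by auto
    next
      case False
      let ?g = "f(v := \<zero>)"
      have "{w. ?g w \<noteq> \<zero>} \<subseteq> {w. f w \<noteq> \<zero>}" by auto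
      then have "finite {w. ?g w \<noteq> \<zero>}"
        by (rule finite_subset) (use insert.prems in \<open>simp add: free_alg_simps\<close>)
      moreover have "range ?g \<subseteq> carrier R" "\<forall>w. ?g w \<noteq> \<zero> \<longrightarrow> set w \<subseteq> carrier H"
        using insert.prems c by (auto simp: free_alg_simps)
      ultimately have g: "?g \<in> carrier (free_alg R H)" unfolding free_alg_simps(1) by blast
      have "P ?g" using insert.prems by (intro insert.IH[OF g]) auto
      moreover have v: "set v \<subseteq> carrier H" using False insert.prems by (auto simp: free_alg_simps)
      ultimately have "P (free_monom R (f v) v \<oplus>\<^bsub>free_alg R H\<^esub> ?g)"
        using assms(3,4) free_monom_closed g c by blast
      moreover have "free_monom R (f v) v \<oplus>\<^bsub>free_alg R H\<^esub> ?g = f"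
        using c by (auto simp: free_alg_simps free_monom_def)
      ultimately show ?thesis by simp
    qed
  qed
  then show ?thesis using assms(1) by (auto simp: free_alg_simps)
qed

end

text \<open>
  The value on words of the algebra map that extends \<open>\<phi>\<close>.
\<close>

definition word_prod :: "('e, 's) monoid_scheme \<Rightarrow> ('h \<Rightarrow> 'e) \<Rightarrow> 'h list \<Rightarrow> 'e"
  where "word_prod E \<phi> w = foldr (\<lambda>h e. \<phi> h \<otimes>\<^bsub>E\<^esub> e) w \<one>\<^bsub>E\<^esub>"

lemma (in k_algebra) word_prod_closed: "\<phi> \<in> carrier H \<rightarrow> carrier E \<Longrightarrow> set w \<subseteq> carrier H \<Longrightarrow> word_prod E \<phi> w \<in> carrier E"
  by (induction w) (auto simp: word_prod_def)

lemma (in k_algebra) word_prod_append: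
  assumes "\<phi> \<in> carrier H \<rightarrow> carrier E" "set u \<subseteq> carrier H" "set v \<subseteq> carrier H"
  shows "word_prod E \<phi> (u @ v) = word_prod E \<phi> u \<otimes>\<^bsub>E\<^esub> word_prod E \<phi> v"
  using assms(2)
proof (induction u)
  case Nil
  then show ?case using word_prod_closed[OF assms(1,3)] by (simp add: word_prod_def)
next
  case (Cons x u)
  have "word_prod E \<phi> u \<in> carrier E" "word_prod E \<phi> v \<in> carrier E" "\<phi> x \<in> carrier E"
    using Cons.prems assms word_prod_closed[OF assms(1)] by auto
  then show ?case using Cons by (simp add: word_prod_def m_assoc)
qed

lemma (in k_algebra) free_alg_universal:
  assumes \<phi>: "\<phi> \<in> carrier H \<rightarrow> carrier E"
  obtains \<Phi> where "\<Phi> \<in> ring_hom (free_alg K H) E"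
    "\<And>r w. \<lbrakk>r \<in> carrier K; set w \<subseteq> carrier H\<rbrakk> \<Longrightarrow> \<Phi> (free_monom K r w) = r \<odot>\<^bsub>E\<^esub> word_prod E \<phi> w"
proof -
  interpret F: ring "free_alg K H" by (rule R.free_alg_ring)
  note fs = R.free_alg_simps
  define \<Phi> where "\<Phi> f = finsum E (\<lambda>w. f w \<odot>\<^bsub>E\<^esub> word_prod E \<phi> w) {w. f w \<noteq> \<zero>\<^bsub>K\<^esub>}" for f
  have c: "f w \<in> carrier K" if "f \<in> carrier (free_alg K H)" for f w using that by (auto simp: fs)
  have wp: "word_prod E \<phi> w \<in> carrier E" if "set w \<subseteq> carrier H" for w
    using word_prod_closed[OF \<phi> that] .
  have sup: "\<Phi> f = finsum E (\<lambda>w. f w \<odot>\<^bsub>E\<^esub> word_prod E \<phi> w) F"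
    if f: "f \<in> carrier (free_alg K H)" and F: "finite F" "{w. f w \<noteq> \<zero>\<^bsub>K\<^esub>} \<subseteq> F" "\<And>w. w \<in> F \<Longrightarrow> set w \<subseteq> carrier H" for f F
    unfolding \<Phi>_def
    by (rule M.add.finprod_mono_neutral_cong_left) (use that c wp in auto)
  have add: "\<Phi> (f \<oplus>\<^bsub>free_alg K H\<^esub> g) = \<Phi> f \<oplus>\<^bsub>E\<^esub> \<Phi> g"
    if f: "f \<in> carrier (free_alg K H)" and g: "g \<in> carrier (free_alg K H)" for f g
  proof -
    let ?F = "{w. f w \<noteq> \<zero>\<^bsub>K\<^esub>} \<union> {w. g w \<noteq> \<zero>\<^bsub>K\<^esub>}"
    have F: "finite ?F" "\<And>w. w \<in> ?F \<Longrightarrow> set w \<subseteq> carrier H" using f g by (auto simp: fs)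
    have fg: "f \<oplus>\<^bsub>free_alg K H\<^esub> g \<in> carrier (free_alg K H)" using f g by simp
    have "{w. (f \<oplus>\<^bsub>free_alg K H\<^esub> g) w \<noteq> \<zero>\<^bsub>K\<^esub>} \<subseteq> ?F" by (auto simp: fs)
    then have "\<Phi> (f \<oplus>\<^bsub>free_alg K H\<^esub> g) = finsum E (\<lambda>w. (f w \<oplus>\<^bsub>K\<^esub> g w) \<odot>\<^bsub>E\<^esub> word_prod E \<phi> w) ?F"
      using sup[OF fg F(1) _ F(2)] by (simp add: fs(3))
    also have "\<dots> = finsum E (\<lambda>w. f w \<odot>\<^bsub>E\<^esub> word_prod E \<phi> w \<oplus>\<^bsub>E\<^esub> g w \<odot>\<^bsub>E\<^esub> word_prod E \<phi> w) ?F"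
      using F(2) c[OF f] c[OF g] wp by (intro M.finsum_cong') (auto simp: smult_l_distr)
    also have "\<dots> = finsum E (\<lambda>w. f w \<odot>\<^bsub>E\<^esub> word_prod E \<phi> w) ?F \<oplus>\<^bsub>E\<^esub> finsum E (\<lambda>w. g w \<odot>\<^bsub>E\<^esub> word_prod E \<phi> w) ?F"
      using F(2) c[OF f] c[OF g] wp by (intro M.finsum_addf) auto
    also have "\<dots> = \<Phi> f \<oplus>\<^bsub>E\<^esub> \<Phi> g"
      using sup[OF f F(1) _ F(2)] sup[OF g F(1) _ F(2)] by simp
    finally show ?thesis .
  qed
  have monom: "\<Phi> (free_monom K r w) = r \<odot>\<^bsub>E\<^esub> word_prod E \<phi> w" if "r \<in> carrier K" "set w \<subseteq> carrier H" for r w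
  proof -
    have "\<Phi> (free_monom K r w) = finsum E (\<lambda>v. free_monom K r w v \<odot>\<^bsub>E\<^esub> word_prod E \<phi> v) {w}"
      using that by (intro sup R.free_monom_closed) (auto simp: free_monom_def)
    then show ?thesis using that wp by (simp add: free_monom_def)
  qed
  have closed: "\<Phi> f \<in> carrier E" if "f \<in> carrier (free_alg K H)" for f
    unfolding \<Phi>_def using c[OF that] wp that by (intro M.finsum_closed) (auto simp: fs)
  have \<Phi>0: "\<Phi> (\<lambda>w. \<zero>\<^bsub>K\<^esub>) = \<zero>\<^bsub>E\<^esub>" by (simp add: \<Phi>_def)
  have mult: "\<Phi> (f \<otimes>\<^bsub>free_alg K H\<^esub> g) = \<Phi> f \<otimes>\<^bsub>E\<^esub> \<Phi> g"
    if f: "f \<in> carrier (free_alg K H)" and g: "g \<in> carrier (free_alg K H)" for f g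
    using f
  proof (induction rule: R.free_alg_induct)
    case zero
    then show ?case using F.l_null[OF g] closed[OF g] \<Phi>0 by (simp add: fs(4))
  next
    case (monom r u)
    note ru = monom
    note mc = R.free_monom_closed[OF ru]
    from g show ?case
    proof (induction rule: R.free_alg_induct)
      case zero
      then show ?case using F.r_null[OF mc] closed[OF mc] \<Phi>0 by (simp add: fs(4))
    next
      case (monom s v)
      have "(r \<otimes>\<^bsub>K\<^esub> s) \<odot>\<^bsub>E\<^esub> (word_prod E \<phi> u \<otimes>\<^bsub>E\<^esub> word_prod E \<phi> v) = (r \<odot>\<^bsub>E\<^esub> word_prod E \<phi> u) \<otimes>\<^bsub>E\<^esub> (s \<odot>\<^bsub>E\<^esub> word_prod E \<phi> v)"
        using monom ru wp smult_mult_left[of r "word_prod E \<phi> u" "s \<odot>\<^bsub>E\<^esub> word_prod E \<phi> v"]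
          smult_mult_right[of s "word_prod E \<phi> u" "word_prod E \<phi> v"]
        by (simp add: smult_assoc1)
      then show ?case
        using monom ru word_prod_append[OF \<phi>, of u v]
        by (simp add: R.free_monom_mult \<open>\<And>w r. \<lbrakk>r \<in> carrier K; set w \<subseteq> carrier H\<rbrakk> \<Longrightarrow> \<Phi> (free_monom K r w) = r \<odot>\<^bsub>E\<^esub> word_prod E \<phi> w\<close>)
    next
      case (add g g')
      then show ?case
        using mc closed F.r_distr[of g g' "free_monom K r u"] \<open>\<And>f g. \<lbrakk>f \<in> carrier (free_alg K H); g \<in> carrier (free_alg K H)\<rbrakk> \<Longrightarrow> \<Phi> (f \<oplus>\<^bsub>free_alg K H\<^esub> g) = \<Phi> f \<oplus>\<^bsub>E\<^esub> \<Phi> g\<close>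
        by (simp add: r_distr)
    qed
  next
    case (add f f')
    then show ?case
      using g closed F.l_distr[of f f' g] \<open>\<And>f g. \<lbrakk>f \<in> carrier (free_alg K H); g \<in> carrier (free_alg K H)\<rbrakk> \<Longrightarrow> \<Phi> (f \<oplus>\<^bsub>free_alg K H\<^esub> g) = \<Phi> f \<oplus>\<^bsub>E\<^esub> \<Phi> g\<close>
      by (simp add: l_distr)
  qed
  have "\<Phi> \<one>\<^bsub>free_alg K H\<^esub> = \<one>\<^bsub>E\<^esub>"
    unfolding fs(5) by (subst monom) (auto simp: word_prod_def)
  then have "\<Phi> \<in> ring_hom (free_alg K H) E"
    using closed mult add by (intro ring_hom_memI) auto
  then show thesis using that monom by blast
qed

text \<open>
  The kernel of a homomorphism is an ideal, hence contains the ideal generated by any of its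
  subsets.
\<close>

lemma quotient_universal:
  assumes R: "ring R" and E: "ring E" and gens: "gens \<subseteq> carrier R"
    and f: "f \<in> ring_hom R E" and zero: "\<And>x. x \<in> gens \<Longrightarrow> f x = \<zero>\<^bsub>E\<^esub>"
  obtains g where "g \<in> ring_hom (R Quot Idl\<^bsub>R\<^esub> gens) E" "\<And>x. x \<in> carrier R \<Longrightarrow> g (Idl\<^bsub>R\<^esub> gens +>\<^bsub>R\<^esub> x) = f x"
proof -
  interpret R: ring R by fact
  interpret E: ring E by fact
  interpret f: ring_hom_ring R E f by (unfold_locales) (rule f)
  interpret I: ideal "Idl\<^bsub>R\<^esub> gens" R by (rule R.genideal_ideal[OF gens])
  interpret q: ring_hom_ring R "R Quot Idl\<^bsub>R\<^esub> gens" "(+>\<^bsub>R\<^esub>) (Idl\<^bsub>R\<^esub> gens)" by (rule I.rcos_ring_hom_ring)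
  have sub: "Idl\<^bsub>R\<^esub> gens \<subseteq> a_kernel R E f"
    by (rule R.genideal_minimal[OF f.kernel_is_ideal]) (rule subsetI, simp only: a_kernel_def' mem_Collect_eq, use gens zero in blast)
  have ker: "f x = \<zero>\<^bsub>E\<^esub>" if "x \<in> Idl\<^bsub>R\<^esub> gens" for x
    using subsetD[OF sub that] unfolding a_kernel_def' mem_Collect_eq by (rule conjunct2)
  have wd: "f x = f y" if "x \<in> carrier R" "y \<in> carrier R" "Idl\<^bsub>R\<^esub> gens +>\<^bsub>R\<^esub> x = Idl\<^bsub>R\<^esub> gens +>\<^bsub>R\<^esub> y" for x y
  proof -
    have "x \<ominus>\<^bsub>R\<^esub> y \<in> Idl\<^bsub>R\<^esub> gens" using R.quotient_eq_iff_same_a_r_cos[OF I.is_ideal that(1,2)] that(3) by simp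
    then have "f x \<ominus>\<^bsub>E\<^esub> f y = \<zero>\<^bsub>E\<^esub>" using ker[of "x \<ominus>\<^bsub>R\<^esub> y"] that by (simp add: R.minus_eq E.minus_eq)
    then show ?thesis using that by (simp add: E.r_right_minus_eq)
  qed
  define g where "g Z = f (SOME x. x \<in> carrier R \<and> Z = Idl\<^bsub>R\<^esub> gens +>\<^bsub>R\<^esub> x)" for Z
  have g: "g (Idl\<^bsub>R\<^esub> gens +>\<^bsub>R\<^esub> x) = f x" if "x \<in> carrier R" for x
  proof -
    let ?x = "SOME y. y \<in> carrier R \<and> Idl\<^bsub>R\<^esub> gens +>\<^bsub>R\<^esub> x = Idl\<^bsub>R\<^esub> gens +>\<^bsub>R\<^esub> y"
    have "?x \<in> carrier R \<and> Idl\<^bsub>R\<^esub> gens +>\<^bsub>R\<^esub> x = Idl\<^bsub>R\<^esub> gens +>\<^bsub>R\<^esub> ?x"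
      by (rule someI[of _ x]) (simp add: that)
    then show ?thesis unfolding g_def using wd[OF that, of ?x] by simp
  qed
  have surj: "\<exists>x\<in>carrier R. Z = Idl\<^bsub>R\<^esub> gens +>\<^bsub>R\<^esub> x" if "Z \<in> carrier (R Quot Idl\<^bsub>R\<^esub> gens)" for Z
    using that unfolding FactRing_def A_RCOSETS_def' partial_object.simps by blast
  have "g \<in> ring_hom (R Quot Idl\<^bsub>R\<^esub> gens) E"
  proof (rule ring_hom_memI)
    fix Z assume "Z \<in> carrier (R Quot Idl\<^bsub>R\<^esub> gens)"
    then obtain x where x: "x \<in> carrier R" "Z = Idl\<^bsub>R\<^esub> gens +>\<^bsub>R\<^esub> x" using surj by blast
    then show "g Z \<in> carrier E" by (simp add: g)
    fix W assume "W \<in> carrier (R Quot Idl\<^bsub>R\<^esub> gens)"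
    then obtain y where y: "y \<in> carrier R" "W = Idl\<^bsub>R\<^esub> gens +>\<^bsub>R\<^esub> y" using surj by blast
    show "g (Z \<otimes>\<^bsub>R Quot Idl\<^bsub>R\<^esub> gens\<^esub> W) = g Z \<otimes>\<^bsub>E\<^esub> g W"
      using x y q.hom_mult[of x y, symmetric] by (simp only: g f.hom_mult R.m_closed)
    show "g (Z \<oplus>\<^bsub>R Quot Idl\<^bsub>R\<^esub> gens\<^esub> W) = g Z \<oplus>\<^bsub>E\<^esub> g W"
      using x y q.hom_add[of x y, symmetric] by (simp only: g f.hom_add R.a_closed)
  next
    show "g \<one>\<^bsub>R Quot Idl\<^bsub>R\<^esub> gens\<^esub> = \<one>\<^bsub>E\<^esub>"
      using q.hom_one[symmetric] by (simp only: g f.hom_one R.one_closed)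
  qed
  then show thesis using that g by blast
qed

section \<open>The partial Hopf algebra and its universal property\<close>

context cocommutative_hopf
begin

abbreviation F where "F \<equiv> free_alg K H"
abbreviation TA where "TA \<equiv> tensor_alg K H"
abbreviation A where "A \<equiv> par_alg K H \<Delta> S"
abbreviation mult_A (infixl "\<bullet>" 70) where "x \<bullet> y \<equiv> x \<otimes>\<^bsub>A\<^esub> y"
abbreviation tens where "tens \<equiv> talg_monom K H"
abbreviation mon where "mon \<equiv> par_monom K H \<Delta> S"
abbreviation cl where "cl \<equiv> par_class K H \<Delta> S"

definition lin_gens where "lin_gens =
  {free_monom K \<one>\<^bsub>K\<^esub> [x \<oplus>\<^bsub>H\<^esub> y] \<ominus>\<^bsub>F\<^esub> (free_monom K \<one>\<^bsub>K\<^esub> [x] \<oplus>\<^bsub>F\<^esub> free_monom K \<one>\<^bsub>K\<^esub> [y]) | x y. x \<in> carrier H \<and> y \<in> carrier H} \<union>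
  {free_monom K \<one>\<^bsub>K\<^esub> [r \<odot>\<^bsub>H\<^esub> x] \<ominus>\<^bsub>F\<^esub> free_monom K r [x] | r x. r \<in> carrier K \<and> x \<in> carrier H}"

lemma linear_ideal_eq: "linear_ideal K H = Idl\<^bsub>F\<^esub> lin_gens"
  by (simp add: linear_ideal_def Let_def lin_gens_def)

lemma F_ring: "ring F"
  by (rule R.free_alg_ring)

lemma lin_gens_closed: "lin_gens \<subseteq> carrier F"
proof -
  interpret F: ring F by (rule F_ring)
  show ?thesis
    unfolding lin_gens_def using R.free_monom_closed[where H = H]
    by (intro Un_least subsetI; elim CollectE exE conjE) simp_all
qed

lemma linear_ideal: "ideal (linear_ideal K H) F"
proof -
  interpret F: ring F by (rule F_ring)
  show ?thesis unfolding linear_ideal_eq by (rule F.genideal_ideal[OF lin_gens_closed])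
qed

lemma TA_ring: "ring TA"
  unfolding tensor_alg_def by (rule ideal.quotient_is_ring[OF linear_ideal])

lemma F_TA_hom: "ring_hom_ring F TA ((+>\<^bsub>F\<^esub>) (linear_ideal K H))"
  unfolding tensor_alg_def by (rule ideal.rcos_ring_hom_ring[OF linear_ideal])

lemma tens_closed: "\<lbrakk>r \<in> carrier K; set w \<subseteq> carrier H\<rbrakk> \<Longrightarrow> tens r w \<in> carrier TA"
  unfolding talg_monom_def
  by (rule ring_hom_closed[OF ring_hom_ring.homh[OF F_TA_hom]]) (rule R.free_monom_closed)

definition par_gens where "par_gens =
  {tens \<one>\<^bsub>K\<^esub> [\<one>\<^bsub>H\<^esub>] \<ominus>\<^bsub>TA\<^esub> \<one>\<^bsub>TA\<^esub>} \<union>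
  {add_list TA [tens \<one>\<^bsub>K\<^esub> [h, a, S b]. (a, b) \<leftarrow> ps] \<ominus>\<^bsub>TA\<^esub> add_list TA [tens \<one>\<^bsub>K\<^esub> [h \<cdot> a, S b]. (a, b) \<leftarrow> ps]
    | h k ps. h \<in> carrier H \<and> sweedler K H \<Delta> k ps} \<union>
  {add_list TA [tens \<one>\<^bsub>K\<^esub> [a, S b, k]. (a, b) \<leftarrow> ps] \<ominus>\<^bsub>TA\<^esub> add_list TA [tens \<one>\<^bsub>K\<^esub> [a, S b \<cdot> k]. (a, b) \<leftarrow> ps]
    | h k ps. k \<in> carrier H \<and> sweedler K H \<Delta> h ps} \<union>
  {add_list TA [tens \<one>\<^bsub>K\<^esub> [h, S a, b]. (a, b) \<leftarrow> ps] \<ominus>\<^bsub>TA\<^esub> add_list TA [tens \<one>\<^bsub>K\<^esub> [h \<cdot> S a, b]. (a, b) \<leftarrow> ps]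
    | h k ps. h \<in> carrier H \<and> sweedler K H \<Delta> k ps} \<union>
  {add_list TA [tens \<one>\<^bsub>K\<^esub> [S a, b, k]. (a, b) \<leftarrow> ps] \<ominus>\<^bsub>TA\<^esub> add_list TA [tens \<one>\<^bsub>K\<^esub> [S a, b \<cdot> k]. (a, b) \<leftarrow> ps]
    | h k ps. k \<in> carrier H \<and> sweedler K H \<Delta> h ps}"

lemma par_ideal_eq: "par_ideal K H \<Delta> S = Idl\<^bsub>TA\<^esub> par_gens"
  by (simp add: par_ideal_def Let_def par_gens_def)

lemma sweedler_closed: "sweedler K H \<Delta> h ps \<Longrightarrow> set ps \<subseteq> carrier H \<times> carrier H"
  by (simp add: sweedler_def)

lemma list_closed:
  assumes "sweedler K H \<Delta> h ps" "\<And>a b. \<lbrakk>a \<in> carrier H; b \<in> carrier H\<rbrakk> \<Longrightarrow> f a b \<in> C"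
  shows "set [f a b. (a, b) \<leftarrow> ps] \<subseteq> C"
  using assms by (auto simp: sweedler_def)

lemma par_gens_closed: "par_gens \<subseteq> carrier TA"
proof -
  interpret TA: ring TA by (rule TA_ring)
  have *: "add_list TA [f a b. (a, b) \<leftarrow> ps] \<in> carrier TA"
    if "sweedler K H \<Delta> h ps" "\<And>a b. \<lbrakk>a \<in> carrier H; b \<in> carrier H\<rbrakk> \<Longrightarrow> f a b \<in> carrier TA" for f h ps
    by (rule TA.add_list_closed[OF list_closed[OF that]])
  show ?thesis
    unfolding par_gens_def
    by (intro Un_least subsetI; elim CollectE exE conjE singletonE)
      (simp_all only:, (intro TA.minus_closed TA.one_closed *; (assumption | (rule tens_closed; simp add: antipode_closed)))+)
qed

lemma par_ideal: "ideal (par_ideal K H \<Delta> S) TA"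
  unfolding par_ideal_eq by (rule ring.genideal_ideal[OF TA_ring par_gens_closed])

lemma A_ring: "ring A"
  unfolding par_alg_def by (rule ideal.quotient_is_ring[OF par_ideal])

lemma TA_A_hom: "ring_hom_ring TA A ((+>\<^bsub>TA\<^esub>) (par_ideal K H \<Delta> S))"
  unfolding par_alg_def by (rule ideal.rcos_ring_hom_ring[OF par_ideal])

definition quot where "quot f = par_ideal K H \<Delta> S +>\<^bsub>TA\<^esub> (linear_ideal K H +>\<^bsub>F\<^esub> f)"

lemma quot_hom: "ring_hom_ring F A quot"
proof -
  interpret p: ring_hom_ring F TA "(+>\<^bsub>F\<^esub>) (linear_ideal K H)" by (rule F_TA_hom)
  interpret q: ring_hom_ring TA A "(+>\<^bsub>TA\<^esub>) (par_ideal K H \<Delta> S)" by (rule TA_A_hom)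
  have "quot \<in> ring_hom F A"
    using ring_hom_trans[OF p.homh q.homh] by (simp add: quot_def[abs_def] comp_def)
  then show ?thesis by (intro ring_hom_ringI2 F_ring A_ring)
qed

lemma quot_surj:
  assumes "x \<in> carrier A"
  obtains f where "f \<in> carrier F" "x = quot f"
proof -
  obtain y where y: "y \<in> carrier TA" "x = par_ideal K H \<Delta> S +>\<^bsub>TA\<^esub> y"
    using assms unfolding par_alg_def FactRing_def A_RCOSETS_def' partial_object.simps by blast
  obtain f where "f \<in> carrier F" "y = linear_ideal K H +>\<^bsub>F\<^esub> f"
    using y(1) unfolding tensor_alg_def FactRing_def A_RCOSETS_def' partial_object.simps by blast
  then show thesis using that y by (simp add: quot_def)
qed

lemma mon_quot: "mon r w = quot (free_monom K r w)"
  by (simp add: par_monom_def talg_monom_def quot_def)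

lemma mon_closed: "\<lbrakk>r \<in> carrier K; set w \<subseteq> carrier H\<rbrakk> \<Longrightarrow> mon r w \<in> carrier A"
  unfolding mon_quot by (rule ring_hom_closed[OF ring_hom_ring.homh[OF quot_hom]]) (rule R.free_monom_closed)

lemma mon_mult:
  "\<lbrakk>r \<in> carrier K; s \<in> carrier K; set u \<subseteq> carrier H; set v \<subseteq> carrier H\<rbrakk> \<Longrightarrow>
    mon r u \<bullet> mon s v = mon (r \<otimes>\<^bsub>K\<^esub> s) (u @ v)"
  unfolding mon_quot
  by (subst ring_hom_mult[OF ring_hom_ring.homh[OF quot_hom], symmetric])
    (simp_all add: R.free_monom_closed R.free_monom_mult)

lemma mon_add:
  assumes "r \<in> carrier K" "s \<in> carrier K" "set w \<subseteq> carrier H"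
  shows "mon (r \<oplus>\<^bsub>K\<^esub> s) w = mon r w \<oplus>\<^bsub>A\<^esub> mon s w"
proof -
  have "free_monom K (r \<oplus>\<^bsub>K\<^esub> s) w = free_monom K r w \<oplus>\<^bsub>F\<^esub> free_monom K s w"
    by (auto simp: free_monom_def R.free_alg_simps)
  then show ?thesis
    unfolding mon_quot using assms R.free_monom_closed[where H = H]
    by (simp add: ring_hom_add[OF ring_hom_ring.homh[OF quot_hom]])
qed

lemma mon_one: "mon \<one>\<^bsub>K\<^esub> [] = \<one>\<^bsub>A\<^esub>"
  unfolding mon_quot R.free_alg_simps(5)[symmetric, of H]
  by (rule ring_hom_one[OF ring_hom_ring.homh[OF quot_hom]])

lemma quot_zero: "quot (\<lambda>w. \<zero>\<^bsub>K\<^esub>) = \<zero>\<^bsub>A\<^esub>"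
proof -
  interpret q: ring_hom_ring F A quot by (rule quot_hom)
  show ?thesis using q.hom_zero by (simp add: R.free_alg_simps)
qed

lemma mon_zero: "mon \<zero>\<^bsub>K\<^esub> w = \<zero>\<^bsub>A\<^esub>"
proof -
  have "free_monom K \<zero>\<^bsub>K\<^esub> w = (\<lambda>w. \<zero>\<^bsub>K\<^esub>)" by (auto simp: free_monom_def)
  then show ?thesis unfolding mon_quot by (simp add: quot_zero)
qed

lemma cl_mon: "cl h = mon \<one>\<^bsub>K\<^esub> [h]"
  by (simp add: par_class_def)

lemma quot_eqI:
  assumes "x \<in> carrier F" "y \<in> carrier F" "x \<ominus>\<^bsub>F\<^esub> y \<in> lin_gens"
  shows "quot x = quot y"
proof -
  interpret F: ring F by (rule F_ring)
  have "x \<ominus>\<^bsub>F\<^esub> y \<in> linear_ideal K H"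
    unfolding linear_ideal_eq using F.genideal_self[OF lin_gens_closed] assms(3) by blast
  then show ?thesis
    using F.quotient_eq_iff_same_a_r_cos[OF linear_ideal assms(1,2)] by (simp add: quot_def)
qed

lemma cl_add:
  assumes "x \<in> carrier H" "y \<in> carrier H"
  shows "cl (x \<oplus>\<^bsub>H\<^esub> y) = cl x \<oplus>\<^bsub>A\<^esub> cl y"
proof -
  interpret q: ring_hom_ring F A quot by (rule quot_hom)
  have c: "free_monom K \<one>\<^bsub>K\<^esub> [h] \<in> carrier F" if "h \<in> carrier H" for h
    using that by (intro R.free_monom_closed) auto
  have "quot (free_monom K \<one>\<^bsub>K\<^esub> [x \<oplus>\<^bsub>H\<^esub> y]) = quot (free_monom K \<one>\<^bsub>K\<^esub> [x] \<oplus>\<^bsub>F\<^esub> free_monom K \<one>\<^bsub>K\<^esub> [y])"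
  proof (rule quot_eqI)
    show "free_monom K \<one>\<^bsub>K\<^esub> [x \<oplus>\<^bsub>H\<^esub> y] \<ominus>\<^bsub>F\<^esub> (free_monom K \<one>\<^bsub>K\<^esub> [x] \<oplus>\<^bsub>F\<^esub> free_monom K \<one>\<^bsub>K\<^esub> [y]) \<in> lin_gens"
      unfolding lin_gens_def using assms by blast
  qed (use assms c in simp_all)
  then show ?thesis using assms c by (simp add: cl_mon mon_quot)
qed

lemma cl_smult:
  assumes "r \<in> carrier K" "x \<in> carrier H"
  shows "cl (r \<odot>\<^bsub>H\<^esub> x) = mon r [] \<bullet> cl x"
proof -
  have c: "free_monom K r [h] \<in> carrier F" if "h \<in> carrier H" "r \<in> carrier K" for h r
    using that by (intro R.free_monom_closed) auto
  have "quot (free_monom K \<one>\<^bsub>K\<^esub> [r \<odot>\<^bsub>H\<^esub> x]) = quot (free_monom K r [x])"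
  proof (rule quot_eqI)
    show "free_monom K \<one>\<^bsub>K\<^esub> [r \<odot>\<^bsub>H\<^esub> x] \<ominus>\<^bsub>F\<^esub> free_monom K r [x] \<in> lin_gens"
      unfolding lin_gens_def using assms by blast
  qed (use assms c in simp_all)
  then have "cl (r \<odot>\<^bsub>H\<^esub> x) = mon r [x]" by (simp add: cl_mon mon_quot)
  then show ?thesis using assms by (simp add: cl_mon mon_mult)
qed

text \<open>
  The partial Hopf algebra as a \<open>K\<close>-algebra: \<open>r\<close> acts as multiplication by the class of \<open>r 1\<close>.
\<close>

definition PA where "PA = \<lparr>carrier = carrier A, monoid.mult = monoid.mult A, one = \<one>\<^bsub>A\<^esub>,
  ring.zero = \<zero>\<^bsub>A\<^esub>, ring.add = ring.add A, smult = (\<lambda>r x. mon r [] \<bullet> x)\<rparr>"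

abbreviation scale (infixr "\<star>" 75) where "r \<star> x \<equiv> r \<odot>\<^bsub>PA\<^esub> x"

lemma PA_simps [simp]:
  "carrier PA = carrier A" "monoid.mult PA = monoid.mult A" "one PA = \<one>\<^bsub>A\<^esub>"
  "ring.zero PA = \<zero>\<^bsub>A\<^esub>" "ring.add PA = ring.add A" "smult PA r x = mon r [] \<bullet> x"
  by (simp_all add: PA_def)

text \<open>
  Every element is a sum of monomials \<open>r [h\<^sub>1] \<cdots> [h\<^sub>n]\<close>, which are built by left multiplication.
\<close>

lemma par_alg_induct [consumes 1, case_names scalar add cl]:
  assumes "x \<in> carrier A"
    and "\<And>r. r \<in> carrier K \<Longrightarrow> P (mon r [])"
    and "\<And>x y. \<lbrakk>x \<in> carrier A; y \<in> carrier A; P x; P y\<rbrakk> \<Longrightarrow> P (x \<oplus>\<^bsub>A\<^esub> y)"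
    and "\<And>h x. \<lbrakk>h \<in> carrier H; x \<in> carrier A; P x\<rbrakk> \<Longrightarrow> P (cl h \<bullet> x)"
  shows "P x"
proof -
  interpret q: ring_hom_ring F A quot by (rule quot_hom)
  have mon: "P (mon r w)" if "r \<in> carrier K" "set w \<subseteq> carrier H" for r w
    using that(2)
  proof (induction w)
    case Nil
    show ?case by (rule assms(2)[OF that(1)])
  next
    case (Cons h w)
    have "mon r (h # w) = cl h \<bullet> mon r w"
      using Cons.prems that(1) by (simp add: cl_mon mon_mult)
    then show ?case using Cons assms(4)[of h "mon r w"] mon_closed[OF that(1), of w] by simp
  qed
  obtain f where f: "f \<in> carrier F" "x = quot f" using quot_surj[OF assms(1)] .
  have "P (quot f)"
    using f(1)
  proof (induction rule: R.free_alg_induct)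
    case zero
    then show ?case using mon[of "\<zero>\<^bsub>K\<^esub>" "[]"] by (simp add: mon_zero quot_zero)
  next
    case (monom r w)
    then show ?case using mon by (simp add: mon_quot)
  next
    case (add f g)
    then show ?case using assms(3) by simp
  qed
  then show ?thesis using f by simp
qed

lemma cl_closed: "h \<in> carrier H \<Longrightarrow> cl h \<in> carrier A"
  unfolding cl_mon by (rule mon_closed) auto

lemma mon_central:
  assumes r: "r \<in> carrier K" and x: "x \<in> carrier A"
  shows "mon r [] \<bullet> x = x \<bullet> mon r []"
proof -
  interpret A: ring A by (rule A_ring)
  have m: "mon r [] \<in> carrier A" by (rule mon_closed[OF r]) simp
  show ?thesis
    using x
  proof (induction rule: par_alg_induct)
    case (scalar s)
    then show ?case using r by (simp add: mon_mult m_comm)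
  next
    case (add x y)
    then show ?case using m by (simp add: A.l_distr A.r_distr)
  next
    case (cl h x)
    have h: "mon r [] \<bullet> cl h = cl h \<bullet> mon r []" using cl r by (simp add: cl_mon mon_mult)
    have "mon r [] \<bullet> (cl h \<bullet> x) = (cl h \<bullet> mon r []) \<bullet> x"
      using cl m cl_closed[of h] by (simp add: A.m_assoc[symmetric] h)
    also have "\<dots> = cl h \<bullet> (x \<bullet> mon r [])"
      using cl m cl_closed[of h] by (simp add: A.m_assoc)
    finally show ?case using cl m cl_closed[of h] by (simp add: A.m_assoc)
  qed
qed

lemma PA_algebra: "k_algebra K PA"
proof -
  interpret A: ring A by (rule A_ring)
  have m: "mon r [] \<in> carrier A" if "r \<in> carrier K" for r by (rule mon_closed[OF that]) simp
  have ring: "ring PA"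
  proof (rule ringI)
    show "abelian_group PA"
    proof (rule abelian_groupI)
      fix x assume "x \<in> carrier PA"
      then show "\<exists>y\<in>carrier PA. y \<oplus>\<^bsub>PA\<^esub> x = \<zero>\<^bsub>PA\<^esub>" by (intro bexI[of _ "\<ominus>\<^bsub>A\<^esub> x"]) (auto simp: A.l_neg)
    next
      fix x y assume "x \<in> carrier PA" "y \<in> carrier PA"
      then show "x \<oplus>\<^bsub>PA\<^esub> y = y \<oplus>\<^bsub>PA\<^esub> x" by (simp add: A.a_comm)
    qed (auto simp: A.a_assoc)
    show "Group.monoid PA" by (rule monoidI) (auto simp: A.m_assoc)
  qed (auto simp: A.l_distr A.r_distr)
  have "module K PA"
  proof (rule moduleI)
    show "abelian_group PA" using ring by (simp add: ring_def)
    show "\<one>\<^bsub>K\<^esub> \<star> x = x" if "x \<in> carrier PA" for x using that by (simp add: mon_one)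
  qed (use m in \<open>auto simp: R.is_cring mon_add A.l_distr A.r_distr mon_mult A.m_assoc[symmetric]\<close>)
  moreover have "k_algebra_axioms K PA"
  proof (unfold_locales, goal_cases)
    case (1 r x y)
    then show ?case using m by (simp add: A.m_assoc)
  next
    case (2 r x y)
    then have "mon r [] \<bullet> (x \<bullet> y) = (x \<bullet> mon r []) \<bullet> y"
      using m mon_central[of r x] by (simp add: A.m_assoc[symmetric])
    then show ?case using 2 m by (simp add: A.m_assoc)
  qed
  ultimately show ?thesis using ring by (simp add: k_algebra_def)
qed

lemma lin_cl: "lin PA cl"
  by (rule linI) (auto simp: cl_closed cl_add cl_smult)

lemma add_list_PA: "add_list PA xs = add_list A xs"
  by (simp add: add_list_def)

lemma par_relation:
  assumes "x \<in> carrier TA" "y \<in> carrier TA" "x \<ominus>\<^bsub>TA\<^esub> y \<in> par_gens"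
  shows "par_ideal K H \<Delta> S +>\<^bsub>TA\<^esub> x = par_ideal K H \<Delta> S +>\<^bsub>TA\<^esub> y"
proof -
  interpret TA: ring TA by (rule TA_ring)
  have "x \<ominus>\<^bsub>TA\<^esub> y \<in> par_ideal K H \<Delta> S"
    unfolding par_ideal_eq using TA.genideal_self[OF par_gens_closed] assms(3) by blast
  then show ?thesis using TA.quotient_eq_iff_same_a_r_cos[OF par_ideal assms(1,2)] by simp
qed

text \<open>
  The passage from a defining relation, which is a sum over some expansion in the tensor algebra,
  to an identity in the quotient.
\<close>

lemma par_relation_list:
  assumes ps: "sweedler K H \<Delta> h ps"
    and f: "\<And>a b. \<lbrakk>a \<in> carrier H; b \<in> carrier H\<rbrakk> \<Longrightarrow> set (f a b) \<subseteq> carrier H"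
    and g: "\<And>a b. \<lbrakk>a \<in> carrier H; b \<in> carrier H\<rbrakk> \<Longrightarrow> set (g a b) \<subseteq> carrier H"
    and rel: "add_list TA [tens \<one>\<^bsub>K\<^esub> (f a b). (a, b) \<leftarrow> ps] \<ominus>\<^bsub>TA\<^esub> add_list TA [tens \<one>\<^bsub>K\<^esub> (g a b). (a, b) \<leftarrow> ps] \<in> par_gens"
  shows "add_list A [mon \<one>\<^bsub>K\<^esub> (f a b). (a, b) \<leftarrow> ps] = add_list A [mon \<one>\<^bsub>K\<^esub> (g a b). (a, b) \<leftarrow> ps]"
proof -
  interpret q: ring_hom_ring TA A "(+>\<^bsub>TA\<^esub>) (par_ideal K H \<Delta> S)" by (rule TA_A_hom)
  have c: "set [tens \<one>\<^bsub>K\<^esub> (f a b). (a, b) \<leftarrow> ps] \<subseteq> carrier TA"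
    if "\<And>a b. \<lbrakk>a \<in> carrier H; b \<in> carrier H\<rbrakk> \<Longrightarrow> set (f a b) \<subseteq> carrier H" for f
    by (rule list_closed[OF ps]) (rule tens_closed[OF R.one_closed that])
  have eq: "par_ideal K H \<Delta> S +>\<^bsub>TA\<^esub> add_list TA [tens \<one>\<^bsub>K\<^esub> (f a b). (a, b) \<leftarrow> ps] = add_list A [mon \<one>\<^bsub>K\<^esub> (f a b). (a, b) \<leftarrow> ps]"
    if "\<And>a b. \<lbrakk>a \<in> carrier H; b \<in> carrier H\<rbrakk> \<Longrightarrow> set (f a b) \<subseteq> carrier H" for f
    using q.hom_add_list[OF c[OF that]] by (simp add: par_monom_def comp_def case_prod_unfold)
  show ?thesis
    using par_relation[OF _ _ rel] q.R.add_list_closed[OF c[OF f]] q.R.add_list_closed[OF c[OF g]] eq[OF f] eq[OF g]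
    by simp
qed

lemma D_PA: "h \<in> carrier H \<Longrightarrow> D PA h f = add_list A [f a b. (a, b) \<leftarrow> expansion h]"
  by (simp add: D_def add_list_PA)

lemma partial_rep_cl: "partial_rep PA cl"
proof -
  interpret A: ring A by (rule A_ring)
  interpret q: ring_hom_ring TA A "(+>\<^bsub>TA\<^esub>) (par_ideal K H \<Delta> S)" by (rule TA_A_hom)
  have one: "cl \<one>\<^bsub>H\<^esub> = \<one>\<^bsub>A\<^esub>"
  proof -
    have "tens \<one>\<^bsub>K\<^esub> [\<one>\<^bsub>H\<^esub>] \<ominus>\<^bsub>TA\<^esub> \<one>\<^bsub>TA\<^esub> \<in> par_gens" by (simp add: par_gens_def)
    from par_relation[OF tens_closed q.R.one_closed this] show ?thesis
      by (simp add: cl_mon par_monom_def del: q.hom_one) (simp add: q.hom_one)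
  qed
  have 3: "mon \<one>\<^bsub>K\<^esub> [a, b, c] = cl a \<bullet> (cl b \<bullet> cl c)"
    if "a \<in> carrier H" "b \<in> carrier H" "c \<in> carrier H" for a b c
    using that by (simp add: cl_mon mon_mult)
  have 2: "mon \<one>\<^bsub>K\<^esub> [a, b] = cl a \<bullet> cl b" if "a \<in> carrier H" "b \<in> carrier H" for a b
    using that by (simp add: cl_mon mon_mult)
  have rel1: "D PA k (\<lambda>a b. cl h \<bullet> (cl a \<bullet> cl (S b))) = D PA k (\<lambda>a b. cl (h \<cdot> a) \<bullet> cl (S b))"
    if h: "h \<in> carrier H" and k: "k \<in> carrier H" for h k
  proof -
    have "add_list A [mon \<one>\<^bsub>K\<^esub> [h, a, S b]. (a, b) \<leftarrow> expansion k] = add_list A [mon \<one>\<^bsub>K\<^esub> [h \<cdot> a, S b]. (a, b) \<leftarrow> expansion k]"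
    proof (rule par_relation_list[OF sweedler_expansion[OF k]])
      show "add_list TA [tens \<one>\<^bsub>K\<^esub> [h, a, S b]. (a, b) \<leftarrow> expansion k] \<ominus>\<^bsub>TA\<^esub>
          add_list TA [tens \<one>\<^bsub>K\<^esub> [h \<cdot> a, S b]. (a, b) \<leftarrow> expansion k] \<in> par_gens"
        unfolding par_gens_def using h sweedler_expansion[OF k] by blast
    qed (use h in \<open>simp_all add: antipode_closed\<close>)
    then have "D PA k (\<lambda>a b. mon \<one>\<^bsub>K\<^esub> [h, a, S b]) = D PA k (\<lambda>a b. mon \<one>\<^bsub>K\<^esub> [h \<cdot> a, S b])"
      by (simp add: D_PA[OF k])
    then show ?thesis using h by (simp add: 2 3 antipode_closed)
  qed
  have rel2: "D PA h (\<lambda>a b. cl a \<bullet> (cl (S b) \<bullet> cl k)) = D PA h (\<lambda>a b. cl a \<bullet> cl (S b \<cdot> k))"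
    if h: "h \<in> carrier H" and k: "k \<in> carrier H" for h k
  proof -
    have "add_list A [mon \<one>\<^bsub>K\<^esub> [a, S b, k]. (a, b) \<leftarrow> expansion h] = add_list A [mon \<one>\<^bsub>K\<^esub> [a, S b \<cdot> k]. (a, b) \<leftarrow> expansion h]"
    proof (rule par_relation_list[OF sweedler_expansion[OF h]])
      show "add_list TA [tens \<one>\<^bsub>K\<^esub> [a, S b, k]. (a, b) \<leftarrow> expansion h] \<ominus>\<^bsub>TA\<^esub>
          add_list TA [tens \<one>\<^bsub>K\<^esub> [a, S b \<cdot> k]. (a, b) \<leftarrow> expansion h] \<in> par_gens"
        unfolding par_gens_def using k sweedler_expansion[OF h] by blast
    qed (use k in \<open>simp_all add: antipode_closed\<close>)
    then have "D PA h (\<lambda>a b. mon \<one>\<^bsub>K\<^esub> [a, S b, k]) = D PA h (\<lambda>a b. mon \<one>\<^bsub>K\<^esub> [a, S b \<cdot> k])"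
      by (simp add: D_PA[OF h])
    then show ?thesis using k by (simp add: 2 3 antipode_closed)
  qed
  show ?thesis
    unfolding partial_rep_def using lin_cl one rel1 rel2 by simp
qed

text \<open>
  The algebra map of the free algebra that extends \<open>\<pi>\<close> respects linearity, hence factors through the
  tensor algebra, and then it respects the partial relations. These are sums over arbitrary
  expansions of \<open>\<Delta> h\<close>, which take the same value as the chosen one.
\<close>

lemma par_alg_universal:
  assumes E: "k_algebra K E" and \<pi>: "partial_rep E \<pi>"
  obtains g where "g \<in> ring_hom A E" "\<And>r. r \<in> carrier K \<Longrightarrow> g (mon r []) = r \<odot>\<^bsub>E\<^esub> \<one>\<^bsub>E\<^esub>"
    "\<And>h. h \<in> carrier H \<Longrightarrow> g (cl h) = \<pi> h"
proof -
  interpret E: k_algebra K E by fact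
  note G = k_algebra_module[OF E]
  note ag = module_abelian_group[OF G]
  note lin = partial_repD(1)[OF \<pi>]
  note c\<pi> = linD(1)[OF lin]
  note [lins] = E G ag lin_comp[OF lin] c\<pi>
  have \<phi>: "\<pi> \<in> carrier H \<rightarrow> carrier E" using c\<pi> by auto
  note wp = E.word_prod_closed[OF \<phi>]
  show thesis
  proof (rule E.free_alg_universal[OF \<phi>])
    fix f assume f: "f \<in> ring_hom F E"
      and fm: "\<And>r w. \<lbrakk>r \<in> carrier K; set w \<subseteq> carrier H\<rbrakk> \<Longrightarrow> f (free_monom K r w) = r \<odot>\<^bsub>E\<^esub> word_prod E \<pi> w"
    interpret f: ring_hom_ring F E f by (intro ring_hom_ringI2 F_ring E.ring_axioms f)
    have mc: "free_monom K r w \<in> carrier F" if "r \<in> carrier K" "set w \<subseteq> carrier H" for r w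
      using that by (rule R.free_monom_closed)
    have single: "f (free_monom K r [x]) = r \<odot>\<^bsub>E\<^esub> \<pi> x" if "r \<in> carrier K" "x \<in> carrier H" for r x
      using that c\<pi> by (simp add: fm word_prod_def)
    have "f x = \<zero>\<^bsub>E\<^esub>" if "x \<in> lin_gens" for x
      using that unfolding lin_gens_def
    proof (elim UnE CollectE exE conjE)
      fix u v assume "x = free_monom K \<one>\<^bsub>K\<^esub> [u \<oplus>\<^bsub>H\<^esub> v] \<ominus>\<^bsub>F\<^esub> (free_monom K \<one>\<^bsub>K\<^esub> [u] \<oplus>\<^bsub>F\<^esub> free_monom K \<one>\<^bsub>K\<^esub> [v])"
        "u \<in> carrier H" "v \<in> carrier H"
      then show "f x = \<zero>\<^bsub>E\<^esub>"
        using c\<pi> mc by (simp add: f.R.minus_eq single linD(2)[OF lin] E.M.r_neg)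
    next
      fix r u assume "x = free_monom K \<one>\<^bsub>K\<^esub> [r \<odot>\<^bsub>H\<^esub> u] \<ominus>\<^bsub>F\<^esub> free_monom K r [u]" "r \<in> carrier K" "u \<in> carrier H"
      then show "f x = \<zero>\<^bsub>E\<^esub>"
        using c\<pi> mc by (simp add: f.R.minus_eq single linD(3)[OF lin] E.M.r_neg)
    qed
    then show thesis
    proof (rule quotient_universal[OF F_ring E.ring_axioms lin_gens_closed f])
      fix g assume g: "g \<in> ring_hom (F Quot Idl\<^bsub>F\<^esub> lin_gens) E"
        and gf: "\<And>x. x \<in> carrier F \<Longrightarrow> g (Idl\<^bsub>F\<^esub> lin_gens +>\<^bsub>F\<^esub> x) = f x"
      have g': "g \<in> ring_hom TA E" using g by (simp add: tensor_alg_def linear_ideal_eq)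
      interpret g: ring_hom_ring TA E g by (intro ring_hom_ringI2 TA_ring E.ring_axioms g')
      have gt: "g (tens r w) = r \<odot>\<^bsub>E\<^esub> word_prod E \<pi> w" if "r \<in> carrier K" "set w \<subseteq> carrier H" for r w
        using that gf[OF mc] by (simp add: talg_monom_def linear_ideal_eq fm)
      have gl: "g (add_list TA [tens \<one>\<^bsub>K\<^esub> (w a b). (a, b) \<leftarrow> ps]) = D E h u"
        if ps: "sweedler K H \<Delta> h ps"
          and w: "\<And>a b. \<lbrakk>a \<in> carrier H; b \<in> carrier H\<rbrakk> \<Longrightarrow> set (w a b) \<subseteq> carrier H"
          and u: "\<And>a b. \<lbrakk>a \<in> carrier H; b \<in> carrier H\<rbrakk> \<Longrightarrow> word_prod E \<pi> (w a b) = u a b"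
            "\<And>a. a \<in> carrier H \<Longrightarrow> lin E (\<lambda>b. u a b)" "\<And>b. b \<in> carrier H \<Longrightarrow> lin E (\<lambda>a. u a b)" for h ps w u
      proof -
        have "g (add_list TA [tens \<one>\<^bsub>K\<^esub> (w a b). (a, b) \<leftarrow> ps]) = add_list E (map g [tens \<one>\<^bsub>K\<^esub> (w a b). (a, b) \<leftarrow> ps])"
          by (rule g.hom_add_list, rule list_closed[OF ps]) (rule tens_closed[OF R.one_closed w])
        also have "map g [tens \<one>\<^bsub>K\<^esub> (w a b). (a, b) \<leftarrow> ps] = [u a b. (a, b) \<leftarrow> ps]"
        proof -
          have "g (tens \<one>\<^bsub>K\<^esub> (w a b)) = u a b" if "a \<in> carrier H" "b \<in> carrier H" for a b
            using gt[OF R.one_closed w[OF that]] wp[OF w[OF that]] u(1)[OF that] by simp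
          then show ?thesis using sweedler_closed[OF ps] by auto
        qed
        also have "add_list E \<dots> = D E h u" by (rule D_sweedler[OF ag ps u(2,3)])
        finally show ?thesis .
      qed
      have gz: "g x = \<zero>\<^bsub>E\<^esub>"
        if x: "x = add_list TA [tens \<one>\<^bsub>K\<^esub> (w a b). (a, b) \<leftarrow> ps] \<ominus>\<^bsub>TA\<^esub> add_list TA [tens \<one>\<^bsub>K\<^esub> (w' a b). (a, b) \<leftarrow> ps]"
          and ps: "sweedler K H \<Delta> h ps"
          and w: "\<And>a b. \<lbrakk>a \<in> carrier H; b \<in> carrier H\<rbrakk> \<Longrightarrow> set (w a b) \<subseteq> carrier H"
          and w': "\<And>a b. \<lbrakk>a \<in> carrier H; b \<in> carrier H\<rbrakk> \<Longrightarrow> set (w' a b) \<subseteq> carrier H"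
          and e: "g (add_list TA [tens \<one>\<^bsub>K\<^esub> (w a b). (a, b) \<leftarrow> ps]) = g (add_list TA [tens \<one>\<^bsub>K\<^esub> (w' a b). (a, b) \<leftarrow> ps])"
        for x h ps w w'
      proof -
        have "add_list TA [tens \<one>\<^bsub>K\<^esub> (w a b). (a, b) \<leftarrow> ps] \<in> carrier TA" "add_list TA [tens \<one>\<^bsub>K\<^esub> (w' a b). (a, b) \<leftarrow> ps] \<in> carrier TA"
          by (rule g.R.add_list_closed, rule list_closed[OF ps], rule tens_closed[OF R.one_closed], fact w w')+
        then show ?thesis using e by (simp add: x g.R.minus_eq E.M.r_neg)
      qed
      have "g x = \<zero>\<^bsub>E\<^esub>" if "x \<in> par_gens" for x
        using that unfolding par_gens_def
      proof (elim UnE CollectE exE conjE singletonE)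
        assume "x = tens \<one>\<^bsub>K\<^esub> [\<one>\<^bsub>H\<^esub>] \<ominus>\<^bsub>TA\<^esub> \<one>\<^bsub>TA\<^esub>"
        then show ?thesis
          using tens_closed[of "\<one>\<^bsub>K\<^esub>" "[\<one>\<^bsub>H\<^esub>]"] c\<pi>
          by (simp add: g.R.minus_eq gt word_prod_def partial_repD(2)[OF \<pi>] E.M.r_neg)
      next
        fix h k ps
        assume x: "x = add_list TA [tens \<one>\<^bsub>K\<^esub> [h, a, S b]. (a, b) \<leftarrow> ps] \<ominus>\<^bsub>TA\<^esub> add_list TA [tens \<one>\<^bsub>K\<^esub> [h \<cdot> a, S b]. (a, b) \<leftarrow> ps]"
          and h: "h \<in> carrier H" and ps: "sweedler K H \<Delta> k ps"
        have k: "k \<in> carrier H" using ps by (simp add: sweedler_def)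
        have "g (add_list TA [tens \<one>\<^bsub>K\<^esub> [h, a, S b]. (a, b) \<leftarrow> ps]) = D E k (\<lambda>a b. \<pi> h \<otimes>\<^bsub>E\<^esub> (\<pi> a \<otimes>\<^bsub>E\<^esub> \<pi> (S b)))"
          by (rule gl[OF ps]) ((simp add: h antipode_closed word_prod_def c\<pi>; fail) | (assumption | rule lins h)+)+
        moreover have "g (add_list TA [tens \<one>\<^bsub>K\<^esub> [h \<cdot> a, S b]. (a, b) \<leftarrow> ps]) = D E k (\<lambda>a b. \<pi> (h \<cdot> a) \<otimes>\<^bsub>E\<^esub> \<pi> (S b))"
          by (rule gl[OF ps]) ((simp add: h antipode_closed word_prod_def c\<pi>; fail) | (assumption | rule lins h)+)+
        ultimately show ?thesis
          using partial_repD(3)[OF \<pi> h k] by (intro gz[OF x ps]) (simp_all add: h antipode_closed)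
      next
        fix h k ps
        assume x: "x = add_list TA [tens \<one>\<^bsub>K\<^esub> [a, S b, k]. (a, b) \<leftarrow> ps] \<ominus>\<^bsub>TA\<^esub> add_list TA [tens \<one>\<^bsub>K\<^esub> [a, S b \<cdot> k]. (a, b) \<leftarrow> ps]"
          and k: "k \<in> carrier H" and ps: "sweedler K H \<Delta> h ps"
        have h: "h \<in> carrier H" using ps by (simp add: sweedler_def)
        have "g (add_list TA [tens \<one>\<^bsub>K\<^esub> [a, S b, k]. (a, b) \<leftarrow> ps]) = D E h (\<lambda>a b. \<pi> a \<otimes>\<^bsub>E\<^esub> (\<pi> (S b) \<otimes>\<^bsub>E\<^esub> \<pi> k))"
          by (rule gl[OF ps]) ((simp add: k antipode_closed word_prod_def c\<pi>; fail) | (assumption | rule lins k)+)+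
        moreover have "g (add_list TA [tens \<one>\<^bsub>K\<^esub> [a, S b \<cdot> k]. (a, b) \<leftarrow> ps]) = D E h (\<lambda>a b. \<pi> a \<otimes>\<^bsub>E\<^esub> \<pi> (S b \<cdot> k))"
          by (rule gl[OF ps]) ((simp add: k antipode_closed word_prod_def c\<pi>; fail) | (assumption | rule lins k)+)+
        ultimately show ?thesis
          using partial_repD(4)[OF \<pi> h k] by (intro gz[OF x ps]) (simp_all add: k antipode_closed)
      next
        fix h k ps
        assume x: "x = add_list TA [tens \<one>\<^bsub>K\<^esub> [h, S a, b]. (a, b) \<leftarrow> ps] \<ominus>\<^bsub>TA\<^esub> add_list TA [tens \<one>\<^bsub>K\<^esub> [h \<cdot> S a, b]. (a, b) \<leftarrow> ps]"
          and h: "h \<in> carrier H" and ps: "sweedler K H \<Delta> k ps"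
        have k: "k \<in> carrier H" using ps by (simp add: sweedler_def)
        have "g (add_list TA [tens \<one>\<^bsub>K\<^esub> [h, S a, b]. (a, b) \<leftarrow> ps]) = D E k (\<lambda>a b. \<pi> h \<otimes>\<^bsub>E\<^esub> (\<pi> (S a) \<otimes>\<^bsub>E\<^esub> \<pi> b))"
          by (rule gl[OF ps]) ((simp add: h antipode_closed word_prod_def c\<pi>; fail) | (assumption | rule lins h)+)+
        moreover have "g (add_list TA [tens \<one>\<^bsub>K\<^esub> [h \<cdot> S a, b]. (a, b) \<leftarrow> ps]) = D E k (\<lambda>a b. \<pi> (h \<cdot> S a) \<otimes>\<^bsub>E\<^esub> \<pi> b)"
          by (rule gl[OF ps]) ((simp add: h antipode_closed word_prod_def c\<pi>; fail) | (assumption | rule lins h)+)+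
        ultimately show ?thesis
          using partial_rep_antipode(1)[OF E \<pi> h k] by (intro gz[OF x ps]) (simp_all add: h antipode_closed)
      next
        fix h k ps
        assume x: "x = add_list TA [tens \<one>\<^bsub>K\<^esub> [S a, b, k]. (a, b) \<leftarrow> ps] \<ominus>\<^bsub>TA\<^esub> add_list TA [tens \<one>\<^bsub>K\<^esub> [S a, b \<cdot> k]. (a, b) \<leftarrow> ps]"
          and k: "k \<in> carrier H" and ps: "sweedler K H \<Delta> h ps"
        have h: "h \<in> carrier H" using ps by (simp add: sweedler_def)
        have "g (add_list TA [tens \<one>\<^bsub>K\<^esub> [S a, b, k]. (a, b) \<leftarrow> ps]) = D E h (\<lambda>a b. \<pi> (S a) \<otimes>\<^bsub>E\<^esub> (\<pi> b \<otimes>\<^bsub>E\<^esub> \<pi> k))"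
          by (rule gl[OF ps]) ((simp add: k antipode_closed word_prod_def c\<pi>; fail) | (assumption | rule lins k)+)+
        moreover have "g (add_list TA [tens \<one>\<^bsub>K\<^esub> [S a, b \<cdot> k]. (a, b) \<leftarrow> ps]) = D E h (\<lambda>a b. \<pi> (S a) \<otimes>\<^bsub>E\<^esub> \<pi> (b \<cdot> k))"
          by (rule gl[OF ps]) ((simp add: k antipode_closed word_prod_def c\<pi>; fail) | (assumption | rule lins k)+)+
        ultimately show ?thesis
          using partial_rep_antipode(2)[OF E \<pi> h k] by (intro gz[OF x ps]) (simp_all add: k antipode_closed)
      qed
      then show thesis
      proof (rule quotient_universal[OF TA_ring E.ring_axioms par_gens_closed g'])
        fix g2 assume g2: "g2 \<in> ring_hom (TA Quot Idl\<^bsub>TA\<^esub> par_gens) E"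
          and g2g: "\<And>x. x \<in> carrier TA \<Longrightarrow> g2 (Idl\<^bsub>TA\<^esub> par_gens +>\<^bsub>TA\<^esub> x) = g x"
        have m: "g2 (mon r w) = r \<odot>\<^bsub>E\<^esub> word_prod E \<pi> w" if "r \<in> carrier K" "set w \<subseteq> carrier H" for r w
          using g2g[OF tens_closed[OF that]] gt[OF that] by (simp add: par_monom_def par_ideal_eq)
        show thesis
        proof (rule that)
          show "g2 \<in> ring_hom A E" using g2 by (simp add: par_alg_def par_ideal_eq)
          show "g2 (mon r []) = r \<odot>\<^bsub>E\<^esub> \<one>\<^bsub>E\<^esub>" if "r \<in> carrier K" for r
            using m[OF that, of "[]"] by (simp add: word_prod_def)
          show "g2 (cl h) = \<pi> h" if "h \<in> carrier H" for h
            using m[of "\<one>\<^bsub>K\<^esub>" "[h]"] that c\<pi> by (simp add: word_prod_def cl_mon)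
        qed
      qed
    qed
  qed
qed

end

section \<open>Endomorphism algebras and modules of linear maps\<close>

text \<open>
  Functions vanish outside of the carrier, so that equality of endomorphisms is equality of
  functions; this also determines the unit.
\<close>

definition End_alg :: "('k, 's) ring_scheme \<Rightarrow> ('k, 'w, 'z) module_scheme \<Rightarrow> ('k, 'w \<Rightarrow> 'w) module"
  where "End_alg K W =
    \<lparr>carrier = {f. (\<forall>x\<in>carrier W. f x \<in> carrier W) \<and> (\<forall>x. x \<notin> carrier W \<longrightarrow> f x = \<zero>\<^bsub>W\<^esub>) \<and>
       (\<forall>x\<in>carrier W. \<forall>y\<in>carrier W. f (x \<oplus>\<^bsub>W\<^esub> y) = f x \<oplus>\<^bsub>W\<^esub> f y) \<and>
       (\<forall>r\<in>carrier K. \<forall>x\<in>carrier W. f (r \<odot>\<^bsub>W\<^esub> x) = r \<odot>\<^bsub>W\<^esub> f x)},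
     monoid.mult = (\<lambda>f g x. f (g x)), one = (\<lambda>x. if x \<in> carrier W then x else \<zero>\<^bsub>W\<^esub>),
     ring.zero = (\<lambda>x. \<zero>\<^bsub>W\<^esub>), ring.add = (\<lambda>f g x. f x \<oplus>\<^bsub>W\<^esub> g x), smult = (\<lambda>r f x. r \<odot>\<^bsub>W\<^esub> f x)\<rparr>"

lemma End_alg_simps:
  "f \<in> carrier (End_alg K W) \<longleftrightarrow> (\<forall>x\<in>carrier W. f x \<in> carrier W) \<and> (\<forall>x. x \<notin> carrier W \<longrightarrow> f x = \<zero>\<^bsub>W\<^esub>) \<and>
       (\<forall>x\<in>carrier W. \<forall>y\<in>carrier W. f (x \<oplus>\<^bsub>W\<^esub> y) = f x \<oplus>\<^bsub>W\<^esub> f y) \<and>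
       (\<forall>r\<in>carrier K. \<forall>x\<in>carrier W. f (r \<odot>\<^bsub>W\<^esub> x) = r \<odot>\<^bsub>W\<^esub> f x)"
  "f \<otimes>\<^bsub>End_alg K W\<^esub> g = (\<lambda>x. f (g x))"
  "\<one>\<^bsub>End_alg K W\<^esub> = (\<lambda>x. if x \<in> carrier W then x else \<zero>\<^bsub>W\<^esub>)"
  "\<zero>\<^bsub>End_alg K W\<^esub> = (\<lambda>x. \<zero>\<^bsub>W\<^esub>)"
  "f \<oplus>\<^bsub>End_alg K W\<^esub> g = (\<lambda>x. f x \<oplus>\<^bsub>W\<^esub> g x)"
  "r \<odot>\<^bsub>End_alg K W\<^esub> f = (\<lambda>x. r \<odot>\<^bsub>W\<^esub> f x)"
  by (simp_all add: End_alg_def)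

context Module.module
begin

lemma End_zero:
  assumes "f \<in> carrier (End_alg R M)"
  shows "f \<zero>\<^bsub>M\<^esub> = \<zero>\<^bsub>M\<^esub>"
proof -
  have "\<forall>r\<in>carrier R. \<forall>x\<in>carrier M. f (r \<odot>\<^bsub>M\<^esub> x) = r \<odot>\<^bsub>M\<^esub> f x" "f \<zero>\<^bsub>M\<^esub> \<in> carrier M"
    using assms by (auto simp: End_alg_simps)
  from this(1)[rule_format, of \<zero> "\<zero>\<^bsub>M\<^esub>"] this(2) show ?thesis by simp
qed

lemma End_closed: "f \<in> carrier (End_alg R M) \<Longrightarrow> f x \<in> carrier M"
  by (cases "x \<in> carrier M") (auto simp: End_alg_simps)

lemma End_algebra: "k_algebra R (End_alg R M)"
proof -
  let ?E = "End_alg R M"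
  have add: "f \<oplus>\<^bsub>?E\<^esub> g \<in> carrier ?E" if "f \<in> carrier ?E" "g \<in> carrier ?E" for f g
    using that by (auto simp: End_alg_simps M.a_ac smult_r_distr)
  have smult_comm: "r \<odot>\<^bsub>M\<^esub> (s \<odot>\<^bsub>M\<^esub> x) = s \<odot>\<^bsub>M\<^esub> (r \<odot>\<^bsub>M\<^esub> x)" if "r \<in> carrier R" "s \<in> carrier R" "x \<in> carrier M" for r s x
    using that by (simp add: smult_assoc1[symmetric] m_comm)
  have smult: "r \<odot>\<^bsub>?E\<^esub> f \<in> carrier ?E" if "r \<in> carrier R" "f \<in> carrier ?E" for r f
    using that by (auto simp: End_alg_simps smult_r_distr smult_comm)
  have neg: "(\<lambda>x. \<ominus>\<^bsub>M\<^esub> f x) \<in> carrier ?E" if "f \<in> carrier ?E" for f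
    using that smult_r_minus by (auto simp: End_alg_simps M.minus_add M.a_comm)
  have ag: "abelian_group ?E"
  proof (rule abelian_groupI)
    fix f g assume fg: "f \<in> carrier ?E" "g \<in> carrier ?E"
    then show "f \<oplus>\<^bsub>?E\<^esub> g \<in> carrier ?E" by (rule add)
    show "f \<oplus>\<^bsub>?E\<^esub> g = g \<oplus>\<^bsub>?E\<^esub> f"
      using End_closed[OF fg(1)] End_closed[OF fg(2)] by (simp add: End_alg_simps M.a_comm)
  next
    fix f g h assume "f \<in> carrier ?E" "g \<in> carrier ?E" "h \<in> carrier ?E"
    then show "f \<oplus>\<^bsub>?E\<^esub> g \<oplus>\<^bsub>?E\<^esub> h = f \<oplus>\<^bsub>?E\<^esub> (g \<oplus>\<^bsub>?E\<^esub> h)"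
      by (simp add: End_alg_simps(5) M.a_assoc End_closed)
  next
    fix f assume f: "f \<in> carrier ?E"
    then show "\<zero>\<^bsub>?E\<^esub> \<oplus>\<^bsub>?E\<^esub> f = f" by (simp add: End_alg_simps(4,5) End_closed)
    show "\<exists>g\<in>carrier ?E. g \<oplus>\<^bsub>?E\<^esub> f = \<zero>\<^bsub>?E\<^esub>"
      using neg[OF f] End_closed[OF f] by (intro bexI[of _ "\<lambda>x. \<ominus>\<^bsub>M\<^esub> f x"]) (simp_all add: End_alg_simps(4,5) M.l_neg)
  qed (simp add: End_alg_simps)
  have ring: "ring ?E"
  proof (rule ringI[OF ag])
    show "Group.monoid ?E"
    proof (rule monoidI)
      fix f g assume fg: "f \<in> carrier ?E" "g \<in> carrier ?E"
      then show "f \<otimes>\<^bsub>?E\<^esub> g \<in> carrier ?E" using End_zero[OF fg(1)] by (simp add: End_alg_simps)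
    next
      fix f assume f: "f \<in> carrier ?E"
      then show "\<one>\<^bsub>?E\<^esub> \<otimes>\<^bsub>?E\<^esub> f = f" by (simp add: End_alg_simps(2,3) End_closed)
      show "f \<otimes>\<^bsub>?E\<^esub> \<one>\<^bsub>?E\<^esub> = f"
        using End_zero[OF f] f by (auto simp: End_alg_simps)
    qed (auto simp: End_alg_simps)
    fix f g h assume "f \<in> carrier ?E" "g \<in> carrier ?E" "h \<in> carrier ?E"
    then show "(f \<oplus>\<^bsub>?E\<^esub> g) \<otimes>\<^bsub>?E\<^esub> h = f \<otimes>\<^bsub>?E\<^esub> h \<oplus>\<^bsub>?E\<^esub> g \<otimes>\<^bsub>?E\<^esub> h" "h \<otimes>\<^bsub>?E\<^esub> (f \<oplus>\<^bsub>?E\<^esub> g) = h \<otimes>\<^bsub>?E\<^esub> f \<oplus>\<^bsub>?E\<^esub> h \<otimes>\<^bsub>?E\<^esub> g"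
      using End_closed[of f] End_closed[of g] by (auto simp: End_alg_simps)
  qed
  have "Module.module R ?E"
    by (rule moduleI[OF R.is_cring ag])
      (auto simp: smult, auto simp: End_alg_simps(5,6) End_closed smult_l_distr smult_r_distr smult_assoc1)
  moreover have "k_algebra_axioms R ?E"
    using End_closed by (auto simp: k_algebra_axioms_def End_alg_simps)
  ultimately show ?thesis using ring by (simp add: k_algebra_def)
qed

end

context cocommutative_hopf
begin

text \<open>
  The module of \<open>K\<close>-linear maps on \<open>H\<close>, again normalized to zero outside of the carrier.
\<close>

definition LinH :: "('k, 'g, 'z) module_scheme \<Rightarrow> ('k, 'h \<Rightarrow> 'g) module"
  where "LinH G = \<lparr>carrier = {f. lin G f \<and> (\<forall>x. x \<notin> carrier H \<longrightarrow> f x = \<zero>\<^bsub>G\<^esub>)},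
    monoid.mult = undefined, one = undefined, ring.zero = (\<lambda>x. \<zero>\<^bsub>G\<^esub>),
    ring.add = (\<lambda>f g x. f x \<oplus>\<^bsub>G\<^esub> g x), smult = (\<lambda>r f x. r \<odot>\<^bsub>G\<^esub> f x)\<rparr>"

lemma LinH_simps:
  "f \<in> carrier (LinH G) \<longleftrightarrow> lin G f \<and> (\<forall>x. x \<notin> carrier H \<longrightarrow> f x = \<zero>\<^bsub>G\<^esub>)"
  "\<zero>\<^bsub>LinH G\<^esub> = (\<lambda>x. \<zero>\<^bsub>G\<^esub>)"
  "f \<oplus>\<^bsub>LinH G\<^esub> g = (\<lambda>x. f x \<oplus>\<^bsub>G\<^esub> g x)"
  "r \<odot>\<^bsub>LinH G\<^esub> f = (\<lambda>x. r \<odot>\<^bsub>G\<^esub> f x)"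
  by (simp_all add: LinH_def)

lemma LinH_module:
  assumes G: "Module.module K G"
  shows "Module.module K (LinH G)"
proof -
  interpret G: Module.module K G by fact
  let ?W = "LinH G"
  have c: "f x \<in> carrier G" if "f \<in> carrier ?W" for f x
    using that linD(1)[of G f x] by (cases "x \<in> carrier H") (auto simp: LinH_simps)
  have smult_comm: "r \<odot>\<^bsub>G\<^esub> (s \<odot>\<^bsub>G\<^esub> x) = s \<odot>\<^bsub>G\<^esub> (r \<odot>\<^bsub>G\<^esub> x)" if "r \<in> carrier K" "s \<in> carrier K" "x \<in> carrier G" for r s x
    using that by (simp add: G.smult_assoc1[symmetric] m_comm)
  have smult: "r \<odot>\<^bsub>?W\<^esub> f \<in> carrier ?W" if "r \<in> carrier K" "f \<in> carrier ?W" for r f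
    using that c by (auto simp: LinH_simps lin_def G.smult_r_distr smult_comm)
  have ag: "abelian_group ?W"
  proof (rule abelian_groupI)
    fix f g assume fg: "f \<in> carrier ?W" "g \<in> carrier ?W"
    then show "f \<oplus>\<^bsub>?W\<^esub> g \<in> carrier ?W"
      using c by (auto simp: LinH_simps lin_def G.M.a_ac G.smult_r_distr)
    show "f \<oplus>\<^bsub>?W\<^esub> g = g \<oplus>\<^bsub>?W\<^esub> f" using c fg by (simp add: LinH_simps G.M.a_comm)
  next
    fix f g h assume "f \<in> carrier ?W" "g \<in> carrier ?W" "h \<in> carrier ?W"
    then show "f \<oplus>\<^bsub>?W\<^esub> g \<oplus>\<^bsub>?W\<^esub> h = f \<oplus>\<^bsub>?W\<^esub> (g \<oplus>\<^bsub>?W\<^esub> h)" using c by (simp add: LinH_simps(3) G.M.a_assoc)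
  next
    fix f assume f: "f \<in> carrier ?W"
    then show "\<zero>\<^bsub>?W\<^esub> \<oplus>\<^bsub>?W\<^esub> f = f" using c by (simp add: LinH_simps(2,3))
    have "(\<lambda>x. \<ominus>\<^bsub>G\<^esub> f x) \<in> carrier ?W"
      using f c G.smult_r_minus by (auto simp: LinH_simps lin_def G.M.minus_add G.M.a_comm)
    then show "\<exists>g\<in>carrier ?W. g \<oplus>\<^bsub>?W\<^esub> f = \<zero>\<^bsub>?W\<^esub>"
      using c[OF f] by (intro bexI[of _ "\<lambda>x. \<ominus>\<^bsub>G\<^esub> f x"]) (simp_all add: LinH_simps(2,3) G.M.l_neg)
  qed (auto simp: LinH_simps intro: linI)
  show ?thesis
    by (rule moduleI[OF R.is_cring ag])
      (auto simp: smult, auto simp: LinH_simps(3,4) c G.smult_l_distr G.smult_r_distr G.smult_assoc1)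
qed

abbreviation W where "W \<equiv> LinH PA"
abbreviation EW where "EW \<equiv> End_alg K W"

lemma PA_module: "Module.module K PA"
  by (rule k_algebra_module[OF PA_algebra])

lemma PA_abelian: "abelian_group PA"
  by (rule module_abelian_group[OF PA_module])

lemma W_module: "Module.module K W"
  by (rule LinH_module[OF PA_module])

lemma EW_algebra: "k_algebra K EW"
  by (rule module.End_algebra[OF W_module])

lemma W_closed: "f \<in> carrier W \<Longrightarrow> f x \<in> carrier A"
  using linD(1)[of PA f x] A_ring by (cases "x \<in> carrier H") (auto simp: LinH_simps ring.ring_simprules)

lemma W_lin: "f \<in> carrier W \<Longrightarrow> lin PA f"
  by (simp add: LinH_simps)

lemma W_eqI: "\<lbrakk>f \<in> carrier W; g \<in> carrier W; \<And>x. x \<in> carrier H \<Longrightarrow> f x = g x\<rbrakk> \<Longrightarrow> f = g"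
proof (rule ext)
  fix x assume "f \<in> carrier W" "g \<in> carrier W" "\<And>x. x \<in> carrier H \<Longrightarrow> f x = g x"
  then show "f x = g x" by (cases "x \<in> carrier H") (simp_all add: LinH_simps)
qed

lemma EW_closed: "p \<in> carrier EW \<Longrightarrow> p f \<in> carrier W"
  by (rule module.End_closed[OF W_module])

lemma EW_eqI:
  assumes "p \<in> carrier EW" "q \<in> carrier EW"
    and "\<And>f x. \<lbrakk>f \<in> carrier W; x \<in> carrier H\<rbrakk> \<Longrightarrow> p f x = q f x"
  shows "p = q"
proof
  fix f
  show "p f = q f"
  proof (cases "f \<in> carrier W")
    case True
    then show ?thesis using assms EW_closed by (intro W_eqI) auto
  next
    case False
    then show ?thesis using assms by (simp add: End_alg_simps(1))
  qed
qed

lemma D_EW: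
  assumes f: "f \<in> carrier W" and x: "x \<in> carrier H"
    and p: "\<And>a b. \<lbrakk>a \<in> carrier H; b \<in> carrier H\<rbrakk> \<Longrightarrow> p a b \<in> carrier EW"
  shows "D EW h p f x = D PA h (\<lambda>a b. p a b f x)"
proof -
  have "abelian_group_hom EW PA (\<lambda>p. p f x)"
    using EW_closed[of _ f] W_closed
    by (intro abelian_group_homI module_abelian_group[OF k_algebra_module[OF EW_algebra]] PA_abelian)
      (auto simp: End_alg_simps(5) LinH_simps(3))
  from D_hom[OF this p] show ?thesis .
qed

text \<open>
  Turns a formula on linear maps into a normalized endomorphism.
\<close>

definition wrapW :: "(('h \<Rightarrow> ('h list \<Rightarrow> 'k) set set) \<Rightarrow> 'h \<Rightarrow> ('h list \<Rightarrow> 'k) set set) \<Rightarrow>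
    ('h \<Rightarrow> ('h list \<Rightarrow> 'k) set set) \<Rightarrow> 'h \<Rightarrow> ('h list \<Rightarrow> 'k) set set"
  where "wrapW p f = (if f \<in> carrier W then (\<lambda>x. if x \<in> carrier H then p f x else \<zero>\<^bsub>A\<^esub>) else (\<lambda>x. \<zero>\<^bsub>A\<^esub>))"

lemma wrapW_apply [simp]: "\<lbrakk>f \<in> carrier W; x \<in> carrier H\<rbrakk> \<Longrightarrow> wrapW p f x = p f x"
  by (simp add: wrapW_def)

lemma wrapW_closed:
  assumes lin: "\<And>f. f \<in> carrier W \<Longrightarrow> lin PA (p f)"
    and add: "\<And>f g x. \<lbrakk>f \<in> carrier W; g \<in> carrier W; x \<in> carrier H\<rbrakk> \<Longrightarrow> p (f \<oplus>\<^bsub>W\<^esub> g) x = p f x \<oplus>\<^bsub>A\<^esub> p g x"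
    and sm: "\<And>r f x. \<lbrakk>r \<in> carrier K; f \<in> carrier W; x \<in> carrier H\<rbrakk> \<Longrightarrow> p (r \<odot>\<^bsub>W\<^esub> f) x = r \<star> p f x"
  shows "wrapW p \<in> carrier EW"
proof -
  interpret W: Module.module K W by (rule W_module)
  interpret P: Module.module K PA by (rule PA_module)
  have "wrapW p f \<in> carrier W" if "f \<in> carrier W" for f
    using lin[OF that] that by (auto simp: LinH_simps wrapW_def lin_def Pi_iff)
  moreover have "wrapW p (f \<oplus>\<^bsub>W\<^esub> g) = wrapW p f \<oplus>\<^bsub>W\<^esub> wrapW p g" if "f \<in> carrier W" "g \<in> carrier W" for f g
  proof (rule ext)
    fix x
    have "wrapW p (f \<oplus>\<^bsub>W\<^esub> g) x = wrapW p f x \<oplus>\<^bsub>PA\<^esub> wrapW p g x"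
      using add[OF that, of x] W.M.a_closed[OF that] that P.M.l_zero[OF P.M.zero_closed]
      by (cases "x \<in> carrier H") (simp_all add: wrapW_def del: LinH_simps)
    then show "wrapW p (f \<oplus>\<^bsub>W\<^esub> g) x = (wrapW p f \<oplus>\<^bsub>W\<^esub> wrapW p g) x" by (simp add: LinH_simps(3))
  qed
  moreover have "wrapW p (r \<odot>\<^bsub>W\<^esub> f) = r \<odot>\<^bsub>W\<^esub> wrapW p f" if "r \<in> carrier K" "f \<in> carrier W" for r f
  proof (rule ext)
    fix x
    have "wrapW p (r \<odot>\<^bsub>W\<^esub> f) x = r \<star> wrapW p f x"
      using sm[OF that, of x] W.smult_closed[OF that] that P.smult_r_null[OF that(1)]
      by (cases "x \<in> carrier H") (simp_all add: wrapW_def)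
    then show "wrapW p (r \<odot>\<^bsub>W\<^esub> f) x = (r \<odot>\<^bsub>W\<^esub> wrapW p f) x" by (simp add: LinH_simps(4))
  qed
  ultimately show ?thesis
    unfolding End_alg_simps(1) by (auto simp: wrapW_def LinH_simps(2))
qed

end

section \<open>The representation on linear maps\<close>

context cocommutative_hopf
begin

\<comment> \<open>Scalars are treated by the module laws from here on.\<close>
declare PA_simps(6) [simp del]

lemmas PA_mult_left = D_mult_left[OF PA_algebra, unfolded PA_simps(1,2)]
  and PA_mult_right = D_mult_right[OF PA_algebra, unfolded PA_simps(1,2)]
  and lin_PA_mult_left = lin_mult_left[OF PA_algebra, unfolded PA_simps(1,2)]
  and lin_PA_mult_right = lin_mult_right[OF PA_algebra, unfolded PA_simps(1,2)]
  and PA_smult_closed = module_smult_closed[OF PA_module, unfolded PA_simps(1)]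
  and D_PA_closed = D_closed[OF PA_abelian, unfolded PA_simps(1)]
  and lin_PA_counit_smult = lin_counit_smult[OF PA_module, unfolded PA_simps(1)]
  and linD_PA = linD[where G = PA, unfolded PA_simps]
  and cl_lin = lin_comp[OF lin_cl]

lemma A_m_closed: "\<lbrakk>x \<in> carrier A; y \<in> carrier A\<rbrakk> \<Longrightarrow> x \<bullet> y \<in> carrier A"
  using A_ring by (simp add: ring.ring_simprules)

lemmas [lins] = PA_algebra PA_module PA_abelian lin_PA_mult_left lin_PA_mult_right lin_PA_counit_smult
  PA_smult_closed D_PA_closed cl_lin cl_closed A_m_closed

lemma cl_one: "cl \<one>\<^bsub>H\<^esub> = \<one>\<^bsub>A\<^esub>"
  using partial_repD(2)[OF partial_rep_cl] by simp

lemmas cl_rel1 = partial_repD(3)[OF partial_rep_cl, unfolded PA_simps(2)]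
  and cl_rel2 = partial_repD(4)[OF partial_rep_cl, unfolded PA_simps(2)]

text \<open>
  Three partial representations on the linear maps \<open>H \<rightarrow> A\<close>. They commute pairwise, as the first two
  act on values from opposite sides and the third one acts on arguments.
\<close>

definition L_op where "L_op h = wrapW (\<lambda>f x. cl h \<bullet> f x)"
definition R_op where "R_op h = wrapW (\<lambda>f x. f x \<bullet> cl (S h))"
definition M_op where "M_op h = wrapW (\<lambda>f x. f (x \<cdot> h))"

lemma W_add: "(f \<oplus>\<^bsub>W\<^esub> g) x = f x \<oplus>\<^bsub>A\<^esub> g x"
  and W_smult: "(r \<odot>\<^bsub>W\<^esub> f) x = r \<star> f x"
  by (simp_all add: LinH_simps)

lemma L_op_closed: "h \<in> carrier H \<Longrightarrow> L_op h \<in> carrier EW"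
  unfolding L_op_def
proof (rule wrapW_closed)
  interpret A: ring A by (rule A_ring)
  interpret P: k_algebra K PA by (rule PA_algebra)
  assume h: "h \<in> carrier H"
  show "lin PA (\<lambda>x. cl h \<bullet> f x)" if "f \<in> carrier W" for f
    using W_lin[OF that] h by - (assumption | rule lins)+
  show "cl h \<bullet> (f \<oplus>\<^bsub>W\<^esub> g) x = cl h \<bullet> f x \<oplus>\<^bsub>A\<^esub> cl h \<bullet> g x"
    if "f \<in> carrier W" "g \<in> carrier W" "x \<in> carrier H" for f g x
    using that h by (simp add: W_add A.r_distr W_closed cl_closed)
  show "cl h \<bullet> (r \<odot>\<^bsub>W\<^esub> f) x = r \<star> (cl h \<bullet> f x)"
    if "r \<in> carrier K" "f \<in> carrier W" "x \<in> carrier H" for r f x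
    using that h P.smult_mult_right[of r "cl h" "f x"] by (simp add: W_smult W_closed cl_closed)
qed

lemma R_op_closed: "h \<in> carrier H \<Longrightarrow> R_op h \<in> carrier EW"
  unfolding R_op_def
proof (rule wrapW_closed)
  interpret A: ring A by (rule A_ring)
  interpret P: k_algebra K PA by (rule PA_algebra)
  assume h: "h \<in> carrier H"
  show "lin PA (\<lambda>x. f x \<bullet> cl (S h))" if "f \<in> carrier W" for f
    using W_lin[OF that] h by - (assumption | rule lins)+
  show "(f \<oplus>\<^bsub>W\<^esub> g) x \<bullet> cl (S h) = f x \<bullet> cl (S h) \<oplus>\<^bsub>A\<^esub> g x \<bullet> cl (S h)"
    if "f \<in> carrier W" "g \<in> carrier W" "x \<in> carrier H" for f g x
    using that h by (simp add: W_add A.l_distr W_closed cl_closed antipode_closed)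
  show "(r \<odot>\<^bsub>W\<^esub> f) x \<bullet> cl (S h) = r \<star> (f x \<bullet> cl (S h))"
    if "r \<in> carrier K" "f \<in> carrier W" "x \<in> carrier H" for r f x
    using that h P.smult_mult_left[of r "f x" "cl (S h)"] by (simp add: W_smult W_closed cl_closed antipode_closed)
qed

lemma M_op_closed: "h \<in> carrier H \<Longrightarrow> M_op h \<in> carrier EW"
  unfolding M_op_def
proof (rule wrapW_closed)
  assume h: "h \<in> carrier H"
  show "lin PA (\<lambda>x. f (x \<cdot> h))" if "f \<in> carrier W" for f
    using h by - (rule lin_comp[OF W_lin[OF that]], (assumption | rule lins)+)
qed (auto simp: W_add W_smult)

lemma linEW_I:
  assumes "\<And>h. h \<in> carrier H \<Longrightarrow> p h \<in> carrier EW"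
    and "\<And>f x. \<lbrakk>f \<in> carrier W; x \<in> carrier H\<rbrakk> \<Longrightarrow> lin PA (\<lambda>h. p h f x)"
  shows "lin EW p"
proof -
  interpret E: k_algebra K EW by (rule EW_algebra)
  show ?thesis
  proof (rule linI)
    fix h k assume hk: "h \<in> carrier H" "k \<in> carrier H"
    show "p (h \<oplus>\<^bsub>H\<^esub> k) = p h \<oplus>\<^bsub>EW\<^esub> p k"
    proof (rule EW_eqI)
      show "p (h \<oplus>\<^bsub>H\<^esub> k) f x = (p h \<oplus>\<^bsub>EW\<^esub> p k) f x" if "f \<in> carrier W" "x \<in> carrier H" for f x
        using linD_PA(2)[OF assms(2)[OF that] hk] by (simp add: End_alg_simps(5) W_add)
    qed (use assms(1) hk in auto)
  next
    fix r h assume rh: "r \<in> carrier K" "h \<in> carrier H"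
    show "p (r \<odot>\<^bsub>H\<^esub> h) = r \<odot>\<^bsub>EW\<^esub> p h"
    proof (rule EW_eqI)
      show "p (r \<odot>\<^bsub>H\<^esub> h) f x = (r \<odot>\<^bsub>EW\<^esub> p h) f x" if "f \<in> carrier W" "x \<in> carrier H" for f x
        using linD(3)[OF assms(2)[OF that] rh] by (simp add: End_alg_simps(6) W_smult)
    qed (use assms(1) rh in auto)
  qed (rule assms(1))
qed

lemma L_op_apply: "\<lbrakk>f \<in> carrier W; x \<in> carrier H\<rbrakk> \<Longrightarrow> L_op h f x = cl h \<bullet> f x"
  and R_op_apply: "\<lbrakk>f \<in> carrier W; x \<in> carrier H\<rbrakk> \<Longrightarrow> R_op h f x = f x \<bullet> cl (S h)"
  and M_op_apply: "\<lbrakk>f \<in> carrier W; x \<in> carrier H\<rbrakk> \<Longrightarrow> M_op h f x = f (x \<cdot> h)"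
  by (simp_all add: L_op_def R_op_def M_op_def)

lemma EW_one_apply: "f \<in> carrier W \<Longrightarrow> \<one>\<^bsub>EW\<^esub> f = f"
  by (simp add: End_alg_simps(3))

lemma EW_mult_apply: "(p \<otimes>\<^bsub>EW\<^esub> q) f = p (q f)"
  by (simp add: End_alg_simps(2))

text \<open>
  Endomorphisms agree if they agree on all linear maps at all points.
\<close>

lemma partial_rep_EW_I:
  assumes lin: "lin EW p" and one: "\<And>f x. \<lbrakk>f \<in> carrier W; x \<in> carrier H\<rbrakk> \<Longrightarrow> p \<one>\<^bsub>H\<^esub> f x = f x"
    and rel1: "\<And>h k f x. \<lbrakk>h \<in> carrier H; k \<in> carrier H; f \<in> carrier W; x \<in> carrier H\<rbrakk> \<Longrightarrow>
      D PA k (\<lambda>a b. p h (p a (p (S b) f)) x) = D PA k (\<lambda>a b. p (h \<cdot> a) (p (S b) f) x)"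
    and rel2: "\<And>h k f x. \<lbrakk>h \<in> carrier H; k \<in> carrier H; f \<in> carrier W; x \<in> carrier H\<rbrakk> \<Longrightarrow>
      D PA h (\<lambda>a b. p a (p (S b) (p k f)) x) = D PA h (\<lambda>a b. p a (p (S b \<cdot> k) f) x)"
  shows "partial_rep EW p"
proof -
  interpret E: k_algebra K EW by (rule EW_algebra)
  note c = linD(1)[OF lin]
  have Dc: "D EW h q \<in> carrier EW" if "\<And>a b. \<lbrakk>a \<in> carrier H; b \<in> carrier H\<rbrakk> \<Longrightarrow> q a b \<in> carrier EW" for h q
    by (rule D_closed[OF E.M.abelian_group_axioms that])
  show ?thesis
    unfolding partial_rep_def
  proof (intro conjI ballI lin)
    show "p \<one>\<^bsub>H\<^esub> = \<one>\<^bsub>EW\<^esub>"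
      by (rule EW_eqI) (auto simp: c one EW_one_apply)
    show "D EW k (\<lambda>a b. p h \<otimes>\<^bsub>EW\<^esub> (p a \<otimes>\<^bsub>EW\<^esub> p (S b))) = D EW k (\<lambda>a b. p (h \<cdot> a) \<otimes>\<^bsub>EW\<^esub> p (S b))"
      if "h \<in> carrier H" "k \<in> carrier H" for h k
      by (rule EW_eqI) (use that in \<open>simp_all add: Dc c antipode_closed D_EW EW_mult_apply rel1\<close>)
    show "D EW h (\<lambda>a b. p a \<otimes>\<^bsub>EW\<^esub> (p (S b) \<otimes>\<^bsub>EW\<^esub> p k)) = D EW h (\<lambda>a b. p a \<otimes>\<^bsub>EW\<^esub> p (S b \<cdot> k))"
      if "h \<in> carrier H" "k \<in> carrier H" for h k
      by (rule EW_eqI) (use that in \<open>simp_all add: Dc c antipode_closed D_EW EW_mult_apply rel2\<close>)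
  qed
qed

lemma partial_rep_L: "partial_rep EW L_op"
proof (rule partial_rep_EW_I)
  interpret A: ring A by (rule A_ring)
  show "lin EW L_op"
  proof (rule linEW_I[OF L_op_closed])
    fix f x assume fx: "f \<in> carrier W" "x \<in> carrier H"
    show "lin PA (\<lambda>h. L_op h f x)"
      unfolding L_op_apply[OF fx] by (assumption | rule lins W_closed fx)+
  qed
  show "L_op \<one>\<^bsub>H\<^esub> f x = f x" if "f \<in> carrier W" "x \<in> carrier H" for f x
    using that by (simp add: L_op_apply cl_one W_closed)
  note appl = L_op_apply EW_closed[OF L_op_closed]
  fix h k f x assume h: "h \<in> carrier H" and k: "k \<in> carrier H" and f: "f \<in> carrier W" and x: "x \<in> carrier H"
  have c: "f x \<in> carrier A" by (rule W_closed[OF f])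
  have "D PA k (\<lambda>a b. L_op h (L_op a (L_op (S b) f)) x) = D PA k (\<lambda>a b. (cl h \<bullet> (cl a \<bullet> cl (S b))) \<bullet> f x)"
    using h f x c by (simp add: appl antipode_closed A.m_assoc cl_closed)
  also have "\<dots> = D PA k (\<lambda>a b. cl (h \<cdot> a) \<bullet> cl (S b)) \<bullet> f x"
    unfolding cl_rel1[OF h k, symmetric] by (rule PA_mult_right) (assumption | rule lins h c)+
  also have "\<dots> = D PA k (\<lambda>a b. cl (h \<cdot> a) \<bullet> cl (S b) \<bullet> f x)"
    by (rule PA_mult_right[symmetric]) (assumption | rule lins h c)+
  finally show "D PA k (\<lambda>a b. L_op h (L_op a (L_op (S b) f)) x) = D PA k (\<lambda>a b. L_op (h \<cdot> a) (L_op (S b) f) x)"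
    using h f x c by (simp add: appl antipode_closed A.m_assoc cl_closed)
  have "D PA h (\<lambda>a b. L_op a (L_op (S b) (L_op k f)) x) = D PA h (\<lambda>a b. (cl a \<bullet> (cl (S b) \<bullet> cl k)) \<bullet> f x)"
    using k f x c by (simp add: appl antipode_closed A.m_assoc cl_closed)
  also have "\<dots> = D PA h (\<lambda>a b. cl a \<bullet> cl (S b \<cdot> k)) \<bullet> f x"
    unfolding cl_rel2[OF h k, symmetric] by (rule PA_mult_right) (assumption | rule lins k c)+
  also have "\<dots> = D PA h (\<lambda>a b. cl a \<bullet> cl (S b \<cdot> k) \<bullet> f x)"
    by (rule PA_mult_right[symmetric]) (assumption | rule lins k c)+
  finally show "D PA h (\<lambda>a b. L_op a (L_op (S b) (L_op k f)) x) = D PA h (\<lambda>a b. L_op a (L_op (S b \<cdot> k) f) x)"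
    using k f x c by (simp add: appl antipode_closed A.m_assoc cl_closed)
qed

text \<open>
  Right multiplication reverses products, and so does \<open>S\<close>. After exchanging the legs of \<open>k\<close> by
  cocommutativity, either relation for \<^const>\<open>R_op\<close> is the other relation for \<open>[\<cdot>]\<close>.
\<close>

lemma partial_rep_R: "partial_rep EW R_op"
proof (rule partial_rep_EW_I)
  interpret A: ring A by (rule A_ring)
  show "lin EW R_op"
  proof (rule linEW_I[OF R_op_closed])
    fix f x assume fx: "f \<in> carrier W" "x \<in> carrier H"
    show "lin PA (\<lambda>h. R_op h f x)"
      unfolding R_op_apply[OF fx] by (assumption | rule lins W_closed fx)+
  qed
  show "R_op \<one>\<^bsub>H\<^esub> f x = f x" if "f \<in> carrier W" "x \<in> carrier H" for f x
    using that by (simp add: R_op_apply cl_one antipode_one W_closed)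
  note appl = R_op_apply EW_closed[OF R_op_closed]
  fix h k f x assume h: "h \<in> carrier H" and k: "k \<in> carrier H" and f: "f \<in> carrier W" and x: "x \<in> carrier H"
  have c: "f x \<in> carrier A" by (rule W_closed[OF f])
  have "D PA k (\<lambda>a b. R_op h (R_op a (R_op (S b) f)) x) = D PA k (\<lambda>a b. f x \<bullet> (cl b \<bullet> (cl (S a) \<bullet> cl (S h))))"
    using h f x c by (simp add: appl antipode_closed A.m_assoc cl_closed antipode_antipode)
  also have "\<dots> = f x \<bullet> D PA k (\<lambda>a b. cl b \<bullet> (cl (S a) \<bullet> cl (S h)))"
    by (rule PA_mult_left) (assumption | rule lins h c)+
  also have "D PA k (\<lambda>a b. cl b \<bullet> (cl (S a) \<bullet> cl (S h))) = D PA k (\<lambda>b a. cl b \<bullet> (cl (S a) \<bullet> cl (S h)))"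
    by (rule D_cocomm) (assumption | rule lins h)+
  also have "\<dots> = D PA k (\<lambda>b a. cl b \<bullet> cl (S a \<cdot> S h))"
    by (rule cl_rel2[OF k antipode_closed[OF h]])
  also have "\<dots> = D PA k (\<lambda>a b. cl b \<bullet> cl (S a \<cdot> S h))"
    by (rule D_cocomm) (assumption | rule lins h)+
  also have "f x \<bullet> \<dots> = D PA k (\<lambda>a b. f x \<bullet> (cl b \<bullet> cl (S a \<cdot> S h)))"
    by (rule PA_mult_left[symmetric]) (assumption | rule lins h c)+
  finally show "D PA k (\<lambda>a b. R_op h (R_op a (R_op (S b) f)) x) = D PA k (\<lambda>a b. R_op (h \<cdot> a) (R_op (S b) f) x)"
    using h f x c by (simp add: appl antipode_closed A.m_assoc cl_closed antipode_antipode antipode_mult)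
  have "D PA h (\<lambda>a b. R_op a (R_op (S b) (R_op k f)) x) = D PA h (\<lambda>a b. f x \<bullet> (cl (S k) \<bullet> (cl b \<bullet> cl (S a))))"
    using k f x c by (simp add: appl antipode_closed A.m_assoc cl_closed antipode_antipode)
  also have "\<dots> = f x \<bullet> D PA h (\<lambda>a b. cl (S k) \<bullet> (cl b \<bullet> cl (S a)))"
    by (rule PA_mult_left) (assumption | rule lins k c)+
  also have "D PA h (\<lambda>a b. cl (S k) \<bullet> (cl b \<bullet> cl (S a))) = D PA h (\<lambda>b a. cl (S k) \<bullet> (cl b \<bullet> cl (S a)))"
    by (rule D_cocomm) (assumption | rule lins k)+
  also have "\<dots> = D PA h (\<lambda>b a. cl (S k \<cdot> b) \<bullet> cl (S a))"
    by (rule cl_rel1[OF antipode_closed[OF k] h])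
  also have "\<dots> = D PA h (\<lambda>a b. cl (S k \<cdot> b) \<bullet> cl (S a))"
    by (rule D_cocomm) (assumption | rule lins k)+
  also have "f x \<bullet> \<dots> = D PA h (\<lambda>a b. f x \<bullet> (cl (S k \<cdot> b) \<bullet> cl (S a)))"
    by (rule PA_mult_left[symmetric]) (assumption | rule lins k c)+
  finally show "D PA h (\<lambda>a b. R_op a (R_op (S b) (R_op k f)) x) = D PA h (\<lambda>a b. R_op a (R_op (S b \<cdot> k) f) x)"
    using k f x c by (simp add: appl antipode_closed A.m_assoc cl_closed antipode_antipode antipode_mult)
qed

text \<open>
  Translation is an honest representation of \<open>H\<close>.
\<close>

lemma partial_rep_M: "partial_rep EW M_op"
proof (rule partial_rep_EW_I)
  show "lin EW M_op"
  proof (rule linEW_I[OF M_op_closed])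
    fix f x assume fx: "f \<in> carrier W" "x \<in> carrier H"
    show "lin PA (\<lambda>h. M_op h f x)"
      unfolding M_op_apply[OF fx] by (rule lin_comp[OF W_lin[OF fx(1)]]) (assumption | rule lins fx)+
  qed
  show "M_op \<one>\<^bsub>H\<^esub> f x = f x" if "f \<in> carrier W" "x \<in> carrier H" for f x
    using that by (simp add: M_op_apply)
qed (simp_all add: M_op_apply EW_closed[OF M_op_closed] antipode_closed H.m_assoc)

text \<open>
  The formula for \<open>[h] \<triangleright> a\<close>, for an arbitrary element \<open>a\<close> of the algebra.
\<close>

definition conj :: "'h \<Rightarrow> ('h list \<Rightarrow> 'k) set set \<Rightarrow> ('h list \<Rightarrow> 'k) set set"
  where "conj h a = D PA h (\<lambda>p r. cl p \<bullet> (a \<bullet> cl (S r)))"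

lemma conj_closed: "a \<in> carrier A \<Longrightarrow> conj h a \<in> carrier A"
  unfolding conj_def by (assumption | rule lins)+

lemma lin_conj_arg: "a \<in> carrier A \<Longrightarrow> lin H g \<Longrightarrow> lin PA (\<lambda>x. conj (g x) a)"
  unfolding conj_def by (assumption | rule lins)+

lemma lin_conj: "lin PA g \<Longrightarrow> lin PA (\<lambda>x. conj h (g x))"
  unfolding conj_def by (assumption | rule lins)+

lemmas [lins] = conj_closed lin_conj_arg lin_conj

lemma conj_hom: "abelian_group_hom PA PA (conj h)"
proof -
  interpret A: ring A by (rule A_ring)
  show ?thesis
  proof (rule abelian_group_homI[OF PA_abelian PA_abelian])
    show "conj h \<in> carrier PA \<rightarrow> carrier PA" by (auto simp: conj_closed)
    show "conj h (x \<oplus>\<^bsub>PA\<^esub> y) = conj h x \<oplus>\<^bsub>PA\<^esub> conj h y" if "x \<in> carrier PA" "y \<in> carrier PA" for x y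
    proof -
      have "conj h (x \<oplus>\<^bsub>PA\<^esub> y) = D PA h (\<lambda>p r. cl p \<bullet> (x \<bullet> cl (S r)) \<oplus>\<^bsub>PA\<^esub> cl p \<bullet> (y \<bullet> cl (S r)))"
        unfolding conj_def using that by (simp add: A.l_distr A.r_distr cl_closed antipode_closed)
      also have "\<dots> = conj h x \<oplus>\<^bsub>PA\<^esub> conj h y"
        unfolding conj_def using that by (intro D_add PA_abelian) (simp_all add: cl_closed antipode_closed)
      finally show ?thesis .
    qed
  qed
qed

definition action_op where "action_op = convolve EW (convolve EW L_op R_op) M_op"

lemma conj_op_apply:
  assumes f: "f \<in> carrier W" and x: "x \<in> carrier H"
  shows "convolve EW L_op R_op h f x = conj h (f x)"
proof -
  interpret E: k_algebra K EW by (rule EW_algebra)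
  have "convolve EW L_op R_op h f x = D PA h (\<lambda>a b. (L_op a \<otimes>\<^bsub>EW\<^esub> R_op b) f x)"
    unfolding convolve_def by (rule D_EW[OF f x]) (intro E.m_closed L_op_closed R_op_closed)
  then show ?thesis
    using f x by (simp add: EW_mult_apply L_op_apply R_op_apply EW_closed[OF R_op_closed] conj_def)
qed

lemma partial_rep_conj: "partial_rep EW (convolve EW L_op R_op)"
proof (rule partial_rep_convolve[OF EW_algebra partial_rep_L partial_rep_R])
  interpret E: k_algebra K EW by (rule EW_algebra)
  interpret A: ring A by (rule A_ring)
  fix h k assume hk: "h \<in> carrier H" "k \<in> carrier H"
  show "R_op h \<otimes>\<^bsub>EW\<^esub> L_op k = L_op k \<otimes>\<^bsub>EW\<^esub> R_op h"
    by (rule EW_eqI)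
      (use hk in \<open>simp_all add: EW_mult_apply L_op_apply R_op_apply EW_closed[OF R_op_closed] EW_closed[OF L_op_closed]
        L_op_closed R_op_closed A.m_assoc W_closed cl_closed antipode_closed\<close>)
qed

lemma partial_rep_action: "partial_rep EW action_op"
  unfolding action_op_def
proof (rule partial_rep_convolve[OF EW_algebra partial_rep_conj partial_rep_M])
  interpret E: k_algebra K EW by (rule EW_algebra)
  note c = linD(1)[OF partial_repD(1)[OF partial_rep_conj]]
  fix h k assume hk: "h \<in> carrier H" "k \<in> carrier H"
  show "M_op h \<otimes>\<^bsub>EW\<^esub> convolve EW L_op R_op k = convolve EW L_op R_op k \<otimes>\<^bsub>EW\<^esub> M_op h"
    by (rule EW_eqI)
      (use hk in \<open>simp_all add: EW_mult_apply conj_op_apply M_op_apply EW_closed[OF M_op_closed] EW_closed[OF c]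
        M_op_closed c\<close>)
qed

lemma action_op_apply:
  assumes f: "f \<in> carrier W" and x: "x \<in> carrier H"
  shows "action_op h f x = D PA h (\<lambda>u q. conj u (f (x \<cdot> q)))"
proof -
  interpret E: k_algebra K EW by (rule EW_algebra)
  note c = linD(1)[OF partial_repD(1)[OF partial_rep_conj]]
  have "action_op h f x = D PA h (\<lambda>a b. (convolve EW L_op R_op a \<otimes>\<^bsub>EW\<^esub> M_op b) f x)"
    unfolding action_op_def convolve_def[of EW "convolve EW L_op R_op"]
    by (rule D_EW[OF f x]) (intro E.m_closed c M_op_closed)
  then show ?thesis
    using f x by (simp add: EW_mult_apply conj_op_apply M_op_apply EW_closed[OF M_op_closed])
qed

text \<open>
  The representation of \<open>A\<close> on linear maps; the universal property makes it well defined.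
\<close>

definition W_action where "W_action = (SOME g. g \<in> ring_hom A EW \<and> (\<forall>r\<in>carrier K. g (mon r []) = r \<odot>\<^bsub>EW\<^esub> \<one>\<^bsub>EW\<^esub>) \<and>
  (\<forall>h\<in>carrier H. g (cl h) = action_op h))"

lemma W_action_exists: "W_action \<in> ring_hom A EW \<and> (\<forall>r\<in>carrier K. W_action (mon r []) = r \<odot>\<^bsub>EW\<^esub> \<one>\<^bsub>EW\<^esub>) \<and>
  (\<forall>h\<in>carrier H. W_action (cl h) = action_op h)"
proof -
  have "\<exists>g. g \<in> ring_hom A EW \<and> (\<forall>r\<in>carrier K. g (mon r []) = r \<odot>\<^bsub>EW\<^esub> \<one>\<^bsub>EW\<^esub>) \<and>
      (\<forall>h\<in>carrier H. g (cl h) = action_op h)"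
  proof (rule par_alg_universal[OF EW_algebra partial_rep_action])
    fix g assume "g \<in> ring_hom A EW" "\<And>r. r \<in> carrier K \<Longrightarrow> g (mon r []) = r \<odot>\<^bsub>EW\<^esub> \<one>\<^bsub>EW\<^esub>"
      "\<And>h. h \<in> carrier H \<Longrightarrow> g (cl h) = action_op h"
    then show "\<exists>g. g \<in> ring_hom A EW \<and> (\<forall>r\<in>carrier K. g (mon r []) = r \<odot>\<^bsub>EW\<^esub> \<one>\<^bsub>EW\<^esub>) \<and>
        (\<forall>h\<in>carrier H. g (cl h) = action_op h)"
      by (intro exI[of _ g] conjI ballI)
  qed
  then show ?thesis unfolding W_action_def by (rule someI_ex)
qed

lemma W_action_closed: "x \<in> carrier A \<Longrightarrow> W_action x f \<in> carrier W"
  using ring_hom_closed[of W_action A EW x] W_action_exists by (intro EW_closed) auto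

lemma W_action_scalar: "\<lbrakk>r \<in> carrier K; f \<in> carrier W\<rbrakk> \<Longrightarrow> W_action (mon r []) f = r \<odot>\<^bsub>W\<^esub> f"
  using W_action_exists by (simp add: End_alg_simps(3,6))

lemma W_action_cl: "\<lbrakk>h \<in> carrier H; f \<in> carrier W; x \<in> carrier H\<rbrakk> \<Longrightarrow> W_action (cl h) f x = D PA h (\<lambda>u q. conj u (f (x \<cdot> q)))"
  using W_action_exists by (simp add: action_op_apply)

lemma W_action_add: "\<lbrakk>x \<in> carrier A; y \<in> carrier A\<rbrakk> \<Longrightarrow> W_action (x \<oplus>\<^bsub>A\<^esub> y) f = W_action x f \<oplus>\<^bsub>W\<^esub> W_action y f"
  using ring_hom_add[of W_action A EW x y] W_action_exists by (simp add: End_alg_simps(5))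

lemma W_action_mult: "\<lbrakk>x \<in> carrier A; y \<in> carrier A\<rbrakk> \<Longrightarrow> W_action (x \<bullet> y) f = W_action x (W_action y f)"
  using ring_hom_mult[of W_action A EW x y] W_action_exists by (simp add: End_alg_simps(2))

lemma W_action_arg_add: "\<lbrakk>x \<in> carrier A; f \<in> carrier W; g \<in> carrier W\<rbrakk> \<Longrightarrow> W_action x (f \<oplus>\<^bsub>W\<^esub> g) = W_action x f \<oplus>\<^bsub>W\<^esub> W_action x g"
  using ring_hom_closed[of W_action A EW x] W_action_exists by (simp add: End_alg_simps(1))

end

section \<open>The action and the base algebra\<close>

context cocommutative_hopf
begin

lemma PA_smult_add: "\<lbrakk>r \<in> carrier K; x \<in> carrier A; y \<in> carrier A\<rbrakk> \<Longrightarrow> r \<star> (x \<oplus>\<^bsub>A\<^esub> y) = r \<star> x \<oplus>\<^bsub>A\<^esub> r \<star> y"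
  and PA_smult_assoc: "\<lbrakk>r \<in> carrier K; s \<in> carrier K; x \<in> carrier A\<rbrakk> \<Longrightarrow> (r \<otimes>\<^bsub>K\<^esub> s) \<star> x = r \<star> (s \<star> x)"
  and PA_smult_one: "x \<in> carrier A \<Longrightarrow> \<one>\<^bsub>K\<^esub> \<star> x = x"
  and PA_smult_mult_left: "\<lbrakk>r \<in> carrier K; x \<in> carrier A; y \<in> carrier A\<rbrakk> \<Longrightarrow> (r \<star> x) \<bullet> y = r \<star> (x \<bullet> y)"
  and PA_smult_mult_right: "\<lbrakk>r \<in> carrier K; x \<in> carrier A; y \<in> carrier A\<rbrakk> \<Longrightarrow> x \<bullet> (r \<star> y) = r \<star> (x \<bullet> y)"
proof -
  interpret P: k_algebra K PA by (rule PA_algebra)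
  show "\<lbrakk>r \<in> carrier K; x \<in> carrier A; y \<in> carrier A\<rbrakk> \<Longrightarrow> r \<star> (x \<oplus>\<^bsub>A\<^esub> y) = r \<star> x \<oplus>\<^bsub>A\<^esub> r \<star> y"
    using P.smult_r_distr[of r x y] by simp
  show "\<lbrakk>r \<in> carrier K; s \<in> carrier K; x \<in> carrier A\<rbrakk> \<Longrightarrow> (r \<otimes>\<^bsub>K\<^esub> s) \<star> x = r \<star> (s \<star> x)"
    using P.smult_assoc1[of r s x] by simp
  show "x \<in> carrier A \<Longrightarrow> \<one>\<^bsub>K\<^esub> \<star> x = x"
    using P.smult_one[of x] by simp
  show "\<lbrakk>r \<in> carrier K; x \<in> carrier A; y \<in> carrier A\<rbrakk> \<Longrightarrow> (r \<star> x) \<bullet> y = r \<star> (x \<bullet> y)"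
    using P.smult_mult_left[of r x y] by simp
  show "\<lbrakk>r \<in> carrier K; x \<in> carrier A; y \<in> carrier A\<rbrakk> \<Longrightarrow> x \<bullet> (r \<star> y) = r \<star> (x \<bullet> y)"
    using P.smult_mult_right[of r x y] by simp
qed

lemma PA_smult_commute: "\<lbrakk>r \<in> carrier K; s \<in> carrier K; x \<in> carrier A\<rbrakk> \<Longrightarrow> r \<star> (s \<star> x) = s \<star> (r \<star> x)"
  by (simp add: PA_smult_assoc[symmetric] m_comm)

lemma D_PA_smult:
  "\<lbrakk>r \<in> carrier K; \<And>a b. \<lbrakk>a \<in> carrier H; b \<in> carrier H\<rbrakk> \<Longrightarrow> f a b \<in> carrier A\<rbrakk> \<Longrightarrow>
    D PA h (\<lambda>a b. r \<star> f a b) = r \<star> D PA h f"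
  using D_smult[OF PA_module, of r f h] by simp

lemma conj_smult: "\<lbrakk>r \<in> carrier K; a \<in> carrier A\<rbrakk> \<Longrightarrow> conj h (r \<star> a) = r \<star> conj h a"
  unfolding conj_def
  by (simp add: PA_smult_mult_left PA_smult_mult_right cl_closed antipode_closed A_m_closed D_PA_smult)

text \<open>
  The linear map \<open>x \<mapsto> \<epsilon> x a\<close>. Translating its argument contributes only a factor \<open>\<epsilon>\<close>, so \<open>[h]\<close> acts on
  it as on \<open>a\<close>; this embeds the action on elements into the representation on linear maps.
\<close>

definition const :: "('h list \<Rightarrow> 'k) set set \<Rightarrow> 'h \<Rightarrow> ('h list \<Rightarrow> 'k) set set"
  where "const a = (\<lambda>k. if k \<in> carrier H then \<epsilon> k \<star> a else \<zero>\<^bsub>A\<^esub>)"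

lemma const_apply: "k \<in> carrier H \<Longrightarrow> const a k = \<epsilon> k \<star> a"
  by (simp add: const_def)

lemma W_restrict:
  assumes "lin PA f"
  shows "(\<lambda>k. if k \<in> carrier H then f k else \<zero>\<^bsub>A\<^esub>) \<in> carrier W"
  using assms by (auto simp: LinH_simps lin_def Pi_iff)

lemma const_closed: "a \<in> carrier A \<Longrightarrow> const a \<in> carrier W"
  unfolding const_def by (rule W_restrict) (assumption | rule lins)+

lemma const_one: "a \<in> carrier A \<Longrightarrow> const a \<one>\<^bsub>H\<^esub> = a"
  by (simp add: const_apply counit_one PA_smult_one)

lemma W_action_cl_const:
  assumes h: "h \<in> carrier H" and a: "a \<in> carrier A"
  shows "W_action (cl h) (const a) = const (conj h a)"
proof (rule W_eqI)
  fix x assume x: "x \<in> carrier H"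
  have "W_action (cl h) (const a) x = D PA h (\<lambda>u q. \<epsilon> q \<star> (\<epsilon> x \<star> conj u a))"
    unfolding W_action_cl[OF h const_closed[OF a] x]
  proof (intro D_cong refl)
    fix u q assume uq: "u \<in> carrier H" "q \<in> carrier H"
    have "conj u (const a (x \<cdot> q)) = (\<epsilon> x \<otimes>\<^bsub>K\<^esub> \<epsilon> q) \<star> conj u a"
      using x uq a by (simp add: const_apply counit_mult conj_smult counit_closed)
    then show "conj u (const a (x \<cdot> q)) = \<epsilon> q \<star> (\<epsilon> x \<star> conj u a)"
      using x uq a by (simp add: m_comm[of "\<epsilon> x"] PA_smult_assoc counit_closed conj_closed)
  qed
  also have "\<dots> = \<epsilon> x \<star> conj h a"
    by (rule D_counit_right[OF PA_abelian _ h], rule lin_smult[OF PA_module]) (assumption | rule lins x a)+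
  finally show "W_action (cl h) (const a) x = const (conj h a) x" using x by (simp add: const_apply)
qed (use assms in \<open>simp_all add: W_action_closed cl_closed const_closed conj_closed\<close>)

text \<open>
  The action extended from the classes \<open>[h]\<close> to all of \<open>A\<close>.
\<close>

definition act where "act x a = W_action x (const a) \<one>\<^bsub>H\<^esub>"

lemma W_action_const: "\<lbrakk>x \<in> carrier A; a \<in> carrier A\<rbrakk> \<Longrightarrow> W_action x (const a) = const (act x a) \<and> act x a \<in> carrier A"
proof -
  assume x: "x \<in> carrier A" and a: "a \<in> carrier A"
  interpret A: ring A by (rule A_ring)
  have "\<forall>a\<in>carrier A. \<exists>a'\<in>carrier A. W_action x (const a) = const a'"
    using x
  proof (induction rule: par_alg_induct)
    case (scalar r)
    show ?case
    proof
      fix a assume a: "a \<in> carrier A"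
      have "W_action (mon r []) (const a) = const (r \<star> a)"
        unfolding W_action_scalar[OF scalar const_closed[OF a]]
      proof (rule W_eqI)
        interpret W: module K W by (rule W_module)
        show "r \<odot>\<^bsub>W\<^esub> const a \<in> carrier W" using scalar const_closed[OF a] by simp
        show "const (r \<star> a) \<in> carrier W" using scalar a by (intro const_closed PA_smult_closed)
        show "(r \<odot>\<^bsub>W\<^esub> const a) k = const (r \<star> a) k" if "k \<in> carrier H" for k
          using that scalar a by (simp add: W_smult const_apply PA_smult_commute counit_closed)
      qed
      then show "\<exists>a'\<in>carrier A. W_action (mon r []) (const a) = const a'" using scalar a PA_smult_closed by blast
    qed
  next
    case (add x y)
    show ?case
    proof
      fix a assume a: "a \<in> carrier A"
      obtain b c where bc: "b \<in> carrier A" "W_action x (const a) = const b" "c \<in> carrier A" "W_action y (const a) = const c"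
        using add a by metis
      have "W_action (x \<oplus>\<^bsub>A\<^esub> y) (const a) = const (b \<oplus>\<^bsub>A\<^esub> c)"
        unfolding W_action_add[OF add(1,2)] bc
      proof (rule W_eqI)
        interpret W: module K W by (rule W_module)
        show "const b \<oplus>\<^bsub>W\<^esub> const c \<in> carrier W" using bc const_closed by simp
        show "const (b \<oplus>\<^bsub>A\<^esub> c) \<in> carrier W" using bc by (intro const_closed) simp
        show "(const b \<oplus>\<^bsub>W\<^esub> const c) k = const (b \<oplus>\<^bsub>A\<^esub> c) k" if "k \<in> carrier H" for k
          using that bc by (simp add: W_add const_apply PA_smult_add counit_closed)
      qed
      then show "\<exists>a'\<in>carrier A. W_action (x \<oplus>\<^bsub>A\<^esub> y) (const a) = const a'" using bc by blast
    qed
  next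
    case (cl h x)
    then show ?case using W_action_mult[OF cl_closed[OF cl(1)] cl(2)] W_action_cl_const[OF cl(1)] conj_closed by metis
  qed
  then obtain a' where "a' \<in> carrier A" "W_action x (const a) = const a'" using a by blast
  then show ?thesis by (simp add: act_def const_one)
qed

lemma act_closed: "\<lbrakk>x \<in> carrier A; a \<in> carrier A\<rbrakk> \<Longrightarrow> act x a \<in> carrier A"
  using W_action_const by blast

lemma act_cl: "\<lbrakk>h \<in> carrier H; a \<in> carrier A\<rbrakk> \<Longrightarrow> act (cl h) a = conj h a"
  by (simp add: act_def W_action_cl_const const_one conj_closed)

lemma act_mult: "\<lbrakk>x \<in> carrier A; y \<in> carrier A; a \<in> carrier A\<rbrakk> \<Longrightarrow> act (x \<bullet> y) a = act x (act y a)"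
  using W_action_const[of y a] by (simp add: act_def[of "x \<bullet> y"] W_action_mult) (simp add: act_def)

lemma act_add: "\<lbrakk>x \<in> carrier A; y \<in> carrier A; a \<in> carrier A\<rbrakk> \<Longrightarrow> act (x \<oplus>\<^bsub>A\<^esub> y) a = act x a \<oplus>\<^bsub>A\<^esub> act y a"
  by (simp add: act_def W_action_add W_add)

lemma act_scalar: "\<lbrakk>r \<in> carrier K; a \<in> carrier A\<rbrakk> \<Longrightarrow> act (mon r []) a = r \<star> a"
  by (simp add: act_def W_action_scalar const_closed W_smult const_one)

lemma act_one: "a \<in> carrier A \<Longrightarrow> act \<one>\<^bsub>A\<^esub> a = a"
  using act_scalar[of "\<one>\<^bsub>K\<^esub>" a] by (simp add: mon_one PA_smult_one)

lemma act_arg_add: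
  assumes "x \<in> carrier A" "a \<in> carrier A" "b \<in> carrier A"
  shows "act x (a \<oplus>\<^bsub>A\<^esub> b) = act x a \<oplus>\<^bsub>A\<^esub> act x b"
proof -
  interpret A: ring A by (rule A_ring)
  have "const (a \<oplus>\<^bsub>A\<^esub> b) = const a \<oplus>\<^bsub>W\<^esub> const b"
  proof (rule W_eqI)
    interpret W: module K W by (rule W_module)
    show "const a \<oplus>\<^bsub>W\<^esub> const b \<in> carrier W" "const (a \<oplus>\<^bsub>A\<^esub> b) \<in> carrier W" using assms const_closed by simp_all
    show "const (a \<oplus>\<^bsub>A\<^esub> b) k = (const a \<oplus>\<^bsub>W\<^esub> const b) k" if "k \<in> carrier H" for k
      using that assms by (simp add: W_add const_apply PA_smult_add counit_closed)
  qed
  then show ?thesis using assms by (simp add: act_def W_action_arg_add const_closed W_add)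
qed

abbreviation B where "B \<equiv> par_base K H \<Delta> S"

definition e where "e h = D PA h (\<lambda>a b. cl a \<bullet> cl (S b))"

lemma e_closed: "h \<in> carrier H \<Longrightarrow> e h \<in> carrier A"
  unfolding e_def by (assumption | rule lins)+

lemma lin_e: "lin H g \<Longrightarrow> lin PA (\<lambda>x. e (g x))"
  unfolding e_def by (assumption | rule lins)+

lemmas [lins] = e_closed lin_e

text \<open>
  The generators in the definition of the base algebra range over all expansions of all elements,
  but their value depends only on the element.
\<close>

lemma sweedler_e: "sweedler K H \<Delta> h ps \<Longrightarrow> add_list A [cl a \<bullet> cl (S b). (a, b) \<leftarrow> ps] = e h"
  unfolding e_def add_list_PA[symmetric] by (rule D_sweedler[OF PA_abelian]) (assumption | rule lins)+

lemma base_generate: "B = generate_ring A ({mon r [] | r. r \<in> carrier K} \<union> e ` carrier H)"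
proof -
  have "{add_list A [cl a \<bullet> cl (S b). (a, b) \<leftarrow> ps] | h ps. sweedler K H \<Delta> h ps} = e ` carrier H"
  proof (intro equalityI subsetI)
    fix x assume "x \<in> {add_list A [cl a \<bullet> cl (S b). (a, b) \<leftarrow> ps] | h ps. sweedler K H \<Delta> h ps}"
    then obtain h ps where "x = add_list A [cl a \<bullet> cl (S b). (a, b) \<leftarrow> ps]" "sweedler K H \<Delta> h ps" by blast
    then show "x \<in> e ` carrier H" using sweedler_e by (auto simp: sweedler_def)
  next
    fix x assume "x \<in> e ` carrier H"
    then obtain h where "h \<in> carrier H" "x = e h" by blast
    then show "x \<in> {add_list A [cl a \<bullet> cl (S b). (a, b) \<leftarrow> ps] | h ps. sweedler K H \<Delta> h ps}"
      using sweedler_e[OF sweedler_expansion] sweedler_expansion by blast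
  qed
  then show ?thesis by (simp add: par_base_def Let_def)
qed

lemma base_subring: "subring B A"
proof -
  interpret A: ring A by (rule A_ring)
  show ?thesis
    unfolding base_generate by (rule A.generate_ring_is_subring) (auto intro: mon_closed e_closed)
qed

lemma B_closed: "b \<in> B \<Longrightarrow> b \<in> carrier A"
  using subringE(1)[OF base_subring] by blast

lemma mon_base: "r \<in> carrier K \<Longrightarrow> mon r [] \<in> B"
  unfolding base_generate by (rule generate_ring.incl) blast

lemma e_base: "h \<in> carrier H \<Longrightarrow> e h \<in> B"
  unfolding base_generate by (rule generate_ring.incl) blast

lemma base_induct [consumes 1, case_names scalar e uminus add mult]:
  assumes "b \<in> B"
    and "\<And>r. r \<in> carrier K \<Longrightarrow> P (mon r [])" and "\<And>h. h \<in> carrier H \<Longrightarrow> P (e h)"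
    and "\<And>b. \<lbrakk>b \<in> B; P b\<rbrakk> \<Longrightarrow> P (\<ominus>\<^bsub>A\<^esub> b)"
    and "\<And>b c. \<lbrakk>b \<in> B; c \<in> B; P b; P c\<rbrakk> \<Longrightarrow> P (b \<oplus>\<^bsub>A\<^esub> c)"
    and "\<And>b c. \<lbrakk>b \<in> B; c \<in> B; P b; P c\<rbrakk> \<Longrightarrow> P (b \<bullet> c)"
  shows "P b"
  using assms(1) unfolding base_generate
proof (induction rule: generate_ring.induct)
  case one
  then show ?case using assms(2)[of "\<one>\<^bsub>K\<^esub>"] by (simp add: mon_one)
next
  case (incl h)
  then show ?case using assms(2,3) by blast
qed (use assms(4-6) in \<open>simp_all add: base_generate\<close>)

lemma D_mem:
  assumes zero: "\<zero>\<^bsub>A\<^esub> \<in> M" and add: "\<And>x y. \<lbrakk>x \<in> M; y \<in> M\<rbrakk> \<Longrightarrow> x \<oplus>\<^bsub>A\<^esub> y \<in> M"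
    and f: "\<And>a b. \<lbrakk>a \<in> carrier H; b \<in> carrier H\<rbrakk> \<Longrightarrow> f a b \<in> M"
  shows "D PA h f \<in> M"
proof -
  have "add_list A xs \<in> M" if "set xs \<subseteq> M" for xs
    using that zero add by (induction xs) (auto simp: add_list_def)
  moreover have "set [f a b. (a, b) \<leftarrow> expansion h] \<subseteq> M" if h: "h \<in> carrier H"
  proof -
    have "f (fst p) (snd p) \<in> M" if "p \<in> set (expansion h)" for p
      using expansion_closed'[OF h that] f by blast
    then show ?thesis by (force simp: case_prod_unfold)
  qed
  ultimately show ?thesis
    using zero by (cases "h \<in> carrier H") (simp_all only: D_PA D_def if_True if_False add_list_def foldr.simps id_apply PA_simps)
qed

lemma D_base: "(\<And>a b. \<lbrakk>a \<in> carrier H; b \<in> carrier H\<rbrakk> \<Longrightarrow> f a b \<in> B) \<Longrightarrow> D PA h f \<in> B"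
  by (rule D_mem[OF subringE(2,7)[OF base_subring]])

section \<open>Commutation relations in the base algebra\<close>

text \<open>
  \<open>e\<^sub>x [z] = [x\<^sub>1][S x\<^sub>2][z] = [x\<^sub>1][S x\<^sub>2 z]\<close>.
\<close>

lemma e_mult_cl:
  assumes "x \<in> carrier H" "z \<in> carrier H"
  shows "e x \<bullet> cl z = D PA x (\<lambda>p q. cl p \<bullet> cl (S q \<cdot> z))"
proof -
  interpret A: ring A by (rule A_ring)
  have "e x \<bullet> cl z = D PA x (\<lambda>p q. (cl p \<bullet> cl (S q)) \<bullet> cl z)"
    unfolding e_def by (rule PA_mult_right[symmetric]) (assumption | rule lins assms)+
  also have "\<dots> = D PA x (\<lambda>p q. cl p \<bullet> (cl (S q) \<bullet> cl z))"
    using assms by (simp add: A.m_assoc cl_closed antipode_closed)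
  finally show ?thesis using cl_rel2[OF assms] by simp
qed

text \<open>
  By the preceding lemma the right-hand side is \<open>[h\<^sub>1 k\<^sub>1][S (h\<^sub>2 k\<^sub>2) h\<^sub>3]\<close>, which collapses to \<open>[h k\<^sub>1][S k\<^sub>2]\<close>
  and thus to \<open>[h][k\<^sub>1][S k\<^sub>2]\<close>.
\<close>

lemma cl_mult_e:
  assumes h: "h \<in> carrier H" and k: "k \<in> carrier H"
  shows "cl h \<bullet> e k = D PA h (\<lambda>a b. e (a \<cdot> k) \<bullet> cl b)"
proof -
  interpret A: ring A by (rule A_ring)
  have "D PA h (\<lambda>a b. e (a \<cdot> k) \<bullet> cl b) =
      D PA h (\<lambda>a b. D PA a (\<lambda>p q. D PA k (\<lambda>s t. cl (p \<cdot> s) \<bullet> cl (S (q \<cdot> t) \<cdot> b))))"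
  proof (intro D_cong refl)
    fix a b assume ab: "a \<in> carrier H" "b \<in> carrier H"
    have "e (a \<cdot> k) \<bullet> cl b = D PA (a \<cdot> k) (\<lambda>p q. cl p \<bullet> cl (S q \<cdot> b))"
      using ab k by (simp add: e_mult_cl)
    also have "\<dots> = D PA a (\<lambda>p q. D PA k (\<lambda>s t. cl (p \<cdot> s) \<bullet> cl (S (q \<cdot> t) \<cdot> b)))"
      by (rule D_mult[OF PA_abelian _ _ ab(1) k]) (assumption | rule lins ab)+
    finally show "e (a \<cdot> k) \<bullet> cl b = D PA a (\<lambda>p q. D PA k (\<lambda>s t. cl (p \<cdot> s) \<bullet> cl (S (q \<cdot> t) \<cdot> b)))" .
  qed
  also have "\<dots> = D PA h (\<lambda>p r. D PA r (\<lambda>q b. D PA k (\<lambda>s t. cl (p \<cdot> s) \<bullet> cl (S (q \<cdot> t) \<cdot> b))))"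
    by (rule D_coassoc[OF PA_abelian]) (assumption | rule lins)+
  also have "\<dots> = D PA h (\<lambda>p r. \<epsilon> r \<star> D PA k (\<lambda>s t. cl (p \<cdot> s) \<bullet> cl (S t)))"
  proof (intro D_cong refl)
    fix p r assume pr: "p \<in> carrier H" "r \<in> carrier H"
    have "D PA r (\<lambda>q b. D PA k (\<lambda>s t. cl (p \<cdot> s) \<bullet> cl (S (q \<cdot> t) \<cdot> b))) =
        D PA k (\<lambda>s t. D PA r (\<lambda>q b. cl (p \<cdot> s) \<bullet> cl (S (q \<cdot> t) \<cdot> b)))"
      by (rule D_swap[OF PA_abelian]) (unfold PA_simps(1), (assumption | rule lins pr)+)
    also have "\<dots> = D PA k (\<lambda>s t. \<epsilon> r \<star> (cl (p \<cdot> s) \<bullet> cl (S t)))"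
    proof (intro D_cong refl)
      fix s t assume st: "s \<in> carrier H" "t \<in> carrier H"
      have lin: "lin PA (\<lambda>z. cl (p \<cdot> s) \<bullet> cl z)" by (assumption | rule lins pr st)+
      have "D PA r (\<lambda>q b. cl (p \<cdot> s) \<bullet> cl (S (q \<cdot> t) \<cdot> b)) =
          cl (p \<cdot> s) \<bullet> cl (D H r (\<lambda>q b. S (q \<cdot> t) \<cdot> b))"
        by (rule D_hom[OF lin_abelian_group_hom[OF PA_abelian lin], symmetric]) (assumption | rule lins st)+
      also have "\<dots> = cl (p \<cdot> s) \<bullet> cl (\<epsilon> r \<odot>\<^bsub>H\<^esub> S t)"
        by (simp only: antipode_mult_collapse[OF pr(2) st(2)])
      also have "\<dots> = \<epsilon> r \<star> (cl (p \<cdot> s) \<bullet> cl (S t))"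
        using linD(3)[OF lin counit_closed[OF pr(2)] antipode_closed[OF st(2)]] .
      finally show "D PA r (\<lambda>q b. cl (p \<cdot> s) \<bullet> cl (S (q \<cdot> t) \<cdot> b)) = \<epsilon> r \<star> (cl (p \<cdot> s) \<bullet> cl (S t))" .
    qed
    also have "\<dots> = \<epsilon> r \<star> D PA k (\<lambda>s t. cl (p \<cdot> s) \<bullet> cl (S t))"
      by (rule D_PA_smult) (assumption | rule lins pr)+
    finally show "D PA r (\<lambda>q b. D PA k (\<lambda>s t. cl (p \<cdot> s) \<bullet> cl (S (q \<cdot> t) \<cdot> b))) =
        \<epsilon> r \<star> D PA k (\<lambda>s t. cl (p \<cdot> s) \<bullet> cl (S t))" .
  qed
  also have "\<dots> = D PA k (\<lambda>s t. cl (h \<cdot> s) \<bullet> cl (S t))"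
    by (rule D_counit_right[OF PA_abelian _ h]) (assumption | rule lins)+
  also have "\<dots> = D PA k (\<lambda>s t. cl h \<bullet> (cl s \<bullet> cl (S t)))"
    by (rule cl_rel1[OF h k, symmetric])
  also have "\<dots> = cl h \<bullet> e k"
    unfolding e_def by (rule PA_mult_left) (assumption | rule lins h)+
  finally show ?thesis by simp
qed

text \<open>
  Moving \<open>e\<^sub>k\<close> to the left through \<open>[h\<^sub>1][S h\<^sub>2]\<close> turns its index into \<open>h\<^sub>1 S h\<^sub>3 k\<close>, up to the numbering
  of the legs; cocommutativity makes the first two factors of the index neighbours, and they cancel.
\<close>

lemma e_commute:
  assumes h: "h \<in> carrier H" and k: "k \<in> carrier H"
  shows "e h \<bullet> e k = e k \<bullet> e h"
proof -
  interpret A: ring A by (rule A_ring)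
  have "e h \<bullet> e k = D PA h (\<lambda>a b. (cl a \<bullet> cl (S b)) \<bullet> e k)"
    unfolding e_def[of h] by (rule PA_mult_right[symmetric]) (assumption | rule lins k)+
  also have "\<dots> = D PA h (\<lambda>a b. D PA a (\<lambda>p q. D PA b (\<lambda>c d. e (p \<cdot> (S c \<cdot> k)) \<bullet> (cl q \<bullet> cl (S d)))))"
  proof (intro D_cong refl)
    fix a b assume ab: "a \<in> carrier H" "b \<in> carrier H"
    have 1: "cl (S b) \<bullet> e k = D PA b (\<lambda>c d. e (S c \<cdot> k) \<bullet> cl (S d))"
      unfolding cl_mult_e[OF antipode_closed[OF ab(2)] k]
      by (rule D_antipode[OF PA_module _ _ ab(2)]) (assumption | rule lins k)+
    have "(cl a \<bullet> cl (S b)) \<bullet> e k = cl a \<bullet> (cl (S b) \<bullet> e k)"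
      using ab k by (simp add: A.m_assoc cl_closed antipode_closed e_closed)
    also have "\<dots> = D PA b (\<lambda>c d. cl a \<bullet> (e (S c \<cdot> k) \<bullet> cl (S d)))"
      unfolding 1 by (rule PA_mult_left[symmetric]) (assumption | rule lins ab k)+
    also have "\<dots> = D PA b (\<lambda>c d. D PA a (\<lambda>p q. e (p \<cdot> (S c \<cdot> k)) \<bullet> (cl q \<bullet> cl (S d))))"
    proof (intro D_cong refl)
      fix c d assume cd: "c \<in> carrier H" "d \<in> carrier H"
      have "cl a \<bullet> (e (S c \<cdot> k) \<bullet> cl (S d)) = (cl a \<bullet> e (S c \<cdot> k)) \<bullet> cl (S d)"
        using ab cd k by (simp add: A.m_assoc cl_closed antipode_closed e_closed)
      also have "\<dots> = D PA a (\<lambda>p q. (e (p \<cdot> (S c \<cdot> k)) \<bullet> cl q) \<bullet> cl (S d))"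
        unfolding cl_mult_e[OF ab(1) H.m_closed[OF antipode_closed[OF cd(1)] k]]
        by (rule PA_mult_right[symmetric]) (assumption | rule lins cd k)+
      finally show "cl a \<bullet> (e (S c \<cdot> k) \<bullet> cl (S d)) = D PA a (\<lambda>p q. e (p \<cdot> (S c \<cdot> k)) \<bullet> (cl q \<bullet> cl (S d)))"
        using cd k by (simp add: A.m_assoc cl_closed antipode_closed e_closed)
    qed
    also have "\<dots> = D PA a (\<lambda>p q. D PA b (\<lambda>c d. e (p \<cdot> (S c \<cdot> k)) \<bullet> (cl q \<bullet> cl (S d))))"
      by (rule D_swap[OF PA_abelian]) (unfold PA_simps(1), (assumption | rule lins k)+)
    finally show "(cl a \<bullet> cl (S b)) \<bullet> e k =
        D PA a (\<lambda>p q. D PA b (\<lambda>c d. e (p \<cdot> (S c \<cdot> k)) \<bullet> (cl q \<bullet> cl (S d))))" .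
  qed
  also have "\<dots> = D PA h (\<lambda>a b. D PA a (\<lambda>p c. e (p \<cdot> (S c \<cdot> k))) \<bullet> D PA b (\<lambda>q d. cl q \<bullet> cl (S d)))"
    by (rule D_product[OF PA_algebra, unfolded PA_simps(2)]) (assumption | rule lins k)+
  also have "\<dots> = D PA h (\<lambda>a b. \<epsilon> a \<star> (e k \<bullet> e b))"
  proof (intro D_cong refl)
    fix a b assume ab: "a \<in> carrier H" "b \<in> carrier H"
    have "D PA a (\<lambda>p c. e (p \<cdot> (S c \<cdot> k))) = D PA a (\<lambda>p c. e ((p \<cdot> S c) \<cdot> k))"
      using k by (simp add: H.m_assoc antipode_closed)
    also have "\<dots> = \<epsilon> a \<star> e (\<one>\<^bsub>H\<^esub> \<cdot> k)"
      by (rule D_antipode_right[OF PA_abelian, where f = "\<lambda>z. e (z \<cdot> k)"]) (assumption | rule lins k ab)+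
    finally show "D PA a (\<lambda>p c. e (p \<cdot> (S c \<cdot> k))) \<bullet> D PA b (\<lambda>q d. cl q \<bullet> cl (S d)) = \<epsilon> a \<star> (e k \<bullet> e b)"
      using k ab by (simp add: e_def[of b, symmetric] PA_smult_mult_left counit_closed e_closed)
  qed
  also have "\<dots> = e k \<bullet> e h"
    by (rule D_counit_left[OF PA_abelian _ h]) (assumption | rule lins k)+
  finally show ?thesis .
qed

text \<open>
  \<open>[q\<^sub>1][S q\<^sub>2 q\<^sub>3 h] = [q][h]\<close>.
\<close>

lemma e_cl_absorb:
  assumes q: "q \<in> carrier H" and h: "h \<in> carrier H"
  shows "D PA q (\<lambda>s t. e s \<bullet> cl (t \<cdot> h)) = cl q \<bullet> cl h"
proof -
  have "D PA q (\<lambda>s t. e s \<bullet> cl (t \<cdot> h)) = D PA q (\<lambda>s t. D PA s (\<lambda>p r. cl p \<bullet> cl (S r \<cdot> (t \<cdot> h))))"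
    using h by (simp add: e_mult_cl)
  also have "\<dots> = D PA q (\<lambda>p z. D PA z (\<lambda>r t. cl p \<bullet> cl (S r \<cdot> (t \<cdot> h))))"
    by (rule D_coassoc[OF PA_abelian]) (assumption | rule lins h)+
  also have "\<dots> = D PA q (\<lambda>p z. \<epsilon> z \<star> (cl p \<bullet> cl h))"
  proof (intro D_cong refl)
    fix p z assume pz: "p \<in> carrier H" "z \<in> carrier H"
    have "D PA z (\<lambda>r t. cl p \<bullet> cl (S r \<cdot> (t \<cdot> h))) = D PA z (\<lambda>r t. cl p \<bullet> cl ((S r \<cdot> t) \<cdot> h))"
      using h by (simp add: H.m_assoc antipode_closed)
    also have "\<dots> = \<epsilon> z \<star> (cl p \<bullet> cl (\<one>\<^bsub>H\<^esub> \<cdot> h))"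
      by (rule D_antipode_left[OF PA_abelian, where f = "\<lambda>x. cl p \<bullet> cl (x \<cdot> h)"]) (assumption | rule lins pz h)+
    finally show "D PA z (\<lambda>r t. cl p \<bullet> cl (S r \<cdot> (t \<cdot> h))) = \<epsilon> z \<star> (cl p \<bullet> cl h)"
      using h by simp
  qed
  also have "\<dots> = cl q \<bullet> cl h"
    by (rule D_counit_right[OF PA_abelian _ q]) (assumption | rule lins h)+
  finally show ?thesis .
qed

lemma e_cl: "q \<in> carrier H \<Longrightarrow> D PA q (\<lambda>s t. e s \<bullet> cl t) = cl q"
proof -
  assume q: "q \<in> carrier H"
  interpret A: ring A by (rule A_ring)
  show ?thesis using e_cl_absorb[OF q H.one_closed] q by (simp add: cl_one cl_closed)
qed

lemma e_e:
  assumes h: "h \<in> carrier H"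
  shows "D PA h (\<lambda>a b. e a \<bullet> e b) = e h"
proof -
  interpret A: ring A by (rule A_ring)
  have "D PA h (\<lambda>a b. e a \<bullet> e b) = D PA h (\<lambda>a b. D PA b (\<lambda>c d. (e a \<bullet> cl c) \<bullet> cl (S d)))"
  proof (intro D_cong refl)
    fix a b assume ab: "a \<in> carrier H" "b \<in> carrier H"
    have "e a \<bullet> e b = D PA b (\<lambda>c d. e a \<bullet> (cl c \<bullet> cl (S d)))"
      unfolding e_def[of b] by (rule PA_mult_left[symmetric]) (assumption | rule lins ab)+
    then show "e a \<bullet> e b = D PA b (\<lambda>c d. (e a \<bullet> cl c) \<bullet> cl (S d))"
      using ab by (simp add: A.m_assoc e_closed cl_closed antipode_closed)
  qed
  also have "\<dots> = D PA h (\<lambda>u d. D PA u (\<lambda>a c. (e a \<bullet> cl c) \<bullet> cl (S d)))"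
    by (rule D_coassoc[OF PA_abelian, symmetric]) (assumption | rule lins)+
  also have "\<dots> = D PA h (\<lambda>u d. D PA u (\<lambda>a c. e a \<bullet> cl c) \<bullet> cl (S d))"
    by (rule D_cong[OF refl], rule PA_mult_right) (assumption | rule lins)+
  also have "\<dots> = D PA h (\<lambda>u d. cl u \<bullet> cl (S d))" by (simp add: e_cl)
  finally show ?thesis by (simp only: e_def[of h])
qed

text \<open>
  In particular \<open>B\<close> is commutative.
\<close>

lemma base_commute_e:
  assumes "b \<in> B" "h \<in> carrier H"
  shows "b \<bullet> e h = e h \<bullet> b"
proof -
  interpret A: ring A by (rule A_ring)
  note c = B_closed e_closed[OF assms(2)]
  show ?thesis
    using assms(1)
  proof (induction rule: base_induct)
    case (scalar r)
    then show ?case by (rule mon_central) (rule c(2))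
  next
    case (e k)
    then show ?case by (rule e_commute[OF _ assms(2)])
  next
    case (uminus b)
    then show ?case using c by (simp add: A.l_minus A.r_minus)
  next
    case (add b b')
    then show ?case using c by (simp add: A.l_distr A.r_distr)
  next
    case (mult b b')
    then have "b \<bullet> b' \<bullet> e h = b \<bullet> (e h \<bullet> b')" using c by (simp add: A.m_assoc)
    also have "\<dots> = (b \<bullet> e h) \<bullet> b'" using mult c by (intro A.m_assoc[symmetric]) auto
    also have "\<dots> = (e h \<bullet> b) \<bullet> b'" using mult(3) by (simp only:)
    also have "\<dots> = e h \<bullet> (b \<bullet> b')" using mult c by (intro A.m_assoc) auto
    finally show ?case .
  qed
qed

text \<open>
  For \<open>b = e\<^sub>k\<close> the map \<open>\<beta>\<close> is \<open>p \<mapsto>\<close> \<open>e\<close> of \<open>p k\<close>. The property is closed under products: for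
  \<open>b b'\<close> the convolution of the two maps can be taken.
\<close>

lemma cl_base:
  assumes "b \<in> B"
  obtains \<beta> where "lin PA \<beta>" "\<And>h. h \<in> carrier H \<Longrightarrow> \<beta> h \<in> B"
    "\<And>h. h \<in> carrier H \<Longrightarrow> cl h \<bullet> b = D PA h (\<lambda>p q. \<beta> p \<bullet> cl q)"
proof -
  interpret A: ring A by (rule A_ring)
  note sub = subringE[OF base_subring]
  have "\<exists>\<beta>. lin PA \<beta> \<and> (\<forall>h\<in>carrier H. \<beta> h \<in> B) \<and> (\<forall>h\<in>carrier H. cl h \<bullet> b = D PA h (\<lambda>p q. \<beta> p \<bullet> cl q))"
    using assms
  proof (induction rule: base_induct)
    case (scalar r)
    have m: "mon r [] \<in> carrier A" using scalar by (rule mon_closed) simp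
    have B: "\<epsilon> h \<star> mon r [] \<in> B" if "h \<in> carrier H" for h
      using that scalar mon_base sub(6) counit_closed by (simp add: PA_simps(6))
    have "cl h \<bullet> mon r [] = D PA h (\<lambda>p q. (\<epsilon> p \<star> mon r []) \<bullet> cl q)" if h: "h \<in> carrier H" for h
    proof -
      have "D PA h (\<lambda>p q. (\<epsilon> p \<star> mon r []) \<bullet> cl q) = D PA h (\<lambda>p q. \<epsilon> p \<star> (mon r [] \<bullet> cl q))"
        using m by (simp add: PA_smult_mult_left counit_closed cl_closed)
      also have "\<dots> = mon r [] \<bullet> cl h"
        by (rule D_counit_left[OF PA_abelian _ h]) (assumption | rule lins m)+
      finally show ?thesis using mon_central[OF scalar cl_closed[OF h]] by simp
    qed
    moreover have "lin PA (\<lambda>h. \<epsilon> h \<star> mon r [])" by (assumption | rule lins m)+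
    ultimately show ?case using B by (intro exI[of _ "\<lambda>h. \<epsilon> h \<star> mon r []"]) simp
  next
    case (e k)
    have "lin PA (\<lambda>h. e (h \<cdot> k))" by (assumption | rule lins e)+
    then show ?case using e cl_mult_e e_base by (intro exI[of _ "\<lambda>h. e (h \<cdot> k)"]) simp
  next
    case (uminus b)
    then obtain \<beta> where \<beta>: "lin PA \<beta>" "\<And>h. h \<in> carrier H \<Longrightarrow> \<beta> h \<in> B"
      "\<And>h. h \<in> carrier H \<Longrightarrow> cl h \<bullet> b = D PA h (\<lambda>p q. \<beta> p \<bullet> cl q)" by blast
    have neg: "abelian_group_hom PA PA (a_inv A)"
      by (rule abelian_group_homI[OF PA_abelian PA_abelian]) (auto simp: A.minus_add)
    have c: "\<beta> h \<in> carrier A" if "h \<in> carrier H" for h using \<beta>(2)[OF that] by (rule B_closed)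
    have "cl h \<bullet> (\<ominus>\<^bsub>A\<^esub> b) = D PA h (\<lambda>p q. (\<ominus>\<^bsub>A\<^esub> \<beta> p) \<bullet> cl q)" if h: "h \<in> carrier H" for h
    proof -
      have "cl h \<bullet> (\<ominus>\<^bsub>A\<^esub> b) = \<ominus>\<^bsub>A\<^esub> D PA h (\<lambda>p q. \<beta> p \<bullet> cl q)"
        using h uminus B_closed cl_closed \<beta>(3)[OF h] by (simp add: A.r_minus)
      also have "\<dots> = D PA h (\<lambda>p q. \<ominus>\<^bsub>A\<^esub> (\<beta> p \<bullet> cl q))"
        by (rule D_hom[OF neg]) (simp add: c cl_closed)
      finally show ?thesis by (simp add: c cl_closed A.l_minus)
    qed
    moreover have "lin PA (\<lambda>h. \<ominus>\<^bsub>A\<^esub> \<beta> h)"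
    proof (rule linI)
      show "\<ominus>\<^bsub>A\<^esub> \<beta> (r \<odot>\<^bsub>H\<^esub> x) = r \<star> (\<ominus>\<^bsub>A\<^esub> \<beta> x)" if "r \<in> carrier K" "x \<in> carrier H" for r x
        using linD(3)[OF \<beta>(1) that] that c mon_closed[OF that(1), of "[]"] by (simp add: PA_simps(6) A.r_minus)
    qed (use c linD_PA(2)[OF \<beta>(1)] in \<open>simp_all add: A.minus_add A.a_comm\<close>)
    ultimately show ?case using \<beta>(2) sub(5) by (intro exI[of _ "\<lambda>h. \<ominus>\<^bsub>A\<^esub> \<beta> h"]) simp
  next
    case (add b b')
    then obtain \<beta> \<beta>' where \<beta>: "lin PA \<beta>" "\<And>h. h \<in> carrier H \<Longrightarrow> \<beta> h \<in> B"
      "\<And>h. h \<in> carrier H \<Longrightarrow> cl h \<bullet> b = D PA h (\<lambda>p q. \<beta> p \<bullet> cl q)"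
      and \<beta>': "lin PA \<beta>'" "\<And>h. h \<in> carrier H \<Longrightarrow> \<beta>' h \<in> B"
      "\<And>h. h \<in> carrier H \<Longrightarrow> cl h \<bullet> b' = D PA h (\<lambda>p q. \<beta>' p \<bullet> cl q)" by blast
    have c: "\<beta> h \<in> carrier A" "\<beta>' h \<in> carrier A" if "h \<in> carrier H" for h using \<beta>(2)[OF that] \<beta>'(2)[OF that] by (auto intro: B_closed)
    have "cl h \<bullet> (b \<oplus>\<^bsub>A\<^esub> b') = D PA h (\<lambda>p q. (\<beta> p \<oplus>\<^bsub>A\<^esub> \<beta>' p) \<bullet> cl q)" if h: "h \<in> carrier H" for h
    proof -
      have "cl h \<bullet> (b \<oplus>\<^bsub>A\<^esub> b') = D PA h (\<lambda>p q. \<beta> p \<bullet> cl q) \<oplus>\<^bsub>PA\<^esub> D PA h (\<lambda>p q. \<beta>' p \<bullet> cl q)"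
        using h add B_closed cl_closed \<beta>(3)[OF h] \<beta>'(3)[OF h] by (simp add: A.r_distr)
      also have "\<dots> = D PA h (\<lambda>p q. \<beta> p \<bullet> cl q \<oplus>\<^bsub>PA\<^esub> \<beta>' p \<bullet> cl q)"
        by (rule D_add[OF PA_abelian, symmetric]) (simp_all add: c cl_closed)
      finally show ?thesis by (simp add: c cl_closed A.l_distr)
    qed
    moreover have "lin PA (\<lambda>h. \<beta> h \<oplus>\<^bsub>A\<^esub> \<beta>' h)"
    proof (rule linI)
      show "\<beta> (r \<odot>\<^bsub>H\<^esub> x) \<oplus>\<^bsub>A\<^esub> \<beta>' (r \<odot>\<^bsub>H\<^esub> x) = r \<star> (\<beta> x \<oplus>\<^bsub>A\<^esub> \<beta>' x)" if "r \<in> carrier K" "x \<in> carrier H" for r x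
        using linD(3)[OF \<beta>(1) that] linD(3)[OF \<beta>'(1) that] that c by (simp add: PA_smult_add)
      show "\<beta> (x \<oplus>\<^bsub>H\<^esub> y) \<oplus>\<^bsub>A\<^esub> \<beta>' (x \<oplus>\<^bsub>H\<^esub> y) = \<beta> x \<oplus>\<^bsub>A\<^esub> \<beta>' x \<oplus>\<^bsub>PA\<^esub> (\<beta> y \<oplus>\<^bsub>A\<^esub> \<beta>' y)"
        if "x \<in> carrier H" "y \<in> carrier H" for x y
        using that c linD_PA(2)[OF \<beta>(1) that] linD_PA(2)[OF \<beta>'(1) that] by (simp add: A.a_ac)
    qed (use c in simp)
    ultimately show ?case using \<beta>(2) \<beta>'(2) sub(7) by (intro exI[of _ "\<lambda>h. \<beta> h \<oplus>\<^bsub>A\<^esub> \<beta>' h"]) simp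
  next
    case (mult b b')
    then obtain \<beta> \<beta>' where \<beta>: "lin PA \<beta>" "\<And>h. h \<in> carrier H \<Longrightarrow> \<beta> h \<in> B"
      "\<And>h. h \<in> carrier H \<Longrightarrow> cl h \<bullet> b = D PA h (\<lambda>p q. \<beta> p \<bullet> cl q)"
      and \<beta>': "lin PA \<beta>'" "\<And>h. h \<in> carrier H \<Longrightarrow> \<beta>' h \<in> B"
      "\<And>h. h \<in> carrier H \<Longrightarrow> cl h \<bullet> b' = D PA h (\<lambda>p q. \<beta>' p \<bullet> cl q)" by blast
    have c: "\<beta> h \<in> carrier A" "\<beta>' h \<in> carrier A" if "h \<in> carrier H" for h using \<beta>(2)[OF that] \<beta>'(2)[OF that] by (auto intro: B_closed)
    note [lins] = lin_comp[OF \<beta>(1)] lin_comp[OF \<beta>'(1)] c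
    have "cl h \<bullet> (b \<bullet> b') = D PA h (\<lambda>p q. D PA p (\<lambda>s t. \<beta> s \<bullet> \<beta>' t) \<bullet> cl q)" if h: "h \<in> carrier H" for h
    proof -
      have "cl h \<bullet> (b \<bullet> b') = D PA h (\<lambda>p q. \<beta> p \<bullet> cl q) \<bullet> b'"
        using h mult B_closed cl_closed by (simp add: A.m_assoc[symmetric] \<beta>(3)[OF h])
      also have "\<dots> = D PA h (\<lambda>p q. (\<beta> p \<bullet> cl q) \<bullet> b')"
        by (rule PA_mult_right[symmetric]) (assumption | rule lins B_closed[OF mult(2)])+
      also have "\<dots> = D PA h (\<lambda>p q. D PA q (\<lambda>t d. (\<beta> p \<bullet> \<beta>' t) \<bullet> cl d))"
      proof (intro D_cong refl)
        fix p q assume pq: "p \<in> carrier H" "q \<in> carrier H"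
        have "(\<beta> p \<bullet> cl q) \<bullet> b' = \<beta> p \<bullet> D PA q (\<lambda>t d. \<beta>' t \<bullet> cl d)"
          using pq c mult B_closed cl_closed by (simp add: A.m_assoc \<beta>'(3)[OF pq(2), symmetric])
        also have "\<dots> = D PA q (\<lambda>t d. \<beta> p \<bullet> (\<beta>' t \<bullet> cl d))"
          by (rule PA_mult_left[symmetric]) (assumption | rule lins pq)+
        finally show "(\<beta> p \<bullet> cl q) \<bullet> b' = D PA q (\<lambda>t d. (\<beta> p \<bullet> \<beta>' t) \<bullet> cl d)"
          using pq c by (simp add: A.m_assoc cl_closed)
      qed
      also have "\<dots> = D PA h (\<lambda>p q. D PA p (\<lambda>s t. (\<beta> s \<bullet> \<beta>' t) \<bullet> cl q))"
        by (rule D_coassoc[OF PA_abelian, symmetric]) (assumption | rule lins)+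
      also have "\<dots> = D PA h (\<lambda>p q. D PA p (\<lambda>s t. \<beta> s \<bullet> \<beta>' t) \<bullet> cl q)"
        by (rule D_cong[OF refl], rule PA_mult_right) (assumption | rule lins)+
      finally show ?thesis .
    qed
    moreover have "lin PA (\<lambda>h. D PA h (\<lambda>s t. \<beta> s \<bullet> \<beta>' t))" by (assumption | rule lins)+
    moreover have "D PA h (\<lambda>s t. \<beta> s \<bullet> \<beta>' t) \<in> B" for h
      using \<beta>(2) \<beta>'(2) sub(6) by (intro D_base) simp
    ultimately show ?case by (intro exI[of _ "\<lambda>h. D PA h (\<lambda>s t. \<beta> s \<bullet> \<beta>' t)"]) simp
  qed
  then show thesis using that by blast
qed

text \<open>
  With \<open>\<beta>\<close> from the preceding lemma the conjugate is \<open>\<beta> h\<^sub>1 [h\<^sub>2][S h\<^sub>3]\<close>, which is \<open>\<beta> h\<^sub>1\<close> times the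
  \<open>e\<close> of \<open>h\<^sub>2\<close>.
\<close>

lemma conj_base:
  assumes b: "b \<in> B" and h: "h \<in> carrier H"
  shows "conj h b \<in> B"
proof -
  interpret A: ring A by (rule A_ring)
  show ?thesis
  proof (rule cl_base[OF b])
    fix \<beta> assume \<beta>: "lin PA \<beta>" "\<And>h. h \<in> carrier H \<Longrightarrow> \<beta> h \<in> B"
      "\<And>h. h \<in> carrier H \<Longrightarrow> cl h \<bullet> b = D PA h (\<lambda>p q. \<beta> p \<bullet> cl q)"
    have c: "\<beta> h \<in> carrier A" if "h \<in> carrier H" for h using \<beta>(2)[OF that] by (rule B_closed)
    note [lins] = lin_comp[OF \<beta>(1)] c
    have "conj h b = D PA h (\<lambda>p r. (cl p \<bullet> b) \<bullet> cl (S r))"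
      unfolding conj_def using B_closed[OF b] by (simp add: A.m_assoc cl_closed antipode_closed)
    also have "\<dots> = D PA h (\<lambda>p r. D PA p (\<lambda>s t. \<beta> s \<bullet> cl t) \<bullet> cl (S r))"
      by (simp add: \<beta>(3))
    also have "\<dots> = D PA h (\<lambda>p r. D PA p (\<lambda>s t. (\<beta> s \<bullet> cl t) \<bullet> cl (S r)))"
      by (rule D_cong[OF refl], rule PA_mult_right[symmetric]) (assumption | rule lins)+
    also have "\<dots> = D PA h (\<lambda>s q. D PA q (\<lambda>t r. (\<beta> s \<bullet> cl t) \<bullet> cl (S r)))"
      by (rule D_coassoc[OF PA_abelian]) (assumption | rule lins)+
    also have "\<dots> = D PA h (\<lambda>s q. D PA q (\<lambda>t r. \<beta> s \<bullet> (cl t \<bullet> cl (S r))))"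
      using c by (simp add: A.m_assoc cl_closed antipode_closed)
    also have "\<dots> = D PA h (\<lambda>s q. \<beta> s \<bullet> e q)"
      unfolding e_def by (rule D_cong[OF refl], rule PA_mult_left) (assumption | rule lins)+
    also have "\<dots> \<in> B"
      using \<beta>(2) e_base subringE(6)[OF base_subring] by (intro D_base) simp
    finally show ?thesis .
  qed
qed

lemma act_base: "\<lbrakk>x \<in> carrier A; b \<in> B\<rbrakk> \<Longrightarrow> act x b \<in> B"
proof (induction arbitrary: b rule: par_alg_induct)
  case (scalar r)
  then show ?case
    using mon_base[OF scalar(1)] subringE(6)[OF base_subring] B_closed by (simp add: act_scalar PA_simps(6))
next
  case (add x y)
  then show ?case using subringE(7)[OF base_subring] B_closed by (simp add: act_add)
next
  case (cl h x)
  then show ?case using conj_base B_closed act_closed by (simp add: act_mult cl_closed act_cl)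
qed

lemma e_eq_sum: "k \<in> carrier H \<Longrightarrow> W_action (e k) f = D W k (\<lambda>a b. W_action (cl a) (W_action (cl (S b)) f))"
proof -
  assume k: "k \<in> carrier H"
  interpret A: ring A by (rule A_ring)
  interpret W: module K W by (rule W_module)
  have "abelian_group_hom PA W (\<lambda>x. W_action x f)"
    using W_action_closed by (intro abelian_group_homI PA_abelian W.M.abelian_group_axioms) (auto simp: W_action_add)
  from D_hom[OF this, of "\<lambda>a b. cl a \<bullet> cl (S b)" k] show ?thesis
    unfolding e_def by (simp add: cl_closed antipode_closed W_action_mult)
qed

lemma D_W_apply:
  assumes x: "x \<in> carrier H" and p: "\<And>a b. \<lbrakk>a \<in> carrier H; b \<in> carrier H\<rbrakk> \<Longrightarrow> p a b \<in> carrier W"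
  shows "D W h p x = D PA h (\<lambda>a b. p a b x)"
proof -
  interpret W: module K W by (rule W_module)
  have "abelian_group_hom W PA (\<lambda>f. f x)"
    using W_closed by (intro abelian_group_homI W.M.abelian_group_axioms PA_abelian) (auto simp: W_add)
  from D_hom[OF this p] show ?thesis .
qed

text \<open>
  The left-hand side is \<open>[k\<^sub>1][S k\<^sub>3] c [k\<^sub>4][S k\<^sub>2]\<close>, and after exchanging the inner
  legs \<open>c\<close> lies between the \<open>e\<close> of \<open>k\<^sub>1\<close> and the \<open>e\<close> of \<open>k\<^sub>2\<close>. These commute with \<open>c\<close>, and their product
  collapses by \<open>e_e\<close>.
\<close>

lemma conj_conj_antipode:
  assumes k: "k \<in> carrier H" and c: "c \<in> B"
  shows "D PA k (\<lambda>a b. conj a (conj (S b) c)) = e k \<bullet> c"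
proof -
  interpret A: ring A by (rule A_ring)
  note cA = B_closed[OF c]
  have "D PA k (\<lambda>a b. conj a (conj (S b) c)) =
      D PA k (\<lambda>a b. D PA a (\<lambda>p q. D PA b (\<lambda>s t. (cl p \<bullet> cl (S s)) \<bullet> (c \<bullet> (cl t \<bullet> cl (S q))))))"
  proof (intro D_cong refl)
    fix a b assume ab: "a \<in> carrier H" "b \<in> carrier H"
    have "conj (S b) c = D PA b (\<lambda>s t. cl (S s) \<bullet> (c \<bullet> cl (S (S t))))"
      unfolding conj_def by (rule D_antipode[OF PA_module _ _ ab(2)]) (assumption | rule lins cA)+
    then have Sb: "conj (S b) c = D PA b (\<lambda>s t. cl (S s) \<bullet> (c \<bullet> cl t))"
      by (simp add: antipode_antipode)
    show "conj a (conj (S b) c) = D PA a (\<lambda>p q. D PA b (\<lambda>s t. (cl p \<bullet> cl (S s)) \<bullet> (c \<bullet> (cl t \<bullet> cl (S q)))))"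
      unfolding conj_def[of a] Sb
    proof (intro D_cong refl)
      fix p q assume pq: "p \<in> carrier H" "q \<in> carrier H"
      have "D PA b (\<lambda>s t. cl (S s) \<bullet> (c \<bullet> cl t)) \<bullet> cl (S q) = D PA b (\<lambda>s t. (cl (S s) \<bullet> (c \<bullet> cl t)) \<bullet> cl (S q))"
        by (rule PA_mult_right[symmetric]) (assumption | rule lins pq cA)+
      then have "cl p \<bullet> (D PA b (\<lambda>s t. cl (S s) \<bullet> (c \<bullet> cl t)) \<bullet> cl (S q)) =
          cl p \<bullet> D PA b (\<lambda>s t. (cl (S s) \<bullet> (c \<bullet> cl t)) \<bullet> cl (S q))" by simp
      also have "\<dots> = D PA b (\<lambda>s t. cl p \<bullet> ((cl (S s) \<bullet> (c \<bullet> cl t)) \<bullet> cl (S q)))"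
        by (rule PA_mult_left[symmetric]) (assumption | rule lins pq cA)+
      finally show "cl p \<bullet> (D PA b (\<lambda>s t. cl (S s) \<bullet> (c \<bullet> cl t)) \<bullet> cl (S q)) =
          D PA b (\<lambda>s t. (cl p \<bullet> cl (S s)) \<bullet> (c \<bullet> (cl t \<bullet> cl (S q))))"
        using pq cA by (simp add: A.m_assoc cl_closed antipode_closed)
    qed
  qed
  also have "\<dots> = D PA k (\<lambda>a b. D PA a (\<lambda>p s. cl p \<bullet> cl (S s)) \<bullet> D PA b (\<lambda>q t. c \<bullet> (cl t \<bullet> cl (S q))))"
    by (rule D_product[OF PA_algebra, unfolded PA_simps(2)]) (assumption | rule lins cA)+
  also have "\<dots> = D PA k (\<lambda>a b. (e a \<bullet> e b) \<bullet> c)"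
  proof (intro D_cong refl)
    fix a b assume ab: "a \<in> carrier H" "b \<in> carrier H"
    have "D PA b (\<lambda>q t. c \<bullet> (cl t \<bullet> cl (S q))) = c \<bullet> D PA b (\<lambda>q t. cl t \<bullet> cl (S q))"
      by (rule PA_mult_left) (assumption | rule lins cA)+
    also have "D PA b (\<lambda>q t. cl t \<bullet> cl (S q)) = D PA b (\<lambda>t q. cl t \<bullet> cl (S q))"
      by (rule D_cocomm[OF PA_abelian]) (assumption | rule lins)+
    finally show "D PA a (\<lambda>p s. cl p \<bullet> cl (S s)) \<bullet> D PA b (\<lambda>q t. c \<bullet> (cl t \<bullet> cl (S q))) = (e a \<bullet> e b) \<bullet> c"
      using ab cA base_commute_e[OF c ab(2)] by (simp add: e_def[symmetric] A.m_assoc e_closed)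
  qed
  also have "\<dots> = D PA k (\<lambda>a b. e a \<bullet> e b) \<bullet> c"
    by (rule PA_mult_right) (assumption | rule lins cA)+
  finally show ?thesis by (simp add: e_e[OF k])
qed

end

section \<open>Dual bases of projective modules\<close>

lemma (in left_module) smult_l_zero: "x \<in> carrier M \<Longrightarrow> \<zero>\<^bsub>R\<^esub> \<odot>\<^bsub>M\<^esub> x = \<zero>\<^bsub>M\<^esub>"
proof -
  assume x: "x \<in> carrier M"
  have "abelian_group_hom R M (\<lambda>a. a \<odot>\<^bsub>M\<^esub> x)"
    using x by (intro abelian_group_homI R.abelian_group_axioms M.abelian_group_axioms) (auto simp: smult_closed smult_l_distr)
  then show ?thesis by (rule abelian_group_hom.hom_zero)
qed

text \<open>
  The identity of \<open>P\<close> lifts along the canonical surjection from the free module on the set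
  \<open>carrier P\<close>; the components of the lift are the coordinates.
\<close>

lemma projective_dual_basis:
  fixes R :: "('r, 's) ring_scheme" and P :: "('r, 'm, 't) module_scheme"
  assumes proj: "projective TYPE('m \<Rightarrow> 'r) TYPE('m) R P"
  obtains \<phi> where
    "\<And>y x. x \<in> carrier P \<Longrightarrow> \<phi> y x \<in> carrier R"
    "\<And>y x x'. \<lbrakk>x \<in> carrier P; x' \<in> carrier P\<rbrakk> \<Longrightarrow> \<phi> y (x \<oplus>\<^bsub>P\<^esub> x') = \<phi> y x \<oplus>\<^bsub>R\<^esub> \<phi> y x'"
    "\<And>y a x. \<lbrakk>a \<in> carrier R; x \<in> carrier P\<rbrakk> \<Longrightarrow> \<phi> y (a \<odot>\<^bsub>P\<^esub> x) = a \<otimes>\<^bsub>R\<^esub> \<phi> y x"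
    "\<And>x. x \<in> carrier P \<Longrightarrow> finite {y \<in> carrier P. \<phi> y x \<noteq> \<zero>\<^bsub>R\<^esub>}"
    "\<And>x. x \<in> carrier P \<Longrightarrow> x = finsum P (\<lambda>y. \<phi> y x \<odot>\<^bsub>P\<^esub> y) {y \<in> carrier P. \<phi> y x \<noteq> \<zero>\<^bsub>R\<^esub>}"
proof -
  have P: "left_module R P" using proj by (simp add: projective_def)
  interpret P: left_module R P by (rule P)
  \<comment> \<open>\<open>P\<close> without additional record fields, as the lifting property speaks about plain modules\<close>
  define N :: "('r, 'm) module" where "N = \<lparr>carrier = carrier P, monoid.mult = monoid.mult P, one = one P,
    ring.zero = ring.zero P, ring.add = ring.add P, smult = smult P\<rparr>"
  have Ns: "carrier N = carrier P" "ring.zero N = \<zero>\<^bsub>P\<^esub>" "ring.add N = ring.add P" "smult N = smult P"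
    by (simp_all add: N_def)
  \<comment> \<open>the free module, as finitely supported functions\<close>
  define M :: "('r, 'm \<Rightarrow> 'r) module" where "M = \<lparr>carrier = {f. range f \<subseteq> carrier R \<and>
      {y. f y \<noteq> \<zero>\<^bsub>R\<^esub>} \<subseteq> carrier P \<and> finite {y. f y \<noteq> \<zero>\<^bsub>R\<^esub>}},
    monoid.mult = undefined, one = undefined, ring.zero = (\<lambda>y. \<zero>\<^bsub>R\<^esub>),
    ring.add = (\<lambda>f g y. f y \<oplus>\<^bsub>R\<^esub> g y), smult = (\<lambda>a f y. a \<otimes>\<^bsub>R\<^esub> f y)\<rparr>"
  have Ms: "f \<in> carrier M \<longleftrightarrow> range f \<subseteq> carrier R \<and> {y. f y \<noteq> \<zero>\<^bsub>R\<^esub>} \<subseteq> carrier P \<and> finite {y. f y \<noteq> \<zero>\<^bsub>R\<^esub>}"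
    "ring.zero M = (\<lambda>y. \<zero>\<^bsub>R\<^esub>)" "ring.add M f g = (\<lambda>y. f y \<oplus>\<^bsub>R\<^esub> g y)" "smult M a f = (\<lambda>y. a \<otimes>\<^bsub>R\<^esub> f y)" for f g a
    by (simp_all add: M_def)
  have Mc: "f y \<in> carrier R" if "f \<in> carrier M" for f y using that by (auto simp: Ms)
  have sub: "f \<in> carrier M" if "\<And>y. f y \<in> carrier R" "{y. f y \<noteq> \<zero>\<^bsub>R\<^esub>} \<subseteq> F" "finite F" "F \<subseteq> carrier P" for f F
    using that finite_subset[of "{y. f y \<noteq> \<zero>\<^bsub>R\<^esub>}" F] by (auto simp: Ms(1))
  have add: "(\<lambda>y. f y \<oplus>\<^bsub>R\<^esub> g y) \<in> carrier M" if "f \<in> carrier M" "g \<in> carrier M" for f g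
    by (rule sub[of _ "{y. f y \<noteq> \<zero>\<^bsub>R\<^esub>} \<union> {y. g y \<noteq> \<zero>\<^bsub>R\<^esub>}"]) (use that Mc in \<open>auto simp: Ms(1)\<close>)
  have smult: "(\<lambda>y. a \<otimes>\<^bsub>R\<^esub> f y) \<in> carrier M" if "a \<in> carrier R" "f \<in> carrier M" for a f
    by (rule sub[of _ "{y. f y \<noteq> \<zero>\<^bsub>R\<^esub>}"]) (use that Mc in \<open>auto simp: Ms(1)\<close>)
  have M: "left_module R M"
  proof (intro left_module.intro left_module_axioms.intro P.R.ring_axioms)
    show "abelian_group M"
    proof (rule abelian_groupI)
      fix f assume f: "f \<in> carrier M"
      show "\<exists>g\<in>carrier M. g \<oplus>\<^bsub>M\<^esub> f = \<zero>\<^bsub>M\<^esub>"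
      proof (rule bexI[of _ "\<lambda>y. \<ominus>\<^bsub>R\<^esub> f y"])
        show "(\<lambda>y. \<ominus>\<^bsub>R\<^esub> f y) \<oplus>\<^bsub>M\<^esub> f = \<zero>\<^bsub>M\<^esub>" using Mc[OF f] by (simp add: Ms(2,3) P.R.l_neg)
        show "(\<lambda>y. \<ominus>\<^bsub>R\<^esub> f y) \<in> carrier M"
          by (rule sub[of _ "{y. f y \<noteq> \<zero>\<^bsub>R\<^esub>}"]) (use f Mc[OF f] in \<open>auto simp: Ms(1)\<close>)
      qed
    qed (auto simp: Ms(2,3) add Mc P.R.a_ac, simp_all add: Ms(1))
  qed (auto simp: Ms(3,4) smult Mc P.R.l_distr P.R.r_distr P.R.m_assoc)
  have N: "left_module R N"
  proof (intro left_module.intro left_module_axioms.intro P.R.ring_axioms abelian_groupI)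
    show "\<exists>y\<in>carrier N. y \<oplus>\<^bsub>N\<^esub> x = \<zero>\<^bsub>N\<^esub>" if "x \<in> carrier N" for x
      using that by (intro bexI[of _ "\<ominus>\<^bsub>P\<^esub> x"]) (simp_all add: Ns P.M.l_neg)
  qed (auto simp: Ns P.smult_closed P.smult_l_distr P.smult_r_distr P.smult_assoc P.smult_one P.M.a_ac)
  interpret N: left_module R N by (rule N)
  define g where "g f = fsum N (\<lambda>y. f y \<odot>\<^bsub>N\<^esub> y) (carrier P)" for f
  have ev: "(\<lambda>f. f y \<odot>\<^bsub>N\<^esub> y) \<in> lmod_hom R M N" if "y \<in> carrier P" for y
    using that Mc by (auto simp: lmod_hom_def Ns Ms(3,4) P.smult_closed P.smult_l_distr P.smult_assoc)
  have g: "g \<in> lmod_hom R M N"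
    unfolding g_def[abs_def]
  proof (rule lmod_hom_fsum[OF M N ev])
    fix f assume "f \<in> carrier M"
    then have fin: "finite {y. f y \<noteq> \<zero>\<^bsub>R\<^esub>}" by (simp add: Ms(1))
    show "finite {y \<in> carrier P. f y \<odot>\<^bsub>N\<^esub> y \<noteq> \<zero>\<^bsub>N\<^esub>}"
      by (rule finite_subset[OF _ fin]) (auto simp: Ns P.smult_l_zero)
  qed
  have "x \<in> g ` carrier M" if x: "x \<in> carrier N" for x
  proof
    let ?d = "\<lambda>y. if y = x then \<one>\<^bsub>R\<^esub> else \<zero>\<^bsub>R\<^esub>"
    show "?d \<in> carrier M" by (rule sub[of _ "{x}"]) (use x in \<open>auto simp: Ns\<close>)
    have "g ?d = finsum N (\<lambda>y. ?d y \<odot>\<^bsub>N\<^esub> y) {x}"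
      unfolding g_def by (rule N.M.fsum_superset) (use x in \<open>auto simp: Ns P.smult_l_zero P.smult_closed\<close>)
    then show "x = g ?d" using x N.smult_one[OF x] by simp
  qed
  then have surj: "g ` carrier M = carrier N"
    using g by (auto simp: lmod_hom_def)
  have "(\<lambda>x. x) \<in> lmod_hom R P N" by (auto simp: lmod_hom_def Ns)
  then obtain h where h: "h \<in> lmod_hom R P M" "\<And>x. x \<in> carrier P \<Longrightarrow> g (h x) = x"
    using proj M N g surj unfolding projective_def by blast
  have hM: "h x \<in> carrier M" if "x \<in> carrier P" for x using h(1) that by (auto simp: lmod_hom_def)
  show thesis
  proof (rule that[of "\<lambda>y x. h x y"])
    show "h x y \<in> carrier R" if "x \<in> carrier P" for x y using Mc[OF hM[OF that]] .
    show "h (x \<oplus>\<^bsub>P\<^esub> x') y = h x y \<oplus>\<^bsub>R\<^esub> h x' y" if "x \<in> carrier P" "x' \<in> carrier P" for x x' y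
      using h(1) that by (simp add: lmod_hom_def Ms(3))
    show "h (a \<odot>\<^bsub>P\<^esub> x) y = a \<otimes>\<^bsub>R\<^esub> h x y" if "a \<in> carrier R" "x \<in> carrier P" for a x y
      using h(1) that by (simp add: lmod_hom_def Ms(4))
    fix x assume x: "x \<in> carrier P"
    show fin: "finite {y \<in> carrier P. h x y \<noteq> \<zero>\<^bsub>R\<^esub>}" using hM[OF x] by (simp add: Ms(1))
    have "fsum N (\<lambda>y. h x y \<odot>\<^bsub>N\<^esub> y) (carrier P) = finsum N (\<lambda>y. h x y \<odot>\<^bsub>N\<^esub> y) {y \<in> carrier P. h x y \<noteq> \<zero>\<^bsub>R\<^esub>}"
      by (rule N.M.fsum_superset[OF fin]) (use Mc[OF hM[OF x]] in \<open>auto simp: Ns P.smult_l_zero P.smult_closed\<close>)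
    then have "x = finsum N (\<lambda>y. h x y \<odot>\<^bsub>N\<^esub> y) {y \<in> carrier P. h x y \<noteq> \<zero>\<^bsub>R\<^esub>}"
      using h(2)[OF x] by (simp add: g_def)
    then show "x = finsum P (\<lambda>y. h x y \<odot>\<^bsub>P\<^esub> y) {y \<in> carrier P. h x y \<noteq> \<zero>\<^bsub>R\<^esub>}"
    proof -
      have "abelian_group_hom N P (\<lambda>x. x)"
        by (intro abelian_group_homI N.M.abelian_group_axioms P.M.abelian_group_axioms) (auto simp: Ns)
      from abelian_group_hom.hom_finsum_finite[OF this fin, of "\<lambda>y. h x y \<odot>\<^bsub>N\<^esub> y"]
      show ?thesis using Mc[OF hM[OF x]] \<open>x = finsum N _ _\<close> by (simp add: Ns P.smult_closed Pi_iff)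
    qed
  qed
qed

section \<open>The base algebra as a module\<close>

context cocommutative_hopf
begin

lemma a_inv_PA: "a_inv PA = a_inv A"
  by (simp add: fun_eq_iff a_inv_def m_inv_def)

text \<open>
  On the generators this is \<open>conj_conj_antipode\<close>, and both sides are multiplicative in \<open>b\<close>.
\<close>

lemma act_base_mult: "\<lbrakk>b \<in> B; c \<in> B\<rbrakk> \<Longrightarrow> act b c = b \<bullet> c"
proof (induction arbitrary: c rule: base_induct)
  case (scalar r)
  then show ?case by (simp add: act_scalar B_closed PA_simps(6))
next
  case (e k)
  have "abelian_group_hom PA PA (\<lambda>x. act x c)"
    using e B_closed by (intro abelian_group_homI PA_abelian) (auto simp: act_closed act_add)
  then have "act (e k) c = D PA k (\<lambda>a b. act (cl a \<bullet> cl (S b)) c)"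
    unfolding e_def by (rule D_hom) (simp add: A_m_closed cl_closed antipode_closed)
  also have "\<dots> = D PA k (\<lambda>a b. conj a (conj (S b) c))"
    using B_closed[OF e(2)] by (simp add: act_mult act_cl cl_closed antipode_closed conj_closed)
  finally show ?case by (simp add: conj_conj_antipode e)
next
  case (uminus b)
  interpret A: ring A by (rule A_ring)
  have "abelian_group_hom PA PA (\<lambda>x. act x c)"
    using uminus B_closed by (intro abelian_group_homI PA_abelian) (auto simp: act_closed act_add)
  then show ?case
    using abelian_group_hom.hom_a_inv[of PA PA "\<lambda>x. act x c" b] uminus B_closed by (simp add: a_inv_PA A.l_minus)
next
  case (add b b')
  interpret A: ring A by (rule A_ring)
  show ?case using add B_closed by (simp add: act_add A.l_distr)
next
  case (mult b b')
  interpret A: ring A by (rule A_ring)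
  show ?case using mult B_closed subringE(6)[OF base_subring] by (simp add: act_mult A.m_assoc)
qed

lemma par_base_lmod_simps:
  "carrier (par_base_lmod K H \<Delta> S f) = B" "ring.add (par_base_lmod K H \<Delta> S f) = ring.add A"
  "ring.zero (par_base_lmod K H \<Delta> S f) = \<zero>\<^bsub>A\<^esub>" "smult (par_base_lmod K H \<Delta> S f) = f"
  by (simp_all add: par_base_lmod_def Let_def)

lemma sweedler_conj:
  assumes ps: "sweedler K H \<Delta> h ps" and b: "b \<in> carrier A"
  shows "add_list A [cl x \<bullet> b \<bullet> cl (S y). (x, y) \<leftarrow> ps] = conj h b"
proof -
  interpret A: ring A by (rule A_ring)
  have "add_list PA [cl x \<bullet> b \<bullet> cl (S y). (x, y) \<leftarrow> ps] = D PA h (\<lambda>x y. cl x \<bullet> b \<bullet> cl (S y))"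
    by (rule D_sweedler[OF PA_abelian ps]) (assumption | rule lins b)+
  then show ?thesis
    using b by (simp add: add_list_PA conj_def A.m_assoc cl_closed antipode_closed)
qed

lemma is_par_action_act: "is_par_action K H \<Delta> S act"
proof -
  interpret A: ring A by (rule A_ring)
  note sub = subringE[OF base_subring]
  have "abelian_group (par_base_lmod K H \<Delta> S act)"
  proof (rule abelian_groupI)
    show "\<exists>y\<in>carrier (par_base_lmod K H \<Delta> S act). y \<oplus>\<^bsub>par_base_lmod K H \<Delta> S act\<^esub> x = \<zero>\<^bsub>par_base_lmod K H \<Delta> S act\<^esub>"
      if "x \<in> carrier (par_base_lmod K H \<Delta> S act)" for x
      using that sub(5)[of x] B_closed[of x] by (intro bexI[of _ "\<ominus>\<^bsub>A\<^esub> x"]) (simp_all add: par_base_lmod_simps A.l_neg)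
  qed (use sub(2,7) B_closed in \<open>auto simp: par_base_lmod_simps A.a_ac\<close>)
  then have "left_module A (par_base_lmod K H \<Delta> S act)"
    by (intro left_module.intro left_module_axioms.intro A_ring)
      (auto simp: par_base_lmod_simps act_base B_closed act_add act_arg_add act_mult act_one)
  then show ?thesis
    using sweedler_conj B_closed by (auto simp: is_par_action_def Let_def act_cl sweedler_def)
qed

text \<open>
  The algebra is generated by the \<open>[h]\<close>: the scalar \<open>r 1\<close> is the class of \<open>r \<odot> \<one>\<close>.
\<close>

lemma par_action_unique:
  assumes f: "is_par_action K H \<Delta> S f" and x: "x \<in> carrier A"
  shows "b \<in> B \<Longrightarrow> f x b = act x b"
proof -
  interpret N: left_module A "par_base_lmod K H \<Delta> S f" using f by (simp add: is_par_action_def Let_def)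
  note N = N.smult_l_distr[unfolded par_base_lmod_simps] N.smult_assoc[unfolded par_base_lmod_simps]
  have cl: "f (cl h) b = conj h b" if "h \<in> carrier H" "b \<in> B" for h b
    using f sweedler_expansion[OF that(1)] that(2) sweedler_conj[OF sweedler_expansion[OF that(1)] B_closed[OF that(2)]]
    by (auto simp: is_par_action_def Let_def)
  show "b \<in> B \<Longrightarrow> f x b = act x b"
    using x
  proof (induction arbitrary: b rule: par_alg_induct)
    case (scalar r)
    have "mon r [] = cl (r \<odot>\<^bsub>H\<^esub> \<one>\<^bsub>H\<^esub>)"
      using scalar mon_closed[of r "[]"] N.R.r_one by (simp add: cl_smult cl_one)
    then show ?case using scalar by (simp add: cl act_cl B_closed)
  next
    case (add x y)
    then show ?case by (simp add: N act_add B_closed)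
  next
    case (cl h x)
    then show ?case using cl_closed[OF cl(1)] \<open>\<And>b h. \<lbrakk>h \<in> carrier H; b \<in> B\<rbrakk> \<Longrightarrow> f (cl h) b = conj h b\<close>
      by (simp add: N act_mult act_cl B_closed act_base act_closed)
  qed
qed

lemma is_par_action_par_act: "is_par_action K H \<Delta> S (par_act K H \<Delta> S)"
  unfolding par_act_def by (rule someI[of "is_par_action K H \<Delta> S", OF is_par_action_act])

lemma par_act_eq: "\<lbrakk>x \<in> carrier A; b \<in> B\<rbrakk> \<Longrightarrow> par_act K H \<Delta> S x b = act x b"
  by (rule par_action_unique[OF is_par_action_par_act])

section \<open>A dual basis of the partial Hopf algebra over its base\<close>

lemma W_action_values_base:
  "\<lbrakk>x \<in> carrier A; f \<in> carrier W; \<And>k. k \<in> carrier H \<Longrightarrow> f k \<in> B; k \<in> carrier H\<rbrakk> \<Longrightarrow> W_action x f k \<in> B"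
proof (induction arbitrary: k rule: par_alg_induct)
  case (scalar r)
  then show ?case using mon_base subringE(6)[OF base_subring] by (simp add: W_action_scalar W_smult PA_simps(6))
next
  case (add x y)
  then show ?case using subringE(7)[OF base_subring] by (simp add: W_action_add W_add)
next
  case (cl h x)
  have "W_action (cl h \<bullet> x) f k = D PA h (\<lambda>u q. conj u (W_action x f (k \<cdot> q)))"
    using cl by (simp add: W_action_mult cl_closed W_action_cl W_action_closed)
  also have "\<dots> \<in> B"
    using cl by (intro D_base conj_base) auto
  finally show ?case .
qed

text \<open>
  The value at \<open>k\<close> is \<open>h\<^sub>1 \<triangleright> (S h\<^sub>3 \<triangleright> f (k h\<^sub>2 S h\<^sub>4))\<close>. Exchanging the inner legs cancels the
  translations, and what remains is \<open>conj_conj_antipode\<close>.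
\<close>

lemma W_action_e_apply:
  assumes h: "h \<in> carrier H" and f: "f \<in> carrier W" and fB: "\<And>k. k \<in> carrier H \<Longrightarrow> f k \<in> B" and k: "k \<in> carrier H"
  shows "W_action (e h) f k = e h \<bullet> f k"
proof -
  note [lins] = lin_comp[OF W_lin[OF f]] W_closed[OF f]
  have "W_action (e h) f k = D PA h (\<lambda>a b. W_action (cl a) (W_action (cl (S b)) f) k)"
    unfolding e_eq_sum[OF h] by (rule D_W_apply[OF k]) (simp add: W_action_closed cl_closed)
  also have "\<dots> = D PA h (\<lambda>a b. D PA a (\<lambda>u q. D PA b (\<lambda>s t. conj u (conj (S s) (f (k \<cdot> (q \<cdot> S t)))))))"
  proof (intro D_cong refl)
    fix a b assume ab: "a \<in> carrier H" "b \<in> carrier H"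
    have "W_action (cl a) (W_action (cl (S b)) f) k = D PA a (\<lambda>u q. conj u (W_action (cl (S b)) f (k \<cdot> q)))"
      using ab k f by (intro W_action_cl W_action_closed) (simp_all add: cl_closed antipode_closed)
    also have "\<dots> = D PA a (\<lambda>u q. D PA b (\<lambda>s t. conj u (conj (S s) (f (k \<cdot> (q \<cdot> S t))))))"
    proof (intro D_cong refl)
      fix u q assume uq: "u \<in> carrier H" "q \<in> carrier H"
      have "W_action (cl (S b)) f (k \<cdot> q) = D PA (S b) (\<lambda>s t. conj s (f (k \<cdot> (q \<cdot> t))))"
        using ab k uq f by (simp add: W_action_cl antipode_closed H.m_assoc)
      also have "\<dots> = D PA b (\<lambda>s t. conj (S s) (f (k \<cdot> (q \<cdot> S t))))"
        by (rule D_antipode[OF PA_module _ _ ab(2)]) (assumption | rule lins k uq)+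
      finally have "conj u (W_action (cl (S b)) f (k \<cdot> q)) = conj u (D PA b (\<lambda>s t. conj (S s) (f (k \<cdot> (q \<cdot> S t)))))"
        by simp
      also have "\<dots> = D PA b (\<lambda>s t. conj u (conj (S s) (f (k \<cdot> (q \<cdot> S t)))))"
        by (rule D_hom[OF conj_hom]) (simp add: conj_closed W_closed[OF f])
      finally show "conj u (W_action (cl (S b)) f (k \<cdot> q)) = D PA b (\<lambda>s t. conj u (conj (S s) (f (k \<cdot> (q \<cdot> S t)))))" .
    qed
    finally show "W_action (cl a) (W_action (cl (S b)) f) k = D PA a (\<lambda>u q. D PA b (\<lambda>s t. conj u (conj (S s) (f (k \<cdot> (q \<cdot> S t))))))" .
  qed
  also have "\<dots> = D PA h (\<lambda>a b. D PA a (\<lambda>u s. D PA b (\<lambda>q t. conj u (conj (S s) (f (k \<cdot> (q \<cdot> S t)))))))"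
    by (rule D_middle_swap[OF PA_module]) (assumption | rule lins k)+
  also have "\<dots> = D PA h (\<lambda>a b. \<epsilon> b \<star> (e a \<bullet> f k))"
  proof (intro D_cong refl)
    fix a b assume ab: "a \<in> carrier H" "b \<in> carrier H"
    have "D PA a (\<lambda>u s. D PA b (\<lambda>q t. conj u (conj (S s) (f (k \<cdot> (q \<cdot> S t)))))) =
        D PA a (\<lambda>u s. \<epsilon> b \<star> conj u (conj (S s) (f k)))"
    proof (intro D_cong refl)
      fix u s assume us: "u \<in> carrier H" "s \<in> carrier H"
      have "D PA b (\<lambda>q t. conj u (conj (S s) (f (k \<cdot> (q \<cdot> S t))))) = \<epsilon> b \<star> conj u (conj (S s) (f (k \<cdot> \<one>\<^bsub>H\<^esub>)))"
        by (rule D_antipode_right[OF PA_abelian _ ab(2), where f = "\<lambda>z. conj u (conj (S s) (f (k \<cdot> z)))"]) (assumption | rule lins k)+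
      then show "D PA b (\<lambda>q t. conj u (conj (S s) (f (k \<cdot> (q \<cdot> S t))))) = \<epsilon> b \<star> conj u (conj (S s) (f k))"
        using k by simp
    qed
    also have "\<dots> = \<epsilon> b \<star> D PA a (\<lambda>u s. conj u (conj (S s) (f k)))"
      using ab by (intro D_PA_smult counit_closed conj_closed W_closed[OF f])
    finally show "D PA a (\<lambda>u s. D PA b (\<lambda>q t. conj u (conj (S s) (f (k \<cdot> (q \<cdot> S t)))))) = \<epsilon> b \<star> (e a \<bullet> f k)"
      by (simp add: conj_conj_antipode[OF ab(1) fB[OF k]])
  qed
  also have "\<dots> = e h \<bullet> f k"
    by (rule D_counit_right[OF PA_abelian _ h]) (assumption | rule lins)+
  finally show ?thesis .
qed

text \<open>
  The product case uses that \<open>B\<close>-valued maps form a subrepresentation.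
\<close>

lemma W_action_base_apply:
  "\<lbrakk>b \<in> B; f \<in> carrier W; \<And>k. k \<in> carrier H \<Longrightarrow> f k \<in> B; k \<in> carrier H\<rbrakk> \<Longrightarrow> W_action b f k = b \<bullet> f k"
proof (induction arbitrary: f k rule: base_induct)
  case (scalar r)
  then show ?case by (simp add: W_action_scalar W_smult PA_simps(6))
next
  case (e h)
  then show ?case by (intro W_action_e_apply)
next
  case (uminus b)
  interpret A: ring A by (rule A_ring)
  have "abelian_group_hom PA PA (\<lambda>x. W_action x f k)"
    using W_closed[OF W_action_closed] by (intro abelian_group_homI PA_abelian) (auto simp: W_action_add W_add)
  from abelian_group_hom.hom_a_inv[OF this, of b] show ?case
    using uminus by (simp add: a_inv_PA A.l_minus B_closed W_closed)
next
  case (add b b')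
  interpret A: ring A by (rule A_ring)
  show ?case using add by (simp add: W_action_add W_add A.l_distr B_closed W_closed)
next
  case (mult b b')
  interpret A: ring A by (rule A_ring)
  have "W_action b (W_action b' f) k = b \<bullet> W_action b' f k"
    using mult(5-7) B_closed[OF mult(2)] by (intro mult(3) W_action_closed W_action_values_base) auto
  then show ?case using mult by (simp add: W_action_mult A.m_assoc B_closed W_closed)
qed

end

locale cocommutative_hopf_dual_basis = cocommutative_hopf K H \<Delta> \<epsilon> S
  for K :: "('k, 's) ring_scheme" and H :: "('k, 'h, 't) module_scheme"
    and \<Delta> :: "'h \<Rightarrow> ('h list \<Rightarrow>\<^sub>0 int) set" and \<epsilon> :: "'h \<Rightarrow> 'k" and S :: "'h \<Rightarrow> 'h" +
  fixes \<phi> :: "'h \<Rightarrow> 'h \<Rightarrow> 'k"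
  assumes phi_closed: "x \<in> carrier H \<Longrightarrow> \<phi> y x \<in> carrier K"
    and phi_add: "\<lbrakk>x \<in> carrier H; x' \<in> carrier H\<rbrakk> \<Longrightarrow> \<phi> y (x \<oplus>\<^bsub>H\<^esub> x') = \<phi> y x \<oplus>\<^bsub>K\<^esub> \<phi> y x'"
    and phi_smult: "\<lbrakk>r \<in> carrier K; x \<in> carrier H\<rbrakk> \<Longrightarrow> \<phi> y (r \<odot>\<^bsub>H\<^esub> x) = r \<otimes>\<^bsub>K\<^esub> \<phi> y x"
    and phi_finite: "x \<in> carrier H \<Longrightarrow> finite {y \<in> carrier H. \<phi> y x \<noteq> \<zero>\<^bsub>K\<^esub>}"
    and phi_expansion: "x \<in> carrier H \<Longrightarrow> x = finsum H (\<lambda>y. \<phi> y x \<odot>\<^bsub>H\<^esub> y) {y \<in> carrier H. \<phi> y x \<noteq> \<zero>\<^bsub>K\<^esub>}"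
begin

definition scalar_phi where "scalar_phi y = (\<lambda>k. if k \<in> carrier H then \<phi> y k \<star> \<one>\<^bsub>A\<^esub> else \<zero>\<^bsub>A\<^esub>)"

definition \<theta> where "\<theta> y x = W_action x (scalar_phi y) \<one>\<^bsub>H\<^esub>"

lemma scalar_phi_apply: "k \<in> carrier H \<Longrightarrow> scalar_phi y k = \<phi> y k \<star> \<one>\<^bsub>A\<^esub>"
  by (simp add: scalar_phi_def)

lemma scalar_phi_closed: "scalar_phi y \<in> carrier W"
proof -
  interpret A: ring A by (rule A_ring)
  have "lin PA (\<lambda>k. \<phi> y k \<star> \<one>\<^bsub>A\<^esub>)"
  proof (rule linI)
    fix x assume x: "x \<in> carrier H"
    show "\<phi> y x \<star> \<one>\<^bsub>A\<^esub> \<in> carrier PA" using x by (simp add: PA_smult_closed phi_closed)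
  next
    fix r x assume x: "r \<in> carrier K" "x \<in> carrier H"
    show "\<phi> y (r \<odot>\<^bsub>H\<^esub> x) \<star> \<one>\<^bsub>A\<^esub> = r \<star> (\<phi> y x \<star> \<one>\<^bsub>A\<^esub>)"
      using x by (simp add: phi_smult PA_smult_assoc phi_closed)
  next
    fix x x' assume x: "x \<in> carrier H" "x' \<in> carrier H"
    show "\<phi> y (x \<oplus>\<^bsub>H\<^esub> x') \<star> \<one>\<^bsub>A\<^esub> = \<phi> y x \<star> \<one>\<^bsub>A\<^esub> \<oplus>\<^bsub>PA\<^esub> \<phi> y x' \<star> \<one>\<^bsub>A\<^esub>"
      using x module.smult_l_distr[OF PA_module, of "\<phi> y x" "\<phi> y x'" "\<one>\<^bsub>A\<^esub>"] by (simp add: phi_add phi_closed)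
  qed
  then show ?thesis unfolding scalar_phi_def by (rule W_restrict)
qed

lemma PA_smult_base: "\<lbrakk>r \<in> carrier K; b \<in> B\<rbrakk> \<Longrightarrow> r \<star> b \<in> B"
  using mon_base subringE(6)[OF base_subring] by (simp add: PA_simps(6))

lemma scalar_phi_base: "k \<in> carrier H \<Longrightarrow> scalar_phi y k \<in> B"
  using subringE(3)[OF base_subring] by (simp add: scalar_phi_apply PA_smult_base phi_closed)

lemma theta_base: "x \<in> carrier A \<Longrightarrow> \<theta> y x \<in> B"
  unfolding \<theta>_def by (rule W_action_values_base[OF _ scalar_phi_closed scalar_phi_base]) auto

lemma theta_additive: "\<lbrakk>x \<in> carrier A; x' \<in> carrier A\<rbrakk> \<Longrightarrow> \<theta> y (x \<oplus>\<^bsub>A\<^esub> x') = \<theta> y x \<oplus>\<^bsub>A\<^esub> \<theta> y x'"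
  by (simp add: \<theta>_def W_action_add W_add)

text \<open>
  \<open>b\<close> acts on the \<open>B\<close>-valued map \<^term>\<open>W_action x (scalar_phi y)\<close> by pointwise multiplication.
\<close>

lemma theta_base_linear: "\<lbrakk>b \<in> B; x \<in> carrier A\<rbrakk> \<Longrightarrow> \<theta> y (b \<bullet> x) = b \<bullet> \<theta> y x"
proof -
  assume b: "b \<in> B" and x: "x \<in> carrier A"
  have "W_action b (W_action x (scalar_phi y)) \<one>\<^bsub>H\<^esub> = b \<bullet> W_action x (scalar_phi y) \<one>\<^bsub>H\<^esub>"
    using W_action_values_base[OF x scalar_phi_closed scalar_phi_base] by (intro W_action_base_apply[OF b W_action_closed[OF x]]) auto
  then show ?thesis by (simp add: \<theta>_def W_action_mult[OF B_closed[OF b] x])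
qed

lemma theta_cl: "h \<in> carrier H \<Longrightarrow> \<theta> y (cl h) = D PA h (\<lambda>u q. \<phi> y q \<star> e u)"
proof -
  interpret A: ring A by (rule A_ring)
  assume h: "h \<in> carrier H"
  have "conj u \<one>\<^bsub>A\<^esub> = e u" for u
    by (simp add: conj_def e_def cl_closed antipode_closed)
  then show ?thesis
    using W_action_cl[OF h scalar_phi_closed H.one_closed]
    by (simp add: \<theta>_def scalar_phi_apply conj_smult phi_closed)
qed

text \<open>
  The expansion in the dual basis, over some finite set that contains the support. Not insisting
  on the support itself makes the property additive.
\<close>

definition expands where
  "expands x \<longleftrightarrow> x \<in> carrier A \<and> (\<exists>Y. finite Y \<and> Y \<subseteq> carrier H \<and> (\<forall>y\<in>carrier H - Y. \<theta> y x = \<zero>\<^bsub>A\<^esub>) \<and>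
    x = finsum A (\<lambda>y. \<theta> y x \<bullet> cl y) Y)"

lemma theta_cl_closed: "\<lbrakk>x \<in> carrier A; y \<in> carrier H\<rbrakk> \<Longrightarrow> \<theta> y x \<bullet> cl y \<in> carrier A"
  using theta_base B_closed by (simp add: A_m_closed cl_closed)

lemma finsum_enlarge:
  assumes "x \<in> carrier A" "finite G" "G \<subseteq> carrier H" "Y \<subseteq> G" "\<forall>y\<in>carrier H - Y. \<theta> y x = \<zero>\<^bsub>A\<^esub>"
  shows "finsum A (\<lambda>y. \<theta> y x \<bullet> cl y) Y = finsum A (\<lambda>y. \<theta> y x \<bullet> cl y) G"
proof -
  interpret A: ring A by (rule A_ring)
  show ?thesis
    using assms theta_cl_closed by (intro A.add.finprod_mono_neutral_cong_left) (auto simp: cl_closed)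
qed

lemma expandsD:
  assumes "expands x"
  shows "finite {y \<in> carrier H. \<theta> y x \<noteq> \<zero>\<^bsub>A\<^esub>}"
    and "x = finsum A (\<lambda>y. \<theta> y x \<bullet> cl y) {y \<in> carrier H. \<theta> y x \<noteq> \<zero>\<^bsub>A\<^esub>}"
proof -
  obtain Y where Y: "finite Y" "Y \<subseteq> carrier H" "\<forall>y\<in>carrier H - Y. \<theta> y x = \<zero>\<^bsub>A\<^esub>" "x = finsum A (\<lambda>y. \<theta> y x \<bullet> cl y) Y"
    and x: "x \<in> carrier A"
    using assms by (auto simp: expands_def)
  have sub: "{y \<in> carrier H. \<theta> y x \<noteq> \<zero>\<^bsub>A\<^esub>} \<subseteq> Y" using Y by auto
  then show "finite {y \<in> carrier H. \<theta> y x \<noteq> \<zero>\<^bsub>A\<^esub>}" using Y(1) by (rule finite_subset)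
  show "x = finsum A (\<lambda>y. \<theta> y x \<bullet> cl y) {y \<in> carrier H. \<theta> y x \<noteq> \<zero>\<^bsub>A\<^esub>}"
    using finsum_enlarge[OF x Y(1,2) sub] Y(4) by auto
qed

lemma expands_add:
  assumes "expands x" "expands x'"
  shows "expands (x \<oplus>\<^bsub>A\<^esub> x')"
proof -
  interpret A: ring A by (rule A_ring)
  obtain Y Y' where Y: "finite Y" "Y \<subseteq> carrier H" "\<forall>y\<in>carrier H - Y. \<theta> y x = \<zero>\<^bsub>A\<^esub>" "x = finsum A (\<lambda>y. \<theta> y x \<bullet> cl y) Y"
    and Y': "finite Y'" "Y' \<subseteq> carrier H" "\<forall>y\<in>carrier H - Y'. \<theta> y x' = \<zero>\<^bsub>A\<^esub>" "x' = finsum A (\<lambda>y. \<theta> y x' \<bullet> cl y) Y'"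
    and x: "x \<in> carrier A" "x' \<in> carrier A"
    using assms by (auto simp: expands_def)
  have G: "finite (Y \<union> Y')" "Y \<union> Y' \<subseteq> carrier H" using Y Y' by auto
  have "finsum A (\<lambda>y. \<theta> y (x \<oplus>\<^bsub>A\<^esub> x') \<bullet> cl y) (Y \<union> Y') =
      finsum A (\<lambda>y. \<theta> y x \<bullet> cl y \<oplus>\<^bsub>A\<^esub> \<theta> y x' \<bullet> cl y) (Y \<union> Y')"
    using G x theta_base B_closed theta_cl_closed
    by (intro A.finsum_cong') (auto simp: theta_additive A.l_distr cl_closed subset_iff)
  also have "\<dots> = finsum A (\<lambda>y. \<theta> y x \<bullet> cl y) (Y \<union> Y') \<oplus>\<^bsub>A\<^esub> finsum A (\<lambda>y. \<theta> y x' \<bullet> cl y) (Y \<union> Y')"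
    using G x theta_cl_closed by (intro A.finsum_addf) auto
  also have "\<dots> = x \<oplus>\<^bsub>A\<^esub> x'"
    using finsum_enlarge[OF x(1) G _ Y(3)] finsum_enlarge[OF x(2) G _ Y'(3)] Y(4) Y'(4) by simp
  finally show ?thesis
    unfolding expands_def using G x Y(3) Y'(3)
    by (intro conjI exI[of _ "Y \<union> Y'"]) (auto simp: theta_additive)
qed

lemma expands_base_mult:
  assumes b: "b \<in> B" and "expands x"
  shows "expands (b \<bullet> x)"
proof -
  interpret A: ring A by (rule A_ring)
  note bA = B_closed[OF b]
  obtain Y where Y: "finite Y" "Y \<subseteq> carrier H" "\<forall>y\<in>carrier H - Y. \<theta> y x = \<zero>\<^bsub>A\<^esub>" "x = finsum A (\<lambda>y. \<theta> y x \<bullet> cl y) Y"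
    and x: "x \<in> carrier A"
    using assms(2) by (auto simp: expands_def)
  have "finsum A (\<lambda>y. \<theta> y (b \<bullet> x) \<bullet> cl y) Y = finsum A (\<lambda>y. b \<bullet> (\<theta> y x \<bullet> cl y)) Y"
    using Y x bA theta_base[OF x] B_closed theta_cl_closed[OF x]
    by (intro A.finsum_cong') (auto simp: theta_base_linear[OF b] A.m_assoc cl_closed subset_iff)
  also have "\<dots> = b \<bullet> finsum A (\<lambda>y. \<theta> y x \<bullet> cl y) Y"
    using Y x bA theta_cl_closed[OF x] by (intro A.finsum_rdistr[symmetric]) auto
  finally show ?thesis
    unfolding expands_def using Y x bA
    by (intro conjI exI[of _ Y]) (auto simp: theta_base_linear[OF b])
qed

lemma expands_zero: "expands \<zero>\<^bsub>A\<^esub>"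
proof -
  interpret A: ring A by (rule A_ring)
  have "\<theta> y \<zero>\<^bsub>A\<^esub> = \<zero>\<^bsub>A\<^esub>" for y
    using theta_additive[of "\<zero>\<^bsub>A\<^esub>" "\<zero>\<^bsub>A\<^esub>" y] B_closed[OF theta_base[of "\<zero>\<^bsub>A\<^esub>" y]]
    by (metis A.zero_closed A.l_zero A.add.r_cancel_one)
  then show ?thesis by (auto simp: expands_def intro!: exI[of _ "{}"])
qed

lemma finsum_add_list:
  assumes "finite Y" "\<And>y p. \<lbrakk>y \<in> Y; p \<in> set ps\<rbrakk> \<Longrightarrow> f y p \<in> carrier A"
  shows "finsum A (\<lambda>y. add_list A (map (f y) ps)) Y = add_list A (map (\<lambda>p. finsum A (\<lambda>y. f y p) Y) ps)"
proof -
  interpret A: ring A by (rule A_ring)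
  have closed: "add_list A (map (f y) qs) \<in> carrier A" if "set qs \<subseteq> set ps" "y \<in> Y" for y qs
    using that assms(2) by (intro A.add_list_closed) auto
  have "set qs \<subseteq> set ps \<Longrightarrow> finsum A (\<lambda>y. add_list A (map (f y) qs)) Y = add_list A (map (\<lambda>p. finsum A (\<lambda>y. f y p) Y) qs)" for qs
    using assms closed by (induction qs) (auto simp: A.finsum_addf Pi_iff)
  then show ?thesis by simp
qed

text \<open>
  \<open>\<theta>\<^sub>y [h]\<close> is the sum of the \<open>\<phi>\<^sub>y h\<^sub>2\<close> times the \<open>e\<close> of \<open>h\<^sub>1\<close>. Summing the products with \<open>[y]\<close> over \<open>y\<close> restores \<open>[h\<^sub>2]\<close>, and
  the result is \<open>[h]\<close> by \<open>e_cl\<close>.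
\<close>

lemma expands_cl:
  assumes h: "h \<in> carrier H"
  shows "expands (cl h)"
proof -
  interpret A: ring A by (rule A_ring)
  interpret P: k_algebra K PA by (rule PA_algebra)
  \<comment> \<open>the finitely many coordinates that any second leg of the chosen expansion of \<open>h\<close> involves\<close>
  define Y where "Y = (\<Union>p\<in>set (expansion h). {y \<in> carrier H. \<phi> y (snd p) \<noteq> \<zero>\<^bsub>K\<^esub>})"
  have ex: "u \<in> carrier H" "q \<in> carrier H" if "(u, q) \<in> set (expansion h)" for u q
    using expansion_closed[OF h that] by auto
  have Y: "finite Y" "Y \<subseteq> carrier H"
    unfolding Y_def using ex phi_finite by auto
  define g where "g y p = (\<phi> y (snd p) \<star> e (fst p)) \<bullet> cl y" for y p
  have th: "\<theta> y (cl h) = add_list A [\<phi> y q \<star> e u. (u, q) \<leftarrow> expansion h]" for y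
    by (simp only: theta_cl[OF h] D_PA[OF h])
  have zero: "\<theta> y (cl h) = \<zero>\<^bsub>A\<^esub>" if "y \<in> carrier H - Y" for y
  proof -
    have "\<phi> y q \<star> e u = \<zero>\<^bsub>A\<^esub>" if p: "(u, q) \<in> set (expansion h)" for u q
    proof -
      have "\<phi> y q = \<zero>\<^bsub>K\<^esub>" using p \<open>y \<in> carrier H - Y\<close> by (auto simp: Y_def)
      then show ?thesis using P.smult_l_null[of "e u"] ex(1)[OF p] by (simp add: e_closed)
    qed
    then have "[\<phi> y q \<star> e u. (u, q) \<leftarrow> expansion h] = map (\<lambda>p. \<zero>\<^bsub>A\<^esub>) (expansion h)" by auto
    then show ?thesis by (simp only: th A.add_list_zero)
  qed
  have gc: "g y p \<in> carrier A" if "y \<in> Y" "p \<in> set (expansion h)" for y p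
    using that Y ex[of "fst p" "snd p"] by (auto simp: g_def phi_closed e_closed cl_closed PA_smult_closed A_m_closed)
  have "finsum A (\<lambda>y. \<theta> y (cl h) \<bullet> cl y) Y = finsum A (\<lambda>y. add_list A (map (g y) (expansion h))) Y"
  proof (rule A.finsum_cong'[OF refl])
    show "(\<lambda>y. add_list A (map (g y) (expansion h))) \<in> Y \<rightarrow> carrier A"
      using gc by (intro funcsetI A.add_list_closed) auto
    fix y assume y: "y \<in> Y"
    have "abelian_group_hom A A (\<lambda>x. x \<bullet> cl y)"
      using y Y cl_closed by (intro abelian_group_homI A.abelian_group_axioms) (auto simp: A.l_distr)
    note hom = abelian_group_hom.hom_add_list[OF this, of "[\<phi> y q \<star> e u. (u, q) \<leftarrow> expansion h]"]
    have "\<phi> y (snd p) \<star> e (fst p) \<in> carrier A" if "p \<in> set (expansion h)" for p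
      using ex[of "fst p" "snd p"] that by (simp add: phi_closed e_closed PA_smult_closed)
    then have sm: "set [\<phi> y q \<star> e u. (u, q) \<leftarrow> expansion h] \<subseteq> carrier A" by (force simp: case_prod_unfold)
    show "\<theta> y (cl h) \<bullet> cl y = add_list A (map (g y) (expansion h))"
      unfolding th using hom[OF sm] by (simp add: g_def[abs_def] comp_def case_prod_unfold)
  qed
  also have "\<dots> = add_list A (map (\<lambda>p. finsum A (\<lambda>y. g y p) Y) (expansion h))"
    using gc by (intro finsum_add_list Y) auto
  also have "map (\<lambda>p. finsum A (\<lambda>y. g y p) Y) (expansion h) = [e u \<bullet> cl q. (u, q) \<leftarrow> expansion h]"
  proof -
    have "finsum A (\<lambda>y. g y (u, q)) Y = e u \<bullet> cl q" if p: "(u, q) \<in> set (expansion h)" for u q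
    proof -
      note uq = ex[OF p]
      have hom: "abelian_group_hom H A (\<lambda>x. e u \<bullet> cl x)"
        using uq by (intro abelian_group_homI H_module(2) A.abelian_group_axioms)
          (auto simp: cl_closed e_closed cl_add A.r_distr)
      have q: "q = finsum H (\<lambda>y. \<phi> y q \<odot>\<^bsub>H\<^esub> y) Y"
      proof -
        have "finsum H (\<lambda>y. \<phi> y q \<odot>\<^bsub>H\<^esub> y) {y \<in> carrier H. \<phi> y q \<noteq> \<zero>\<^bsub>K\<^esub>} = finsum H (\<lambda>y. \<phi> y q \<odot>\<^bsub>H\<^esub> y) Y"
          using Y p uq by (intro M.add.finprod_mono_neutral_cong_left) (force simp: Y_def phi_closed)+
        then show ?thesis using phi_expansion[OF uq(2)] by simp
      qed
      have "finsum A (\<lambda>y. g y (u, q)) Y = finsum A (\<lambda>y. e u \<bullet> cl (\<phi> y q \<odot>\<^bsub>H\<^esub> y)) Y"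
        using Y uq phi_closed
        by (intro A.finsum_cong')
          (auto simp: g_def linD(3)[OF lin_cl] PA_smult_mult_left PA_smult_mult_right e_closed cl_closed subset_iff PA_smult_closed)
      also have "\<dots> = e u \<bullet> cl (finsum H (\<lambda>y. \<phi> y q \<odot>\<^bsub>H\<^esub> y) Y)"
        using Y uq phi_closed by (intro abelian_group_hom.hom_finsum_finite[OF hom, symmetric]) auto
      finally show ?thesis using q by simp
    qed
    then show ?thesis by auto
  qed
  also have "add_list A [e u \<bullet> cl q. (u, q) \<leftarrow> expansion h] = cl h"
    using e_cl[OF h] by (simp only: D_PA[OF h])
  finally show ?thesis
    unfolding expands_def using Y zero by (intro conjI exI[of _ Y] cl_closed h) auto
qed

text \<open>
  \<open>[h] c\<close> is a left \<open>B\<close>-combination of classes by \<open>cl_base\<close>, and so is each product of two classes by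
  \<open>e_cl_absorb\<close>.
\<close>

lemma expands_cl_mult:
  assumes h: "h \<in> carrier H" and c: "c \<in> B" and y: "y \<in> carrier H"
  shows "expands (cl h \<bullet> (c \<bullet> cl y))"
proof (rule cl_base[OF c])
  interpret A: ring A by (rule A_ring)
  fix \<beta> assume \<beta>: "lin PA \<beta>" "\<And>h. h \<in> carrier H \<Longrightarrow> \<beta> h \<in> B"
    "\<And>h. h \<in> carrier H \<Longrightarrow> cl h \<bullet> c = D PA h (\<lambda>p q. \<beta> p \<bullet> cl q)"
  have \<beta>c: "\<beta> k \<in> carrier A" if "k \<in> carrier H" for k using \<beta>(2)[OF that] by (rule B_closed)
  note [lins] = lin_comp[OF \<beta>(1)] \<beta>c
  have "cl h \<bullet> (c \<bullet> cl y) = D PA h (\<lambda>p q. \<beta> p \<bullet> cl q) \<bullet> cl y"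
    using h y B_closed[OF c] by (simp add: A.m_assoc[symmetric] cl_closed \<beta>(3))
  also have "\<dots> = D PA h (\<lambda>p q. (\<beta> p \<bullet> cl q) \<bullet> cl y)"
    by (rule PA_mult_right[symmetric]) (assumption | rule lins y)+
  also have "\<dots> = D PA h (\<lambda>p q. \<beta> p \<bullet> D PA q (\<lambda>s t. e s \<bullet> cl (t \<cdot> y)))"
    using \<beta>c y by (simp add: A.m_assoc cl_closed e_cl_absorb)
  finally have eq: "cl h \<bullet> (c \<bullet> cl y) = D PA h (\<lambda>p q. \<beta> p \<bullet> D PA q (\<lambda>s t. e s \<bullet> cl (t \<cdot> y)))" .
  have D: "expands (D PA k f)" if "\<And>a b. \<lbrakk>a \<in> carrier H; b \<in> carrier H\<rbrakk> \<Longrightarrow> expands (f a b)" for k f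
    using D_mem[of "Collect expands" f k] expands_zero expands_add that by simp
  show ?thesis
    unfolding eq using \<beta>(2) e_base y by (intro D expands_base_mult expands_cl) auto
qed

text \<open>
  Expandable elements form a left \<open>B\<close>-submodule that contains all \<open>[y]\<close>. By the preceding lemma it is
  stable under left multiplication by \<open>[h]\<close>, hence everything.
\<close>

lemma theta_spans: "x \<in> carrier A \<Longrightarrow> expands x"
proof (induction rule: par_alg_induct)
  case (scalar r)
  interpret A: ring A by (rule A_ring)
  show ?case
    using expands_base_mult[OF mon_base[OF scalar] expands_cl[OF H.one_closed]] mon_closed[OF scalar, of "[]"]
    by (simp add: cl_one)
next
  case (add x x')
  then show ?case by (intro expands_add)
next
  case (cl h x)
  interpret A: ring A by (rule A_ring)
  note h = cl_closed[OF cl(1)]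
  have sum: "expands (finsum A f Y)" if "finite Y" "\<And>y. y \<in> Y \<Longrightarrow> expands (f y)" for f Y
    using that
  proof (induction Y)
    case (insert y Y)
    then have "f \<in> Y \<rightarrow> carrier A" "f y \<in> carrier A" by (auto simp: expands_def)
    then show ?case using insert by (simp add: expands_add)
  qed (simp add: expands_zero)
  let ?Y = "{y \<in> carrier H. \<theta> y x \<noteq> \<zero>\<^bsub>A\<^esub>}"
  have "cl h \<bullet> x = cl h \<bullet> finsum A (\<lambda>y. \<theta> y x \<bullet> cl y) ?Y"
    using expandsD(2)[OF cl(3)] by simp
  also have "\<dots> = finsum A (\<lambda>y. cl h \<bullet> (\<theta> y x \<bullet> cl y)) ?Y"
    using expandsD(1)[OF cl(3)] theta_cl_closed[OF cl(2)] h by (intro A.finsum_rdistr) auto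
  finally show ?case
    using expandsD(1)[OF cl(3)] theta_base[OF cl(2)] cl(1) by (auto intro!: sum expands_cl_mult)
qed

lemma theta_bar_projective: "bar_projective A B (par_base_lmod K H \<Delta> S (par_act K H \<Delta> S)) (par_psi K H \<Delta> S) (carrier H) cl \<theta>"
proof -
  interpret A: ring A by (rule A_ring)
  have "left_module A (par_base_lmod K H \<Delta> S (par_act K H \<Delta> S))"
    using is_par_action_par_act by (simp add: is_par_action_def Let_def)
  then show ?thesis
    by (intro bar_projective.intro bar_resolution.intro bar_construction.intro bar_construction_axioms.intro
        bar_resolution_axioms.intro bar_projective_axioms.intro A_ring base_subring)
      (simp_all add: par_base_lmod_simps par_act_eq act_base_mult B_closed par_psi_def cl_closed theta_base
        theta_additive theta_base_linear expandsD[OF theta_spans])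
qed

end

section \<open>The projective resolution of the base algebra\<close>

theorem proposition6p3:
  fixes K :: "('k, 's) ring_scheme"
    and H :: "('k, 'h, 't) module_scheme"
    and \<Delta> :: "'h \<Rightarrow> ('h list \<Rightarrow>\<^sub>0 int) set"
    and \<epsilon> :: "'h \<Rightarrow> 'k"
    and S :: "'h \<Rightarrow> 'h"
  assumes "cocommutative_hopf_algebra K H \<Delta> \<epsilon> S"
    and "projective TYPE('h \<Rightarrow> 'k) TYPE('h) K H"
  shows "let A = par_alg K H \<Delta> S; B = par_base K H \<Delta> S; \<psi> = par_psi K H \<Delta> S in
           projective_resolution TYPE('x) TYPE('y) A
             (bar_module A B) (bar_diff A B \<psi>) (bar_aug A B \<psi>)
             (par_base_lmod K H \<Delta> S (par_act K H \<Delta> S))"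
proof (rule projective_dual_basis[OF assms(2)])
  fix \<phi>
  assume \<phi>: "\<And>y x. x \<in> carrier H \<Longrightarrow> \<phi> y x \<in> carrier K"
    "\<And>y x x'. \<lbrakk>x \<in> carrier H; x' \<in> carrier H\<rbrakk> \<Longrightarrow> \<phi> y (x \<oplus>\<^bsub>H\<^esub> x') = \<phi> y x \<oplus>\<^bsub>K\<^esub> \<phi> y x'"
    "\<And>y a x. \<lbrakk>a \<in> carrier K; x \<in> carrier H\<rbrakk> \<Longrightarrow> \<phi> y (a \<odot>\<^bsub>H\<^esub> x) = a \<otimes>\<^bsub>K\<^esub> \<phi> y x"
    "\<And>x. x \<in> carrier H \<Longrightarrow> finite {y \<in> carrier H. \<phi> y x \<noteq> \<zero>\<^bsub>K\<^esub>}"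
    "\<And>x. x \<in> carrier H \<Longrightarrow> x = finsum H (\<lambda>y. \<phi> y x \<odot>\<^bsub>H\<^esub> y) {y \<in> carrier H. \<phi> y x \<noteq> \<zero>\<^bsub>K\<^esub>}"
  have "cocommutative_hopf_dual_basis K H \<Delta> \<epsilon> S \<phi>"
    by (intro cocommutative_hopf_dual_basis.intro cocommutative_hopf_dual_basis_axioms.intro
        cocommutative_hopf.intro assms(1)) (rule \<phi>; assumption)+
  then interpret cocommutative_hopf_dual_basis K H \<Delta> \<epsilon> S \<phi> .
  show ?thesis
    unfolding Let_def by (rule bar_projective.bar_projective_resolution[OF theta_bar_projective])
qed

end
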